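(* Let $L$ be a (Hausdorff) locally compact group, let $G$ be a discrete group in the class $\mathcal G$, and let $\varphi:L\to G$ be an abstract (not necessarily continuous) homomorphism. Then either $\varphi$ is continuous, or there is a finite nontrivial subgroup $F\subseteq G$ such that $\varphi(L)$ is contained in the normalizer of $F$ in $G$.
   Context: $\mathcal G$ is the class of all groups $G$ such that (1) every torsion subgroup of $G$ is finite, and (2) every abelian subgroup of $G$ is a (possibly infinite) direct sum of cyclic groups. *)

theory Defs
  imports "HOL-Analysis.Analysis" "HOL-Algebra.Algebra"
begin

definition topological_group :: "('a, 'b) monoid_scheme \<Rightarrow> 'a topology \<Rightarrow> bool" where
  "topological_group L T \<longleftrightarrow>
     group L \<and> topspace T = carrier L \<and>
     continuous_map (prod_topology T T) T (\<lambda>p. fst p \<otimes>\<^bsub>L\<^esub> snd p) \<and>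
     continuous_map T T (\<lambda>x. inv\<^bsub>L\<^esub> x)"

definition locally_compact_group :: "('a, 'b) monoid_scheme \<Rightarrow> 'a topology \<Rightarrow> bool" where
  "locally_compact_group L T \<longleftrightarrow>
     topological_group L T \<and> Hausdorff_space T \<and> locally_compact_space T"

text \<open>Torsion subgroup: every element has finite order (ord = 0 means infinite order).\<close>
definition torsion_subgroup :: "('a, 'b) monoid_scheme \<Rightarrow> 'a set \<Rightarrow> bool" where
  "torsion_subgroup G H \<longleftrightarrow> subgroup H G \<and> (\<forall>x\<in>H. group.ord G x \<noteq> 0)"

definition abelian_subgroup :: "('a, 'b) monoid_scheme \<Rightarrow> 'a set \<Rightarrow> bool" where
  "abelian_subgroup G H \<longleftrightarrow> subgroup H G \<and> (\<forall>x\<in>H. \<forall>y\<in>H. x \<otimes>\<^bsub>G\<^esub> y = y \<otimes>\<^bsub>G\<^esub> x)"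

text \<open>H (a subgroup of G) is isomorphic to a (possibly infinite) direct sum of cyclic groups.
  Index set and summands are taken in the element type of G, which is large enough.\<close>
definition direct_sum_of_cyclic :: "('a, 'b) monoid_scheme \<Rightarrow> 'a set \<Rightarrow> bool" where
  "direct_sum_of_cyclic G H \<longleftrightarrow>
     (\<exists>(I :: 'a set) (C :: 'a \<Rightarrow> 'a monoid).
        (\<forall>i\<in>I. group (C i) \<and> cyclic_group (C i)) \<and>
        subgroup_generated G H \<cong> sum_group I C)"

definition class_G :: "('a, 'b) monoid_scheme \<Rightarrow> bool" where
  "class_G G \<longleftrightarrow> group G \<and>
     (\<forall>H. torsion_subgroup G H \<longrightarrow> finite H) \<and>
     (\<forall>H. abelian_subgroup G H \<longrightarrow> direct_sum_of_cyclic G H)"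

end

theory Submission
  imports Defs
begin

text \<open>
  A compact subgroup of \<open>L\<close> has finite image. If \<open>\<phi> x\<close> had infinite order, an abelian subgroup
  containing it would map to the integers with \<open>x\<close> going to some \<open>m \<noteq> 0\<close>; but limits \<open>y\<^sub>n\<close> of powers
  of \<open>x\<close> with \<open>y\<^sub>n = x y\<^sub>n\<^sub>+\<^sub>1\<^sup>k\<close> force the image of \<open>y\<^sub>0\<close> to be \<open>-m / (k - 1)\<close>, which is not an integer
  for large \<open>k\<close>.

  By a trapping argument in the style of Gleason, the elements all of whose powers stay in a small
  neighbourhood \<open>V\<close> of the identity generate a relatively compact subgroup. Its closure has finite
  image, and for \<open>V\<close> small this image \<open>F\<close> no longer depends on \<open>V\<close>, so it is invariant under
  conjugation by \<open>\<phi>(L)\<close>.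

  If \<open>F\<close> is trivial, the kernel contains a compact subgroup \<open>K\<close> that contains every sufficiently small
  subgroup. The normaliser of \<open>K\<close> is open, and its quotient by \<open>K\<close> has no small subgroups, so a
  neighbourhood of its identity is generated by one-parameter subgroups. The image of the reals in
  \<open>G\<close> under a homomorphism is divisible and therefore trivial; hence the kernel of \<open>\<phi>\<close> is open.
\<close>

section \<open>Ultrafilters\<close>

text \<open>Since \<open>\<phi>\<close> need not be continuous, only algebra crosses over to
  \<open>G\<close>: compactness is spent inside \<open>L\<close> on producing solutions of equations
  such as y = x z^k, and one-parameter subgroups matter only as homomorphisms from the additive
  reals. The obstacle to trapping is that products of elements with small powers may accumulate on a
  nontrivial compact subgroup \<open>H\<close>. It is met by a gap: inside any neighbourhood of the
  identity a compact group has a closed subgroup \<open>K\<close> such that every subgroup close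
  enough to \<open>K\<close> is contained in it. This is the consequence of the Peter-Weyl theorem
  that matters, and it is obtained from the decay of the iterates of a single self-adjoint
  convolution operator. The same gap supplies the \<open>K\<close> of the last paragraph. In the
  quotient, lengths come from convolving a Lipschitz function with itself: each factor absorbs one
  difference, so second differences are of second order. As \<open>L\<close> may fail to be
  metrizable, limits are taken along ultrafilters.\<close>

definition ultrafilter :: "'i filter \<Rightarrow> bool" where
  "ultrafilter F \<longleftrightarrow> F \<noteq> bot \<and> (\<forall>P. eventually P F \<or> eventually (\<lambda>x. \<not> P x) F)"

lemma ultrafilter_not_eventually:
  "ultrafilter F \<Longrightarrow> \<not> eventually P F \<longleftrightarrow> eventually (\<lambda>x. \<not> P x) F"
  unfolding ultrafilter_def using eventually_conj[of P F "\<lambda>x. \<not> P x"]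
  by (auto simp: eventually_False)

text \<open>Zorn's lemma for the reversed order: a minimal filter different from \<open>bot\<close>
  decides every predicate, since cutting it down by \<open>principal {x. P x}\<close> either gives
  \<open>bot\<close> or changes nothing. A chain is bounded by its infimum, which is proper because
  finite infima of members are members.\<close>

lemma ultrafilter_exists:
  fixes F :: "'i filter"
  assumes "F \<noteq> bot"
  obtains U where "ultrafilter U" "U \<le> F"
proof -
  let ?A = "{G. G \<noteq> bot \<and> G \<le> F}"
  have "\<exists>m\<in>?A. \<forall>a\<in>?A. m \<ge> a \<longrightarrow> a = m"
  proof (rule predicate_Zorn)
    show "partial_order_on ?A (relation_of (\<lambda>x y. y \<le> x) ?A)"
      by (auto simp: partial_order_on_def preorder_on_def refl_on_def trans_def antisym_def relation_of_def)
    fix C assume "C \<in> Chains (relation_of (\<lambda>x y. y \<le> x) ?A)"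
    then have C: "C \<subseteq> ?A" "\<And>x y. x \<in> C \<Longrightarrow> y \<in> C \<Longrightarrow> x \<le> y \<or> y \<le> x"
      by (auto simp: Chains_def relation_of_def)
    show "\<exists>u\<in>?A. \<forall>a\<in>C. u \<le> a"
    proof (cases "C = {}")
      case True
      then show ?thesis using assms by auto
    next
      case False
      have fin: "Inf Z \<in> C" if "finite Z" "Z \<noteq> {}" "Z \<subseteq> C" for Z
        using that
      proof (induction Z rule: finite_ne_induct)
        case (insert x Z)
        then have "Inf Z \<in> C" "x \<in> C" by auto
        then show ?case using C(2)[of x "Inf Z"]
          by (auto simp: inf_absorb1 inf_absorb2)
      qed auto
      have "Inf C \<noteq> bot"
      proof (rule Inf_filter_not_bot)
        fix Z assume "Z \<subseteq> C" "finite Z"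
        show "Inf Z \<noteq> bot"
        proof (cases "Z = {}")
          case True
          have "(Orderings.top :: 'i filter) \<noteq> bot" using assms Orderings.top_greatest[of F] bot.extremum_uniqueI by force
          then show ?thesis using True by simp
        next
          case False
          then show ?thesis using fin[of Z] C(1) \<open>Z \<subseteq> C\<close> \<open>finite Z\<close> by auto
        qed
      qed
      moreover have "Inf C \<le> F"
      proof -
        obtain c where "c \<in> C" using False by blast
        then have "Inf C \<le> c" "c \<le> F" using C(1) by (auto intro: Inf_lower)
        then show ?thesis by (rule order_trans)
      qed
      ultimately show ?thesis by (auto intro: Inf_lower)
    qed
  qed
  then obtain m where m: "m \<noteq> bot" "m \<le> F" and max: "\<And>a. a \<noteq> bot \<Longrightarrow> a \<le> F \<Longrightarrow> a \<le> m \<Longrightarrow> a = m"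
    by auto
  have "eventually P m \<or> eventually (\<lambda>x. \<not> P x) m" for P
  proof (rule disjCI)
    assume "\<not> eventually (\<lambda>x. \<not> P x) m"
    then have "inf m (principal {x. P x}) \<noteq> bot"
      by (simp add: trivial_limit_def eventually_inf_principal)
    then have "inf m (principal {x. P x}) = m"
      using max[of "inf m (principal {x. P x})"] m(2) by (simp add: le_infI1)
    moreover have "eventually P (inf m (principal {x. P x}))" by (simp add: eventually_inf_principal)
    ultimately show "eventually P m" by simp
  qed
  then show ?thesis using that m by (auto simp: ultrafilter_def)
qed

text \<open>If no point of \<open>C\<close> were a limit, each would have a neighbourhood that the
  ultrafilter avoids, and a finite subcover would be avoided all at once. This takes the place of
  convergent subsequences.\<close>

lemma ultrafilter_compactin_limit:
  assumes U: "ultrafilter U" and C: "compactin Z C" and ev: "eventually (\<lambda>i. f i \<in> C) U"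
  obtains l where "l \<in> C" "limitin Z f l U"
proof -
  have "\<exists>l\<in>C. limitin Z f l U"
  proof (rule ccontr)
    assume "\<not> ?thesis"
    then have "\<forall>l\<in>C. \<exists>S. openin Z S \<and> l \<in> S \<and> \<not> eventually (\<lambda>i. f i \<in> S) U"
      using compactin_subset_topspace[OF C] by (auto simp: limitin_def)
    then obtain S where S: "\<And>l. l \<in> C \<Longrightarrow> openin Z (S l) \<and> l \<in> S l \<and> \<not> eventually (\<lambda>i. f i \<in> S l) U"
      by metis
    obtain D where D: "finite D" "D \<subseteq> C" "C \<subseteq> \<Union>(S ` D)"
    proof -
      have "\<exists>\<F>. finite \<F> \<and> \<F> \<subseteq> S ` C \<and> C \<subseteq> \<Union>\<F>"
        using compactinD[OF C, of "S ` C"] S by blast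
      then show ?thesis using that by (metis finite_subset_image)
    qed
    have "eventually (\<lambda>i. \<forall>l\<in>D. f i \<notin> S l) U"
      using D S U by (intro eventually_ball_finite) (auto simp: ultrafilter_not_eventually)
    with ev have "eventually (\<lambda>i. False) U"
      by eventually_elim (use D in auto)
    then show False using U by (auto simp: ultrafilter_def)
  qed
  then show ?thesis using that by blast
qed

section \<open>Topological groups\<close>

locale topgrp = group L for L (structure) +
  fixes T
  assumes topspace_T [simp]: "topspace T = carrier L"
    and cont_mult: "continuous_map (prod_topology T T) T (\<lambda>p. fst p \<otimes> snd p)"
    and cont_inv: "continuous_map T T (\<lambda>x. inv x)"
begin

lemma continuous_map_mult [continuous_intros]:
  assumes "continuous_map Z T f" "continuous_map Z T g"
  shows "continuous_map Z T (\<lambda>x. f x \<otimes> g x)"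
  using continuous_map_compose[OF _ cont_mult, of Z "\<lambda>x. (f x, g x)"] assms
  by (simp add: o_def continuous_map_pairwise)

lemma continuous_map_inverse [continuous_intros]:
  assumes "continuous_map Z T f"
  shows "continuous_map Z T (\<lambda>x. inv (f x))"
  using continuous_map_compose[OF assms cont_inv] by (simp add: o_def)

lemma continuous_map_const_grp [continuous_intros]:
  "a \<in> carrier L \<Longrightarrow> continuous_map Z T (\<lambda>x. a)"
  by simp

lemma continuous_map_ident [continuous_intros]: "continuous_map T T (\<lambda>x. x)"
  by simp

lemma continuous_map_ltrans: "a \<in> carrier L \<Longrightarrow> continuous_map T T (\<lambda>x. a \<otimes> x)"
  by (intro continuous_intros)

lemma continuous_map_rtrans: "a \<in> carrier L \<Longrightarrow> continuous_map T T (\<lambda>x. x \<otimes> a)"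
  by (intro continuous_intros)

lemma limitin_mult:
  assumes "limitin T f a F" "limitin T g b F"
  shows "limitin T (\<lambda>i. f i \<otimes> g i) (a \<otimes> b) F"
proof -
  have "limitin (prod_topology T T) (\<lambda>i. (f i, g i)) (a, b) F"
    using assms by (simp add: limitin_pairwise o_def)
  from continuous_map_limit[OF cont_mult this] show ?thesis by (simp add: o_def)
qed

lemma limitin_pow:
  assumes "limitin T f a F"
  shows "limitin T (\<lambda>i. f i [^] (n::nat)) (a [^] n) F"
proof (induction n)
  case 0
  then show ?case by (simp add: limitin_const_iff)
next
  case (Suc n)
  then show ?case using limitin_mult[OF Suc assms] by simp
qed

definition nbh :: "'a set \<Rightarrow> bool" where
  "nbh V \<longleftrightarrow> openin T V \<and> \<one> \<in> V"

lemma nbh_carrier: "nbh V \<Longrightarrow> V \<subseteq> carrier L"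
  using openin_subset[of T V] by (simp add: nbh_def)

lemma nbh_Int: "nbh V \<Longrightarrow> nbh W \<Longrightarrow> nbh (V \<inter> W)"
  by (auto simp: nbh_def)

lemma nbh_univ: "nbh (carrier L)"
  using openin_topspace[of T] by (auto simp: nbh_def)

lemma openin_preimage:
  assumes "continuous_map T T f" "openin T W"
  shows "openin T {x \<in> carrier L. f x \<in> W}"
  using openin_continuous_map_preimage[OF assms] by simp

lemma nbh_inv:
  assumes "nbh V" shows "nbh {x \<in> carrier L. inv x \<in> V}"
  using openin_preimage[OF cont_inv, of V] assms by (auto simp: nbh_def)

definition symm :: "'a set \<Rightarrow> bool" where "symm V \<longleftrightarrow> (\<forall>x\<in>V. inv x \<in> V)"

lemma nbh_sym:
  assumes "nbh V"
  obtains W where "nbh W" "symm W" "W \<subseteq> V"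
proof
  let ?W = "V \<inter> {x \<in> carrier L. inv x \<in> V}"
  show "nbh ?W" using nbh_Int nbh_inv assms by blast
  show "symm ?W" by (auto simp: symm_def)
qed auto

text \<open>The tube lemma along \<open>C\<close> times the identity: an open condition that holds
  for all of a compact set at \<open>\<one>\<close> holds there with one common neighbourhood.
  Uniform smallness of conjugates and thickenings of compact sets are its instances.\<close>

lemma nbh_tube:
  assumes g: "continuous_map (prod_topology T T) T (\<lambda>p. g (fst p) (snd p))"
    and C: "compactin T C" and W: "openin T W" and sub: "\<And>y. y \<in> C \<Longrightarrow> g y \<one> \<in> W"
  obtains V where "nbh V" "\<And>y h. y \<in> C \<Longrightarrow> h \<in> V \<Longrightarrow> g y h \<in> W"
proof -
  let ?W = "{p \<in> topspace (prod_topology T T). g (fst p) (snd p) \<in> W}"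
  have Co: "C \<subseteq> carrier L" using compactin_subset_topspace[OF C] by simp
  have op: "openin (prod_topology T T) ?W"
    by (rule openin_continuous_map_preimage[OF g W])
  have "C \<times> {\<one>} \<subseteq> ?W"
    using sub Co by auto
  then obtain U V where "openin T U" "openin T V" "C \<subseteq> U" "{\<one>} \<subseteq> V" "U \<times> V \<subseteq> ?W"
    using Wallace_theorem_prod_topology[OF C _ op, of "{\<one>}"] by auto
  moreover have "g y h \<in> W" if "y \<in> C" "h \<in> V" for y h
    using subsetD[OF \<open>U \<times> V \<subseteq> ?W\<close>, of "(y,h)"] that \<open>C \<subseteq> U\<close> by auto
  ultimately show ?thesis using that[of V] by (auto simp: nbh_def)
qed

lemma nbh_mult:
  assumes "nbh V"
  obtains W where "nbh W" "symm W" "W \<subseteq> V" "\<And>x y. x \<in> W \<Longrightarrow> y \<in> W \<Longrightarrow> x \<otimes> y \<in> V"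
proof -
  have "openin (prod_topology T T) {p \<in> topspace (prod_topology T T). fst p \<otimes> snd p \<in> V}"
    using openin_continuous_map_preimage[OF cont_mult] assms by (simp add: nbh_def)
  moreover have "(\<one>,\<one>) \<in> {p \<in> topspace (prod_topology T T). fst p \<otimes> snd p \<in> V}"
    using assms by (simp add: nbh_def)
  ultimately obtain A B where AB: "openin T A" "openin T B" "\<one> \<in> A" "\<one> \<in> B"
    "A \<times> B \<subseteq> {p \<in> topspace (prod_topology T T). fst p \<otimes> snd p \<in> V}"
    by (smt (verit, best) mem_Sigma_iff openin_prod_topology_alt)
  then have "nbh (A \<inter> B \<inter> V)" using assms by (auto simp: nbh_def)
  then obtain W where "nbh W" "symm W" "W \<subseteq> A \<inter> B \<inter> V" using nbh_sym by blast
  moreover have "x \<otimes> y \<in> V" if "x \<in> W" "y \<in> W" for x y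
    using subsetD[OF AB(5), of "(x,y)"] that \<open>W \<subseteq> A \<inter> B \<inter> V\<close> by auto
  ultimately show ?thesis by (intro that[of W]) auto
qed

lemma nbh_conj:
  assumes C: "compactin T C" and V: "nbh V"
  obtains W where "nbh W" "\<And>y h. y \<in> C \<Longrightarrow> h \<in> W \<Longrightarrow> inv y \<otimes> h \<otimes> y \<in> V"
proof -
  have Co: "C \<subseteq> carrier L" using compactin_subset_topspace[OF C] by simp
  show ?thesis
  proof (rule nbh_tube[of "\<lambda>y h. inv y \<otimes> h \<otimes> y" C V])
    show "continuous_map (prod_topology T T) T (\<lambda>p. inv (fst p) \<otimes> snd p \<otimes> fst p)"
      by (intro continuous_intros continuous_map_fst continuous_map_snd)
  qed (use C V Co that in \<open>auto simp: nbh_def l_inv subset_iff\<close>)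
qed

lemma nbh_compact_mult:
  assumes C: "compactin T C" and W: "openin T W" "C \<subseteq> W"
  obtains V where "nbh V" "C <#> V \<subseteq> W"
proof -
  have Co: "C \<subseteq> carrier L" using compactin_subset_topspace[OF C] by simp
  obtain V where "nbh V" "\<And>y h. y \<in> C \<Longrightarrow> h \<in> V \<Longrightarrow> y \<otimes> h \<in> W"
    using nbh_tube[OF cont_mult C W(1)] Co W(2) by (smt (verit, best) r_one subsetD)
  then show ?thesis by (intro that[of V]) (auto simp: set_mult_def)
qed

lemma compactin_mult:
  assumes "compactin T A" "compactin T B"
  shows "compactin T (A <#> B)"
proof -
  have "compactin T ((\<lambda>p. fst p \<otimes> snd p) ` (A \<times> B))"
    using assms by (intro image_compactin[OF _ cont_mult]) (simp add: compactin_Times)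
  moreover have "(\<lambda>p. fst p \<otimes> snd p) ` (A \<times> B) = A <#> B"
    by (force simp: set_mult_def image_iff)
  ultimately show ?thesis by simp
qed

lemma compactin_inv: "compactin T A \<Longrightarrow> compactin T ((\<lambda>x. inv x) ` A)"
  using image_compactin[OF _ cont_inv] .

lemma openin_ltrans:
  assumes "a \<in> carrier L" "openin T W"
  shows "openin T ((\<lambda>x. a \<otimes> x) ` W)"
proof -
  have "(\<lambda>x. a \<otimes> x) ` W = {x \<in> carrier L. inv a \<otimes> x \<in> W}"
  proof -
    have "W \<subseteq> carrier L" using openin_subset[OF assms(2)] by simp
    moreover have "x = a \<otimes> (inv a \<otimes> x)" if "x \<in> carrier L" for x
      using that assms by (simp add: m_assoc[symmetric])
    moreover have "inv a \<otimes> (a \<otimes> x) = x" if "x \<in> carrier L" for x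
      using that assms by (simp add: m_assoc[symmetric])
    ultimately show ?thesis using assms by (auto 4 4 simp: image_iff)
  qed
  then show ?thesis using assms openin_preimage[OF continuous_map_ltrans, of "inv a" W] by simp
qed

lemma openin_rtrans:
  assumes "a \<in> carrier L" "openin T W"
  shows "openin T ((\<lambda>x. x \<otimes> a) ` W)"
proof -
  have "(\<lambda>x. x \<otimes> a) ` W = {x \<in> carrier L. x \<otimes> inv a \<in> W}"
  proof -
    have "W \<subseteq> carrier L" using openin_subset[OF assms(2)] by simp
    moreover have "x = (x \<otimes> inv a) \<otimes> a" if "x \<in> carrier L" for x
      using that assms by (simp add: m_assoc)
    moreover have "(x \<otimes> a) \<otimes> inv a = x" if "x \<in> carrier L" for x
      using that assms by (simp add: m_assoc)
    ultimately show ?thesis using assms by (auto 4 4 simp: image_iff)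
  qed
  then show ?thesis using assms openin_preimage[OF continuous_map_rtrans, of "inv a" W] by simp
qed

lemma openin_set_mult_right:
  assumes "A \<subseteq> carrier L" "openin T W"
  shows "openin T (A <#> W)"
proof -
  have "A <#> W = (\<Union>a\<in>A. (\<lambda>x. a \<otimes> x) ` W)" by (auto simp: set_mult_def)
  then show ?thesis using assms openin_ltrans by (auto intro!: openin_Union)
qed

lemma openin_set_mult_left:
  assumes "A \<subseteq> carrier L" "openin T W"
  shows "openin T (W <#> A)"
proof -
  have "W <#> A = (\<Union>a\<in>A. (\<lambda>x. x \<otimes> a) ` W)" by (auto simp: set_mult_def)
  then show ?thesis using assms openin_rtrans by (auto intro!: openin_Union)
qed

text \<open>The translate by \<open>x\<close> of the inverse of \<open>V\<close> is a neighbourhood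
  of \<open>x\<close>, so it meets \<open>A\<close> in some a = x y, and then x = a y^-1.\<close>

lemma closure_of_subset_set_mult:
  assumes "A \<subseteq> carrier L" "nbh V"
  shows "T closure_of A \<subseteq> A <#> V"
proof
  fix x assume x: "x \<in> T closure_of A"
  then have xc: "x \<in> carrier L" by (simp add: in_closure_of)
  let ?W = "(\<lambda>y. x \<otimes> y) ` {y \<in> carrier L. inv y \<in> V}"
  have "openin T ?W" "x \<in> ?W"
    using openin_ltrans[OF xc, of "{y \<in> carrier L. inv y \<in> V}"] nbh_inv[OF assms(2)] xc
    by (auto simp: nbh_def image_iff intro!: exI[of _ \<one>])
  moreover have "\<forall>W. x \<in> W \<and> openin T W \<longrightarrow> (\<exists>y. y \<in> A \<and> y \<in> W)"
    using x by (simp add: in_closure_of)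
  ultimately obtain a where a: "a \<in> A" "a \<in> ?W" by meson
  then obtain y where y: "y \<in> carrier L" "inv y \<in> V" "a = x \<otimes> y" by auto
  then have "x = a \<otimes> inv y" using xc by (simp add: m_assoc)
  then show "x \<in> A <#> V" using a y by (auto simp: set_mult_def)
qed

lemma subgroup_closure:
  assumes H: "subgroup H L"
  shows "subgroup (T closure_of H) L"
proof -
  have Hc: "H \<subseteq> carrier L" using H by (rule subgroup.subset)
  show ?thesis
  proof (rule subgroupI)
    show "T closure_of H \<subseteq> carrier L" using closure_of_subset_topspace[of T H] by simp
    show "T closure_of H \<noteq> {}"
      using closure_of_subset[of H T] Hc subgroup.one_closed[OF H] by auto
    show "inv a \<in> T closure_of H" if "a \<in> T closure_of H" for a
    proof -
      have "(\<lambda>x. inv x) ` (T closure_of H) \<subseteq> T closure_of ((\<lambda>x. inv x) ` H)"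
        by (rule continuous_map_image_closure_subset[OF cont_inv])
      moreover have "(\<lambda>x. inv x) ` H \<subseteq> H" using H by (auto intro: subgroup.m_inv_closed)
      ultimately show ?thesis using that closure_of_mono[of "(\<lambda>x. inv x) ` H" H T] by (metis imageI subsetD)
    qed
    show "a \<otimes> b \<in> T closure_of H" if "a \<in> T closure_of H" "b \<in> T closure_of H" for a b
    proof -
      have "(a,b) \<in> prod_topology T T closure_of (H \<times> H)"
        using that by (simp add: closure_of_Times)
      then have "a \<otimes> b \<in> T closure_of ((\<lambda>p. fst p \<otimes> snd p) ` (H \<times> H))"
        using continuous_map_image_closure_subset[OF cont_mult, of "H \<times> H"] by force
      moreover have "(\<lambda>p. fst p \<otimes> snd p) ` (H \<times> H) \<subseteq> H" using H by (auto intro: subgroup.m_closed)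
      ultimately show ?thesis using closure_of_mono subsetD by metis
    qed
  qed
qed

lemma topgrp_subgroup:
  assumes H: "subgroup H L"
  shows "topgrp (L\<lparr>carrier := H\<rparr>) (subtopology T H)"
proof -
  interpret H: group "L\<lparr>carrier := H\<rparr>" using H by (rule subgroup.subgroup_is_group) (rule is_group)
  have Hc: "H \<subseteq> carrier L" using H by (rule subgroup.subset)
  show ?thesis
  proof
    show "topspace (subtopology T H) = carrier (L\<lparr>carrier := H\<rparr>)" using Hc by auto
    have "continuous_map (subtopology (prod_topology T T) (H \<times> H)) T (\<lambda>p. fst p \<otimes> snd p)"
      using cont_mult continuous_map_from_subtopology by blast
    then show "continuous_map (prod_topology (subtopology T H) (subtopology T H)) (subtopology T H)
        (\<lambda>p. fst p \<otimes>\<^bsub>L\<lparr>carrier := H\<rparr>\<^esub> snd p)"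
      using H Hc by (auto simp: continuous_map_in_subtopology subtopology_Times[symmetric] intro: subgroup.m_closed)
    have "continuous_map (subtopology T H) (subtopology T H) (\<lambda>x. inv x)"
      using cont_inv H by (auto simp: continuous_map_in_subtopology continuous_map_from_subtopology intro: subgroup.m_inv_closed)
    then show "continuous_map (subtopology T H) (subtopology T H) (\<lambda>x. inv\<^bsub>L\<lparr>carrier := H\<rparr>\<^esub> x)"
      by (rule continuous_map_eq) (use H Hc in \<open>auto simp: m_inv_consistent\<close>)
  qed
qed

end

locale lcgrp = topgrp +
  assumes Hausdorff_T: "Hausdorff_space T" and lc_T: "locally_compact_space T"
begin

lemma nbh_compact:
  assumes "nbh V"
  obtains W C where "nbh W" "compactin T C" "W \<subseteq> C" "C \<subseteq> V"
proof -
  have "neighbourhood_base_of (compactin T) T"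
    using locally_compact_space_neighbourhood_base Hausdorff_T lc_T by blast
  then show ?thesis using assms that unfolding neighbourhood_base_of nbh_def by (metis openin_subset)
qed

lemma compactin_closed: "compactin T C \<Longrightarrow> closedin T C"
  using compactin_imp_closedin Hausdorff_T by blast

lemma lcgrp_closed_subgroup:
  assumes "subgroup H L" "closedin T H"
  shows "lcgrp (L\<lparr>carrier := H\<rparr>) (subtopology T H)"
  unfolding lcgrp_def lcgrp_axioms_def
  using topgrp_subgroup[OF assms(1)] Hausdorff_space_subtopology[OF Hausdorff_T]
    locally_compact_space_closed_subset[OF lc_T assms(2)] by auto

lemma lcgrp_open_subgroup:
  assumes "subgroup H L" "openin T H"
  shows "lcgrp (L\<lparr>carrier := H\<rparr>) (subtopology T H)"
  unfolding lcgrp_def lcgrp_axioms_def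
  using topgrp_subgroup[OF assms(1)] Hausdorff_space_subtopology[OF Hausdorff_T]
    locally_compact_space_open_subset[OF _ lc_T assms(2)] Hausdorff_T by auto

lemma bump_function:
  assumes "nbh V"
  obtains h :: "'a \<Rightarrow> real" and C where "continuous_map T euclideanreal h" "compactin T C" "C \<subseteq> V"
    "\<And>x. x \<in> carrier L \<Longrightarrow> 0 \<le> h x" "\<And>x. x \<in> carrier L \<Longrightarrow> h x \<le> 1" "h \<one> = 1"
    "\<And>x. x \<in> carrier L \<Longrightarrow> x \<notin> C \<Longrightarrow> h x = 0"
proof -
  obtain W C where W: "nbh W" "compactin T C" "W \<subseteq> C" "C \<subseteq> V" using nbh_compact[OF assms] .
  have "completely_regular_space T"
    using locally_compact_regular_imp_completely_regular_space lc_T Hausdorff_T by blast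
  moreover have "closedin T (carrier L - W)" using W closedin_diff[of T "carrier L" W] by (metis closedin_topspace topspace_T nbh_def)
  moreover have "\<one> \<in> topspace T - (carrier L - W)" using W by (auto simp: nbh_def)
  ultimately obtain f :: "'a \<Rightarrow> real" where f: "continuous_map T (top_of_set {0..1}) f" "f \<one> = 0" "f ` (carrier L - W) \<subseteq> {1}"
    unfolding completely_regular_space_def by blast
  show ?thesis
  proof (rule that[of "\<lambda>x. 1 - f x" C])
    show "continuous_map T euclideanreal (\<lambda>x. 1 - f x)"
      using f(1) by (intro continuous_map_diff) (auto simp: continuous_map_in_subtopology)
    show "0 \<le> 1 - f x" "1 - f x \<le> 1" if "x \<in> carrier L" for x
      using f(1) that by (auto simp: continuous_map_in_subtopology)
    show "1 - f x = 0" if "x \<in> carrier L" "x \<notin> C" for x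
      using f(3) that W by auto
  qed (use f W in auto)
qed

end

lemma ultrafilter_base:
  assumes "B \<noteq> {}" "\<And>A. A \<in> B \<Longrightarrow> A \<noteq> {}" "\<And>A C. A \<in> B \<Longrightarrow> C \<in> B \<Longrightarrow> \<exists>D\<in>B. D \<subseteq> A \<inter> C"
  obtains U where "ultrafilter U" "\<And>A. A \<in> B \<Longrightarrow> eventually (\<lambda>x. x \<in> A) U"
proof -
  let ?F = "INF A\<in>B. principal A"
  have ev: "eventually P ?F \<longleftrightarrow> (\<exists>A\<in>B. \<forall>x\<in>A. P x)" for P
    using assms(1,3) by (subst eventually_INF_base) (auto simp: eventually_principal)
  have "?F \<noteq> bot"
    using ev[of "\<lambda>x. False"] assms(2) by (auto simp: trivial_limit_def)
  then obtain U where "ultrafilter U" "U \<le> ?F" by (rule ultrafilter_exists)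
  then show ?thesis using that ev by (metis filter_leD)
qed

section \<open>Haar integral\<close>

context lcgrp begin

text \<open>Values off \<open>carrier L\<close> are unconstrained, so functions that agree on the
  carrier may differ; that they have the same integral is proved separately
  (\<open>I_cong\<close>).\<close>

definition Cc :: "('a \<Rightarrow> real) set" where
  "Cc = {f. continuous_map T euclideanreal f \<and> (\<exists>C. compactin T C \<and> (\<forall>x\<in>carrier L - C. f x = 0))}"

lemma CcI: "continuous_map T euclideanreal f \<Longrightarrow> compactin T C \<Longrightarrow> (\<And>x. x \<in> carrier L \<Longrightarrow> x \<notin> C \<Longrightarrow> f x = 0) \<Longrightarrow> f \<in> Cc"
  by (auto simp: Cc_def)

lemma Cc_cont: "f \<in> Cc \<Longrightarrow> continuous_map T euclideanreal f"
  by (simp add: Cc_def)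

lemma Cc_supp:
  assumes "f \<in> Cc"
  obtains C where "compactin T C" "\<And>x. x \<in> carrier L \<Longrightarrow> x \<notin> C \<Longrightarrow> f x = 0"
  using assms by (auto simp: Cc_def)

lemma Cc_mult:
  assumes "f \<in> Cc" "continuous_map T euclideanreal g"
  shows "(\<lambda>x. f x * g x) \<in> Cc" "(\<lambda>x. g x * f x) \<in> Cc"
proof -
  obtain C where C: "compactin T C" "\<And>x. x \<in> carrier L \<Longrightarrow> x \<notin> C \<Longrightarrow> f x = 0" using Cc_supp[OF assms(1)] by blast
  show "(\<lambda>x. f x * g x) \<in> Cc" "(\<lambda>x. g x * f x) \<in> Cc"
    by (auto intro!: CcI[OF _ C(1)] continuous_map_real_mult simp: C(2) Cc_cont[OF assms(1)] assms(2))
qed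

lemma Cc_scale: "f \<in> Cc \<Longrightarrow> (\<lambda>x. c * f x) \<in> Cc"
  by (rule Cc_mult(2)) auto

lemma Cc_minus: "f \<in> Cc \<Longrightarrow> (\<lambda>x. - f x) \<in> Cc"
  using Cc_scale[of f "-1"] by simp

lemma Cc_add:
  assumes "f \<in> Cc" "g \<in> Cc" shows "(\<lambda>x. f x + g x) \<in> Cc"
proof -
  obtain C where C: "compactin T C" "\<And>x. x \<in> carrier L \<Longrightarrow> x \<notin> C \<Longrightarrow> f x = 0" using Cc_supp[OF assms(1)] by blast
  obtain D where D: "compactin T D" "\<And>x. x \<in> carrier L \<Longrightarrow> x \<notin> D \<Longrightarrow> g x = 0" using Cc_supp[OF assms(2)] by blast
  show ?thesis
    by (rule CcI[of _ "C \<union> D"]) (auto intro!: compactin_Un continuous_map_add simp: C D Cc_cont assms)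
qed

lemma Cc_diff: "f \<in> Cc \<Longrightarrow> g \<in> Cc \<Longrightarrow> (\<lambda>x. f x - g x) \<in> Cc"
  using Cc_add[of f "\<lambda>x. - g x"] Cc_minus[of g] by simp

lemma Cc_zero: "(\<lambda>x. 0) \<in> Cc"
  by (rule CcI[of _ "{}"]) auto

lemma Cc_pos_part:
  assumes "f \<in> Cc" shows "(\<lambda>x. max 0 (f x)) \<in> Cc"
proof -
  obtain C where C: "compactin T C" "\<And>x. x \<in> carrier L \<Longrightarrow> x \<notin> C \<Longrightarrow> f x = 0" using Cc_supp[OF assms(1)] by blast
  show ?thesis
    by (rule CcI[of _ C]) (auto intro!: continuous_map_real_max simp: C Cc_cont assms)
qed

lemma Cc_abs:
  assumes "f \<in> Cc" shows "(\<lambda>x. \<bar>f x\<bar>) \<in> Cc"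
proof -
  obtain C where C: "compactin T C" "\<And>x. x \<in> carrier L \<Longrightarrow> x \<notin> C \<Longrightarrow> f x = 0" using Cc_supp[OF assms(1)] by blast
  show ?thesis
    by (rule CcI[of _ C]) (auto intro!: continuous_map_real_abs simp: C Cc_cont assms)
qed

lemma continuous_map_compose_grp:
  assumes "continuous_map T euclideanreal f" "continuous_map Z T g"
  shows "continuous_map Z euclideanreal (\<lambda>x. f (g x))"
  using continuous_map_compose[OF assms(2,1)] by (simp add: o_def)

lemma Cc_ltrans:
  assumes "f \<in> Cc" "g \<in> carrier L" shows "(\<lambda>x. f (g \<otimes> x)) \<in> Cc"
proof -
  obtain C where C: "compactin T C" "\<And>x. x \<in> carrier L \<Longrightarrow> x \<notin> C \<Longrightarrow> f x = 0" using Cc_supp[OF assms(1)] by blast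
  have comp: "compactin T ((\<lambda>x. inv g \<otimes> x) ` C)"
    by (rule image_compactin[OF C(1) continuous_map_ltrans]) (simp add: assms)
  show ?thesis
  proof (rule CcI[OF _ comp])
    show "continuous_map T euclideanreal (\<lambda>x. f (g \<otimes> x))"
      by (rule continuous_map_compose_grp[OF Cc_cont[OF assms(1)] continuous_map_ltrans]) (rule assms)
    fix x assume x: "x \<in> carrier L" "x \<notin> (\<lambda>x. inv g \<otimes> x) ` C"
    have "x = inv g \<otimes> (g \<otimes> x)" using x assms by (simp add: m_assoc[symmetric])
    then show "f (g \<otimes> x) = 0" using x assms C(2)[of "g \<otimes> x"] by auto
  qed
qed

lemma Cc_inv:
  assumes "f \<in> Cc" shows "(\<lambda>x. f (inv x)) \<in> Cc"
proof -
  obtain C where C: "compactin T C" "\<And>x. x \<in> carrier L \<Longrightarrow> x \<notin> C \<Longrightarrow> f x = 0" using Cc_supp[OF assms(1)] by blast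
  show ?thesis
  proof (rule CcI[OF _ compactin_inv[OF C(1)]])
    show "continuous_map T euclideanreal (\<lambda>x. f (inv x))"
      by (rule continuous_map_compose_grp[OF Cc_cont[OF assms(1)] cont_inv])
    fix x assume x: "x \<in> carrier L" "x \<notin> (\<lambda>x. inv x) ` C"
    have "inv x \<notin> C" using x by (metis imageI inv_inv)
    then show "f (inv x) = 0" using x C(2)[of "inv x"] by auto
  qed
qed

lemma Cc_bounded:
  assumes "f \<in> Cc"
  obtains M where "M > 0" "\<And>x. x \<in> carrier L \<Longrightarrow> \<bar>f x\<bar> \<le> M"
proof -
  obtain C where C: "compactin T C" "\<And>x. x \<in> carrier L \<Longrightarrow> x \<notin> C \<Longrightarrow> f x = 0" using Cc_supp[OF assms(1)] by blast
  have "compactin euclideanreal (f ` C)"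
    using image_compactin[OF C(1) Cc_cont[OF assms]] .
  then have "bounded (f ` C)" by (simp add: compact_imp_bounded)
  then obtain M where M: "M > 0" "\<And>x. x \<in> C \<Longrightarrow> \<bar>f x\<bar> \<le> M"
    unfolding bounded_pos by auto
  have "\<bar>f x\<bar> \<le> M" if "x \<in> carrier L" for x
    using M C(2)[OF that] by (cases "x \<in> C") auto
  then show ?thesis using that M by blast
qed

text \<open>On \<open>C <#> D\<close>, a compact thickening of the support, uniformity comes from
  the tube lemma. Off it both values vanish: the symmetric \<open>V'\<close> lies inside
  \<open>D\<close>, so a translation by \<open>z\<close> cannot reach \<open>C\<close> from
  outside.\<close>

lemma Cc_uniform_right:
  assumes f: "f \<in> Cc" and e: "e > 0"
  obtains V where "nbh V" "\<And>x z. x \<in> carrier L \<Longrightarrow> z \<in> V \<Longrightarrow> \<bar>f (x \<otimes> z) - f x\<bar> < e"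
proof -
  obtain C where C: "compactin T C" "\<And>x. x \<in> carrier L \<Longrightarrow> x \<notin> C \<Longrightarrow> f x = 0" using Cc_supp[OF f] by blast
  have Cc: "C \<subseteq> carrier L" using compactin_subset_topspace[OF C(1)] by simp
  obtain W D where W: "nbh W" "compactin T D" "W \<subseteq> D" and Dc: "D \<subseteq> carrier L"
    using nbh_compact[OF nbh_univ] .
  let ?C = "C <#> D"
  have comp: "compactin T ?C" by (rule compactin_mult[OF C(1) W(2)])
  let ?P = "{p \<in> topspace (prod_topology T T). (f (fst p \<otimes> snd p) - f (fst p)) \<in> {-e<..<e}}"
  have "continuous_map (prod_topology T T) euclideanreal (\<lambda>p. f (fst p \<otimes> snd p) - f (fst p))"
    using Cc_cont[OF f] by (intro continuous_map_diff continuous_map_compose_grp[OF _ cont_mult]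
        continuous_map_compose_grp[OF _ continuous_map_fst]) auto
  then have op: "openin (prod_topology T T) ?P"
    by (rule openin_continuous_map_preimage) auto
  have "?C \<times> {\<one>} \<subseteq> ?P"
    using Cc Dc e by (auto simp: set_mult_def subset_iff)
  then obtain A V where V: "openin T A" "openin T V" "?C \<subseteq> A" "{\<one>} \<subseteq> V" "A \<times> V \<subseteq> ?P"
    using Wallace_theorem_prod_topology[OF comp _ op, of "{\<one>}"] by auto
  obtain V' where V': "nbh V'" "symm V'" "V' \<subseteq> V \<inter> W"
    using nbh_sym[of "V \<inter> W"] V W by (auto simp: nbh_def)
  show ?thesis
  proof (rule that[OF V'(1)])
    fix x z assume x: "x \<in> carrier L" and z: "z \<in> V'"
    have zc: "z \<in> carrier L" using z nbh_carrier[OF V'(1)] by auto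
    show "\<bar>f (x \<otimes> z) - f x\<bar> < e"
    proof (cases "x \<in> ?C")
      case True
      have "(x,z) \<in> ?P" using V(5) V(3) True z V'(3) by blast
      then show ?thesis by auto
    next
      case False
      have "x \<notin> C"
      proof
        assume "x \<in> C"
        moreover have "\<one> \<in> D" using W by (auto simp: nbh_def)
        ultimately have "x \<otimes> \<one> \<in> ?C" unfolding set_mult_def by blast
        then show False using False x by simp
      qed
      moreover have "x \<otimes> z \<notin> C"
      proof
        assume "x \<otimes> z \<in> C"
        moreover have "inv z \<in> D" using V' z W by (auto simp: symm_def)
        ultimately have "x \<otimes> z \<otimes> inv z \<in> ?C" unfolding set_mult_def by blast
        then show False using False x zc by (simp add: m_assoc)
      qed
      ultimately show ?thesis using C(2) x zc e by simp
    qed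
  qed
qed

lemma Cc_uniform_left:
  assumes f: "f \<in> Cc" and e: "e > 0"
  obtains V where "nbh V" "\<And>x z. x \<in> carrier L \<Longrightarrow> z \<in> V \<Longrightarrow> \<bar>f (z \<otimes> x) - f x\<bar> < e"
proof -
  obtain V where V: "nbh V" "\<And>x z. x \<in> carrier L \<Longrightarrow> z \<in> V \<Longrightarrow> \<bar>f (inv (x \<otimes> z)) - f (inv x)\<bar> < e"
    using Cc_uniform_right[OF Cc_inv[OF f] e] by blast
  obtain W where W: "nbh W" "symm W" "W \<subseteq> V" using nbh_sym[OF V(1)] .
  show ?thesis
  proof (rule that[OF W(1)])
    fix x z assume xz: "x \<in> carrier L" "z \<in> W"
    then have "z \<in> carrier L" using nbh_carrier[OF W(1)] by auto
    moreover have "inv z \<in> V" using W xz by (auto simp: symm_def)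
    ultimately show "\<bar>f (z \<otimes> x) - f x\<bar> < e"
      using V(2)[of "inv x" "inv z"] xz by (simp add: inv_mult_group)
  qed
qed

section \<open>Nonnegative test functions and covering numbers\<close>

definition Cp :: "('a \<Rightarrow> real) set" where "Cp = {f \<in> Cc. \<forall>x\<in>carrier L. 0 \<le> f x}"

lemma CpI: "f \<in> Cc \<Longrightarrow> (\<And>x. x \<in> carrier L \<Longrightarrow> 0 \<le> f x) \<Longrightarrow> f \<in> Cp" by (simp add: Cp_def)
lemma CpD: "f \<in> Cp \<Longrightarrow> f \<in> Cc" "f \<in> Cp \<Longrightarrow> x \<in> carrier L \<Longrightarrow> 0 \<le> f x" by (auto simp: Cp_def)

lemma Cp_bump:
  assumes "nbh V"
  obtains h where "h \<in> Cp" "\<And>x. x \<in> carrier L \<Longrightarrow> h x \<le> 1" "h \<one> = 1"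
    "\<And>x. x \<in> carrier L \<Longrightarrow> h x \<noteq> 0 \<Longrightarrow> x \<in> V"
  using bump_function[OF assms] by (smt (verit) CcI CpI subsetD)

text \<open>\<open>hc f \<phi>\<close> is the covering number \<open>(f : \<phi>)\<close> of Weil's construction of the Haar integral.\<close>

definition covs :: "('a \<Rightarrow> real) \<Rightarrow> ('a \<Rightarrow> real) \<Rightarrow> (real \<times> 'a) list set" where
  "covs f \<phi> = {cs. (\<forall>(c,s)\<in>set cs. 0 \<le> c \<and> s \<in> carrier L) \<and>
     (\<forall>x\<in>carrier L. f x \<le> (\<Sum>(c,s)\<leftarrow>cs. c * \<phi> (inv s \<otimes> x)))}"

definition hc :: "('a \<Rightarrow> real) \<Rightarrow> ('a \<Rightarrow> real) \<Rightarrow> real" where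
  "hc f \<phi> = Inf ((\<lambda>cs. \<Sum>(c,s)\<leftarrow>cs. c) ` covs f \<phi>)"

lemma sum_list_nonneg_fst: "cs \<in> covs f \<phi> \<Longrightarrow> 0 \<le> (\<Sum>(c,s)\<leftarrow>cs. c)"
  by (auto simp: covs_def intro!: sum_list_nonneg)

lemma covsD: "cs \<in> covs f \<phi> \<Longrightarrow> (c,s) \<in> set cs \<Longrightarrow> 0 \<le> c \<and> s \<in> carrier L"
  by (auto simp: covs_def)

lemma hc_le: "cs \<in> covs f \<phi> \<Longrightarrow> hc f \<phi> \<le> (\<Sum>(c,s)\<leftarrow>cs. c)"
  unfolding hc_def by (rule cInf_lower) (auto intro!: bdd_belowI[of _ 0] sum_list_nonneg_fst)

lemma compactin_translates:
  assumes C: "compactin T C" and W: "nbh W"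
  obtains S where "finite S" "S \<subseteq> carrier L" "\<And>x. x \<in> C \<Longrightarrow> \<exists>s\<in>S. inv s \<otimes> x \<in> W"
proof -
  have Co: "C \<subseteq> carrier L" using compactin_subset_topspace[OF C] by simp
  have "\<exists>\<F>. finite \<F> \<and> \<F> \<subseteq> (\<lambda>s. {x \<in> carrier L. inv s \<otimes> x \<in> W}) ` C \<and> C \<subseteq> \<Union>\<F>"
  proof (rule compactinD[OF C])
    show "openin T U" if "U \<in> (\<lambda>s. {x \<in> carrier L. inv s \<otimes> x \<in> W}) ` C" for U
      using that Co W by (auto intro!: openin_preimage continuous_map_ltrans simp: nbh_def subset_iff)
    show "C \<subseteq> \<Union>((\<lambda>s. {x \<in> carrier L. inv s \<otimes> x \<in> W}) ` C)"
    proof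
      fix x assume x: "x \<in> C"
      then have "inv x \<otimes> x \<in> W" using Co W by (auto simp: nbh_def subset_iff l_inv)
      then show "x \<in> \<Union>((\<lambda>s. {x \<in> carrier L. inv s \<otimes> x \<in> W}) ` C)" using x Co by blast
    qed
  qed
  then obtain \<F> where F: "finite \<F>" "\<F> \<subseteq> (\<lambda>s. {x \<in> carrier L. inv s \<otimes> x \<in> W}) ` C" "C \<subseteq> \<Union>\<F>" by auto
  from finite_subset_image[OF F(1,2)] obtain S where S: "finite S" "S \<subseteq> C" "\<F> = (\<lambda>s. {x \<in> carrier L. inv s \<otimes> x \<in> W}) ` S"
    by auto
  show ?thesis
    by (rule that[of S]) (use S F Co in auto)
qed

text \<open>Finitely many translates of the set where \<open>\<phi>\<close> exceeds half its value
  at \<open>\<one>\<close> cover the support of \<open>f\<close>; the coefficient 2 M / \<phi>(1)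
  makes each of them dominate the bound \<open>M\<close> of \<open>f\<close> there.\<close>

lemma covs_nonempty:
  assumes f: "f \<in> Cc" and p: "\<phi> \<in> Cp" "\<phi> \<one> > 0"
  shows "covs f \<phi> \<noteq> {}"
proof -
  obtain C where C: "compactin T C" "\<And>x. x \<in> carrier L \<Longrightarrow> x \<notin> C \<Longrightarrow> f x = 0" using Cc_supp[OF f] by blast
  obtain M where M: "M > 0" "\<And>x. x \<in> carrier L \<Longrightarrow> \<bar>f x\<bar> \<le> M" using Cc_bounded[OF f] by blast
  let ?W = "{x \<in> carrier L. \<phi> x \<in> {\<phi> \<one> / 2<..}}"
  have W: "nbh ?W"
    using openin_continuous_map_preimage[OF Cc_cont[OF CpD(1)[OF p(1)]], of "{\<phi> \<one> / 2<..}"] p(2)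
    by (simp add: nbh_def)
  obtain S where S: "finite S" "S \<subseteq> carrier L" "\<And>x. x \<in> C \<Longrightarrow> \<exists>s\<in>S. inv s \<otimes> x \<in> ?W"
    using compactin_translates[OF C(1) W] by blast
  obtain ss where ss: "set ss = S" using finite_list[OF S(1)] by blast
  let ?c = "2 * M / \<phi> \<one>"
  have "map (\<lambda>s. (?c, s)) ss \<in> covs f \<phi>"
    unfolding covs_def mem_Collect_eq
  proof (intro conjI ballI)
    fix p' assume "p' \<in> set (map (\<lambda>s. (?c, s)) ss)"
    then show "case p' of (c, s) \<Rightarrow> 0 \<le> c \<and> s \<in> carrier L" using ss S M p by auto
  next
    fix x assume x: "x \<in> carrier L"
    have nn: "0 \<le> ?c * \<phi> (inv s \<otimes> x)" if "s \<in> S" for s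
      using that S x p M by (auto intro!: divide_nonneg_nonneg mult_nonneg_nonneg CpD(2)[OF p(1)])
    have nn': "0 \<le> sum_list (map (\<lambda>s. ?c * \<phi> (inv s \<otimes> x)) ss)"
      using nn ss by (intro sum_list_nonneg) auto
    have "f x \<le> sum_list (map (\<lambda>s. ?c * \<phi> (inv s \<otimes> x)) ss)"
    proof (cases "x \<in> C")
      case True
      then obtain s where s: "s \<in> S" "inv s \<otimes> x \<in> ?W" using S by blast
      have "f x \<le> M" using M(2)[OF x] by auto
      also have "M = ?c * (\<phi> \<one> / 2)" using p by simp
      also have "\<dots> \<le> ?c * \<phi> (inv s \<otimes> x)" using s M p by (intro mult_left_mono) auto
      also have "\<dots> \<le> sum_list (map (\<lambda>s. ?c * \<phi> (inv s \<otimes> x)) ss)"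
        using nn ss s by (intro member_le_sum_list) auto
      finally show ?thesis .
    next
      case False
      then show ?thesis using C(2)[OF x] nn' by simp
    qed
    then show "f x \<le> (\<Sum>(c, s)\<leftarrow>map (\<lambda>s. (?c, s)) ss. c * \<phi> (inv s \<otimes> x))"
      by (simp add: o_def)
  qed
  then show ?thesis by blast
qed

lemma hc_approx:
  assumes "f \<in> Cc" "\<phi> \<in> Cp" "\<phi> \<one> > 0" "e > 0"
  obtains cs where "cs \<in> covs f \<phi>" "(\<Sum>(c,s)\<leftarrow>cs. c) < hc f \<phi> + e"
proof -
  have "Inf ((\<lambda>cs. \<Sum>(c,s)\<leftarrow>cs. c) ` covs f \<phi>) < hc f \<phi> + e" using assms by (simp add: hc_def)
  from cInf_lessD[OF _ this] show ?thesis using covs_nonempty[OF assms(1-3)] that by auto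
qed

lemma hc_greatest:
  assumes "f \<in> Cc" "\<phi> \<in> Cp" "\<phi> \<one> > 0" "\<And>cs. cs \<in> covs f \<phi> \<Longrightarrow> b \<le> (\<Sum>(c,s)\<leftarrow>cs. c)"
  shows "b \<le> hc f \<phi>"
  unfolding hc_def using covs_nonempty[OF assms(1-3)] assms(4) by (intro cInf_greatest) auto

lemma hc_nonneg: "f \<in> Cc \<Longrightarrow> \<phi> \<in> Cp \<Longrightarrow> \<phi> \<one> > 0 \<Longrightarrow> 0 \<le> hc f \<phi>"
  by (rule hc_greatest) (auto intro: sum_list_nonneg_fst)

lemma hc_mono:
  assumes "f \<in> Cc" "g \<in> Cc" "\<phi> \<in> Cp" "\<phi> \<one> > 0" "\<And>x. x \<in> carrier L \<Longrightarrow> f x \<le> g x"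
  shows "hc f \<phi> \<le> hc g \<phi>"
proof (rule hc_greatest[OF assms(2-4)])
  fix cs assume "cs \<in> covs g \<phi>"
  then have "cs \<in> covs f \<phi>" using assms(5) by (fastforce simp: covs_def)
  then show "hc f \<phi> \<le> (\<Sum>(c,s)\<leftarrow>cs. c)" by (rule hc_le)
qed

lemma hc_add:
  assumes "f \<in> Cc" "g \<in> Cc" "\<phi> \<in> Cp" "\<phi> \<one> > 0"
  shows "hc (\<lambda>x. f x + g x) \<phi> \<le> hc f \<phi> + hc g \<phi>"
proof (rule field_le_epsilon)
  fix e :: real assume e: "e > 0"
  obtain cs where cs: "cs \<in> covs f \<phi>" "(\<Sum>(c,s)\<leftarrow>cs. c) < hc f \<phi> + e/2"
    using hc_approx[OF assms(1,3,4), of "e/2"] e by auto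
  obtain ds where ds: "ds \<in> covs g \<phi>" "(\<Sum>(c,s)\<leftarrow>ds. c) < hc g \<phi> + e/2"
    using hc_approx[OF assms(2,3,4), of "e/2"] e by auto
  have "cs @ ds \<in> covs (\<lambda>x. f x + g x) \<phi>"
    using cs(1) ds(1) unfolding covs_def by (auto intro!: add_mono)
  from hc_le[OF this] show "hc (\<lambda>x. f x + g x) \<phi> \<le> hc f \<phi> + hc g \<phi> + e"
    using cs ds by simp
qed

lemma hc_ltrans_le:
  assumes "f \<in> Cc" "\<phi> \<in> Cp" "\<phi> \<one> > 0" "g \<in> carrier L"
  shows "hc (\<lambda>x. f (inv g \<otimes> x)) \<phi> \<le> hc f \<phi>"
proof (rule hc_greatest[OF assms(1-3)])
  fix cs assume cs: "cs \<in> covs f \<phi>"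
  let ?ds = "map (\<lambda>(c,s). (c, g \<otimes> s)) cs"
  have "?ds \<in> covs (\<lambda>x. f (inv g \<otimes> x)) \<phi>"
    unfolding covs_def mem_Collect_eq
  proof (intro conjI ballI)
    fix p assume "p \<in> set ?ds"
    then show "case p of (c,s) \<Rightarrow> 0 \<le> c \<and> s \<in> carrier L" using cs assms(4) by (auto simp: covs_def)
  next
    fix x assume x: "x \<in> carrier L"
    have "f (inv g \<otimes> x) \<le> (\<Sum>(c,s)\<leftarrow>cs. c * \<phi> (inv s \<otimes> (inv g \<otimes> x)))"
      using cs x assms(4) by (auto simp: covs_def)
    also have "\<dots> = (\<Sum>(c,s)\<leftarrow>?ds. c * \<phi> (inv s \<otimes> x))"
    proof -
      have "map (\<lambda>(c,s). c * \<phi> (inv s \<otimes> (inv g \<otimes> x))) cs = map (\<lambda>(c,s). c * \<phi> (inv (g \<otimes> s) \<otimes> x)) cs"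
        using covsD[OF cs] x assms(4) by (auto simp: inv_mult_group m_assoc)
      from arg_cong[OF this, of sum_list] show ?thesis by (simp add: o_def case_prod_unfold)
    qed
    finally show "f (inv g \<otimes> x) \<le> (\<Sum>(c,s)\<leftarrow>?ds. c * \<phi> (inv s \<otimes> x))" .
  qed
  from hc_le[OF this] show "hc (\<lambda>x. f (inv g \<otimes> x)) \<phi> \<le> (\<Sum>(c,s)\<leftarrow>cs. c)"
    by (simp add: o_def case_prod_unfold)
qed

lemma hc_ltrans:
  assumes "f \<in> Cc" "\<phi> \<in> Cp" "\<phi> \<one> > 0" "g \<in> carrier L"
  shows "hc (\<lambda>x. f (inv g \<otimes> x)) \<phi> = hc f \<phi>"
proof (rule antisym[OF hc_ltrans_le[OF assms]])
  have tr: "(\<lambda>x. f (inv g \<otimes> x)) \<in> Cc" using assms by (intro Cc_ltrans) auto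
  have "hc f \<phi> \<le> hc (\<lambda>x. f (inv g \<otimes> (inv (inv g) \<otimes> x))) \<phi>"
    using assms tr by (intro hc_mono Cc_ltrans[OF tr]) (auto simp: m_assoc[symmetric])
  also have "\<dots> \<le> hc (\<lambda>x. f (inv g \<otimes> x)) \<phi>"
    using hc_ltrans_le[OF tr assms(2,3), of "inv g"] assms by auto
  finally show "hc f \<phi> \<le> hc (\<lambda>x. f (inv g \<otimes> x)) \<phi>" .
qed

lemma hc_scale_le:
  assumes "f \<in> Cc" "\<phi> \<in> Cp" "\<phi> \<one> > 0" "c > 0"
  shows "hc (\<lambda>x. c * f x) \<phi> \<le> c * hc f \<phi>"
proof -
  have "hc (\<lambda>x. c * f x) \<phi> / c \<le> hc f \<phi>"
  proof (rule hc_greatest[OF assms(1-3)])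
    fix cs assume cs: "cs \<in> covs f \<phi>"
    let ?ds = "map (\<lambda>(a,s). (c * a, s)) cs"
    have "?ds \<in> covs (\<lambda>x. c * f x) \<phi>"
      unfolding covs_def mem_Collect_eq
    proof (intro conjI ballI)
      fix p assume "p \<in> set ?ds"
      then show "case p of (c,s) \<Rightarrow> 0 \<le> c \<and> s \<in> carrier L" using cs assms(4) by (auto simp: covs_def)
    next
      fix x assume x: "x \<in> carrier L"
      have "c * f x \<le> c * (\<Sum>(c,s)\<leftarrow>cs. c * \<phi> (inv s \<otimes> x))"
        using cs x assms(4) by (auto simp: covs_def intro!: mult_left_mono)
      also have "\<dots> = (\<Sum>(c,s)\<leftarrow>?ds. c * \<phi> (inv s \<otimes> x))"
        by (simp add: o_def case_prod_unfold sum_list_const_mult[symmetric] mult.assoc)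
      finally show "c * f x \<le> (\<Sum>(c,s)\<leftarrow>?ds. c * \<phi> (inv s \<otimes> x))" .
    qed
    from hc_le[OF this] have "hc (\<lambda>x. c * f x) \<phi> \<le> c * (\<Sum>(c,s)\<leftarrow>cs. c)"
      by (simp add: o_def case_prod_unfold sum_list_const_mult)
    then show "hc (\<lambda>x. c * f x) \<phi> / c \<le> (\<Sum>(c,s)\<leftarrow>cs. c)" using assms(4) by (simp add: field_simps)
  qed
  then show ?thesis using assms(4) by (simp add: field_simps)
qed

lemma hc_scale:
  assumes "f \<in> Cc" "\<phi> \<in> Cp" "\<phi> \<one> > 0" "c > 0"
  shows "hc (\<lambda>x. c * f x) \<phi> = c * hc f \<phi>"
proof (rule antisym[OF hc_scale_le[OF assms]])
  have "hc (\<lambda>x. (1/c) * (c * f x)) \<phi> \<le> (1/c) * hc (\<lambda>x. c * f x) \<phi>"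
    using assms by (intro hc_scale_le Cc_scale) auto
  then show "c * hc f \<phi> \<le> hc (\<lambda>x. c * f x) \<phi>" using assms(4) by (simp add: field_simps)
qed

text \<open>Substituting a covering of \<open>\<psi>\<close> by translates of \<open>\<phi>\<close>
  into a covering of \<open>f\<close> by translates of \<open>\<psi>\<close> multiplies the
  coefficient sums. This bounds the normalised covering numbers from above and, with the roles
  exchanged, away from 0, independently of \<open>\<phi>\<close>.\<close>

lemma hc_trans:
  assumes "f \<in> Cc" "\<psi> \<in> Cp" "\<psi> \<one> > 0" "\<phi> \<in> Cp" "\<phi> \<one> > 0"
  shows "hc f \<phi> \<le> hc f \<psi> * hc \<psi> \<phi>"
proof -
  have pc: "\<psi> \<in> Cc" using assms(2) by (rule CpD)
  have key: "hc f \<phi> \<le> (\<Sum>(c,s)\<leftarrow>cs. c) * (\<Sum>(c,s)\<leftarrow>ds. c)"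
    if cs: "cs \<in> covs f \<psi>" and ds: "ds \<in> covs \<psi> \<phi>" for cs ds
  proof -
    let ?es = "concat (map (\<lambda>(c,s). map (\<lambda>(d,t). (c * d, s \<otimes> t)) ds) cs)"
    have "?es \<in> covs f \<phi>"
      unfolding covs_def mem_Collect_eq
    proof (intro conjI ballI)
      fix p assume "p \<in> set ?es"
      then show "case p of (c,s) \<Rightarrow> 0 \<le> c \<and> s \<in> carrier L" using cs ds by (fastforce simp: covs_def)
    next
      fix x assume x: "x \<in> carrier L"
      have "f x \<le> (\<Sum>(c,s)\<leftarrow>cs. c * \<psi> (inv s \<otimes> x))" using cs x by (auto simp: covs_def)
      also have "\<dots> \<le> (\<Sum>(c,s)\<leftarrow>cs. (\<Sum>(d,t)\<leftarrow>ds. c * d * \<phi> (inv (s \<otimes> t) \<otimes> x)))"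
      proof (rule sum_list_mono)
        fix p assume p: "p \<in> set cs"
        obtain c s where ps: "p = (c,s)" by fastforce
        have c: "0 \<le> c" "s \<in> carrier L" using p ps cs by (auto simp: covs_def)
        have "c * \<psi> (inv s \<otimes> x) \<le> c * (\<Sum>(d,t)\<leftarrow>ds. d * \<phi> (inv t \<otimes> (inv s \<otimes> x)))"
          using ds c x by (intro mult_left_mono) (auto simp: covs_def)
        also have "\<dots> = (\<Sum>(d,t)\<leftarrow>ds. c * d * \<phi> (inv (s \<otimes> t) \<otimes> x))"
        proof -
          have "map (\<lambda>(d,t). c * (d * \<phi> (inv t \<otimes> (inv s \<otimes> x)))) ds = map (\<lambda>(d,t). c * d * \<phi> (inv (s \<otimes> t) \<otimes> x)) ds"
            using covsD[OF ds] x c by (auto simp: inv_mult_group m_assoc mult.assoc)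
          from arg_cong[OF this, of sum_list] show ?thesis by (simp add: sum_list_const_mult[symmetric] case_prod_unfold)
        qed
        finally show "(case p of (c,s) \<Rightarrow> c * \<psi> (inv s \<otimes> x)) \<le> (case p of (c,s) \<Rightarrow> (\<Sum>(d,t)\<leftarrow>ds. c * d * \<phi> (inv (s \<otimes> t) \<otimes> x)))"
          by (simp add: ps)
      qed
      also have "\<dots> = (\<Sum>(c,s)\<leftarrow>?es. c * \<phi> (inv s \<otimes> x))"
        by (induction cs) (auto simp: o_def case_prod_unfold)
      finally show "f x \<le> (\<Sum>(c,s)\<leftarrow>?es. c * \<phi> (inv s \<otimes> x))" .
    qed
    from hc_le[OF this] have "hc f \<phi> \<le> (\<Sum>(c,s)\<leftarrow>?es. c)" .
    also have "\<dots> = (\<Sum>(c,s)\<leftarrow>cs. c) * (\<Sum>(c,s)\<leftarrow>ds. c)"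
      by (induction cs) (auto simp: o_def case_prod_unfold sum_list_const_mult distrib_right)
    finally show ?thesis .
  qed
  have step: "hc f \<phi> \<le> (\<Sum>(c,s)\<leftarrow>cs. c) * hc \<psi> \<phi>" if cs: "cs \<in> covs f \<psi>" for cs
  proof (rule field_le_epsilon)
    fix e :: real assume e: "e > 0"
    let ?S = "(\<Sum>(c,s)\<leftarrow>cs. c)"
    have S: "0 \<le> ?S" using sum_list_nonneg_fst[OF cs] .
    obtain ds where ds: "ds \<in> covs \<psi> \<phi>" "(\<Sum>(c,s)\<leftarrow>ds. c) < hc \<psi> \<phi> + e / (?S + 1)"
      using hc_approx[OF pc assms(4,5), of "e / (?S + 1)"] e S by auto
    have "hc f \<phi> \<le> ?S * (hc \<psi> \<phi> + e / (?S + 1))"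
      using key[OF cs ds(1)] mult_left_mono[OF less_imp_le[OF ds(2)] S] by linarith
    also have "\<dots> \<le> ?S * hc \<psi> \<phi> + e"
      using S e by (simp add: field_simps)
    finally show "hc f \<phi> \<le> ?S * hc \<psi> \<phi> + e" .
  qed
  show ?thesis
  proof (rule field_le_epsilon)
    fix e :: real assume e: "e > 0"
    have S: "0 \<le> hc \<psi> \<phi>" using hc_nonneg[OF pc assms(4,5)] .
    obtain cs where cs: "cs \<in> covs f \<psi>" "(\<Sum>(c,s)\<leftarrow>cs. c) < hc f \<psi> + e / (hc \<psi> \<phi> + 1)"
      using hc_approx[OF assms(1-3), of "e / (hc \<psi> \<phi> + 1)"] e S by auto
    have "hc f \<phi> \<le> (hc f \<psi> + e / (hc \<psi> \<phi> + 1)) * hc \<psi> \<phi>"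
      using step[OF cs(1)] mult_right_mono[OF less_imp_le[OF cs(2)] S] by linarith
    also have "\<dots> \<le> hc f \<psi> * hc \<psi> \<phi> + e"
      using S e by (simp add: field_simps)
    finally show "hc f \<phi> \<le> hc f \<psi> * hc \<psi> \<phi> + e" .
  qed
qed

lemma hc_pos:
  assumes "f \<in> Cc" "\<phi> \<in> Cp" "\<phi> \<one> > 0" "x \<in> carrier L" "f x > 0"
  shows "hc f \<phi> > 0"
proof -
  obtain M where M: "M > 0" "\<And>x. x \<in> carrier L \<Longrightarrow> \<bar>\<phi> x\<bar> \<le> M" using Cc_bounded[OF CpD(1)[OF assms(2)]] by blast
  have "f x / M \<le> hc f \<phi>"
  proof (rule hc_greatest[OF assms(1-3)])
    fix cs assume cs: "cs \<in> covs f \<phi>"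
    have "f x \<le> (\<Sum>(c,s)\<leftarrow>cs. c * \<phi> (inv s \<otimes> x))" using cs assms(4) by (auto simp: covs_def)
    also have "\<dots> \<le> (\<Sum>(c,s)\<leftarrow>cs. M * c)"
    proof (rule sum_list_mono)
      fix p assume p: "p \<in> set cs"
      obtain c s where ps: "p = (c,s)" by fastforce
      have c: "0 \<le> c" "s \<in> carrier L" using p ps cs by (auto simp: covs_def)
      then have "c * \<phi> (inv s \<otimes> x) \<le> c * M" using M(2)[of "inv s \<otimes> x"] assms(4) by (intro mult_left_mono) auto
      then show "(case p of (c,s) \<Rightarrow> c * \<phi> (inv s \<otimes> x)) \<le> (case p of (c,s) \<Rightarrow> M * c)" by (simp add: ps mult.commute)
    qed
    also have "\<dots> = M * (\<Sum>(c,s)\<leftarrow>cs. c)" by (simp add: case_prod_unfold sum_list_const_mult)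
    finally show "f x / M \<le> (\<Sum>(c,s)\<leftarrow>cs. c)" using M(1) by (simp add: field_simps)
  qed
  then show ?thesis using M(1) assms(5) by (smt (verit) divide_pos_pos)
qed

lemma Cp_ge_one_on_compact:
  assumes "compactin T C"
  obtains h where "h \<in> Cp" "\<And>x. x \<in> C \<Longrightarrow> 1 \<le> h x"
proof -
  obtain b where b: "b \<in> Cp" "\<And>x. x \<in> carrier L \<Longrightarrow> b x \<le> 1" "b \<one> = 1"
    using Cp_bump[OF nbh_univ] by metis
  let ?W = "{x \<in> carrier L. b x \<in> {1 / 2<..}}"
  have W: "nbh ?W"
    using openin_continuous_map_preimage[OF Cc_cont[OF CpD(1)[OF b(1)]], of "{1 / 2<..}"] b(3)
    by (simp add: nbh_def)
  obtain S where S: "finite S" "S \<subseteq> carrier L" "\<And>x. x \<in> C \<Longrightarrow> \<exists>s\<in>S. inv s \<otimes> x \<in> ?W"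
    using compactin_translates[OF assms W] by blast
  let ?h = "\<lambda>x. \<Sum>s\<in>S. 2 * b (inv s \<otimes> x)"
  have nn: "0 \<le> b (inv s \<otimes> x)" if "s \<in> S" "x \<in> carrier L" for s x
    using that S by (auto intro!: CpD(2)[OF b(1)])
  have "?h \<in> Cc" using S(1,2)
    by (induction S rule: finite_induct) (auto intro!: Cc_zero Cc_add Cc_scale Cc_ltrans CpD(1)[OF b(1)])
  then have "?h \<in> Cp" using nn by (auto intro!: CpI sum_nonneg)
  moreover have "1 \<le> ?h x" if "x \<in> C" for x
  proof -
    have xc: "x \<in> carrier L" using that compactin_subset_topspace[OF assms] by auto
    obtain s where s: "s \<in> S" "inv s \<otimes> x \<in> ?W" using S(3)[OF \<open>x \<in> C\<close>] by blast
    have "1 \<le> 2 * b (inv s \<otimes> x)" using s by auto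
    also have "\<dots> \<le> ?h x" using s S nn xc by (intro member_le_sum) auto
    finally show ?thesis .
  qed
  ultimately show ?thesis using that by blast
qed

text \<open>The approximate reverse of \<open>hc_add\<close>. A covering by translates of a
  concentrated \<open>\<phi>\<close> is divided between \<open>f1\<close> and \<open>f2\<close> in
  proportions \<open>h1\<close> and \<open>h2\<close> that are nearly constant on each translate.
  The function \<open>h\<close> does not depend on \<open>e\<close>, so the error term disappears as
  \<open>e\<close> tends to 0.\<close>

lemma hc_almost_additive:
  assumes f: "f1 \<in> Cp" "f2 \<in> Cp"
  obtains h where "h \<in> Cp" "\<And>e. e > 0 \<Longrightarrow> \<exists>V. nbh V \<and> (\<forall>\<phi>\<in>Cp. \<phi> \<one> > 0 \<longrightarrow> (\<forall>x\<in>carrier L. \<phi> x \<noteq> 0 \<longrightarrow> x \<in> V) \<longrightarrow>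
     hc f1 \<phi> + hc f2 \<phi> \<le> (1 + 2 * e) * (hc (\<lambda>x. f1 x + f2 x) \<phi> + e * hc h \<phi>))"
proof -
  obtain C1 where C1: "compactin T C1" "\<And>x. x \<in> carrier L \<Longrightarrow> x \<notin> C1 \<Longrightarrow> f1 x = 0" using Cc_supp[OF CpD(1)[OF f(1)]] by blast
  obtain C2 where C2: "compactin T C2" "\<And>x. x \<in> carrier L \<Longrightarrow> x \<notin> C2 \<Longrightarrow> f2 x = 0" using Cc_supp[OF CpD(1)[OF f(2)]] by blast
  obtain h where h: "h \<in> Cp" "\<And>x. x \<in> C1 \<union> C2 \<Longrightarrow> 1 \<le> h x"
    using Cp_ge_one_on_compact[OF compactin_Un[OF C1(1) C2(1)]] by blast
  show ?thesis
  proof (rule that[OF h(1)])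
    fix e :: real assume e: "e > 0"
    \<comment> \<open>Two versions of the perturbed sum: the constant summand of \<open>D\<close>
      makes the quotients \<open>h1\<close> and \<open>h2\<close> continuous everywhere, while
      \<open>F\<close> has compact support and so can be covered. Wherever \<open>f1\<close> or
      \<open>f2\<close> is nonzero, \<open>h\<close> is at least 1, hence
      \<open>D \<le> F\<close>.\<close>
    define D where "D x = f1 x + f2 x + e" for x
    define F where "F x = f1 x + f2 x + e * h x" for x
    define h1 where "h1 x = f1 x / D x" for x
    define h2 where "h2 x = f2 x / D x" for x
    have fc: "f1 \<in> Cc" "f2 \<in> Cc" "h \<in> Cc" using f h by (auto simp: Cp_def)
    have Dpos: "D x > 0" if "x \<in> carrier L" for x using that f e by (auto simp: D_def Cp_def intro!: add_nonneg_pos)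
    have Dcont: "continuous_map T euclideanreal (\<lambda>x. 1 / D x)"
    proof -
      have "continuous_map T euclideanreal D"
        unfolding D_def[abs_def] using fc by (auto intro!: continuous_map_add simp: Cc_cont)
      then show ?thesis using Dpos by (intro continuous_map_real_divide) (auto simp: less_imp_neq[symmetric])
    qed
    have h12: "h1 \<in> Cc" "h2 \<in> Cc" using Cc_mult(1)[OF fc(1) Dcont] Cc_mult(1)[OF fc(2) Dcont] by (auto simp: h1_def[abs_def] h2_def[abs_def])
    have hnn: "0 \<le> h1 x" "0 \<le> h2 x" "h1 x + h2 x \<le> 1" if "x \<in> carrier L" for x
    proof -
      show "0 \<le> h1 x" "0 \<le> h2 x"
        using that f Dpos[OF that] by (auto simp: h1_def h2_def Cp_def)
      have "h1 x + h2 x = (f1 x + f2 x) / D x" by (simp add: h1_def h2_def add_divide_distrib)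
      also have "\<dots> \<le> 1" using Dpos[OF that] e by (simp add: D_def)
      finally show "h1 x + h2 x \<le> 1" .
    qed
    have Fc: "F \<in> Cc" unfolding F_def using fc by (intro Cc_add Cc_scale)
    have hF: "f1 x \<le> h1 x * F x" "f2 x \<le> h2 x * F x" if x: "x \<in> carrier L" for x
    proof -
      have "f1 x = 0 \<or> D x \<le> F x"
        using C1(2)[OF x] h(2)[of x] e by (cases "x \<in> C1") (auto simp: D_def F_def)
      then show "f1 x \<le> h1 x * F x"
      proof
        assume "f1 x = 0"
        then show ?thesis by (simp add: h1_def)
      next
        assume le: "D x \<le> F x"
        have "f1 x = h1 x * D x" using Dpos[OF x] by (simp add: h1_def)
        also have "\<dots> \<le> h1 x * F x" using le hnn(1)[OF x] by (rule mult_left_mono)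
        finally show ?thesis .
      qed
      have "f2 x = 0 \<or> D x \<le> F x"
        using C2(2)[OF x] h(2)[of x] e by (cases "x \<in> C2") (auto simp: D_def F_def)
      then show "f2 x \<le> h2 x * F x"
      proof
        assume "f2 x = 0"
        then show ?thesis by (simp add: h2_def)
      next
        assume le: "D x \<le> F x"
        have "f2 x = h2 x * D x" using Dpos[OF x] by (simp add: h2_def)
        also have "\<dots> \<le> h2 x * F x" using le hnn(2)[OF x] by (rule mult_left_mono)
        finally show ?thesis .
      qed
    qed
    obtain V1 where V1: "nbh V1" "\<And>x z. x \<in> carrier L \<Longrightarrow> z \<in> V1 \<Longrightarrow> \<bar>h1 (x \<otimes> z) - h1 x\<bar> < e"
      using Cc_uniform_right[OF h12(1) e] by blast
    obtain V2 where V2: "nbh V2" "\<And>x z. x \<in> carrier L \<Longrightarrow> z \<in> V2 \<Longrightarrow> \<bar>h2 (x \<otimes> z) - h2 x\<bar> < e"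
      using Cc_uniform_right[OF h12(2) e] by blast
    show "\<exists>V. nbh V \<and> (\<forall>\<phi>\<in>Cp. \<phi> \<one> > 0 \<longrightarrow> (\<forall>x\<in>carrier L. \<phi> x \<noteq> 0 \<longrightarrow> x \<in> V) \<longrightarrow>
     hc f1 \<phi> + hc f2 \<phi> \<le> (1 + 2 * e) * (hc (\<lambda>x. f1 x + f2 x) \<phi> + e * hc h \<phi>))"
    proof (intro exI conjI ballI impI)
      show "nbh (V1 \<inter> V2)" using V1 V2 nbh_Int by blast
      fix \<phi> assume phi: "\<phi> \<in> Cp" "\<phi> \<one> > 0" and supp: "\<forall>x\<in>carrier L. \<phi> x \<noteq> 0 \<longrightarrow> x \<in> V1 \<inter> V2"
      have gen: "hc fi \<phi> \<le> (\<Sum>(c,s)\<leftarrow>cs. c * (hi s + e))"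
        if cs: "cs \<in> covs F \<phi>" and hi: "\<And>x. x \<in> carrier L \<Longrightarrow> 0 \<le> hi x" "\<And>x. x \<in> carrier L \<Longrightarrow> fi x \<le> hi x * F x"
          "\<And>x z. x \<in> carrier L \<Longrightarrow> z \<in> V1 \<inter> V2 \<Longrightarrow> \<bar>hi (x \<otimes> z) - hi x\<bar> < e" for cs fi hi
      proof -
        let ?ds = "map (\<lambda>(c,s). (c * (hi s + e), s)) cs"
        have "?ds \<in> covs fi \<phi>"
          unfolding covs_def mem_Collect_eq
        proof (intro conjI ballI)
          fix p assume "p \<in> set ?ds"
          then show "case p of (c,s) \<Rightarrow> 0 \<le> c \<and> s \<in> carrier L"
            using cs hi(1) e by (auto simp: covs_def intro!: mult_nonneg_nonneg add_nonneg_nonneg)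
        next
          fix x assume x: "x \<in> carrier L"
          have "fi x \<le> hi x * F x" using hi x by blast
          also have "\<dots> \<le> hi x * (\<Sum>(c,s)\<leftarrow>cs. c * \<phi> (inv s \<otimes> x))"
            using cs x hi(1) by (intro mult_left_mono) (auto simp: covs_def)
          also have "\<dots> = (\<Sum>(c,s)\<leftarrow>cs. hi x * (c * \<phi> (inv s \<otimes> x)))"
            by (simp add: case_prod_unfold sum_list_const_mult)
          also have "\<dots> \<le> (\<Sum>(c,s)\<leftarrow>cs. c * (hi s + e) * \<phi> (inv s \<otimes> x))"
          proof (rule sum_list_mono)
            fix p assume p: "p \<in> set cs"
            obtain c s where ps: "p = (c,s)" by fastforce
            have c: "0 \<le> c" "s \<in> carrier L" using p ps cs by (auto simp: covs_def)
            have ph: "0 \<le> \<phi> (inv s \<otimes> x)" using c x phi by (auto simp: Cp_def)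
            have "hi x * (c * \<phi> (inv s \<otimes> x)) \<le> (hi s + e) * (c * \<phi> (inv s \<otimes> x))"
            proof (cases "\<phi> (inv s \<otimes> x) = 0")
              case False
              then have "inv s \<otimes> x \<in> V1 \<inter> V2" using supp c x by auto
              moreover have "s \<otimes> (inv s \<otimes> x) = x" using c x by (simp add: m_assoc[symmetric])
              ultimately have "hi x \<le> hi s + e" using hi(3)[of s "inv s \<otimes> x"] c by auto
              then show ?thesis using c ph by (intro mult_right_mono) auto
            qed simp
            then show "(case p of (c,s) \<Rightarrow> hi x * (c * \<phi> (inv s \<otimes> x))) \<le> (case p of (c,s) \<Rightarrow> c * (hi s + e) * \<phi> (inv s \<otimes> x))"
              by (simp add: ps mult_ac)
          qed
          also have "\<dots> = (\<Sum>(c,s)\<leftarrow>?ds. c * \<phi> (inv s \<otimes> x))" by (simp add: o_def case_prod_unfold)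
          finally show "fi x \<le> (\<Sum>(c,s)\<leftarrow>?ds. c * \<phi> (inv s \<otimes> x))" .
        qed
        from hc_le[OF this] show ?thesis by (simp add: o_def case_prod_unfold)
      qed
      have "hc f1 \<phi> + hc f2 \<phi> \<le> (1 + 2 * e) * (\<Sum>(c,s)\<leftarrow>cs. c)" if cs: "cs \<in> covs F \<phi>" for cs
      proof -
        have "hc f1 \<phi> + hc f2 \<phi> \<le> (\<Sum>(c,s)\<leftarrow>cs. c * (h1 s + e)) + (\<Sum>(c,s)\<leftarrow>cs. c * (h2 s + e))"
          using gen[OF cs, of h1 f1] gen[OF cs, of h2 f2] hnn hF V1 V2 by (intro add_mono) auto
        also have "\<dots> = (\<Sum>(c,s)\<leftarrow>cs. c * (h1 s + h2 s + 2 * e))"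
          by (simp add: case_prod_unfold sum_list_addf[symmetric] algebra_simps)
        also have "\<dots> \<le> (\<Sum>(c,s)\<leftarrow>cs. (1 + 2 * e) * c)"
        proof (rule sum_list_mono)
          fix p assume p: "p \<in> set cs"
          obtain c s where ps: "p = (c,s)" by fastforce
          have c: "0 \<le> c" "s \<in> carrier L" using p ps cs by (auto simp: covs_def)
          then have "c * (h1 s + h2 s + 2 * e) \<le> c * (1 + 2 * e)" using hnn(3)[of s] by (intro mult_left_mono) auto
          then show "(case p of (c,s) \<Rightarrow> c * (h1 s + h2 s + 2 * e)) \<le> (case p of (c,s) \<Rightarrow> (1 + 2 * e) * c)"
            by (simp add: ps mult.commute)
        qed
        also have "\<dots> = (1 + 2 * e) * (\<Sum>(c,s)\<leftarrow>cs. c)" by (simp add: case_prod_unfold sum_list_const_mult)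
        finally show ?thesis .
      qed
      then have "(hc f1 \<phi> + hc f2 \<phi>) / (1 + 2 * e) \<le> hc F \<phi>"
        using e by (intro hc_greatest[OF Fc phi]) (simp add: field_simps)
      then have "hc f1 \<phi> + hc f2 \<phi> \<le> (1 + 2 * e) * hc F \<phi>" using e by (simp add: field_simps)
      also have "\<dots> \<le> (1 + 2 * e) * (hc (\<lambda>x. f1 x + f2 x) \<phi> + e * hc h \<phi>)"
      proof (rule mult_left_mono)
        have "hc F \<phi> \<le> hc (\<lambda>x. f1 x + f2 x) \<phi> + hc (\<lambda>x. e * h x) \<phi>"
          unfolding F_def using fc phi by (intro hc_add Cc_add Cc_scale)
        also have "hc (\<lambda>x. e * h x) \<phi> = e * hc h \<phi>" using fc phi e by (intro hc_scale)
        finally show "hc F \<phi> \<le> hc (\<lambda>x. f1 x + f2 x) \<phi> + e * hc h \<phi>" .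
      qed (use e in auto)
      finally show "hc f1 \<phi> + hc f2 \<phi> \<le> (1 + 2 * e) * (hc (\<lambda>x. f1 x + f2 x) \<phi> + e * hc h \<phi>)" .
    qed
  qed
qed

text \<open>For each \<open>f\<close> the ratios \<open>R f \<phi>\<close> lie in a bounded
  interval, so they converge along an ultrafilter of test functions \<open>\<phi>\<close> whose
  supports shrink to \<open>\<one>\<close>. In this limit approximate additivity becomes
  exact.\<close>

lemma haar_exists:
  obtains I :: "('a \<Rightarrow> real) \<Rightarrow> real" where
    "\<And>f g. f \<in> Cc \<Longrightarrow> g \<in> Cc \<Longrightarrow> I (\<lambda>x. f x + g x) = I f + I g"
    "\<And>f c. f \<in> Cc \<Longrightarrow> I (\<lambda>x. c * f x) = c * I f"
    "\<And>f. f \<in> Cp \<Longrightarrow> 0 \<le> I f"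
    "\<And>f g. f \<in> Cc \<Longrightarrow> g \<in> carrier L \<Longrightarrow> I (\<lambda>x. f (inv g \<otimes> x)) = I f"
    "\<And>f x. f \<in> Cp \<Longrightarrow> x \<in> carrier L \<Longrightarrow> f x > 0 \<Longrightarrow> I f > 0"
proof -
  obtain f0 where f0: "f0 \<in> Cp" "f0 \<one> = 1" using Cp_bump[OF nbh_univ] by metis
  have f0c: "f0 \<in> Cc" and f0p: "f0 \<one> > 0" using f0 by (auto simp: Cp_def)
  define A where "A V = {\<phi>\<in>Cp. \<phi> \<one> > 0 \<and> (\<forall>x\<in>carrier L. \<phi> x \<noteq> 0 \<longrightarrow> x \<in> V)}" for V
  obtain U where U: "ultrafilter U" and UA: "\<And>V. nbh V \<Longrightarrow> eventually (\<lambda>\<phi>. \<phi> \<in> A V) U"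
  proof (rule ultrafilter_base[of "A ` {V. nbh V}"])
    show "A ` {V. nbh V} \<noteq> {}" using nbh_univ by auto
    show "B \<noteq> {}" if B: "B \<in> A ` {V. nbh V}" for B
    proof -
      obtain V where V: "nbh V" "B = A V" using B by auto
      obtain h where "h \<in> Cp" "h \<one> = 1" "\<And>x. x \<in> carrier L \<Longrightarrow> h x \<noteq> 0 \<Longrightarrow> x \<in> V" using Cp_bump[OF V(1)] by metis
      then have "h \<in> A V" by (auto simp: A_def)
      then show ?thesis using V by auto
    qed
    show "\<exists>D\<in>A ` {V. nbh V}. D \<subseteq> B \<inter> C" if BC: "B \<in> A ` {V. nbh V}" "C \<in> A ` {V. nbh V}" for B C
    proof -
      obtain V W where "nbh V" "B = A V" "nbh W" "C = A W" using BC by auto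
      moreover have "A (V \<inter> W) \<subseteq> A V \<inter> A W" by (auto simp: A_def)
      ultimately show ?thesis using nbh_Int by blast
    qed
  qed auto
  have nb: "U \<noteq> bot" using U by (simp add: ultrafilter_def)
  have good: "eventually (\<lambda>\<phi>. \<phi> \<in> Cp \<and> \<phi> \<one> > 0) U"
    using UA[OF nbh_univ] by eventually_elim (auto simp: A_def)
  define R where "R f \<phi> = hc f \<phi> / hc f0 \<phi>" for f \<phi>
  define I0 where "I0 f = Lim U (R f)" for f
  have h0: "hc f0 \<phi> > 0" if "\<phi> \<in> Cp" "\<phi> \<one> > 0" for \<phi>
    using hc_pos[OF f0c that, of \<one>] f0 by simp
  have tend: "(R f \<longlongrightarrow> I0 f) U" if f: "f \<in> Cp" for f
  proof -
    have fc: "f \<in> Cc" using f by (rule CpD)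
    have "eventually (\<lambda>\<phi>. R f \<phi> \<in> {0..hc f f0}) U"
      using good
    proof eventually_elim
      case (elim \<phi>)
      have "hc f \<phi> \<le> hc f f0 * hc f0 \<phi>" using elim by (intro hc_trans fc f0 f0p) auto
      then show ?case using h0[of \<phi>] hc_nonneg[OF fc, of \<phi>] elim by (auto simp: R_def field_simps)
    qed
    then obtain l where "limitin euclideanreal (R f) l U"
      using ultrafilter_compactin_limit[OF U, of euclideanreal "{0..hc f f0}" "R f"] by auto
    then have "(R f \<longlongrightarrow> l) U" by simp
    then show ?thesis using tendsto_Lim[OF nb, of "R f" l] by (simp add: I0_def)
  qed
  have uniq: "l = l'" if "(f \<longlongrightarrow> l) U" "(f \<longlongrightarrow> l') U" for f :: "('a \<Rightarrow> real) \<Rightarrow> real" and l l'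
    using tendsto_unique[OF nb that] .
  have addc: "(\<lambda>x. f x + g x) \<in> Cp" if "f \<in> Cp" "g \<in> Cp" for f g
    using that by (auto simp: Cp_def intro!: Cc_add)
  have Icong: "I0 f = I0 g" if "f \<in> Cp" "g \<in> Cp" "\<And>x. x \<in> carrier L \<Longrightarrow> f x = g x" for f g
  proof (rule uniq[OF tend[OF that(1)]])
    have "eventually (\<lambda>\<phi>. R g \<phi> = R f \<phi>) U"
      using good
    proof eventually_elim
      case (elim \<phi>)
      have "hc f \<phi> = hc g \<phi>"
        using that elim by (intro antisym hc_mono) (auto simp: Cp_def)
      then show ?case by (simp add: R_def)
    qed
    then show "(R f \<longlongrightarrow> I0 g) U" using tend[OF that(2)] tendsto_cong by fastforce
  qed
  have Iadd: "I0 (\<lambda>x. f x + g x) = I0 f + I0 g" if fg: "f \<in> Cp" "g \<in> Cp" for f g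
  proof (rule antisym)
    have fc: "f \<in> Cc" "g \<in> Cc" using fg by (auto simp: Cp_def)
    have t1: "((\<lambda>\<phi>. R f \<phi> + R g \<phi>) \<longlongrightarrow> I0 f + I0 g) U" using tend fg by (intro tendsto_add) auto
    have t2: "(R (\<lambda>x. f x + g x) \<longlongrightarrow> I0 (\<lambda>x. f x + g x)) U" using tend addc fg by auto
    have "eventually (\<lambda>\<phi>. R (\<lambda>x. f x + g x) \<phi> \<le> R f \<phi> + R g \<phi>) U"
      using good
    proof eventually_elim
      case (elim \<phi>)
      show ?case using hc_add[OF fc, of \<phi>] elim h0[of \<phi>] by (auto simp: R_def field_simps)
    qed
    from tendsto_le[OF nb t1 t2 this] show "I0 (\<lambda>x. f x + g x) \<le> I0 f + I0 g" .
    obtain h where h: "h \<in> Cp" and H: "\<And>e. e > 0 \<Longrightarrow> \<exists>V. nbh V \<and> (\<forall>\<phi>\<in>Cp. \<phi> \<one> > 0 \<longrightarrow> (\<forall>x\<in>carrier L. \<phi> x \<noteq> 0 \<longrightarrow> x \<in> V) \<longrightarrow>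
       hc f \<phi> + hc g \<phi> \<le> (1 + 2 * e) * (hc (\<lambda>x. f x + g x) \<phi> + e * hc h \<phi>))"
      using hc_almost_additive[OF fg] by blast
    have le: "I0 f + I0 g \<le> (1 + 2 * e) * (I0 (\<lambda>x. f x + g x) + e * I0 h)" if e: "e > 0" for e
    proof -
      obtain V where V: "nbh V" and HV: "\<And>\<phi>. \<phi> \<in> A V \<Longrightarrow>
          hc f \<phi> + hc g \<phi> \<le> (1 + 2 * e) * (hc (\<lambda>x. f x + g x) \<phi> + e * hc h \<phi>)"
        using H[OF e] unfolding A_def by auto
      have "eventually (\<lambda>\<phi>. R f \<phi> + R g \<phi> \<le> (1 + 2 * e) * (R (\<lambda>x. f x + g x) \<phi> + e * R h \<phi>)) U"
        using UA[OF V] good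
      proof eventually_elim
        case (elim \<phi>)
        have "(hc f \<phi> + hc g \<phi>) / hc f0 \<phi> \<le> ((1 + 2 * e) * (hc (\<lambda>x. f x + g x) \<phi> + e * hc h \<phi>)) / hc f0 \<phi>"
          using HV[of \<phi>] h0[of \<phi>] elim by (intro divide_right_mono) auto
        then show ?case by (simp add: R_def add_divide_distrib[symmetric])
      qed
      moreover have "((\<lambda>\<phi>. (1 + 2 * e) * (R (\<lambda>x. f x + g x) \<phi> + e * R h \<phi>)) \<longlongrightarrow> (1 + 2 * e) * (I0 (\<lambda>x. f x + g x) + e * I0 h)) U"
        using t2 tend[OF h] by (intro tendsto_intros)
      ultimately show ?thesis using tendsto_le[OF nb _ t1] by blast
    qed
    have "((\<lambda>e::real. (1 + 2 * e) * (I0 (\<lambda>x. f x + g x) + e * I0 h)) \<longlongrightarrow> (1 + 2 * 0) * (I0 (\<lambda>x. f x + g x) + 0 * I0 h)) (at_right 0)"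
      by (intro tendsto_intros)
    moreover have "eventually (\<lambda>e. I0 f + I0 g \<le> (1 + 2 * e) * (I0 (\<lambda>x. f x + g x) + e * I0 h)) (at_right 0)"
      using le by (auto simp: eventually_at_filter)
    ultimately show "I0 f + I0 g \<le> I0 (\<lambda>x. f x + g x)"
      using tendsto_lowerbound[of _ _ "at_right (0::real)" "I0 f + I0 g"] by auto
  qed
  have Inn: "0 \<le> I0 f" if f: "f \<in> Cp" for f
  proof -
    have "eventually (\<lambda>\<phi>. 0 \<le> R f \<phi>) U"
      using good
    proof eventually_elim
      case (elim \<phi>)
      show ?case using hc_nonneg[OF CpD(1)[OF f], of \<phi>] h0[of \<phi>] elim by (auto simp: R_def)
    qed
    then show ?thesis using tendsto_lowerbound[OF tend[OF f]] nb by auto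
  qed
  have Iscale: "I0 (\<lambda>x. c * f x) = c * I0 f" if f: "f \<in> Cp" and c: "c \<ge> 0" for f c
  proof (cases "c = 0")
    case True
    have z: "(\<lambda>x. 0) \<in> Cp" by (auto simp: Cp_def Cc_zero)
    have "I0 (\<lambda>x. 0) = 0" using Iadd[OF z z] by simp
    then show ?thesis using True by simp
  next
    case False
    then have c: "c > 0" using c by simp
    have cf: "(\<lambda>x. c * f x) \<in> Cp" using f c by (auto simp: Cp_def intro!: Cc_scale)
    show ?thesis
    proof (rule uniq[OF tend[OF cf]])
      have "eventually (\<lambda>\<phi>. c * R f \<phi> = R (\<lambda>x. c * f x) \<phi>) U"
        using good
      proof eventually_elim
        case (elim \<phi>)
        then show ?case using hc_scale[OF CpD(1)[OF f], of \<phi> c] c by (simp add: R_def)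
      qed
      moreover have "((\<lambda>\<phi>. c * R f \<phi>) \<longlongrightarrow> c * I0 f) U" using tend[OF f] by (intro tendsto_intros)
      ultimately show "(R (\<lambda>x. c * f x) \<longlongrightarrow> c * I0 f) U" using tendsto_cong by fastforce
    qed
  qed
  have trc: "(\<lambda>x. f (inv g \<otimes> x)) \<in> Cp" if "f \<in> Cp" "g \<in> carrier L" for f g
    using that by (auto simp: Cp_def intro!: Cc_ltrans)
  have Itr: "I0 (\<lambda>x. f (inv g \<otimes> x)) = I0 f" if f: "f \<in> Cp" and g: "g \<in> carrier L" for f g
  proof (rule uniq[OF tend[OF trc[OF f g]]])
    have "eventually (\<lambda>\<phi>. R f \<phi> = R (\<lambda>x. f (inv g \<otimes> x)) \<phi>) U"
      using good
    proof eventually_elim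
      case (elim \<phi>)
      then show ?case using hc_ltrans[OF CpD(1)[OF f], of \<phi> g] g by (simp add: R_def)
    qed
    then show "(R (\<lambda>x. f (inv g \<otimes> x)) \<longlongrightarrow> I0 f) U" using tend[OF f] tendsto_cong by fastforce
  qed
  \<comment> \<open>After a translation the positive value sits at \<open>\<one>\<close>, so that
    \<open>?g\<close> is itself admissible as a test function and \<open>hc_trans\<close> bounds the
    ratios below by 1 / hc f0 g.\<close>
  have Ipos: "I0 f > 0" if f: "f \<in> Cp" and x: "x \<in> carrier L" "f x > 0" for f x
  proof -
    let ?g = "\<lambda>y. f (inv (inv x) \<otimes> y)"
    have g: "?g \<in> Cp" using trc[OF f, of "inv x"] x by simp
    have g1: "?g \<one> > 0" using x by simp
    have hg: "hc f0 ?g > 0" using hc_pos[OF f0c g g1, of \<one>] f0 by simp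
    have "eventually (\<lambda>\<phi>. 1 / hc f0 ?g \<le> R ?g \<phi>) U"
      using good
    proof eventually_elim
      case (elim \<phi>)
      have "hc f0 \<phi> \<le> hc f0 ?g * hc ?g \<phi>" using elim by (intro hc_trans f0c g g1) auto
      then show ?case using h0[of \<phi>] elim hg by (simp add: R_def field_simps)
    qed
    then have "1 / hc f0 ?g \<le> I0 ?g" using tendsto_lowerbound[OF tend[OF g]] nb by auto
    moreover have "I0 ?g = I0 f" using Itr[OF f, of "inv x"] x by simp
    ultimately show ?thesis using hg by (smt (verit) divide_pos_pos)
  qed
  \<comment> \<open>The limit \<open>I0\<close> is under control only on nonnegative functions. By
    \<open>Jdiff\<close> any decomposition into a difference of such functions gives the same value
    as the positive and negative parts, which yields additivity for signed functions.\<close>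
  define J where "J f = I0 (\<lambda>x. max 0 (f x)) - I0 (\<lambda>x. max 0 (- f x))" for f
  have pp: "(\<lambda>x. max 0 (f x)) \<in> Cp" "(\<lambda>x. max 0 (- f x)) \<in> Cp" if "f \<in> Cc" for f
    using Cc_pos_part[OF that] Cc_pos_part[OF Cc_minus[OF that]] by (auto simp: Cp_def)
  have Jdiff: "J f = I0 a - I0 b" if f: "f \<in> Cc" and ab: "a \<in> Cp" "b \<in> Cp" and eq: "\<And>x. x \<in> carrier L \<Longrightarrow> f x = a x - b x" for f a b
  proof -
    have "I0 (\<lambda>x. max 0 (f x) + b x) = I0 (\<lambda>x. max 0 (- f x) + a x)"
      using ab pp[OF f] by (intro Icong addc) (auto simp: eq)
    then show ?thesis using Iadd pp[OF f] ab by (simp add: J_def)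
  qed
  have J: "f \<in> Cc \<Longrightarrow> f x = max 0 (f x) - max 0 (- f x)" for f x by simp
  show ?thesis
  proof (rule that[of J])
    fix f g assume fg: "f \<in> Cc" "g \<in> Cc"
    have "J (\<lambda>x. f x + g x) = I0 (\<lambda>x. max 0 (f x) + max 0 (g x)) - I0 (\<lambda>x. max 0 (- f x) + max 0 (- g x))"
      using fg pp by (intro Jdiff Cc_add addc) auto
    also have "\<dots> = J f + J g" using Iadd pp fg by (simp add: J_def)
    finally show "J (\<lambda>x. f x + g x) = J f + J g" .
  next
    fix f and c :: real assume f: "f \<in> Cc"
    show "J (\<lambda>x. c * f x) = c * J f"
    proof (cases "c \<ge> 0")
      case True
      have "J (\<lambda>x. c * f x) = I0 (\<lambda>x. c * max 0 (f x)) - I0 (\<lambda>x. c * max 0 (- f x))"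
        using f pp True by (intro Jdiff Cc_scale) (auto simp: Cp_def intro!: Cc_scale simp: max_def)
      then show ?thesis using Iscale pp f True by (simp add: J_def right_diff_distrib)
    next
      case False
      have "J (\<lambda>x. c * f x) = I0 (\<lambda>x. (-c) * max 0 (- f x)) - I0 (\<lambda>x. (-c) * max 0 (f x))"
      proof (rule Jdiff[OF Cc_scale[OF f]])
        show "(\<lambda>x. (-c) * max 0 (- f x)) \<in> Cp" "(\<lambda>x. (-c) * max 0 (f x)) \<in> Cp"
          using False by (intro CpI Cc_scale CpD(1)[OF pp(2)[OF f]] CpD(1)[OF pp(1)[OF f]] mult_nonneg_nonneg; simp)+
      qed (auto simp: max_def)
      also have "\<dots> = c * J f" using Iscale[OF pp(1)[OF f], of "-c"] Iscale[OF pp(2)[OF f], of "-c"] False by (simp add: J_def right_diff_distrib)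
      finally show ?thesis .
    qed
  next
    fix f assume f: "f \<in> Cp"
    have z: "(\<lambda>x. 0) \<in> Cp" by (auto simp: Cp_def Cc_zero)
    have "I0 (\<lambda>x. 0) = 0" using Iadd[OF z z] by simp
    then have Jf: "J f = I0 f" using Jdiff[OF CpD(1)[OF f] f z] by simp
    then show "0 \<le> J f" using Inn[OF f] by simp
    show "J f > 0" if "x \<in> carrier L" "f x > 0" for x using Ipos[OF f that] Jf by simp
  next
    fix f g assume f: "f \<in> Cc" "g \<in> carrier L"
    have "J (\<lambda>x. f (inv g \<otimes> x)) = I0 (\<lambda>x. max 0 (f (inv g \<otimes> x))) - I0 (\<lambda>x. max 0 (- f (inv g \<otimes> x)))"
      by (simp add: J_def)
    also have "\<dots> = J f" using Itr[OF pp(1)[OF f(1)] f(2)] Itr[OF pp(2)[OF f(1)] f(2)] by (simp add: J_def)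
    finally show "J (\<lambda>x. f (inv g \<otimes> x)) = J f" .
  qed
qed

end

locale haar = lcgrp +
  fixes I :: "('a \<Rightarrow> real) \<Rightarrow> real"
  assumes I_add: "\<And>f g. f \<in> Cc \<Longrightarrow> g \<in> Cc \<Longrightarrow> I (\<lambda>x. f x + g x) = I f + I g"
    and I_scale: "\<And>f c. f \<in> Cc \<Longrightarrow> I (\<lambda>x. c * f x) = c * I f"
    and I_nonneg: "\<And>f. f \<in> Cp \<Longrightarrow> 0 \<le> I f"
    and I_ltrans: "\<And>f g. f \<in> Cc \<Longrightarrow> g \<in> carrier L \<Longrightarrow> I (\<lambda>x. f (inv g \<otimes> x)) = I f"
    and I_pos: "\<And>f x. f \<in> Cp \<Longrightarrow> x \<in> carrier L \<Longrightarrow> f x > 0 \<Longrightarrow> I f > 0"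

lemma (in lcgrp) haar_ex:
  obtains I where "haar L T I"
proof (rule haar_exists)
  fix I :: "('a \<Rightarrow> real) \<Rightarrow> real"
  assume "\<And>f g. f \<in> Cc \<Longrightarrow> g \<in> Cc \<Longrightarrow> I (\<lambda>x. f x + g x) = I f + I g"
    "\<And>f c. f \<in> Cc \<Longrightarrow> I (\<lambda>x. c * f x) = c * I f"
    "\<And>f. f \<in> Cp \<Longrightarrow> 0 \<le> I f"
    "\<And>f g. f \<in> Cc \<Longrightarrow> g \<in> carrier L \<Longrightarrow> I (\<lambda>x. f (inv g \<otimes> x)) = I f"
    "\<And>f x. f \<in> Cp \<Longrightarrow> x \<in> carrier L \<Longrightarrow> f x > 0 \<Longrightarrow> I f > 0"
  then have "haar L T I" by (intro haar.intro lcgrp_axioms haar_axioms.intro)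
  then show thesis by (rule that)
qed

context haar begin

lemma I_diff: "f \<in> Cc \<Longrightarrow> g \<in> Cc \<Longrightarrow> I (\<lambda>x. f x - g x) = I f - I g"
  using I_add[of f "\<lambda>x. (-1) * g x"] I_scale[of g "-1"] Cc_scale[of g "-1"] by simp

lemma I_mono:
  assumes "f \<in> Cc" "g \<in> Cc" "\<And>x. x \<in> carrier L \<Longrightarrow> f x \<le> g x"
  shows "I f \<le> I g"
proof -
  have "0 \<le> I (\<lambda>x. g x - f x)" using assms by (intro I_nonneg CpI Cc_diff) auto
  then show ?thesis using I_diff[OF assms(2,1)] by simp
qed

lemma I_cong:
  assumes "f \<in> Cc" "\<And>x. x \<in> carrier L \<Longrightarrow> f x = g x" "g \<in> Cc"
  shows "I f = I g"
  using assms by (intro antisym I_mono) auto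

lemma I_abs_le:
  assumes "f \<in> Cc" "g \<in> Cc" "\<And>x. x \<in> carrier L \<Longrightarrow> \<bar>f x\<bar> \<le> g x"
  shows "\<bar>I f\<bar> \<le> I g"
proof -
  have "I f \<le> I g" using assms by (intro I_mono) (auto simp: abs_le_iff)
  moreover have "I (\<lambda>x. (-1) * f x) \<le> I g" using assms by (intro I_mono Cc_scale) (auto simp: abs_le_iff)
  ultimately show ?thesis using I_scale[OF assms(1), of "-1"] by simp
qed

end

section \<open>Convolution\<close>

lemma (in topgrp) continuous_map_right_uniform:
  fixes f :: "'a \<Rightarrow> real"
  assumes "\<And>e. e > 0 \<Longrightarrow> \<exists>V. nbh V \<and> (\<forall>x\<in>carrier L. \<forall>z\<in>V. \<bar>f (x \<otimes> z) - f x\<bar> < e)"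
  shows "continuous_map T euclideanreal f"
proof -
  have "openin T {x \<in> topspace T. f x \<in> S}" if S: "open S" for S
  proof (subst openin_subopen, intro ballI)
    fix x assume "x \<in> {x \<in> topspace T. f x \<in> S}"
    then have x: "x \<in> carrier L" "f x \<in> S" by auto
    then obtain e where e: "e > 0" "\<And>y. \<bar>y - f x\<bar> < e \<Longrightarrow> y \<in> S"
      using S unfolding open_dist dist_real_def by blast
    obtain V where V: "nbh V" "\<forall>x\<in>carrier L. \<forall>z\<in>V. \<bar>f (x \<otimes> z) - f x\<bar> < e" using assms[OF e(1)] by auto
    let ?W = "(\<lambda>z. x \<otimes> z) ` V"
    have "openin T ?W" using openin_ltrans[OF x(1)] V(1) by (simp add: nbh_def)
    moreover have "x \<in> ?W" using V(1) x by (auto simp: nbh_def image_iff intro!: bexI[of _ \<one>])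
    moreover have "?W \<subseteq> {x \<in> topspace T. f x \<in> S}"
      using V x e nbh_carrier[OF V(1)] by auto
    ultimately show "\<exists>W. openin T W \<and> x \<in> W \<and> W \<subseteq> {x \<in> topspace T. f x \<in> S}" by (intro exI conjI)
  qed
  then show ?thesis by (auto simp: continuous_map_def)
qed

context haar begin

definition conv :: "('a \<Rightarrow> real) \<Rightarrow> ('a \<Rightarrow> real) \<Rightarrow> 'a \<Rightarrow> real" where
  "conv a b x = I (\<lambda>y. a y * b (inv y \<otimes> x))"

lemma conv_integrand:
  assumes "a \<in> Cc" "b \<in> Cc" "x \<in> carrier L"
  shows "(\<lambda>y. a y * b (inv y \<otimes> x)) \<in> Cc"
  using assms by (intro Cc_mult continuous_map_compose_grp[OF Cc_cont] continuous_map_mult continuous_map_inverse) auto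

text \<open>By left invariance a translation of the convolution moves to its left factor; a
  difference of two translates thus becomes the convolution of a difference.\<close>

lemma conv_ltrans:
  assumes "a \<in> Cc" "b \<in> Cc" "x \<in> carrier L" "g \<in> carrier L"
  shows "conv a b (inv g \<otimes> x) = conv (\<lambda>y. a (inv g \<otimes> y)) b x"
proof -
  let ?F = "\<lambda>y. a y * b (inv y \<otimes> (inv g \<otimes> x))"
  have F: "?F \<in> Cc" using assms by (intro conv_integrand) auto
  have "conv a b (inv g \<otimes> x) = I (\<lambda>y. ?F (inv g \<otimes> y))" using I_ltrans[OF F assms(4)] by (simp add: conv_def)
  also have "\<dots> = I (\<lambda>y. a (inv g \<otimes> y) * b (inv y \<otimes> x))"
  proof (rule I_cong)
    show "(\<lambda>y. ?F (inv g \<otimes> y)) \<in> Cc" using Cc_ltrans[OF F, of "inv g"] assms by simp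
    show "(\<lambda>y. a (inv g \<otimes> y) * b (inv y \<otimes> x)) \<in> Cc" using assms by (intro conv_integrand Cc_ltrans) auto
    fix y assume "y \<in> carrier L"
    then have "inv (inv g \<otimes> y) \<otimes> (inv g \<otimes> x) = inv y \<otimes> x"
      using assms by (simp add: inv_mult_group m_assoc) (simp add: m_assoc[symmetric])
    then show "?F (inv g \<otimes> y) = a (inv g \<otimes> y) * b (inv y \<otimes> x)" by simp
  qed
  finally show ?thesis by (simp add: conv_def)
qed

lemma conv_diff_left:
  assumes "a \<in> Cc" "a' \<in> Cc" "b \<in> Cc" "x \<in> carrier L"
  shows "conv (\<lambda>y. a y - a' y) b x = conv a b x - conv a' b x"
  using I_diff[OF conv_integrand[OF assms(1,3,4)] conv_integrand[OF assms(2,3,4)]] by (simp add: conv_def left_diff_distrib)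

text \<open>Here the translation by \<open>h\<close> is put on the right factor, where it appears
  conjugated, as y^-1 h^-1 y. Smallness of \<open>a\<close> (the factor \<alpha>) and small
  oscillation of \<open>\<eta>\<close> under such conjugates (the factor \<beta>) therefore
  multiply. All second-order estimates below rest on this product; \<open>\<Theta>\<close> is a
  majorant on the support of \<open>a\<close>.\<close>

lemma conv_diff_bound:
  assumes a: "a \<in> Cc" "\<eta> \<in> Cc" and \<Theta>: "\<Theta> \<in> Cc" and h: "h \<in> carrier L" and x: "x \<in> carrier L"
    and bd: "\<And>y. y \<in> carrier L \<Longrightarrow> \<bar>a y\<bar> \<le> \<alpha> * \<Theta> y"
    and osc: "\<And>y z. y \<in> carrier L \<Longrightarrow> a y \<noteq> 0 \<Longrightarrow> z \<in> carrier L \<Longrightarrow> \<bar>\<eta> (inv y \<otimes> inv h \<otimes> y \<otimes> z) - \<eta> z\<bar> \<le> \<beta>"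
    and b: "0 \<le> \<beta>"
  shows "\<bar>conv a \<eta> (inv h \<otimes> x) - conv a \<eta> x\<bar> \<le> \<alpha> * \<beta> * I \<Theta>"
proof -
  have hx: "inv h \<otimes> x \<in> carrier L" using h x by auto
  have "conv a \<eta> (inv h \<otimes> x) - conv a \<eta> x = I (\<lambda>y. a y * \<eta> (inv y \<otimes> (inv h \<otimes> x)) - a y * \<eta> (inv y \<otimes> x))"
    unfolding conv_def by (rule I_diff[symmetric]) (auto intro!: conv_integrand a hx x)
  also have "\<bar>\<dots>\<bar> \<le> I (\<lambda>y. (\<alpha> * \<beta>) * \<Theta> y)"
  proof (rule I_abs_le)
    show "(\<lambda>y. a y * \<eta> (inv y \<otimes> (inv h \<otimes> x)) - a y * \<eta> (inv y \<otimes> x)) \<in> Cc"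
      by (auto intro!: Cc_diff conv_integrand a hx x)
    show "(\<lambda>y. (\<alpha> * \<beta>) * \<Theta> y) \<in> Cc" by (rule Cc_scale[OF \<Theta>])
    fix y assume y: "y \<in> carrier L"
    show "\<bar>a y * \<eta> (inv y \<otimes> (inv h \<otimes> x)) - a y * \<eta> (inv y \<otimes> x)\<bar> \<le> \<alpha> * \<beta> * \<Theta> y"
    proof (cases "a y = 0")
      case True
      then have "0 \<le> (\<alpha> * \<Theta> y) * \<beta>" using bd[OF y] b by (intro mult_nonneg_nonneg[of "\<alpha> * \<Theta> y"]) auto
      then show ?thesis using True by (simp add: mult_ac)
    next
      case False
      have eq: "inv y \<otimes> inv h \<otimes> y \<otimes> (inv y \<otimes> x) = inv y \<otimes> (inv h \<otimes> x)"
      proof -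
        have "y \<otimes> (inv y \<otimes> x) = x" using x y by (simp add: m_assoc[symmetric])
        then show ?thesis using x y h by (simp add: m_assoc)
      qed
      have "\<bar>a y * \<eta> (inv y \<otimes> (inv h \<otimes> x)) - a y * \<eta> (inv y \<otimes> x)\<bar> = \<bar>a y\<bar> * \<bar>\<eta> (inv y \<otimes> (inv h \<otimes> x)) - \<eta> (inv y \<otimes> x)\<bar>"
        by (simp add: abs_mult[symmetric] right_diff_distrib)
      also have "\<dots> \<le> (\<alpha> * \<Theta> y) * \<beta>"
        using bd[OF y] osc[OF y False, of "inv y \<otimes> x"] x y b eq by (intro mult_mono) (auto intro: order_trans[OF abs_ge_zero])
      finally show ?thesis by (simp add: mult_ac)
    qed
  qed
  also have "\<dots> = \<alpha> * \<beta> * I \<Theta>" by (rule I_scale[OF \<Theta>])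
  finally show ?thesis .
qed

lemma conv_bound:
  assumes a: "a \<in> Cc" "\<eta> \<in> Cc" and \<Theta>: "\<Theta> \<in> Cc" and x: "x \<in> carrier L"
    and bd: "\<And>y. y \<in> carrier L \<Longrightarrow> \<bar>a y\<bar> \<le> \<alpha> * \<Theta> y"
    and e: "\<And>z. z \<in> carrier L \<Longrightarrow> \<bar>\<eta> z\<bar> \<le> \<beta>"
  shows "\<bar>conv a \<eta> x\<bar> \<le> \<alpha> * \<beta> * I \<Theta>"
proof -
  have "\<bar>conv a \<eta> x\<bar> \<le> I (\<lambda>y. (\<alpha> * \<beta>) * \<Theta> y)"
    unfolding conv_def
  proof (rule I_abs_le[OF conv_integrand[OF a x] Cc_scale[OF \<Theta>]])
    fix y assume y: "y \<in> carrier L"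
    have "\<bar>a y * \<eta> (inv y \<otimes> x)\<bar> \<le> (\<alpha> * \<Theta> y) * \<beta>"
      unfolding abs_mult using bd[OF y] e[of "inv y \<otimes> x"] x y
      by (intro mult_mono) (auto intro: order_trans[OF abs_ge_zero])
    then show "\<bar>a y * \<eta> (inv y \<otimes> x)\<bar> \<le> \<alpha> * \<beta> * \<Theta> y" by (simp add: mult_ac)
  qed
  then show ?thesis by (simp add: I_scale[OF \<Theta>])
qed

lemma conv_cont:
  assumes a: "a \<in> Cc" "\<eta> \<in> Cc"
  shows "continuous_map T euclideanreal (conv a \<eta>)"
proof (rule continuous_map_right_uniform)
  fix e :: real assume e: "e > 0"
  have aa: "(\<lambda>y. \<bar>a y\<bar>) \<in> Cp" using Cc_abs[OF a(1)] by (auto simp: Cp_def)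
  let ?d = "e / (I (\<lambda>y. \<bar>a y\<bar>) + 1)"
  have In: "0 \<le> I (\<lambda>y. \<bar>a y\<bar>)" using I_nonneg[OF aa] .
  have d: "?d > 0" using e In by auto
  obtain V where V: "nbh V" "\<And>x z. x \<in> carrier L \<Longrightarrow> z \<in> V \<Longrightarrow> \<bar>\<eta> (x \<otimes> z) - \<eta> x\<bar> < ?d"
    using Cc_uniform_right[OF a(2) d] by blast
  show "\<exists>V. nbh V \<and> (\<forall>x\<in>carrier L. \<forall>z\<in>V. \<bar>conv a \<eta> (x \<otimes> z) - conv a \<eta> x\<bar> < e)"
  proof (intro exI conjI ballI, rule V(1))
    fix x z assume x: "x \<in> carrier L" and z: "z \<in> V"
    have zc: "z \<in> carrier L" using z nbh_carrier[OF V(1)] by auto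
    have "conv a \<eta> (x \<otimes> z) - conv a \<eta> x = I (\<lambda>y. a y * \<eta> (inv y \<otimes> (x \<otimes> z)) - a y * \<eta> (inv y \<otimes> x))"
      unfolding conv_def by (rule I_diff[symmetric]) (auto intro!: conv_integrand a x zc)
    also have "\<bar>\<dots>\<bar> \<le> I (\<lambda>y. ?d * \<bar>a y\<bar>)"
    proof (rule I_abs_le)
      fix y assume y: "y \<in> carrier L"
      have "\<bar>a y * \<eta> (inv y \<otimes> (x \<otimes> z)) - a y * \<eta> (inv y \<otimes> x)\<bar> = \<bar>\<eta> (inv y \<otimes> x \<otimes> z) - \<eta> (inv y \<otimes> x)\<bar> * \<bar>a y\<bar>"
        using x y zc by (simp add: abs_mult[symmetric] right_diff_distrib m_assoc mult.commute)
      also have "\<dots> \<le> ?d * \<bar>a y\<bar>"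
        using V(2)[of "inv y \<otimes> x" z] x y z by (intro mult_right_mono) auto
      finally show "\<bar>a y * \<eta> (inv y \<otimes> (x \<otimes> z)) - a y * \<eta> (inv y \<otimes> x)\<bar> \<le> ?d * \<bar>a y\<bar>" .
    qed (intro Cc_diff conv_integrand a x zc Cc_scale Cc_abs m_closed)+
    also have "\<dots> = ?d * I (\<lambda>y. \<bar>a y\<bar>)" by (rule I_scale) (rule Cc_abs[OF a(1)])
    also have "\<dots> < e" using e In by (simp add: field_simps)
    finally show "\<bar>conv a \<eta> (x \<otimes> z) - conv a \<eta> x\<bar> < e" .
  qed
qed

lemma conv_zero:
  assumes "a \<in> Cc" "b \<in> Cc" "x \<in> carrier L" "\<And>y. y \<in> carrier L \<Longrightarrow> a y * b (inv y \<otimes> x) = 0"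
  shows "conv a b x = 0"
  using I_cong[OF conv_integrand[OF assms(1-3)], of "\<lambda>y. 0"] assms(4) Cc_zero I_scale[OF Cc_zero, of 0] by (simp add: conv_def)

lemma conv_Cc:
  assumes "a \<in> Cc" "b \<in> Cc"
  shows "conv a b \<in> Cc"
proof -
  obtain C where C: "compactin T C" "\<And>x. x \<in> carrier L \<Longrightarrow> x \<notin> C \<Longrightarrow> a x = 0" using Cc_supp[OF assms(1)] by blast
  obtain D where D: "compactin T D" "\<And>x. x \<in> carrier L \<Longrightarrow> x \<notin> D \<Longrightarrow> b x = 0" using Cc_supp[OF assms(2)] by blast
  show ?thesis
  proof (rule CcI[OF conv_cont[OF assms] compactin_mult[OF C(1) D(1)]])
    fix x assume x: "x \<in> carrier L" "x \<notin> C <#> D"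
    show "conv a b x = 0"
    proof (rule conv_zero[OF assms x(1)])
      fix y assume y: "y \<in> carrier L"
      have "y \<otimes> (inv y \<otimes> x) = x" using x y by (simp add: m_assoc[symmetric])
      then have "y \<notin> C \<or> inv y \<otimes> x \<notin> D" using x(2) unfolding set_mult_def by force
      then show "a y * b (inv y \<otimes> x) = 0" using C D x y by auto
    qed
  qed
qed

end

section \<open>Small subgroups of compact groups\<close>

text \<open>The ratios of a log-convex sequence are nondecreasing, so an initial ratio r > e would
  force growth at least like r^k, against a bound of order (k + 1) e^k.\<close>

lemma log_convex_decay_step:
  fixes a :: "nat \<Rightarrow> real"
  assumes nn: "\<And>k. 0 \<le> a k" and lc: "\<And>k. (a (Suc k))\<^sup>2 \<le> a k * a (Suc (Suc k))"
    and bd: "\<And>k. a k \<le> C * real (Suc k) * e ^ k" and e: "e > 0"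
  shows "a 1 \<le> e * a 0"
proof (rule ccontr)
  assume neg: "\<not> ?thesis"
  have a0: "a 0 > 0"
  proof (rule ccontr)
    assume "\<not> a 0 > 0"
    then have "a 0 = 0" using nn[of 0] by simp
    then have "a 1 = 0" using lc[of 0] by simp
    then show False using neg \<open>a 0 = 0\<close> by simp
  qed
  define r where "r = a 1 / a 0"
  have r: "r > e" using neg a0 by (simp add: r_def field_simps)
  have ind: "a k > 0 \<and> a (Suc k) \<ge> r * a k" for k
  proof (induction k)
    case 0
    then show ?case using a0 by (simp add: r_def)
  next
    case (Suc k)
    have p: "a (Suc k) > 0" using Suc r e by (smt (verit) mult_pos_pos)
    have "r * a (Suc k) * a k \<le> a (Suc k) * a (Suc k)" using Suc p by (simp add: mult_ac)
    also have "\<dots> \<le> a k * a (Suc (Suc k))" using lc[of k] by (simp add: power2_eq_square)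
    finally have "r * a (Suc k) \<le> a (Suc (Suc k))" using Suc by (simp add: mult_ac)
    then show ?case using p by simp
  qed
  have low: "r ^ k * a 0 \<le> a k" for k
  proof (induction k)
    case (Suc k)
    have "r ^ Suc k * a 0 = r * (r ^ k * a 0)" by simp
    also have "\<dots> \<le> r * a k" using Suc r e by (intro mult_left_mono) auto
    also have "\<dots> \<le> a (Suc k)" using ind by blast
    finally show ?case .
  qed simp
  define q where "q = r / e"
  have q: "q > 1" using r e by (simp add: q_def)
  have key: "q ^ k * a 0 \<le> C * real (Suc k)" for k
  proof -
    have "r ^ k * a 0 \<le> C * real (Suc k) * e ^ k" using low[of k] bd[of k] by linarith
    then have "(r ^ k * a 0) / e ^ k \<le> C * real (Suc k)" using e by (simp add: field_simps)
    then show ?thesis by (simp add: q_def power_divide)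
  qed
  have "(\<lambda>k. real (Suc k) / q ^ k) \<longlonglongrightarrow> 0"
  proof -
    have n1: "norm (1 / q) < 1" using q by simp
    have "(\<lambda>k. real k * (1 / q) ^ k + (1 / q) ^ k) \<longlonglongrightarrow> 0 + 0"
      using powser_times_n_limit_0[OF n1] LIMSEQ_power_zero[OF n1] by (intro tendsto_add) auto
    then show ?thesis by (simp add: power_divide add_divide_distrib add.commute)
  qed
  then have "(\<lambda>k. C * (real (Suc k) / q ^ k)) \<longlonglongrightarrow> C * 0" by (intro tendsto_intros)
  moreover have "a 0 \<le> C * (real (Suc k) / q ^ k)" for k
    using key[of k] q by (simp add: field_simps)
  ultimately have "a 0 \<le> C * 0" by (intro LIMSEQ_le_const) auto
  then show False using a0 by simp
qed

text \<open>The one-step version applies to every shift of the sequence. The constant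
  \<open>C\<close> and the linear factor both disappear, which turns a crude growth estimate into a
  sharp one.\<close>

lemma log_convex_decay:
  fixes a :: "nat \<Rightarrow> real"
  assumes nn: "\<And>k. 0 \<le> a k" and lc: "\<And>k. (a (Suc k))\<^sup>2 \<le> a k * a (Suc (Suc k))"
    and bd: "\<And>k. a k \<le> C * real (Suc k) * e ^ k" and e: "e > 0" and C: "C \<ge> 0"
  shows "a k \<le> e ^ k * a 0"
proof -
  have step: "a (Suc j) \<le> e * a j" for j
  proof -
    have "a (1 + j) \<le> e * a (0 + j)"
    proof (rule log_convex_decay_step[of "\<lambda>k. a (k + j)" "C * real (Suc j) * e ^ j"])
      fix k
      have "a (k + j) \<le> C * real (Suc (k + j)) * e ^ (k + j)" by (rule bd)
      also have "\<dots> \<le> C * (real (Suc j) * real (Suc k)) * e ^ (k + j)"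
        using C e by (intro mult_right_mono mult_left_mono) (auto simp: algebra_simps)
      also have "\<dots> = C * real (Suc j) * e ^ j * real (Suc k) * e ^ k" by (simp add: power_add mult_ac)
      finally show "a (k + j) \<le> C * real (Suc j) * e ^ j * real (Suc k) * e ^ k" .
    qed (use nn lc e in auto)
    then show ?thesis by simp
  qed
  show ?thesis
  proof (induction k)
    case (Suc k)
    have "a (Suc k) \<le> e * a k" by (rule step)
    also have "\<dots> \<le> e * (e ^ k * a 0)" using Suc e by (intro mult_left_mono) auto
    finally show ?case by simp
  qed simp
qed

section \<open>The inner product on continuous functions on a compact group\<close>

locale cgrp = haar +
  assumes compact_T: "compact_space T"
begin

text \<open>Members vanish off the carrier so that identities between translates and iterates of
  operators are equalities of functions; for the same reason \<open>tr\<close>, and later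
  \<open>B\<close>, are cut off outside \<open>carrier L\<close>.\<close>

definition E :: "('a \<Rightarrow> real) set" where
  "E = {u. continuous_map T euclideanreal u \<and> (\<forall>x. x \<notin> carrier L \<longrightarrow> u x = 0)}"

definition ip :: "('a \<Rightarrow> real) \<Rightarrow> ('a \<Rightarrow> real) \<Rightarrow> real" where
  "ip u v = I (\<lambda>x. u x * v x)"

definition nrm :: "('a \<Rightarrow> real) \<Rightarrow> real" where
  "nrm u = sqrt (ip u u)"

definition tr :: "'a \<Rightarrow> ('a \<Rightarrow> real) \<Rightarrow> 'a \<Rightarrow> real" where
  "tr g u = (\<lambda>x. if x \<in> carrier L then u (inv g \<otimes> x) else 0)"

lemma cont_Cc: "continuous_map T euclideanreal u \<Longrightarrow> u \<in> Cc"
  by (rule CcI[of _ "carrier L"]) (use compact_T in \<open>auto simp: compact_space_def\<close>)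

lemma E_Cc: "u \<in> E \<Longrightarrow> u \<in> Cc"
  by (auto simp: E_def intro: cont_Cc)

lemma E_zero: "u \<in> E \<Longrightarrow> x \<notin> carrier L \<Longrightarrow> u x = 0"
  by (simp add: E_def)

lemma E_restrict:
  assumes "continuous_map T euclideanreal u"
  shows "(\<lambda>x. if x \<in> carrier L then u x else 0) \<in> E"
  using continuous_map_eq[OF assms, of "\<lambda>x. if x \<in> carrier L then u x else 0"] by (auto simp: E_def)

lemma E_diff: "u \<in> E \<Longrightarrow> v \<in> E \<Longrightarrow> (\<lambda>x. u x - v x) \<in> E"
  by (auto simp: E_def intro!: continuous_map_diff)

lemma E_add: "u \<in> E \<Longrightarrow> v \<in> E \<Longrightarrow> (\<lambda>x. u x + v x) \<in> E"
  by (auto simp: E_def intro!: continuous_map_add)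

lemma E_scale: "u \<in> E \<Longrightarrow> (\<lambda>x. c * u x) \<in> E"
  using Cc_cont[OF Cc_scale[OF E_Cc]] by (auto simp: E_def)

lemma E_tr: "u \<in> E \<Longrightarrow> g \<in> carrier L \<Longrightarrow> tr g u \<in> E"
  unfolding tr_def by (rule E_restrict, rule Cc_cont, rule Cc_ltrans[OF E_Cc]) auto

lemma ip_Cc: "u \<in> Cc \<Longrightarrow> v \<in> Cc \<Longrightarrow> (\<lambda>x. u x * v x) \<in> Cc"
  by (intro Cc_mult Cc_cont)

lemma ip_sym: "ip u v = ip v u" by (simp add: ip_def mult.commute)

lemma ip_diff: "u \<in> Cc \<Longrightarrow> v \<in> Cc \<Longrightarrow> w \<in> Cc \<Longrightarrow> ip (\<lambda>x. u x - v x) w = ip u w - ip v w"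
  using I_diff[OF ip_Cc[of u w] ip_Cc[of v w]] by (simp add: ip_def left_diff_distrib)

lemma ip_scale: "u \<in> Cc \<Longrightarrow> w \<in> Cc \<Longrightarrow> ip (\<lambda>x. c * u x) w = c * ip u w"
  using I_scale[OF ip_Cc[of u w], of c] by (simp add: ip_def mult.assoc)

lemma ip_nonneg: "u \<in> Cc \<Longrightarrow> 0 \<le> ip u u"
  unfolding ip_def by (intro I_nonneg CpI ip_Cc) auto

lemma nrm_nonneg: "u \<in> Cc \<Longrightarrow> 0 \<le> nrm u"
  by (simp add: nrm_def ip_nonneg)

lemma nrm_sq: "u \<in> Cc \<Longrightarrow> (nrm u)\<^sup>2 = ip u u"
  by (simp add: nrm_def ip_nonneg)

lemma nrm_scale: "u \<in> Cc \<Longrightarrow> nrm (\<lambda>x. c * u x) = \<bar>c\<bar> * nrm u"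
proof -
  assume u: "u \<in> Cc"
  have "ip (\<lambda>x. c * u x) (\<lambda>x. c * u x) = c * (c * ip u u)"
    using ip_scale[OF u Cc_scale[OF u], of c c] ip_scale[OF u u, of c] ip_sym[of u "\<lambda>x. c * u x"] by simp
  then show ?thesis by (simp add: nrm_def real_sqrt_mult mult.assoc[symmetric])
qed

text \<open>Cauchy-Schwarz. If one of the norms vanishes, so does the function, by strict positivity
  of the functional; otherwise the square of the norm of (nrm v) u - (nrm u) v is expanded.\<close>

lemma ip_le_nrm:
  assumes u: "u \<in> Cc" and v: "v \<in> Cc"
  shows "ip u v \<le> nrm u * nrm v"
proof (cases "nrm u * nrm v = 0")
  case True
  have z: "ip a b = 0" if "a \<in> Cc" "b \<in> Cc" "nrm a = 0" for a b
  proof -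
    have ia: "ip a a = 0" using nrm_sq[OF that(1)] that(3) by simp
    have a0: "a x = 0" if x: "x \<in> carrier L" for x
    proof (rule ccontr)
      assume "a x \<noteq> 0"
      then have "I (\<lambda>x. a x * a x) > 0"
        using x \<open>a \<in> Cc\<close> by (intro I_pos[of _ x] CpI ip_Cc) (auto simp: zero_less_mult_iff)
      then show False using ia by (simp add: ip_def)
    qed
    have "ip a b = I (\<lambda>x. 0)" unfolding ip_def
      using that by (intro I_cong ip_Cc Cc_zero) (auto simp: a0)
    then show ?thesis using I_scale[OF Cc_zero, of 0] by simp
  qed
  then show ?thesis using True u v ip_sym[of u v] by auto
next
  case False
  have p: "nrm u * nrm v > 0" using False nrm_nonneg[OF u] nrm_nonneg[OF v] by (intro mult_pos_pos) auto
  define a where "a = nrm v" define b where "b = nrm u"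
  have sq: "ip u u = b\<^sup>2" "ip v v = a\<^sup>2" using nrm_sq u v by (auto simp: a_def b_def)
  let ?w = "\<lambda>x. a * u x - b * v x"
  have w: "?w \<in> Cc" using u v by (intro Cc_diff Cc_scale)
  have "0 \<le> ip ?w ?w" by (rule ip_nonneg[OF w])
  also have "ip ?w ?w = a * ip u ?w - b * ip v ?w"
    using u v w by (simp add: ip_diff ip_scale Cc_scale)
  also have "ip u ?w = a * ip u u - b * ip u v"
    using u v ip_sym[of u ?w] ip_sym[of u v] by (simp add: ip_diff ip_scale Cc_scale)
  also have "ip v ?w = a * ip u v - b * ip v v"
    using u v ip_sym[of v ?w] by (simp add: ip_diff ip_scale Cc_scale)
  finally have "0 \<le> a * (a * b\<^sup>2 - b * ip u v) - b * (a * ip u v - b * a\<^sup>2)" by (simp add: sq)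
  then have "0 \<le> (2 * (a * b)) * (a * b - ip u v)" by (simp add: power2_eq_square algebra_simps)
  then have "0 \<le> a * b - ip u v" using p by (simp add: a_def b_def zero_le_mult_iff mult.commute)
  then show ?thesis by (simp add: a_def b_def mult.commute)
qed

lemma nrm_minus: "u \<in> Cc \<Longrightarrow> nrm (\<lambda>x. - u x) = nrm u"
  using nrm_scale[of u "-1"] by simp

lemma nrm_triangle:
  assumes u: "u \<in> Cc" and v: "v \<in> Cc"
  shows "nrm (\<lambda>x. u x - v x) \<le> nrm u + nrm v"
proof -
  let ?w = "\<lambda>x. u x - v x"
  have w: "?w \<in> Cc" using u v by (rule Cc_diff)
  have m: "(\<lambda>x. - v x) \<in> Cc" using v by (rule Cc_minus)
  have "(nrm ?w)\<^sup>2 = ip u ?w - ip v ?w" using u v w by (simp add: nrm_sq ip_diff)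
  also have "ip u ?w = ip u u - ip u v" using u v ip_sym[of u ?w] ip_sym[of u v] by (simp add: ip_diff)
  also have "ip v ?w = ip u v - ip v v" using u v ip_sym[of v ?w] by (simp add: ip_diff)
  also have "ip u u - ip u v - (ip u v - ip v v) = (nrm u)\<^sup>2 + (nrm v)\<^sup>2 + 2 * ip u (\<lambda>x. - v x)"
  proof -
    have "ip u (\<lambda>x. - v x) = - ip u v"
      using ip_scale[OF v u, of "-1"] ip_sym[of u "\<lambda>x. - v x"] ip_sym[of u v] by simp
    then show ?thesis using u v by (simp add: nrm_sq)
  qed
  also have "\<dots> \<le> (nrm u)\<^sup>2 + (nrm v)\<^sup>2 + 2 * (nrm u * nrm v)"
    using ip_le_nrm[OF u m] v by (simp add: nrm_minus)
  also have "\<dots> = (nrm u + nrm v)\<^sup>2" by (simp add: power2_sum)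
  finally show ?thesis using nrm_nonneg u v by (intro power2_le_imp_le[of "nrm ?w"]) auto
qed

lemma nrm_add:
  assumes u: "u \<in> Cc" and v: "v \<in> Cc"
  shows "nrm (\<lambda>x. u x + v x) \<le> nrm u + nrm v"
  using nrm_triangle[OF u Cc_minus[OF v]] nrm_minus[OF v] by simp

lemma one_Cc: "(\<lambda>x. 1) \<in> Cc" by (rule cont_Cc) auto

text \<open>The square root of the total Haar mass. It is the constant in both comparisons: of the
  L1 norm with the L2 norm, and of the L2 norm with the supremum.\<close>

definition mass :: real where "mass = nrm (\<lambda>x. 1)"

lemma mass_pos: "mass > 0"
proof -
  have "I (\<lambda>x. 1) > 0" by (rule I_pos[of _ \<one>]) (auto intro!: CpI one_Cc)
  then show ?thesis by (simp add: mass_def nrm_def ip_def)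
qed

lemma I_abs_le_nrm: "u \<in> Cc \<Longrightarrow> I (\<lambda>x. \<bar>u x\<bar>) \<le> mass * nrm u"
proof -
  assume u: "u \<in> Cc"
  have "I (\<lambda>x. \<bar>u x\<bar>) = ip (\<lambda>x. 1) (\<lambda>x. \<bar>u x\<bar>)" by (simp add: ip_def)
  also have "\<dots> \<le> mass * nrm (\<lambda>x. \<bar>u x\<bar>)"
    using ip_le_nrm[OF one_Cc Cc_abs[OF u]] by (simp add: mass_def)
  also have "nrm (\<lambda>x. \<bar>u x\<bar>) = nrm u" by (simp add: nrm_def ip_def)
  finally show ?thesis .
qed

lemma nrm_le_sup:
  assumes u: "u \<in> Cc" and c: "\<And>x. x \<in> carrier L \<Longrightarrow> \<bar>u x\<bar> \<le> c"
  shows "nrm u \<le> c * mass"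
proof -
  have c0: "0 \<le> c" using c[of \<one>] by auto
  have "ip u u \<le> I (\<lambda>x. (c * c) * 1)"
    unfolding ip_def
  proof (rule I_mono[OF ip_Cc[OF u u] Cc_scale[OF one_Cc]])
    fix x assume "x \<in> carrier L"
    then have "\<bar>u x\<bar> * \<bar>u x\<bar> \<le> c * c" using c c0 by (intro mult_mono) auto
    then show "u x * u x \<le> c * c * 1" by simp
  qed
  also have "\<dots> = (c * mass)\<^sup>2"
    using I_scale[OF one_Cc, of "c * c"] nrm_sq[OF one_Cc] by (simp add: mass_def power_mult_distrib power2_eq_square ip_def)
  finally have "(nrm u)\<^sup>2 \<le> (c * mass)\<^sup>2" using nrm_sq[OF u] by simp
  then show ?thesis by (rule power2_le_imp_le) (use c0 mass_pos in simp)
qed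

lemma nrm_tr: "u \<in> E \<Longrightarrow> g \<in> carrier L \<Longrightarrow> nrm (tr g u) = nrm u"
proof -
  assume u: "u \<in> E" and g: "g \<in> carrier L"
  have uc: "u \<in> Cc" using u by (rule E_Cc)
  have "ip (tr g u) (tr g u) = I (\<lambda>x. u (inv g \<otimes> x) * u (inv g \<otimes> x))"
    unfolding ip_def using g by (intro I_cong ip_Cc Cc_ltrans uc E_Cc[OF E_tr[OF u g]]) (auto simp: tr_def)
  also have "\<dots> = ip u u" unfolding ip_def using I_ltrans[OF ip_Cc[OF uc uc] g] .
  finally show ?thesis by (simp add: nrm_def)
qed

lemma tr_mult: "g \<in> carrier L \<Longrightarrow> h \<in> carrier L \<Longrightarrow> tr (g \<otimes> h) u = tr g (tr h u)"
  by (auto simp: tr_def fun_eq_iff inv_mult_group m_assoc)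

lemma tr_one: "u \<in> E \<Longrightarrow> tr \<one> u = u"
  by (auto simp: tr_def fun_eq_iff E_zero)

lemma tr_diff: "tr g (\<lambda>x. u x - v x) = (\<lambda>x. tr g u x - tr g v x)"
  by (auto simp: tr_def)

lemma partition_of_unity:
  assumes V: "nbh V"
  obtains S \<rho> where "finite S" "S \<subseteq> carrier L" "\<And>s. s \<in> S \<Longrightarrow> \<rho> s \<in> Cp"
    "\<And>x. x \<in> carrier L \<Longrightarrow> (\<Sum>s\<in>S. \<rho> s x) = 1"
    "\<And>s x. s \<in> S \<Longrightarrow> x \<in> carrier L \<Longrightarrow> \<rho> s x \<noteq> 0 \<Longrightarrow> inv s \<otimes> x \<in> V"
proof -
  obtain b where b: "b \<in> Cp" "b \<one> = 1" "\<And>x. x \<in> carrier L \<Longrightarrow> b x \<noteq> 0 \<Longrightarrow> x \<in> V"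
    using Cp_bump[OF V] by metis
  let ?W = "{x \<in> carrier L. b x \<in> {1 / 2<..}}"
  have W: "nbh ?W"
    using openin_continuous_map_preimage[OF Cc_cont[OF CpD(1)[OF b(1)]], of "{1 / 2<..}"] b(2)
    by (simp add: nbh_def)
  have C: "compactin T (carrier L)" using compact_T by (simp add: compact_space_def)
  obtain S where S: "finite S" "S \<subseteq> carrier L" "\<And>x. x \<in> carrier L \<Longrightarrow> \<exists>s\<in>S. inv s \<otimes> x \<in> ?W"
    using compactin_translates[OF C W] by blast
  define \<sigma> where "\<sigma> = (\<lambda>x. \<Sum>s\<in>S. b (inv s \<otimes> x))"
  have bc: "(\<lambda>x. b (inv s \<otimes> x)) \<in> Cc" if "s \<in> S" for s
    using that S by (intro Cc_ltrans CpD(1)[OF b(1)]) auto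
  have nn: "0 \<le> b (inv s \<otimes> x)" if "s \<in> S" "x \<in> carrier L" for s x
    using that S by (auto intro!: CpD(2)[OF b(1)])
  have sc: "continuous_map T euclideanreal \<sigma>"
    unfolding \<sigma>_def using S(1) bc by (intro continuous_map_sum Cc_cont) auto
  have sp: "\<sigma> x > 0" if x: "x \<in> carrier L" for x
  proof -
    obtain s where s: "s \<in> S" "inv s \<otimes> x \<in> ?W" using S(3)[OF x] by blast
    have "0 < b (inv s \<otimes> x)" using s by auto
    also have "\<dots> \<le> \<sigma> x" unfolding \<sigma>_def using s S nn x by (intro member_le_sum) auto
    finally show ?thesis .
  qed
  have ic: "continuous_map T euclideanreal (\<lambda>x. 1 / \<sigma> x)"
    using sc sp by (intro continuous_map_real_divide) (auto simp: less_imp_neq[symmetric])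
  show ?thesis
  proof (rule that[of S "\<lambda>s x. b (inv s \<otimes> x) / \<sigma> x"])
    show "(\<lambda>x. b (inv s \<otimes> x) / \<sigma> x) \<in> Cp" if "s \<in> S" for s
      using Cc_mult(1)[OF bc[OF that] ic] nn[OF that] sp by (auto intro!: CpI divide_nonneg_pos)
    show "(\<Sum>s\<in>S. b (inv s \<otimes> x) / \<sigma> x) = 1" if "x \<in> carrier L" for x
      using sp[OF that] by (simp add: sum_divide_distrib[symmetric] \<sigma>_def)
    show "inv s \<otimes> x \<in> V" if "s \<in> S" "x \<in> carrier L" "b (inv s \<otimes> x) / \<sigma> x \<noteq> 0" for s x
      using that S by (intro b(3)) auto
  qed (use S in auto)
qed

lemma Cc_sum: "finite S \<Longrightarrow> (\<And>s. s \<in> S \<Longrightarrow> f s \<in> Cc) \<Longrightarrow> (\<lambda>x. \<Sum>s\<in>S. f s x) \<in> Cc"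
  by (induction S rule: finite_induct) (auto intro!: Cc_zero Cc_add)

lemma I_sum: "finite S \<Longrightarrow> (\<And>s. s \<in> S \<Longrightarrow> f s \<in> Cc) \<Longrightarrow> I (\<lambda>x. \<Sum>s\<in>S. f s x) = (\<Sum>s\<in>S. I (f s))"
proof (induction S rule: finite_induct)
  case empty
  then show ?case using I_scale[OF Cc_zero, of 0] by simp
next
  case (insert s S)
  then show ?case using I_add[of "f s" "\<lambda>x. \<Sum>s\<in>S. f s x"] Cc_sum[of S f] by auto
qed

text \<open>Only the Haar functional is available, not a product measure, so Fubini is replaced by an
  approximation of the kernel by sums of products.\<close>

lemma conv_selfadjoint_aux:
  assumes u: "u \<in> Cc" and v: "v \<in> Cc" and eta: "\<eta> \<in> Cc" "\<And>z. z \<in> carrier L \<Longrightarrow> \<eta> (inv z) = \<eta> z" and e: "e > 0"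
  shows "\<bar>ip (conv u \<eta>) v - ip u (conv v \<eta>)\<bar> \<le> 2 * e * (I (\<lambda>x. \<bar>u x\<bar>) * I (\<lambda>x. \<bar>v x\<bar>))"
proof -
  obtain V where V: "nbh V" "\<And>x z. x \<in> carrier L \<Longrightarrow> z \<in> V \<Longrightarrow> \<bar>\<eta> (x \<otimes> z) - \<eta> x\<bar> < e"
    using Cc_uniform_right[OF eta(1) e] by blast
  obtain S \<rho> where S: "finite S" "S \<subseteq> carrier L" and rc: "\<And>s. s \<in> S \<Longrightarrow> \<rho> s \<in> Cp"
    and r1: "\<And>x. x \<in> carrier L \<Longrightarrow> (\<Sum>s\<in>S. \<rho> s x) = 1"
    and rs: "\<And>s x. s \<in> S \<Longrightarrow> x \<in> carrier L \<Longrightarrow> \<rho> s x \<noteq> 0 \<Longrightarrow> inv s \<otimes> x \<in> V"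
    using partition_of_unity[OF V(1)] by blast
  define k where "k x y = \<eta> (inv y \<otimes> x)" for x y
  \<comment> \<open>\<open>k'\<close> replaces \<open>x\<close> by the points \<open>s\<close>,
    weighted by \<open>\<rho> s x\<close>, and stays within \<open>e\<close> of \<open>k\<close> by
    uniform continuity. Being a finite sum of products of a function of \<open>y\<close> and a
    function of \<open>x\<close>, it gives the same double sum \<open>A\<close> in both orders of
    integration.\<close>
  define k' where "k' x y = (\<Sum>s\<in>S. \<eta> (inv y \<otimes> s) * \<rho> s x)" for x y
  have kk: "\<bar>k x y - k' x y\<bar> \<le> e" if xy: "x \<in> carrier L" "y \<in> carrier L" for x y
  proof -
    have "k x y - k' x y = (\<Sum>s\<in>S. (k x y - \<eta> (inv y \<otimes> s)) * \<rho> s x)"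
      using r1[OF xy(1)] by (simp add: k'_def left_diff_distrib sum_subtractf sum_distrib_left[symmetric])
    also have "\<bar>\<dots>\<bar> \<le> (\<Sum>s\<in>S. e * \<rho> s x)"
    proof (rule order_trans[OF sum_abs sum_mono])
      fix s assume s: "s \<in> S"
      have sc: "s \<in> carrier L" using s S by auto
      have rn: "0 \<le> \<rho> s x" using CpD(2)[OF rc[OF s] xy(1)] .
      show "\<bar>(k x y - \<eta> (inv y \<otimes> s)) * \<rho> s x\<bar> \<le> e * \<rho> s x"
      proof (cases "\<rho> s x = 0")
        case False
        have "inv y \<otimes> s \<otimes> (inv s \<otimes> x) = inv y \<otimes> x"
        proof -
          have "s \<otimes> (inv s \<otimes> x) = x" using xy sc by (simp add: m_assoc[symmetric])
          then show ?thesis using xy sc by (simp add: m_assoc)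
        qed
        then have "\<bar>k x y - \<eta> (inv y \<otimes> s)\<bar> \<le> e"
          using V(2)[of "inv y \<otimes> s" "inv s \<otimes> x"] rs[OF s xy(1) False] xy sc by (simp add: k_def)
        then show ?thesis using rn by (simp add: abs_mult mult_right_mono)
      qed simp
    qed
    also have "\<dots> = e" using r1[OF xy(1)] by (simp add: sum_distrib_left[symmetric])
    finally show ?thesis .
  qed
  have uabs: "(\<lambda>x. \<bar>u x\<bar>) \<in> Cc" and vabs: "(\<lambda>x. \<bar>v x\<bar>) \<in> Cc" using u v by (auto intro: Cc_abs)
  have ecy: "(\<lambda>y. \<eta> (inv y \<otimes> s)) \<in> Cc" if "s \<in> carrier L" for s
    using that by (intro cont_Cc continuous_map_compose_grp[OF Cc_cont[OF eta(1)]] continuous_map_mult continuous_map_inverse) auto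
  have ky: "(\<lambda>y. k x y) \<in> Cc" if "x \<in> carrier L" for x using ecy[OF that] by (simp add: k_def)
  have kx: "(\<lambda>x. k x y) \<in> Cc" if "y \<in> carrier L" for y unfolding k_def using that by (intro Cc_ltrans eta) auto
  have Scar: "s \<in> carrier L" if "s \<in> S" for s using that S by auto
  have rcc: "\<rho> s \<in> Cc" if "s \<in> S" for s using rc[OF that] by (rule CpD)
  have k'y: "(\<lambda>y. k' x y) \<in> Cc" for x
    unfolding k'_def by (intro Cc_sum S(1), subst mult.commute, intro Cc_scale ecy Scar)
  have k'x: "(\<lambda>x. k' x y) \<in> Cc" for y
    unfolding k'_def by (intro Cc_sum S(1) Cc_scale rcc)
  define A where "A = (\<Sum>s\<in>S. I (\<lambda>y. u y * \<eta> (inv y \<otimes> s)) * I (\<lambda>x. v x * \<rho> s x))"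
  have uk': "I (\<lambda>y. u y * k' x y) = (\<Sum>s\<in>S. I (\<lambda>y. u y * \<eta> (inv y \<otimes> s)) * \<rho> s x)" for x
  proof -
    have "I (\<lambda>y. u y * k' x y) = I (\<lambda>y. \<Sum>s\<in>S. \<rho> s x * (u y * \<eta> (inv y \<otimes> s)))"
      by (simp add: k'_def sum_distrib_left mult_ac)
    also have "\<dots> = (\<Sum>s\<in>S. I (\<lambda>y. \<rho> s x * (u y * \<eta> (inv y \<otimes> s))))"
      by (intro I_sum S(1) Cc_scale ip_Cc u ecy Scar)
    also have "\<dots> = (\<Sum>s\<in>S. \<rho> s x * I (\<lambda>y. u y * \<eta> (inv y \<otimes> s)))"
      by (intro sum.cong refl I_scale ip_Cc u ecy Scar)
    finally show ?thesis by (simp add: mult.commute)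
  qed
  have vk': "I (\<lambda>x. v x * k' x y) = (\<Sum>s\<in>S. \<eta> (inv y \<otimes> s) * I (\<lambda>x. v x * \<rho> s x))" for y
  proof -
    have "I (\<lambda>x. v x * k' x y) = I (\<lambda>x. \<Sum>s\<in>S. \<eta> (inv y \<otimes> s) * (v x * \<rho> s x))"
      by (simp add: k'_def sum_distrib_left mult_ac)
    also have "\<dots> = (\<Sum>s\<in>S. I (\<lambda>x. \<eta> (inv y \<otimes> s) * (v x * \<rho> s x)))"
      by (intro I_sum S(1) Cc_scale ip_Cc v rcc)
    also have "\<dots> = (\<Sum>s\<in>S. \<eta> (inv y \<otimes> s) * I (\<lambda>x. v x * \<rho> s x))"
      by (intro sum.cong refl I_scale ip_Cc v rcc)
    finally show ?thesis .
  qed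
  let ?Iu = "I (\<lambda>x. \<bar>u x\<bar>)" and ?Iv = "I (\<lambda>x. \<bar>v x\<bar>)"
  have gen: "\<bar>I (\<lambda>y. w y * a y) - I (\<lambda>y. w y * b y)\<bar> \<le> c * I (\<lambda>x. \<bar>w x\<bar>)"
    if w: "w \<in> Cc" "a \<in> Cc" "b \<in> Cc" and c: "\<And>y. y \<in> carrier L \<Longrightarrow> \<bar>a y - b y\<bar> \<le> c" for w a b c
  proof -
    have "I (\<lambda>y. w y * a y) - I (\<lambda>y. w y * b y) = I (\<lambda>y. w y * a y - w y * b y)"
      using w by (intro I_diff[symmetric] ip_Cc)
    also have "\<bar>\<dots>\<bar> \<le> I (\<lambda>y. c * \<bar>w y\<bar>)"
    proof (rule I_abs_le)
      fix y assume "y \<in> carrier L"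
      then have "\<bar>w y\<bar> * \<bar>a y - b y\<bar> \<le> \<bar>w y\<bar> * c" using c by (intro mult_left_mono) auto
      then show "\<bar>w y * a y - w y * b y\<bar> \<le> c * \<bar>w y\<bar>" by (simp add: abs_mult[symmetric] right_diff_distrib mult.commute)
    qed (auto intro!: Cc_diff ip_Cc Cc_scale Cc_abs w)
    finally show ?thesis using I_scale[OF Cc_abs[OF w(1)]] by simp
  qed
  have 1: "\<bar>ip v (conv u \<eta>) - A\<bar> \<le> (e * ?Iu) * ?Iv"
  proof -
    have "A = I (\<lambda>x. v x * I (\<lambda>y. u y * k' x y))"
    proof -
      have "I (\<lambda>x. v x * I (\<lambda>y. u y * k' x y)) = I (\<lambda>x. \<Sum>s\<in>S. I (\<lambda>y. u y * \<eta> (inv y \<otimes> s)) * (v x * \<rho> s x))"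
        by (simp add: uk' sum_distrib_left mult_ac)
      also have "\<dots> = (\<Sum>s\<in>S. I (\<lambda>x. I (\<lambda>y. u y * \<eta> (inv y \<otimes> s)) * (v x * \<rho> s x)))"
        by (intro I_sum S(1) Cc_scale ip_Cc v rcc)
      also have "\<dots> = A" unfolding A_def
        by (intro sum.cong refl I_scale ip_Cc v rcc)
      finally show ?thesis by simp
    qed
    moreover have "\<bar>I (\<lambda>x. v x * conv u \<eta> x) - I (\<lambda>x. v x * I (\<lambda>y. u y * k' x y))\<bar> \<le> (e * ?Iu) * ?Iv"
    proof (rule gen[OF v conv_Cc[OF u eta(1)]])
      show "(\<lambda>x. I (\<lambda>y. u y * k' x y)) \<in> Cc"
        unfolding uk' by (intro Cc_sum S(1) Cc_scale rcc)
      show "\<bar>conv u \<eta> x - I (\<lambda>y. u y * k' x y)\<bar> \<le> e * ?Iu" if x: "x \<in> carrier L" for x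
        using gen[OF u ky[OF x] k'y, of x e] kk[OF x] by (simp add: conv_def k_def)
    qed
    ultimately show ?thesis by (simp add: ip_def)
  qed
  have 2: "\<bar>ip u (conv v \<eta>) - A\<bar> \<le> (e * ?Iv) * ?Iu"
  proof -
    have "A = I (\<lambda>y. u y * I (\<lambda>x. v x * k' x y))"
    proof -
      have "I (\<lambda>y. u y * I (\<lambda>x. v x * k' x y)) = I (\<lambda>y. \<Sum>s\<in>S. I (\<lambda>x. v x * \<rho> s x) * (u y * \<eta> (inv y \<otimes> s)))"
        by (simp add: vk' sum_distrib_left mult_ac)
      also have "\<dots> = (\<Sum>s\<in>S. I (\<lambda>y. I (\<lambda>x. v x * \<rho> s x) * (u y * \<eta> (inv y \<otimes> s))))"
        by (intro I_sum S(1) Cc_scale ip_Cc u ecy Scar)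
      also have "\<dots> = A" unfolding A_def
        by (intro sum.cong refl, subst I_scale, intro ip_Cc u ecy Scar, simp_all add: mult.commute)
      finally show ?thesis by simp
    qed
    moreover have "\<bar>I (\<lambda>y. u y * conv v \<eta> y) - I (\<lambda>y. u y * I (\<lambda>x. v x * k' x y))\<bar> \<le> (e * ?Iv) * ?Iu"
    proof (rule gen[OF u conv_Cc[OF v eta(1)]])
      show "(\<lambda>y. I (\<lambda>x. v x * k' x y)) \<in> Cc"
        unfolding vk' by (intro Cc_sum S(1), subst mult.commute, intro Cc_scale ecy Scar)
      show "\<bar>conv v \<eta> y - I (\<lambda>x. v x * k' x y)\<bar> \<le> e * ?Iv" if y: "y \<in> carrier L" for y
      proof -
        \<comment> \<open>Invariance of \<open>\<eta>\<close> under inversion makes the kernel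
          symmetric, so the same \<open>k\<close> serves both convolutions.\<close>
        have "conv v \<eta> y = I (\<lambda>x. v x * k x y)"
          unfolding conv_def
        proof (rule I_cong[OF conv_integrand[OF v eta(1) y] _ ip_Cc[OF v kx[OF y]]])
          fix x assume x: "x \<in> carrier L"
          have "\<eta> (inv x \<otimes> y) = \<eta> (inv (inv x \<otimes> y))" using eta(2)[of "inv x \<otimes> y"] x y by simp
          also have "inv (inv x \<otimes> y) = inv y \<otimes> x" using x y by (simp add: inv_mult_group)
          finally show "v x * \<eta> (inv x \<otimes> y) = v x * k x y" by (simp add: k_def)
        qed
        then show ?thesis using gen[OF v kx[OF y] k'x, of y e] kk[OF _ y] by simp
      qed
    qed
    ultimately show ?thesis by (simp add: ip_def)
  qed
  have "\<bar>ip v (conv u \<eta>) - ip u (conv v \<eta>)\<bar> \<le> (e * ?Iu) * ?Iv + (e * ?Iv) * ?Iu"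
    using 1 2 by linarith
  then show ?thesis using ip_sym[of "conv u \<eta>" v] by (simp add: mult_ac)
qed

lemma conv_selfadjoint:
  assumes u: "u \<in> Cc" and v: "v \<in> Cc" and eta: "\<eta> \<in> Cc" "\<And>z. z \<in> carrier L \<Longrightarrow> \<eta> (inv z) = \<eta> z"
  shows "ip (conv u \<eta>) v = ip u (conv v \<eta>)"
proof -
  let ?M = "I (\<lambda>x. \<bar>u x\<bar>) * I (\<lambda>x. \<bar>v x\<bar>)"
  have M: "0 \<le> ?M" using u v by (intro mult_nonneg_nonneg I_nonneg CpI Cc_abs) auto
  have "\<bar>ip (conv u \<eta>) v - ip u (conv v \<eta>)\<bar> \<le> 0 + d" if d: "d > 0" for d
  proof -
    have "\<bar>ip (conv u \<eta>) v - ip u (conv v \<eta>)\<bar> \<le> 2 * (d / (2 * (?M + 1))) * ?M"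
      using d M by (intro conv_selfadjoint_aux[OF u v eta]) auto
    also have "\<dots> \<le> d" using d M by (simp add: field_simps)
    finally show ?thesis by simp
  qed
  from field_le_epsilon[OF this] show ?thesis by simp
qed

end

section \<open>The spectral subgroup of a self-adjoint convolution operator\<close>

locale cgrp_op = cgrp +
  fixes \<eta> :: "'a \<Rightarrow> real"
  assumes eta: "\<eta> \<in> Cc" and eta_sym: "\<And>z. z \<in> carrier L \<Longrightarrow> \<eta> (inv z) = \<eta> z"
begin

definition B :: "('a \<Rightarrow> real) \<Rightarrow> 'a \<Rightarrow> real" where
  "B u = (\<lambda>x. if x \<in> carrier L then conv u \<eta> x else 0)"

lemma B_E: "u \<in> E \<Longrightarrow> B u \<in> E"
  unfolding B_def by (intro E_restrict conv_cont E_Cc eta)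

lemma Bk_E: "u \<in> E \<Longrightarrow> (B ^^ k) u \<in> E"
  by (induction k) (auto intro: B_E)

lemma B_diff: "u \<in> E \<Longrightarrow> v \<in> E \<Longrightarrow> B (\<lambda>x. u x - v x) = (\<lambda>x. B u x - B v x)"
  by (auto simp: B_def conv_diff_left E_Cc eta)

lemma B_scale: "u \<in> E \<Longrightarrow> B (\<lambda>x. c * u x) = (\<lambda>x. c * B u x)"
  using I_scale[OF conv_integrand[OF E_Cc eta]] by (auto simp: B_def conv_def mult.assoc)

lemma B_tr:
  assumes u: "u \<in> E" and g: "g \<in> carrier L"
  shows "B (tr g u) = tr g (B u)"
proof
  fix x
  show "B (tr g u) x = tr g (B u) x"
  proof (cases "x \<in> carrier L")
    case True
    have "conv (tr g u) \<eta> x = conv (\<lambda>y. u (inv g \<otimes> y)) \<eta> x"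
      unfolding conv_def
      using u g True by (intro I_cong conv_integrand eta Cc_ltrans E_Cc E_tr) (auto simp: tr_def)
    also have "\<dots> = conv u \<eta> (inv g \<otimes> x)" using conv_ltrans[OF E_Cc[OF u] eta True g] by simp
    finally show ?thesis using True g by (simp add: B_def tr_def)
  qed (simp add: B_def tr_def)
qed

lemma Bk_diff: "u \<in> E \<Longrightarrow> v \<in> E \<Longrightarrow> (B ^^ k) (\<lambda>x. u x - v x) = (\<lambda>x. (B ^^ k) u x - (B ^^ k) v x)"
  by (induction k) (auto simp: B_diff Bk_E)

lemma Bk_scale: "u \<in> E \<Longrightarrow> (B ^^ k) (\<lambda>x. c * u x) = (\<lambda>x. c * (B ^^ k) u x)"
  by (induction k) (auto simp: B_scale Bk_E)

lemma Bk_tr: "u \<in> E \<Longrightarrow> g \<in> carrier L \<Longrightarrow> (B ^^ k) (tr g u) = tr g ((B ^^ k) u)"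
  by (induction k) (auto simp: B_tr Bk_E)

lemma ip_B:
  assumes "u \<in> E" "v \<in> E"
  shows "ip (B u) v = ip u (B v)"
proof -
  have cB: "conv w \<eta> \<in> Cc" "B w \<in> Cc" "w \<in> Cc" if "w \<in> E" for w using that by (auto intro: conv_Cc E_Cc eta B_E)
  have "ip (B u) v = ip (conv u \<eta>) v"
    unfolding ip_def using assms by (intro I_cong ip_Cc cB) (auto simp: B_def)
  also have "\<dots> = ip u (conv v \<eta>)" using assms by (intro conv_selfadjoint E_Cc eta eta_sym)
  also have "\<dots> = ip u (B v)"
    unfolding ip_def using assms by (intro I_cong ip_Cc cB) (auto simp: B_def)
  finally show ?thesis .
qed

lemma B_bound:
  obtains M where "M > 0" "\<And>u. u \<in> E \<Longrightarrow> nrm (B u) \<le> M * nrm u"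
proof -
  obtain m where m: "m > 0" "\<And>x. x \<in> carrier L \<Longrightarrow> \<bar>\<eta> x\<bar> \<le> m" using Cc_bounded[OF eta] by blast
  show ?thesis
  proof (rule that[of "m * mass * mass"])
    show "0 < m * mass * mass" using m mass_pos by simp
    fix u assume u: "u \<in> E"
    have uc: "u \<in> Cc" using u by (rule E_Cc)
    have "\<bar>B u x\<bar> \<le> m * (mass * nrm u)" if x: "x \<in> carrier L" for x
    proof -
      have "\<bar>conv u \<eta> x\<bar> \<le> 1 * m * I (\<lambda>x. \<bar>u x\<bar>)"
        using m(2) by (intro conv_bound[OF uc eta Cc_abs[OF uc] x]) auto
      also have "\<dots> \<le> m * (mass * nrm u)" using I_abs_le_nrm[OF uc] m(1) by simp
      finally show ?thesis using x by (simp add: B_def)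
    qed
    then have "nrm (B u) \<le> (m * (mass * nrm u)) * mass" by (intro nrm_le_sup E_Cc B_E u)
    then show "nrm (B u) \<le> m * mass * mass * nrm u" by (simp add: mult_ac)
  qed
qed

text \<open>Compactness of the group makes all conjugates of a small \<open>h\<close> small at once,
  so translation by \<open>h\<close> moves the whole image of the unit ball under \<open>B\<close>
  by at most \<open>e\<close>. One factor \<open>mass\<close> in \<open>d\<close> passes from the L1
  to the L2 norm of \<open>u\<close>, the other from the supremum to the L2 norm of the
  difference.\<close>

lemma B_osc:
  assumes e: "e > 0"
  obtains W where "nbh W" "\<And>h u. h \<in> W \<Longrightarrow> u \<in> E \<Longrightarrow> nrm (\<lambda>x. B u x - tr h (B u) x) \<le> e * nrm u"
proof -
  define d where "d = e / (mass * mass)"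
  have d: "d > 0" using e mass_pos by (simp add: d_def)
  obtain V where V: "nbh V" "\<And>x z. x \<in> carrier L \<Longrightarrow> z \<in> V \<Longrightarrow> \<bar>\<eta> (z \<otimes> x) - \<eta> x\<bar> < d"
    using Cc_uniform_left[OF eta d] by blast
  have C: "compactin T (carrier L)" using compact_T by (simp add: compact_space_def)
  obtain W0 where W0: "nbh W0" "\<And>y h. y \<in> carrier L \<Longrightarrow> h \<in> W0 \<Longrightarrow> inv y \<otimes> h \<otimes> y \<in> V"
    using nbh_conj[OF C V(1)] by blast
  obtain W where W: "nbh W" "symm W" "W \<subseteq> W0" using nbh_sym[OF W0(1)] .
  show ?thesis
  proof (rule that[OF W(1)])
    fix h u assume h: "h \<in> W" and u: "u \<in> E"
    have hc: "h \<in> carrier L" using h nbh_carrier[OF W(1)] by auto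
    have uc: "u \<in> Cc" using u by (rule E_Cc)
    have "\<bar>B u x - tr h (B u) x\<bar> \<le> d * (mass * nrm u)" if x: "x \<in> carrier L" for x
    proof -
      have "\<bar>conv u \<eta> (inv h \<otimes> x) - conv u \<eta> x\<bar> \<le> 1 * d * I (\<lambda>x. \<bar>u x\<bar>)"
      proof (rule conv_diff_bound[OF uc eta Cc_abs[OF uc] hc x])
        fix y z assume y: "y \<in> carrier L" and z: "z \<in> carrier L"
        have "inv h \<in> W0" using h W by (auto simp: symm_def)
        then show "\<bar>\<eta> (inv y \<otimes> inv h \<otimes> y \<otimes> z) - \<eta> z\<bar> \<le> d"
          using V(2)[OF z, of "inv y \<otimes> inv h \<otimes> y"] W0(2)[OF y, of "inv h"] by simp
      qed (use d in auto)
      also have "\<dots> \<le> d * (mass * nrm u)" using I_abs_le_nrm[OF uc] d by simp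
      finally show ?thesis using x hc by (simp add: B_def tr_def abs_minus_commute)
    qed
    then have "nrm (\<lambda>x. B u x - tr h (B u) x) \<le> (d * (mass * nrm u)) * mass"
      by (intro nrm_le_sup E_Cc E_diff E_tr B_E u hc)
    also have "\<dots> = e * nrm u" using mass_pos by (simp add: d_def)
    finally show "nrm (\<lambda>x. B u x - tr h (B u) x) \<le> e * nrm u" .
  qed
qed

text \<open>Self-adjointness moves one \<open>B\<close> across the inner product; Cauchy-Schwarz
  does the rest.\<close>

lemma nrm_Bk_log_convex:
  assumes u: "u \<in> E"
  shows "(nrm ((B ^^ Suc k) u))\<^sup>2 \<le> nrm ((B ^^ k) u) * nrm ((B ^^ Suc (Suc k)) u)"
proof -
  have k: "(B ^^ k) u \<in> E" for k using Bk_E[OF u] .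
  have "(nrm ((B ^^ Suc k) u))\<^sup>2 = ip (B ((B ^^ k) u)) ((B ^^ Suc k) u)"
    using nrm_sq[OF E_Cc[OF k[of "Suc k"]]] by simp
  also have "\<dots> = ip ((B ^^ k) u) ((B ^^ Suc (Suc k)) u)" using ip_B[OF k[of k] k[of "Suc k"]] by simp
  also have "\<dots> \<le> nrm ((B ^^ k) u) * nrm ((B ^^ Suc (Suc k)) u)" by (intro ip_le_nrm E_Cc k)
  finally show ?thesis .
qed

lemma nrm_Bk_decay:
  assumes u: "u \<in> E" and bd: "\<And>k. nrm ((B ^^ k) u) \<le> C * real (Suc k) * (1/2) ^ k" and C: "C \<ge> 0"
  shows "nrm ((B ^^ k) u) \<le> (1/2) ^ k * nrm u"
  using log_convex_decay[of "\<lambda>k. nrm ((B ^^ k) u)" C "1/2" k] nrm_nonneg[OF E_Cc[OF Bk_E[OF u]]] nrm_Bk_log_convex[OF u] bd C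
  by simp

definition dif :: "'a \<Rightarrow> ('a \<Rightarrow> real) \<Rightarrow> 'a \<Rightarrow> real" where
  "dif g v = (\<lambda>x. v x - tr g v x)"

lemma dif_E: "v \<in> E \<Longrightarrow> g \<in> carrier L \<Longrightarrow> dif g v \<in> E"
  unfolding dif_def by (intro E_diff E_tr)

lemma nrm_dif: "v \<in> E \<Longrightarrow> g \<in> carrier L \<Longrightarrow> nrm (dif g v) \<le> 2 * nrm v"
  using nrm_triangle[OF E_Cc E_Cc[OF E_tr], of v v g] by (simp add: dif_def nrm_tr)

lemma Bk_dif: "v \<in> E \<Longrightarrow> g \<in> carrier L \<Longrightarrow> (B ^^ k) (dif g v) = dif g ((B ^^ k) v)"
  by (simp add: dif_def Bk_diff E_tr Bk_tr)

lemma dif_mult: "v \<in> E \<Longrightarrow> g \<in> carrier L \<Longrightarrow> h \<in> carrier L \<Longrightarrow> dif (g \<otimes> h) v = (\<lambda>x. dif g v x + tr g (dif h v) x)"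
  by (auto simp: dif_def tr_mult tr_diff fun_eq_iff)

text \<open>\<open>K\<close> consists of the elements acting trivially on the spectral part of the self-adjoint operator
  \<open>B\<close> outside \<open>[-1/2, 1/2]\<close>; the growth condition says this without spectral theory.\<close>

definition K :: "'a set" where
  "K = {x \<in> carrier L. \<forall>v\<in>E. \<forall>k. nrm ((B ^^ k) (dif x v)) \<le> 2 * (1/2) ^ k * nrm v}"

lemma K_carrier: "x \<in> K \<Longrightarrow> x \<in> carrier L" by (simp add: K_def)

text \<open>By log-convexity any bound of order (k + 1) 2^-k already implies decay from the initial
  norm, which is at most 2 nrm v; hence the 2 in the definition of \<open>K\<close>. The linear
  factor leaves room for accumulated errors.\<close>

lemma KI:
  assumes x: "x \<in> carrier L" and bd: "\<And>v. v \<in> E \<Longrightarrow> \<exists>C\<ge>0. \<forall>k. nrm ((B ^^ k) (dif x v)) \<le> C * real (Suc k) * (1/2) ^ k"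
  shows "x \<in> K"
proof -
  have "nrm ((B ^^ k) (dif x v)) \<le> 2 * (1/2) ^ k * nrm v" if v: "v \<in> E" for v k
  proof -
    obtain C where C: "C \<ge> 0" "\<And>k. nrm ((B ^^ k) (dif x v)) \<le> C * real (Suc k) * (1/2) ^ k" using bd[OF v] by auto
    have "nrm ((B ^^ k) (dif x v)) \<le> (1/2) ^ k * nrm (dif x v)" by (rule nrm_Bk_decay[OF dif_E[OF v x] C(2,1)])
    also have "\<dots> \<le> (1/2) ^ k * (2 * nrm v)" by (intro mult_left_mono nrm_dif v x) auto
    finally show ?thesis by (simp add: mult_ac)
  qed
  then show ?thesis using x by (simp add: K_def)
qed

lemma K_decay:
  assumes x: "x \<in> K" and v: "v \<in> E"
  shows "nrm ((B ^^ k) (dif x v)) \<le> (1/2) ^ k * nrm (dif x v)"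
proof (rule nrm_Bk_decay[OF dif_E[OF v K_carrier[OF x]]])
  show "0 \<le> 2 * nrm v" using nrm_nonneg[OF E_Cc[OF v]] by simp
  fix k
  have "nrm ((B ^^ k) (dif x v)) \<le> 2 * nrm v * (1/2) ^ k * 1" using x v by (simp add: K_def mult_ac)
  also have "\<dots> \<le> 2 * nrm v * (1/2) ^ k * real (Suc k)" using nrm_nonneg[OF E_Cc[OF v]] by (intro mult_left_mono) auto
  finally show "nrm ((B ^^ k) (dif x v)) \<le> 2 * nrm v * real (Suc k) * (1/2) ^ k" by (simp add: mult_ac)
qed

lemma nrm_Bk_dif_mult:
  assumes "v \<in> E" "g \<in> carrier L" "h \<in> carrier L"
  shows "nrm ((B ^^ k) (dif (g \<otimes> h) v)) \<le> nrm ((B ^^ k) (dif g v)) + nrm ((B ^^ k) (dif h v))"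
proof -
  have "(B ^^ k) (dif (g \<otimes> h) v) = (\<lambda>x. (B ^^ k) (dif g v) x + tr g ((B ^^ k) (dif h v)) x)"
    using Bk_dif[of v "g \<otimes> h" k] Bk_dif[of v g k] Bk_dif[of v h k] dif_mult[OF Bk_E[of v k], of g h] assms by simp
  then show ?thesis
    using nrm_add[OF E_Cc[OF Bk_E[OF dif_E]] E_Cc[OF E_tr[OF Bk_E[OF dif_E]]], of v g v h g k k] assms
    by (simp add: nrm_tr Bk_E dif_E)
qed

lemma subgroup_K: "subgroup K L"
proof (rule subgroupI)
  show "K \<subseteq> carrier L" by (auto simp: K_def)
  have "\<one> \<in> K"
  proof -
    have "dif \<one> v = (\<lambda>x. 0 * v x)" if "v \<in> E" for v using that by (simp add: dif_def tr_one)
    moreover have "nrm ((B ^^ k) (\<lambda>x. 0 * v x)) = 0" if "v \<in> E" for v k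
      unfolding Bk_scale[OF that] using nrm_scale[OF E_Cc[OF Bk_E[OF that]], of 0] by simp
    ultimately show ?thesis using nrm_nonneg[OF E_Cc] by (simp add: K_def)
  qed
  then show "K \<noteq> {}" by auto
  show "inv a \<in> K" if a: "a \<in> K" for a
  proof -
    have ac: "a \<in> carrier L" using a by (rule K_carrier)
    have "dif (inv a) v = (\<lambda>x. (-1) * tr (inv a) (dif a v) x)" if "v \<in> E" for v
      using that ac by (auto simp: dif_def tr_diff tr_mult[symmetric] tr_one)
    moreover have "nrm ((B ^^ k) (\<lambda>x. (-1) * tr (inv a) (dif a v) x)) = nrm ((B ^^ k) (dif a v))" if v: "v \<in> E" for v k
    proof -
      have t: "tr (inv a) (dif a v) \<in> E" using v ac by (intro E_tr dif_E) auto
      show ?thesis unfolding Bk_scale[OF t] using v ac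
        by (simp only: nrm_scale[OF E_Cc[OF Bk_E[OF t]]]) (simp add: Bk_tr dif_E nrm_tr Bk_E)
    qed
    ultimately show ?thesis using a by (simp add: K_def)
  qed
  show "a \<otimes> b \<in> K" if a: "a \<in> K" and b: "b \<in> K" for a b
  proof (rule KI)
    have ac: "a \<in> carrier L" "b \<in> carrier L" using a b by (auto intro: K_carrier)
    then show "a \<otimes> b \<in> carrier L" by simp
    fix v assume v: "v \<in> E"
    have nn: "0 \<le> nrm v" using nrm_nonneg[OF E_Cc[OF v]] .
    show "\<exists>C\<ge>0. \<forall>k. nrm ((B ^^ k) (dif (a \<otimes> b) v)) \<le> C * real (Suc k) * (1/2) ^ k"
    proof (intro exI conjI allI)
      show "0 \<le> 4 * nrm v" using nn by simp
      fix k
      have "nrm ((B ^^ k) (dif (a \<otimes> b) v)) \<le> nrm ((B ^^ k) (dif a v)) + nrm ((B ^^ k) (dif b v))"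
        by (rule nrm_Bk_dif_mult[OF v ac])
      also have "\<dots> \<le> 2 * (1/2) ^ k * nrm v + 2 * (1/2) ^ k * nrm v"
        using a b v by (intro add_mono) (auto simp: K_def)
      also have "\<dots> = 4 * nrm v * (1/2) ^ k * 1" by simp
      also have "\<dots> \<le> 4 * nrm v * (1/2) ^ k * real (Suc k)" using nn by (intro mult_left_mono) auto
      finally show "nrm ((B ^^ k) (dif (a \<otimes> b) v)) \<le> 4 * nrm v * real (Suc k) * (1/2) ^ k" by (simp add: algebra_simps)
    qed
  qed
qed

text \<open>For each fixed \<open>k\<close> the condition is continuous in \<open>x\<close>: with x
  = y z, y in \<open>K\<close> and z near \<open>\<one>\<close>, the excess is at most the norm of
  B^k (dif z v), and B^k is bounded by M^k.\<close>

lemma closed_K: "closedin T K"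
proof -
  have "T closure_of K \<subseteq> K"
  proof
    fix x assume x: "x \<in> T closure_of K"
    have xc: "x \<in> carrier L" using x by (simp add: in_closure_of)
    obtain M where M: "M > 0" "\<And>u. u \<in> E \<Longrightarrow> nrm (B u) \<le> M * nrm u" using B_bound by blast
    have Mk: "nrm ((B ^^ k) u) \<le> M ^ k * nrm u" if "u \<in> E" for u k
    proof (induction k)
      case (Suc k)
      have "nrm ((B ^^ Suc k) u) \<le> M * nrm ((B ^^ k) u)" using M(2)[OF Bk_E[OF that, of k]] by simp
      also have "\<dots> \<le> M * (M ^ k * nrm u)" using Suc M(1) by (intro mult_left_mono) auto
      finally show ?case by (simp add: mult.assoc)
    qed simp
    have "nrm ((B ^^ k) (dif x v)) \<le> 2 * (1/2) ^ k * nrm v" if v: "v \<in> E" for v k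
    proof (rule field_le_epsilon)
      fix e :: real assume e: "e > 0"
      let ?d = "e / (M ^ k * mass)"
      have d: "?d > 0" using e M mass_pos by simp
      obtain V0 where V0: "nbh V0" "\<And>x z. x \<in> carrier L \<Longrightarrow> z \<in> V0 \<Longrightarrow> \<bar>v (z \<otimes> x) - v x\<bar> < ?d"
        using Cc_uniform_left[OF E_Cc[OF v] d] by blast
      obtain V where V: "nbh V" "symm V" "V \<subseteq> V0" using nbh_sym[OF V0(1)] .
      have "x \<in> K <#> V" using closure_of_subset_set_mult[OF _ V(1), of K] x K_carrier by auto
      then obtain y z where yz: "y \<in> K" "z \<in> V" "x = y \<otimes> z" by (auto simp: set_mult_def)
      have c: "y \<in> carrier L" "z \<in> carrier L" using yz K_carrier nbh_carrier[OF V(1)] by auto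
      have iz: "inv z \<in> V0" using yz V by (auto simp: symm_def)
      have "nrm ((B ^^ k) (dif x v)) \<le> nrm ((B ^^ k) (dif y v)) + nrm ((B ^^ k) (dif z v))"
        unfolding yz(3) by (rule nrm_Bk_dif_mult[OF v c])
      also have "nrm ((B ^^ k) (dif y v)) \<le> 2 * (1/2) ^ k * nrm v" using yz(1) v by (simp add: K_def)
      also have "nrm ((B ^^ k) (dif z v)) \<le> M ^ k * nrm (dif z v)" by (rule Mk[OF dif_E[OF v c(2)]])
      also have "\<dots> \<le> M ^ k * (?d * mass)"
      proof (intro mult_left_mono nrm_le_sup E_Cc dif_E v c)
        show "\<bar>dif z v w\<bar> \<le> ?d" if "w \<in> carrier L" for w
          using V0(2)[OF that iz] that by (simp add: dif_def tr_def abs_minus_commute less_imp_le)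
      qed (use M in auto)
      also have "\<dots> = e" using M mass_pos by simp
      finally show "nrm ((B ^^ k) (dif x v)) \<le> 2 * (1/2) ^ k * nrm v + e" by simp
    qed
    then show "x \<in> K" using xc by (simp add: K_def)
  qed
  moreover have "K \<subseteq> topspace T" using K_carrier by auto
  ultimately show ?thesis using closure_of_subset_eq[of K T] by auto
qed

text \<open>On the spectral part of \<open>B\<close> beyond 1/2 elements of \<open>K\<close> act
  trivially and elements of \<open>W\<close> move vectors by a fraction of their length. Hence all
  powers of an \<open>x\<close> in \<open>P\<close> nearly fix that part of y = v - x v, and so does
  their average; but the average almost annihilates y, so that part of y must be zero.\<close>

lemma gap_K:
  assumes W: "nbh W" "\<And>h u. h \<in> W \<Longrightarrow> u \<in> E \<Longrightarrow> nrm (\<lambda>x. B u x - tr h (B u) x) \<le> (1/2) * nrm u"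
    and P: "subgroup P L" "P \<subseteq> W <#> K"
  shows "P \<subseteq> K"
proof
  fix x assume xP: "x \<in> P"
  have xc: "x \<in> carrier L" using subgroup.subset[OF P(1)] xP by auto
  show "x \<in> K"
  proof (rule KI[OF xc])
    fix v assume v: "v \<in> E"
    define y where "y = dif x v"
    have y: "y \<in> E" unfolding y_def by (rule dif_E[OF v xc])
    define a where "a k = nrm ((B ^^ k) y)" for k
    have a0: "0 \<le> a 0" unfolding a_def using nrm_nonneg[OF E_Cc[OF y]] by simp
    obtain M where M: "M > 0" "\<And>u. u \<in> E \<Longrightarrow> nrm (B u) \<le> M * nrm u" using B_bound by blast
    have Mk: "nrm ((B ^^ k) u) \<le> M ^ k * nrm u" if "u \<in> E" for u k
    proof (induction k)
      case (Suc k)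
      have "nrm ((B ^^ Suc k) u) \<le> M * nrm ((B ^^ k) u)" using M(2)[OF Bk_E[OF that, of k]] by simp
      also have "\<dots> \<le> M * (M ^ k * nrm u)" using Suc M(1) by (intro mult_left_mono) auto
      finally show ?case by (simp add: mult.assoc)
    qed simp
    have xpow: "x [^] (j::nat) \<in> P" for j
      using P(1) xP by (induction j) (auto intro: subgroup.one_closed subgroup.m_closed)
    have xpc: "x [^] (j::nat) \<in> carrier L" for j using xc by simp
    \<comment> \<open>The factor \<open>w\<close> costs half of \<open>a k\<close> by the choice of
      \<open>W\<close>. The factor \<open>h\<close> costs only the decaying term, since it lies in
      \<open>K\<close> and translations commute with \<open>B\<close>.\<close>
    have step1: "nrm (dif (x [^] (j::nat)) ((B ^^ Suc k) y)) \<le> (1/2) * a k + 2 * (1/2) ^ Suc k * a 0" for j k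
    proof -
      obtain w h where wh: "w \<in> W" "h \<in> K" "x [^] j = w \<otimes> h" using xpow[of j] P(2) by (auto simp: set_mult_def)
      have c: "w \<in> carrier L" "h \<in> carrier L" using wh K_carrier nbh_carrier[OF W(1)] by auto
      let ?z = "(B ^^ Suc k) y"
      have z: "?z \<in> E" by (rule Bk_E[OF y])
      have "nrm (dif (w \<otimes> h) ?z) \<le> nrm (dif w ?z) + nrm (dif h ?z)"
        using nrm_Bk_dif_mult[OF z c, of 0] by simp
      also have "nrm (dif w ?z) \<le> (1/2) * a k"
        using W(2)[OF wh(1) Bk_E[OF y, of k]] by (simp add: dif_def a_def)
      also have "nrm (dif h ?z) \<le> 2 * (1/2) ^ Suc k * a 0"
      proof -
        have "nrm ((B ^^ Suc k) (dif h y)) \<le> 2 * (1/2) ^ Suc k * nrm y" using wh(2) y unfolding K_def by blast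
        then show ?thesis unfolding Bk_dif[OF y c(2)] by (simp add: a_def)
      qed
      finally show ?thesis by (simp add: wh(3))
    qed
    text \<open>The average of the translates of \<open>y = v - tr x v\<close> along the powers of \<open>x\<close> telescopes.\<close>
    have step2: "a (Suc k) \<le> (1/2) * a k + 2 * (1/2) ^ Suc k * a 0" for k
    proof (rule field_le_epsilon)
      fix e :: real assume e: "e > 0"
      let ?b = "(1/2) * a k + 2 * (1/2) ^ Suc k * a 0"
      let ?z = "(B ^^ Suc k) y"
      have z: "?z \<in> E" by (rule Bk_E[OF y])
      \<comment> \<open>The telescoped sum is bounded by 2 M^(k+1) nrm v whatever the number of
        terms; \<open>n\<close> is so large that its average is below \<open>e\<close>.\<close>
      obtain n :: nat where n: "n > 0" "2 * M ^ Suc k * nrm v / e < real n"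
      proof -
        obtain n where "max 1 (2 * M ^ Suc k * nrm v / e) < real n" using reals_Archimedean2 by blast
        then show ?thesis by (intro that[of n]) auto
      qed
      have tel: "(\<lambda>t. (\<Sum>j<m. tr (x [^] j) ?z t)) = (B ^^ Suc k) (dif (x [^] m) v)" for m :: nat
      proof (induction m)
        case 0
        have "dif \<one> v = (\<lambda>t. 0 * v t)" using v by (simp add: dif_def tr_one)
        then show ?case using Bk_scale[OF v, of "Suc k" 0] by (simp del: funpow.simps)
      next
        case (Suc m)
        have "(\<lambda>t. (\<Sum>j<Suc m. tr (x [^] j) ?z t)) = (\<lambda>t. (B ^^ Suc k) (dif (x [^] m) v) t + tr (x [^] m) ?z t)"
          using fun_cong[OF Suc] by (simp del: funpow.simps)
        also have "\<dots> = (B ^^ Suc k) (dif (x [^] Suc m) v)"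
          using Bk_dif[OF v xpc[of m], of "Suc k"] Bk_dif[OF v xc, of "Suc k"] Bk_dif[OF v xpc[of "Suc m"], of "Suc k"]
            dif_mult[OF Bk_E[OF v, of "Suc k"] xpc[of m] xc] by (simp add: y_def del: funpow.simps)
        finally show ?case .
      qed
      have sumE: "(\<lambda>t. (\<Sum>j<m. dif (x [^] j) ?z t)) \<in> E \<and> nrm (\<lambda>t. (\<Sum>j<m. dif (x [^] j) ?z t)) \<le> real m * ?b" for m :: nat
      proof (induction m)
        case 0
        have "(\<lambda>t. 0 * v t) \<in> E" by (rule E_scale[OF v])
        moreover have "nrm (\<lambda>t. 0 * v t) = 0" using nrm_scale[OF E_Cc[OF v], of 0] by simp
        ultimately show ?case by simp
      next
        case (Suc m)
        have dz: "dif (x [^] m) ?z \<in> E" by (rule dif_E[OF z xpc])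
        have "nrm (\<lambda>t. (\<Sum>j<m. dif (x [^] j) ?z t) + dif (x [^] m) ?z t) \<le> real m * ?b + ?b"
          using nrm_add[OF E_Cc[OF conjunct1[OF Suc]] E_Cc[OF dz]] Suc step1[of m k] by linarith
        also have "real m * ?b + ?b = real (Suc m) * ?b" by (simp add: distrib_right)
        finally show ?case using E_add[OF conjunct1[OF Suc] dz] by (simp only: sum.lessThan_Suc simp_thms)
      qed
      have "(\<lambda>t. real n * ?z t) = (\<lambda>t. (\<Sum>j<n. dif (x [^] j) ?z t) + (B ^^ Suc k) (dif (x [^] n) v) t)"
        using fun_cong[OF tel[of n]] by (simp add: dif_def sum_subtractf fun_eq_iff del: funpow.simps)
      then have "nrm (\<lambda>t. real n * ?z t) \<le> nrm (\<lambda>t. (\<Sum>j<n. dif (x [^] j) ?z t)) + nrm ((B ^^ Suc k) (dif (x [^] n) v))"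
        using nrm_add[OF E_Cc[OF conjunct1[OF sumE[of n]]] E_Cc[OF Bk_E[OF dif_E[OF v xpc[of n]]]], of "Suc k"] by (simp del: funpow.simps)
      also have "\<dots> \<le> real n * ?b + M ^ Suc k * (2 * nrm v)"
      proof (rule add_mono)
        show "nrm (\<lambda>t. (\<Sum>j<n. dif (x [^] j) ?z t)) \<le> real n * ?b" using sumE by blast
        have "nrm ((B ^^ Suc k) (dif (x [^] n) v)) \<le> M ^ Suc k * nrm (dif (x [^] n) v)" by (rule Mk[OF dif_E[OF v xpc]])
        also have "\<dots> \<le> M ^ Suc k * (2 * nrm v)" using M(1) by (intro mult_left_mono nrm_dif v xpc) auto
        finally show "nrm ((B ^^ Suc k) (dif (x [^] n) v)) \<le> M ^ Suc k * (2 * nrm v)" .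
      qed
      also have "\<dots> \<le> real n * ?b + real n * e" using n e by (simp add: field_simps)
      finally have "real n * a (Suc k) \<le> real n * (?b + e)"
        using nrm_scale[OF E_Cc[OF z], of "real n"] by (simp add: a_def algebra_simps del: funpow.simps)
      then show "a (Suc k) \<le> ?b + e" using n by simp
    qed
    \<comment> \<open>The inhomogeneous term of the recursion decays at the same rate as the
      homogeneous solution; this resonance produces the linear factor, which \<open>KI\<close>
      tolerates.\<close>
    have bound: "a k \<le> (1/2) ^ k * (1 + 2 * real k) * a 0" for k
    proof (induction k)
      case (Suc k)
      have "a (Suc k) \<le> (1/2) * a k + 2 * (1/2) ^ Suc k * a 0" by (rule step2)
      also have "\<dots> \<le> (1/2) * ((1/2) ^ k * (1 + 2 * real k) * a 0) + 2 * (1/2) ^ Suc k * a 0" using Suc by simp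
      also have "\<dots> = (1/2) ^ Suc k * (1 + 2 * real (Suc k)) * a 0" by (simp add: algebra_simps)
      finally show ?case .
    qed simp
    show "\<exists>C\<ge>0. \<forall>k. nrm ((B ^^ k) (dif x v)) \<le> C * real (Suc k) * (1/2) ^ k"
    proof (intro exI conjI allI)
      show "0 \<le> 2 * a 0" using a0 by simp
      fix k
      have "a k \<le> (1/2) ^ k * (1 + 2 * real k) * a 0" by (rule bound)
      also have "\<dots> \<le> (1/2) ^ k * (2 * real (Suc k)) * a 0" using a0 by (intro mult_right_mono mult_left_mono) auto
      finally show "nrm ((B ^^ k) (dif x v)) \<le> 2 * a 0 * real (Suc k) * (1/2) ^ k" by (simp add: a_def y_def algebra_simps)
    qed
  qed
qed

end

section \<open>Arbitrarily small subgroups with a gap\<close>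

context cgrp begin

lemma symmetric_bump:
  assumes V: "nbh V"
  obtains \<eta> where "\<eta> \<in> Cp" "\<And>z. z \<in> carrier L \<Longrightarrow> \<eta> (inv z) = \<eta> z" "I \<eta> = 1"
    "\<And>x. x \<in> carrier L \<Longrightarrow> \<eta> x \<noteq> 0 \<Longrightarrow> x \<in> V"
proof -
  obtain W where W: "nbh W" "symm W" "W \<subseteq> V" using nbh_sym[OF V] .
  obtain b where b: "b \<in> Cp" "b \<one> = 1" "\<And>x. x \<in> carrier L \<Longrightarrow> b x \<noteq> 0 \<Longrightarrow> x \<in> W"
    using Cp_bump[OF W(1)] by metis
  let ?h = "\<lambda>x. b x + b (inv x)"
  have h: "?h \<in> Cp" using b(1) by (auto simp: Cp_def intro!: Cc_add Cc_inv)
  have Ih: "I ?h > 0" by (rule I_pos[OF h, of \<one>]) (auto simp: b)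
  show ?thesis
  proof (rule that[of "\<lambda>x. (1 / I ?h) * ?h x"])
    show "(\<lambda>x. (1 / I ?h) * ?h x) \<in> Cp" using CpD(2)[OF h] Ih by (intro CpI Cc_scale[OF CpD(1)[OF h]]) auto
    show "I (\<lambda>x. (1 / I ?h) * ?h x) = 1" using I_scale[OF CpD(1)[OF h], of "1 / I ?h"] Ih by simp
    fix x assume x: "x \<in> carrier L"
    show "(1 / I ?h) * ?h (inv x) = (1 / I ?h) * ?h x" using x by (simp add: add.commute)
    assume "(1 / I ?h) * ?h x \<noteq> 0"
    then have "b x \<noteq> 0 \<or> b (inv x) \<noteq> 0" by auto
    then have "x \<in> W \<or> inv x \<in> W" using b(3) x by auto
    then show "x \<in> V" using W x unfolding symm_def by (metis inv_inv subsetD)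
  qed
qed

text \<open>The bump \<open>u\<close> is moved to a function of disjoint support by every
  \<open>x\<close> outside \<open>V\<close>, and \<open>\<eta>\<close> is so concentrated that
  \<open>B\<close> almost fixes \<open>u\<close>. Elements of \<open>K\<close> cannot displace by
  much what \<open>B\<close> almost fixes, so they stay inside \<open>V\<close>.\<close>

lemma small_subgroup_gap_aux:
  assumes V: "nbh V"
  obtains K W where "subgroup K L" "closedin T K" "K \<subseteq> V" "nbh W"
    "\<And>P. subgroup P L \<Longrightarrow> P \<subseteq> W <#> K \<Longrightarrow> P \<subseteq> K"
proof -
  obtain V1 where V1: "nbh V1" "symm V1" "V1 \<subseteq> V" "\<And>x y. x \<in> V1 \<Longrightarrow> y \<in> V1 \<Longrightarrow> x \<otimes> y \<in> V"
    using nbh_mult[OF V] by blast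
  obtain b where b: "b \<in> Cp" "b \<one> = 1" "\<And>x. x \<in> carrier L \<Longrightarrow> b x \<noteq> 0 \<Longrightarrow> x \<in> V1"
    using Cp_bump[OF V1(1)] by metis
  define u where "u = (\<lambda>x. if x \<in> carrier L then b x else 0)"
  have u: "u \<in> E" unfolding u_def using b by (intro E_restrict Cc_cont CpD(1))
  have u1: "u \<one> = 1" using b by (simp add: u_def)
  have us: "x \<in> V1" if "x \<in> carrier L" "u x \<noteq> 0" for x using that b(3) by (simp add: u_def)
  have nu: "nrm u > 0"
  proof -
    have "I (\<lambda>x. u x * u x) > 0"
      by (rule I_pos[OF CpI[OF ip_Cc[OF E_Cc[OF u] E_Cc[OF u]]], of \<one>]) (auto simp: u1)
    then show ?thesis by (simp add: nrm_def ip_def)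
  qed
  \<comment> \<open>This makes nrm (B u - u) at most a quarter of nrm u. For v = dif x u it follows
    that nrm (B v - v) \<le> nrm u / 2, and for x in \<open>K\<close> also nrm (B v) \<le> nrm v /
    2; together nrm v \<le> nrm u. Disjoint supports would give nrm v = sqrt 2 nrm u.\<close>
  define d where "d = nrm u / (4 * mass)"
  have d: "d > 0" using nu mass_pos by (simp add: d_def)
  obtain V2 where V2: "nbh V2" "\<And>x z. x \<in> carrier L \<Longrightarrow> z \<in> V2 \<Longrightarrow> \<bar>u (x \<otimes> z) - u x\<bar> < d"
    using Cc_uniform_right[OF E_Cc[OF u] d] by blast
  obtain \<eta> where et: "\<eta> \<in> Cp" "\<And>z. z \<in> carrier L \<Longrightarrow> \<eta> (inv z) = \<eta> z" "I \<eta> = 1"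
    "\<And>x. x \<in> carrier L \<Longrightarrow> \<eta> x \<noteq> 0 \<Longrightarrow> x \<in> V2"
    using symmetric_bump[OF V2(1)] by blast
  have ec: "\<eta> \<in> Cc" using et(1) by (rule CpD)
  interpret cgrp_op L T I \<eta> by unfold_locales (use ec et in auto)
  have near: "nrm (\<lambda>x. B u x - u x) \<le> (1/4) * nrm u"
  proof -
    have "\<bar>B u x - u x\<bar> \<le> d" if x: "x \<in> carrier L" for x
    proof -
      have tc: "(\<lambda>y. \<eta> (inv x \<otimes> y)) \<in> Cc" using x by (intro Cc_ltrans ec) auto
      have sw: "\<eta> (inv y \<otimes> x) = \<eta> (inv x \<otimes> y)" if y: "y \<in> carrier L" for y
      proof -
        have "\<eta> (inv (inv y \<otimes> x)) = \<eta> (inv y \<otimes> x)" using x y by (intro et) auto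
        then show ?thesis using x y by (simp add: inv_mult_group)
      qed
      have "I (\<lambda>y. \<eta> (inv x \<otimes> y)) = 1" using I_ltrans[OF ec x] et(3) by simp
      then have "u x = I (\<lambda>y. u x * \<eta> (inv x \<otimes> y))" using I_scale[OF tc, of "u x"] by simp
      moreover have "B u x = I (\<lambda>y. u y * \<eta> (inv x \<otimes> y))"
        using x I_cong[OF conv_integrand[OF E_Cc[OF u] ec x] _ ip_Cc[OF E_Cc[OF u] tc]] sw by (simp add: B_def conv_def)
      ultimately have "B u x - u x = I (\<lambda>y. u y * \<eta> (inv x \<otimes> y) - u x * \<eta> (inv x \<otimes> y))"
        using I_diff[OF ip_Cc[OF E_Cc[OF u] tc] Cc_scale[OF tc, of "u x"]] by simp
      also have "\<bar>\<dots>\<bar> \<le> I (\<lambda>y. d * \<eta> (inv x \<otimes> y))"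
      proof (rule I_abs_le)
        fix y assume y: "y \<in> carrier L"
        have en: "0 \<le> \<eta> (inv x \<otimes> y)" using x y by (intro CpD(2)[OF et(1)]) auto
        show "\<bar>u y * \<eta> (inv x \<otimes> y) - u x * \<eta> (inv x \<otimes> y)\<bar> \<le> d * \<eta> (inv x \<otimes> y)"
        proof (cases "\<eta> (inv x \<otimes> y) = 0")
          case False
          have "inv x \<otimes> y \<in> V2" using False x y by (intro et(4)) auto
          moreover have "x \<otimes> (inv x \<otimes> y) = y" using x y by (simp add: m_assoc[symmetric])
          ultimately have "\<bar>u y - u x\<bar> \<le> d" using V2(2)[OF x, of "inv x \<otimes> y"] by simp
          then have "\<bar>u y - u x\<bar> * \<eta> (inv x \<otimes> y) \<le> d * \<eta> (inv x \<otimes> y)" using en by (rule mult_right_mono)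
          then show ?thesis using en by (simp add: abs_mult left_diff_distrib[symmetric])
        qed simp
      qed (intro Cc_diff ip_Cc[OF E_Cc[OF u] tc] Cc_scale tc)+
      also have "\<dots> = d" using I_scale[OF tc, of d] \<open>I (\<lambda>y. \<eta> (inv x \<otimes> y)) = 1\<close> by simp
      finally show ?thesis .
    qed
    then have "nrm (\<lambda>x. B u x - u x) \<le> d * mass" by (intro nrm_le_sup E_Cc E_diff B_E u)
    then show ?thesis using mass_pos by (simp add: d_def)
  qed
  have KV: "K \<subseteq> V"
  proof
    fix x assume x: "x \<in> K"
    have xc: "x \<in> carrier L" using x by (rule K_carrier)
    show "x \<in> V"
    proof (rule ccontr)
      assume xV: "x \<notin> V"
      have disj: "u y * tr x u y = 0" if y: "y \<in> carrier L" for y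
      proof (rule ccontr)
        assume "u y * tr x u y \<noteq> 0"
        then have "u y \<noteq> 0" "u (inv x \<otimes> y) \<noteq> 0" using y by (auto simp: tr_def)
        then have "y \<in> V1" "inv x \<otimes> y \<in> V1" using us xc y by auto
        then have "y \<otimes> inv (inv x \<otimes> y) \<in> V" using V1 by (auto simp: symm_def)
        moreover have "y \<otimes> inv (inv x \<otimes> y) = x" using xc y by (simp add: inv_mult_group m_assoc[symmetric])
        ultimately show False using xV by simp
      qed
      have tE: "tr x u \<in> E" by (rule E_tr[OF u xc])
      have ip0: "ip u (tr x u) = 0"
      proof -
        have "ip u (tr x u) = I (\<lambda>y. 0)" unfolding ip_def
          by (intro I_cong ip_Cc E_Cc u tE Cc_zero disj)
        then show ?thesis using I_scale[OF Cc_zero, of 0] by simp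
      qed
      let ?v = "dif x u"
      have v: "?v \<in> E" by (rule dif_E[OF u xc])
      have "(nrm ?v)\<^sup>2 = ip u ?v - ip (tr x u) ?v"
        using nrm_sq[OF E_Cc[OF v]] ip_diff[OF E_Cc[OF u] E_Cc[OF tE] E_Cc[OF v]] by (simp add: dif_def)
      also have "ip u ?v = ip u u"
        using ip_diff[OF E_Cc[OF u] E_Cc[OF tE] E_Cc[OF u]] ip_sym[of u ?v] ip_sym[of u "tr x u"] ip0 by (simp add: dif_def)
      also have "ip (tr x u) ?v = - ip (tr x u) (tr x u)"
        using ip_diff[OF E_Cc[OF u] E_Cc[OF tE] E_Cc[OF tE]] ip_sym[of "tr x u" ?v] ip0 by (simp add: dif_def)
      finally have sq: "(nrm ?v)\<^sup>2 = 2 * (nrm u)\<^sup>2"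
        using nrm_sq[OF E_Cc[OF u]] nrm_sq[OF E_Cc[OF tE]] nrm_tr[OF u xc] by simp
      let ?r = "\<lambda>t. B u t - u t"
      have r: "?r \<in> E" by (intro E_diff B_E u)
      have "(\<lambda>t. B ?v t - ?v t) = dif x ?r"
        using Bk_dif[OF u xc, of 1] by (auto simp: dif_def tr_def fun_eq_iff)
      then have "nrm (\<lambda>t. B ?v t - ?v t) \<le> 2 * nrm ?r" using nrm_dif[OF r xc] by simp
      also have "\<dots> \<le> (1/2) * nrm u" using near by simp
      finally have 1: "nrm (\<lambda>t. B ?v t - ?v t) \<le> (1/2) * nrm u" .
      have 2: "nrm (B ?v) \<le> (1/2) * nrm ?v" using K_decay[OF x u, of 1] by simp
      have "nrm ?v \<le> nrm (B ?v) + nrm (\<lambda>t. B ?v t - ?v t)"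
        using nrm_triangle[OF E_Cc[OF B_E[OF v]] E_Cc[OF E_diff[OF B_E[OF v] v]]] by simp
      then have "nrm ?v \<le> nrm u" using 1 2 by linarith
      then have "(nrm ?v)\<^sup>2 \<le> (nrm u)\<^sup>2" using nrm_nonneg[OF E_Cc[OF v]] by (intro power_mono) auto
      then show False using sq nu by (simp add: power2_eq_square)
    qed
  qed
  obtain W where W: "nbh W" "\<And>h u. h \<in> W \<Longrightarrow> u \<in> E \<Longrightarrow> nrm (\<lambda>x. B u x - tr h (B u) x) \<le> (1/2) * nrm u"
    using B_osc[of "1/2"] by (metis half_gt_zero zero_less_one)
  show ?thesis
    by (rule that[OF subgroup_K closed_K KV W(1)]) (rule gap_K[OF W])
qed

end

lemma (in lcgrp) small_subgroup_gap:
  assumes "compact_space T" and V: "nbh V"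
  obtains K W where "subgroup K L" "closedin T K" "K \<subseteq> V" "nbh W"
    "\<And>P. subgroup P L \<Longrightarrow> P \<subseteq> W <#> K \<Longrightarrow> P \<subseteq> K"
proof -
  obtain I where "haar L T I" by (rule haar_ex)
  then interpret cgrp L T I using assms by (simp add: cgrp_def cgrp_axioms_def)
  show ?thesis by (rule small_subgroup_gap_aux[OF V that])
qed

section \<open>Products of elements with small powers\<close>

text \<open>The gap inside the compact group \<open>H\<close>, with the relative neighbourhood
  traded for an open set of \<open>L\<close>: if w k is in \<open>H\<close> and k in
  \<open>K \<subseteq> H\<close>, then w is in \<open>H\<close> as well.\<close>

lemma (in lcgrp) compact_subgroup_gap:
  assumes H: "subgroup H L" and C: "compactin T H" and V: "nbh V"
  obtains K W where "subgroup K L" "compactin T K" "K \<subseteq> V" "K \<subseteq> H" "nbh W"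
    "\<And>P. subgroup P L \<Longrightarrow> P \<subseteq> H \<Longrightarrow> P \<subseteq> W <#> K \<Longrightarrow> P \<subseteq> K"
proof -
  have Hc: "H \<subseteq> carrier L" using H by (rule subgroup.subset)
  interpret H: lcgrp "L\<lparr>carrier := H\<rparr>" "subtopology T H"
    by (rule lcgrp_closed_subgroup[OF H compactin_closed[OF C]])
  have cs: "compact_space (subtopology T H)" using C by (simp add: compactin_subspace)
  have nb: "H.nbh (V \<inter> H)" using V subgroup.one_closed[OF H] by (auto simp: H.nbh_def nbh_def openin_subtopology)
  obtain K W where K: "subgroup K (L\<lparr>carrier := H\<rparr>)" "closedin (subtopology T H) K" "K \<subseteq> V \<inter> H" "H.nbh W"
    "\<And>P. subgroup P (L\<lparr>carrier := H\<rparr>) \<Longrightarrow> P \<subseteq> W <#>\<^bsub>L\<lparr>carrier := H\<rparr>\<^esub> K \<Longrightarrow> P \<subseteq> K"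
    using H.small_subgroup_gap[OF cs nb] by blast
  obtain W' where W': "openin T W'" "W = W' \<inter> H" using K(4) by (auto simp: H.nbh_def openin_subtopology)
  have KL: "subgroup K L" using incl_subgroup[OF H K(1)] .
  show ?thesis
  proof (rule that[of K W'])
    show "compactin T K"
      using closedin_compact_space[OF cs K(2)] by (simp add: compactin_subtopology)
    show "nbh W'" using W' K(4) by (auto simp: nbh_def H.nbh_def)
    fix P assume P: "subgroup P L" "P \<subseteq> H" "P \<subseteq> W' <#> K"
    have "P \<subseteq> W <#>\<^bsub>L\<lparr>carrier := H\<rparr>\<^esub> K"
    proof
      fix p assume p: "p \<in> P"
      then obtain w k where wk: "w \<in> W'" "k \<in> K" "p = w \<otimes> k" using P(3) by (auto simp: set_mult_def)
      have c: "w \<in> carrier L" "k \<in> carrier L" "k \<in> H" using wk openin_subset[OF W'(1)] K(3) Hc by auto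
      have "w = p \<otimes> inv k" using c wk by (simp add: m_assoc)
      also have "\<dots> \<in> H" using P(2) p c H by (auto intro: subgroup.m_closed subgroup.m_inv_closed)
      finally show "p \<in> W <#>\<^bsub>L\<lparr>carrier := H\<rparr>\<^esub> K" using wk W' by (auto simp: set_mult_def)
    qed
    then show "P \<subseteq> K" using K(5)[OF subgroup_incl[OF P(1) H P(2)]] by blast
  qed (use KL K in auto)
qed

section \<open>Words with weighted generators\<close>

context group begin

text \<open>\<open>ball Gen q r\<close>: \<open>q\<close> is a product of generators \<open>g\<close>, each with a weight \<open>w\<close> such that \<open>Gen g w\<close>, of total weight \<open>r\<close>.\<close>

inductive ball :: "('a \<Rightarrow> real \<Rightarrow> bool) \<Rightarrow> 'a \<Rightarrow> real \<Rightarrow> bool" for Gen where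
  ball_one: "ball Gen \<one> 0"
| ball_step: "Gen g w \<Longrightarrow> ball Gen q r \<Longrightarrow> ball Gen (g \<otimes> q) (r + w)"

definition good_gen :: "('a \<Rightarrow> real \<Rightarrow> bool) \<Rightarrow> bool" where
  "good_gen Gen \<longleftrightarrow> (\<forall>g w. Gen g w \<longrightarrow> g \<in> carrier G \<and> 0 < w \<and> Gen (inv g) w)"

lemma good_genD: "good_gen Gen \<Longrightarrow> Gen g w \<Longrightarrow> g \<in> carrier G \<and> 0 < w \<and> Gen (inv g) w"
  by (simp add: good_gen_def)

lemma ball_props: "ball Gen q r \<Longrightarrow> good_gen Gen \<Longrightarrow> q \<in> carrier G \<and> 0 \<le> r"
  by (induction rule: ball.induct) (auto dest: good_genD simp: less_imp_le)

lemma ball_mult: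
  assumes G: "good_gen Gen" and q: "ball Gen q r" and p: "ball Gen p s"
  shows "ball Gen (q \<otimes> p) (r + s)"
  using q
proof (induction rule: ball.induct)
  case ball_one
  then show ?case using p ball_props[OF p G] by simp
next
  case (ball_step g w q r)
  have "ball Gen (g \<otimes> (q \<otimes> p)) ((r + s) + w)" by (rule ball.ball_step[OF ball_step(1,3)])
  then show ?case using ball_props[OF p G] ball_props[OF ball_step(2) G] good_genD[OF G ball_step(1)]
    by (simp add: m_assoc add.commute add.left_commute)
qed

lemma ball_inv:
  assumes G: "good_gen Gen" and q: "ball Gen q r"
  shows "ball Gen (inv q) r"
  using q
proof (induction rule: ball.induct)
  case ball_one
  then show ?case using ball.ball_one by simp
next
  case (ball_step g w q r)
  have g: "g \<in> carrier G" "Gen (inv g) w" using good_genD[OF G ball_step(1)] by auto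
  have "ball Gen (inv g \<otimes> \<one>) (0 + w)" by (intro ball.ball_step g(2) ball.ball_one)
  then have "ball Gen (inv q \<otimes> inv g) (r + w)" using ball_mult[OF G ball_step(3), of "inv g" w] g by simp
  then show ?case using g ball_props[OF ball_step(2) G] by (simp add: inv_mult_group)
qed

definition Bset :: "('a \<Rightarrow> real \<Rightarrow> bool) \<Rightarrow> real \<Rightarrow> 'a set" where
  "Bset Gen r = {q. \<exists>r'\<le>r. ball Gen q r'}"

lemma Bset_mono: "r \<le> s \<Longrightarrow> Bset Gen r \<subseteq> Bset Gen s"
  by (auto simp: Bset_def intro: order_trans)

lemma Bset_mult: "good_gen Gen \<Longrightarrow> q \<in> Bset Gen r \<Longrightarrow> p \<in> Bset Gen s \<Longrightarrow> q \<otimes> p \<in> Bset Gen (r + s)"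
  unfolding Bset_def using ball_mult add_mono by fastforce

lemma Bset_inv: "good_gen Gen \<Longrightarrow> q \<in> Bset Gen r \<Longrightarrow> inv q \<in> Bset Gen r"
  unfolding Bset_def using ball_inv by blast

lemma Bset_one: "0 \<le> r \<Longrightarrow> \<one> \<in> Bset Gen r"
  unfolding Bset_def using ball_one by blast

end

section \<open>Bump functions that are Lipschitz along words\<close>

context lcgrp begin

text \<open>By construction \<open>psi\<close> moves by at most \<open>w / \<kappa>\<close> under translation by a generator of weight \<open>w\<close>.\<close>

definition psi :: "('a \<Rightarrow> real \<Rightarrow> bool) \<Rightarrow> real \<Rightarrow> ('a \<Rightarrow> real) \<Rightarrow> 'a \<Rightarrow> real" where
  "psi Gen \<kappa> \<theta> x = (SUP (q,r)\<in>{(q,r). ball Gen q r}. max 0 (1 - r / \<kappa>) * \<theta> (inv q \<otimes> x))"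

context
  fixes Gen :: "'a \<Rightarrow> real \<Rightarrow> bool" and \<kappa> :: real and \<theta> :: "'a \<Rightarrow> real"
  assumes G: "good_gen Gen" and k: "\<kappa> > 0" and th: "\<theta> \<in> Cp" and th1: "\<And>x. x \<in> carrier L \<Longrightarrow> \<theta> x \<le> 1"
begin

lemma psi_term:
  assumes "ball Gen q r" "x \<in> carrier L"
  shows "0 \<le> max 0 (1 - r / \<kappa>) * \<theta> (inv q \<otimes> x)" "max 0 (1 - r / \<kappa>) * \<theta> (inv q \<otimes> x) \<le> 1"
proof -
  have q: "q \<in> carrier L" "0 \<le> r" using ball_props[OF assms(1) G] by auto
  have t: "0 \<le> \<theta> (inv q \<otimes> x)" "\<theta> (inv q \<otimes> x) \<le> 1" using q assms th1 CpD(2)[OF th] by auto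
  have m: "0 \<le> max 0 (1 - r / \<kappa>)" "max 0 (1 - r / \<kappa>) \<le> 1" using q k by auto
  show "0 \<le> max 0 (1 - r / \<kappa>) * \<theta> (inv q \<otimes> x)" using t m by (intro mult_nonneg_nonneg)
  have "max 0 (1 - r / \<kappa>) * \<theta> (inv q \<otimes> x) \<le> 1 * 1" using t m by (intro mult_mono) auto
  then show "max 0 (1 - r / \<kappa>) * \<theta> (inv q \<otimes> x) \<le> 1" by simp
qed

lemma psi_ge:
  assumes "ball Gen q r" "x \<in> carrier L"
  shows "max 0 (1 - r / \<kappa>) * \<theta> (inv q \<otimes> x) \<le> psi Gen \<kappa> \<theta> x"
proof -
  have "(case (q,r) of (q,r) \<Rightarrow> max 0 (1 - r / \<kappa>) * \<theta> (inv q \<otimes> x)) \<le> psi Gen \<kappa> \<theta> x"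
    unfolding psi_def
  proof (rule cSUP_upper)
    show "bdd_above ((\<lambda>(q, r). max 0 (1 - r / \<kappa>) * \<theta> (inv q \<otimes> x)) ` {(q, r). ball Gen q r})"
      using psi_term(2)[OF _ assms(2)] by (intro bdd_aboveI[of _ 1]) auto
  qed (use assms in auto)
  then show ?thesis by simp
qed

lemma psi_le:
  assumes "\<And>q r. ball Gen q r \<Longrightarrow> max 0 (1 - r / \<kappa>) * \<theta> (inv q \<otimes> x) \<le> b"
  shows "psi Gen \<kappa> \<theta> x \<le> b"
  unfolding psi_def
proof (rule cSUP_least)
  show "{(q, r). ball Gen q r} \<noteq> {}" using ball_one by auto
qed (use assms in auto)

lemma psi_le_one: "x \<in> carrier L \<Longrightarrow> psi Gen \<kappa> \<theta> x \<le> 1"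
  by (rule psi_le) (rule psi_term)

lemma psi_ge_theta: "x \<in> carrier L \<Longrightarrow> \<theta> x \<le> psi Gen \<kappa> \<theta> x"
  using psi_ge[OF ball_one] by simp

lemma psi_nonneg: "x \<in> carrier L \<Longrightarrow> 0 \<le> psi Gen \<kappa> \<theta> x"
  using psi_ge_theta CpD(2)[OF th] order_trans by blast

lemma psi_supp:
  assumes "x \<in> carrier L" "psi Gen \<kappa> \<theta> x \<noteq> 0"
  obtains q r where "ball Gen q r" "r < \<kappa>" "\<theta> (inv q \<otimes> x) \<noteq> 0"
proof -
  have "\<exists>q r. ball Gen q r \<and> r < \<kappa> \<and> \<theta> (inv q \<otimes> x) \<noteq> 0"
  proof (rule ccontr)
    assume neg: "\<not> ?thesis"
    have "psi Gen \<kappa> \<theta> x \<le> 0"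
    proof (rule psi_le)
      fix q r assume b: "ball Gen q r"
      show "max 0 (1 - r / \<kappa>) * \<theta> (inv q \<otimes> x) \<le> 0"
      proof (cases "r < \<kappa>")
        case True
        then show ?thesis using neg b by auto
      next
        case False
        then have "max 0 (1 - r / \<kappa>) = 0" using k by simp
        then show ?thesis by simp
      qed
    qed
    then show False using psi_nonneg[OF assms(1)] assms(2) by simp
  qed
  then show ?thesis using that by blast
qed

text \<open>Prefixing \<open>g\<close> to a word turns a term of the supremum at g^-1 x into one at
  x. The weight grows by \<open>w\<close>, which lowers the cut-off factor by at most w / \<kappa>,
  and \<open>\<theta>\<close> is at most 1.\<close>

lemma psi_lip1:
  assumes g: "Gen g w" and x: "x \<in> carrier L"
  shows "psi Gen \<kappa> \<theta> (inv g \<otimes> x) \<le> psi Gen \<kappa> \<theta> x + w / \<kappa>"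
proof (rule psi_le)
  fix q r assume b: "ball Gen q r"
  have c: "g \<in> carrier L" "0 < w" "q \<in> carrier L" "0 \<le> r" using ball_props[OF b G] good_genD[OF G g] by auto
  have e: "inv (g \<otimes> q) \<otimes> x = inv q \<otimes> (inv g \<otimes> x)" using c x by (simp add: inv_mult_group m_assoc)
  have t: "0 \<le> \<theta> (inv q \<otimes> (inv g \<otimes> x))" "\<theta> (inv q \<otimes> (inv g \<otimes> x)) \<le> 1" using c x th1 CpD(2)[OF th] by auto
  have wk: "0 \<le> w / \<kappa>" using c k by simp
  have "max 0 (1 - r / \<kappa>) \<le> max 0 (1 - (r + w) / \<kappa>) + w / \<kappa>"
    using wk by (simp add: add_divide_distrib max_def)
  then have "max 0 (1 - r / \<kappa>) * \<theta> (inv q \<otimes> (inv g \<otimes> x)) \<le> (max 0 (1 - (r + w) / \<kappa>) + w / \<kappa>) * \<theta> (inv q \<otimes> (inv g \<otimes> x))"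
    using t(1) by (rule mult_right_mono)
  also have "\<dots> = max 0 (1 - (r + w) / \<kappa>) * \<theta> (inv (g \<otimes> q) \<otimes> x) + w / \<kappa> * \<theta> (inv q \<otimes> (inv g \<otimes> x))"
    by (simp add: e distrib_right)
  also have "\<dots> \<le> psi Gen \<kappa> \<theta> x + w / \<kappa> * 1"
    using t wk by (intro add_mono psi_ge x ball_step[OF g b] mult_left_mono)
  finally show "max 0 (1 - r / \<kappa>) * \<theta> (inv q \<otimes> (inv g \<otimes> x)) \<le> psi Gen \<kappa> \<theta> x + w / \<kappa>" by simp
qed

lemma psi_lip:
  assumes g: "Gen g w" and x: "x \<in> carrier L"
  shows "\<bar>psi Gen \<kappa> \<theta> (inv g \<otimes> x) - psi Gen \<kappa> \<theta> x\<bar> \<le> w / \<kappa>"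
proof -
  have c: "g \<in> carrier L" "Gen (inv g) w" using good_genD[OF G g] by auto
  have "inv (inv g) \<otimes> (inv g \<otimes> x) = x" using c x by (simp add: m_assoc[symmetric])
  then have "psi Gen \<kappa> \<theta> x \<le> psi Gen \<kappa> \<theta> (inv g \<otimes> x) + w / \<kappa>"
    using psi_lip1[OF c(2), of "inv g \<otimes> x"] c x by simp
  then show ?thesis using psi_lip1[OF g x] by linarith
qed

text \<open>Words act from the left while uniform continuity is used from the right, so all
  functions in the supremum share one modulus of continuity.\<close>

lemma psi_cont: "continuous_map T euclideanreal (psi Gen \<kappa> \<theta>)"
proof (rule continuous_map_right_uniform)
  fix e :: real assume e: "e > 0"
  obtain V where V: "nbh V" "\<And>x z. x \<in> carrier L \<Longrightarrow> z \<in> V \<Longrightarrow> \<bar>\<theta> (x \<otimes> z) - \<theta> x\<bar> < e / 2"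
    using Cc_uniform_right[OF CpD(1)[OF th], of "e/2"] e by auto
  show "\<exists>V. nbh V \<and> (\<forall>x\<in>carrier L. \<forall>z\<in>V. \<bar>psi Gen \<kappa> \<theta> (x \<otimes> z) - psi Gen \<kappa> \<theta> x\<bar> < e)"
  proof (intro exI conjI ballI, rule V(1))
    fix x z assume x: "x \<in> carrier L" and z: "z \<in> V"
    have zc: "z \<in> carrier L" using z nbh_carrier[OF V(1)] by auto
    have d: "\<bar>max 0 (1 - r / \<kappa>) * \<theta> (inv q \<otimes> (x \<otimes> z)) - max 0 (1 - r / \<kappa>) * \<theta> (inv q \<otimes> x)\<bar> \<le> e / 2"
      if b: "ball Gen q r" for q r
    proof -
      have q: "q \<in> carrier L" "0 \<le> r" using ball_props[OF b G] by auto
      have m: "0 \<le> max 0 (1 - r / \<kappa>)" "max 0 (1 - r / \<kappa>) \<le> 1" using q k by auto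
      have "\<bar>\<theta> (inv q \<otimes> (x \<otimes> z)) - \<theta> (inv q \<otimes> x)\<bar> < e / 2"
        using V(2)[of "inv q \<otimes> x" z] q x z zc by (simp add: m_assoc)
      then have "max 0 (1 - r / \<kappa>) * \<bar>\<theta> (inv q \<otimes> (x \<otimes> z)) - \<theta> (inv q \<otimes> x)\<bar> \<le> 1 * (e / 2)"
        using m by (intro mult_mono) auto
      then show ?thesis using m by (simp add: abs_mult right_diff_distrib[symmetric])
    qed
    have "psi Gen \<kappa> \<theta> (x \<otimes> z) \<le> psi Gen \<kappa> \<theta> x + e / 2"
    proof (rule psi_le)
      fix q r assume b: "ball Gen q r"
      show "max 0 (1 - r / \<kappa>) * \<theta> (inv q \<otimes> (x \<otimes> z)) \<le> psi Gen \<kappa> \<theta> x + e / 2"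
        using d[OF b] psi_ge[OF b x] by linarith
    qed
    moreover have "psi Gen \<kappa> \<theta> x \<le> psi Gen \<kappa> \<theta> (x \<otimes> z) + e / 2"
    proof (rule psi_le)
      fix q r assume b: "ball Gen q r"
      show "max 0 (1 - r / \<kappa>) * \<theta> (inv q \<otimes> x) \<le> psi Gen \<kappa> \<theta> (x \<otimes> z) + e / 2"
      proof -
        have "b' \<le> p + h" if "\<bar>a - b'\<bar> \<le> h" "a \<le> p" for a b' p h :: real using that by linarith
        from this[OF d[OF b] psi_ge[OF b m_closed[OF x zc]]] show ?thesis .
      qed
    qed
    ultimately show "\<bar>psi Gen \<kappa> \<theta> (x \<otimes> z) - psi Gen \<kappa> \<theta> x\<bar> < e" using e by linarith
  qed
qed

lemma psi_Cp:
  assumes Y: "compactin T Y" and sub: "\<And>q r x. ball Gen q r \<Longrightarrow> r < \<kappa> \<Longrightarrow> x \<in> carrier L \<Longrightarrow> \<theta> (inv q \<otimes> x) \<noteq> 0 \<Longrightarrow> x \<in> Y"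
  shows "psi Gen \<kappa> \<theta> \<in> Cp"
proof (rule CpI[OF CcI[OF psi_cont Y]])
  fix x assume x: "x \<in> carrier L" "x \<notin> Y"
  show "psi Gen \<kappa> \<theta> x = 0"
  proof (rule ccontr)
    assume "psi Gen \<kappa> \<theta> x \<noteq> 0"
    then show False using psi_supp[OF x(1)] sub x by metis
  qed
qed (rule psi_nonneg)

end

end

text \<open>The convolution f of \<open>\<psi>\<close> with the reflected \<open>\<theta>\<close> is
  supported near the ball of radius \<open>\<kappa>\<close>, and f(1) is at least the integral of
  the square of \<open>\<theta>\<close>. A generator of weight w changes f by O(\<epsilon> w /
  \<kappa>), better by the factor \<epsilon> than the Lipschitz constant of \<open>\<psi>\<close>
  alone suggests. So even a word much longer than \<open>\<kappa>\<close> keeps f(q) nonzero and is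
  found near that ball.\<close>

lemma (in haar) gleason_trap:
  assumes G: "good_gen Gen" and k: "0 < \<kappa>" "\<kappa> \<le> 1" and th: "\<theta> \<in> Cp" and th1: "\<And>x. x \<in> carrier L \<Longrightarrow> \<theta> x \<le> 1"
    and Y0: "compactin T Y0" "\<And>q r x. ball Gen q r \<Longrightarrow> r < \<kappa> \<Longrightarrow> x \<in> carrier L \<Longrightarrow> \<theta> (inv q \<otimes> x) \<noteq> 0 \<Longrightarrow> x \<in> Y0"
    and Y: "Y0 \<subseteq> Y" "\<And>g w x. Gen g w \<Longrightarrow> x \<in> carrier L \<Longrightarrow> inv g \<otimes> x \<in> Y0 \<Longrightarrow> x \<in> Y"
    and Th: "\<Theta> \<in> Cp" "\<And>y. y \<in> Y \<Longrightarrow> 1 \<le> \<Theta> y"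
    and eps: "0 \<le> \<epsilon>" "\<And>h y z. h \<in> V \<Longrightarrow> h \<in> carrier L \<Longrightarrow> y \<in> Y \<Longrightarrow> y \<in> carrier L \<Longrightarrow> z \<in> carrier L \<Longrightarrow> \<bar>\<theta> (inv (inv y \<otimes> inv h \<otimes> y \<otimes> z)) - \<theta> (inv z)\<bar> \<le> \<epsilon>"
    and gen: "\<And>g w. Gen g w \<Longrightarrow> \<exists>n::nat. 1 \<le> n \<and> w = 1 / real n \<and> (\<forall>j\<le>n. g [^] j \<in> V)"
    and q: "ball Gen q r" "r * (2 * I \<Theta> * \<epsilon> / \<kappa>) < I (\<lambda>x. \<theta> x * \<theta> x)"
  shows "\<exists>q' r' a b. ball Gen q' r' \<and> r' < \<kappa> \<and> a \<in> carrier L \<and> b \<in> carrier L \<and> \<theta> a \<noteq> 0 \<and> \<theta> b \<noteq> 0 \<and> q = q' \<otimes> a \<otimes> inv b"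
proof -
  define \<psi> where "\<psi> = psi Gen \<kappa> \<theta>"
  define \<eta> where "\<eta> = (\<lambda>x. \<theta> (inv x))"
  define f where "f = conv \<psi> \<eta>"
  define A where "A = I \<Theta>"
  have A: "0 \<le> A" unfolding A_def by (rule I_nonneg[OF Th(1)])
  have tc: "\<theta> \<in> Cc" "\<Theta> \<in> Cc" using th Th by (auto simp: Cp_def)
  have pc: "\<psi> \<in> Cp" unfolding \<psi>_def by (rule psi_Cp[OF G k(1) th th1 Y0]) auto
  have pcc: "\<psi> \<in> Cc" using pc by (rule CpD)
  have ec: "\<eta> \<in> Cc" unfolding \<eta>_def by (rule Cc_inv[OF tc(1)])
  have pY: "y \<in> Y0" if "y \<in> carrier L" "\<psi> y \<noteq> 0" for y
    using psi_supp[OF G k(1) th th1, of y] that Y0(2) unfolding \<psi>_def by metis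
  have p01: "0 \<le> \<psi> y" "\<psi> y \<le> 1" if "y \<in> carrier L" for y
    unfolding \<psi>_def using psi_nonneg[OF G k(1) th th1] psi_le_one[OF G k(1) th th1] that by auto
  have Thn: "0 \<le> \<Theta> y" if "y \<in> carrier L" for y using CpD(2)[OF Th(1) that] .
  have osc: "\<bar>\<eta> (inv y \<otimes> inv h \<otimes> y \<otimes> z) - \<eta> z\<bar> \<le> \<epsilon>" if "h \<in> V" "h \<in> carrier L" "y \<in> Y" "y \<in> carrier L" "z \<in> carrier L" for h y z
    using eps(2) that by (simp add: \<eta>_def)
  have bf: "\<bar>f (inv h \<otimes> x) - f x\<bar> \<le> \<epsilon> * A" if h: "h \<in> V" "h \<in> carrier L" and x: "x \<in> carrier L" for h x
  proof -
    have "\<bar>f (inv h \<otimes> x) - f x\<bar> \<le> 1 * \<epsilon> * I \<Theta>"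
      unfolding f_def
    proof (rule conv_diff_bound[OF pcc ec tc(2) h(2) x])
      fix y assume y: "y \<in> carrier L"
      show "\<bar>\<psi> y\<bar> \<le> 1 * \<Theta> y"
      proof (cases "\<psi> y = 0")
        case False
        then have "1 \<le> \<Theta> y" using pY[OF y] Y Th by auto
        then show ?thesis using p01[OF y] by auto
      qed (use Thn[OF y] in simp)
      fix z assume "\<psi> y \<noteq> 0" "z \<in> carrier L"
      then show "\<bar>\<eta> (inv y \<otimes> inv h \<otimes> y \<otimes> z) - \<eta> z\<bar> \<le> \<epsilon>" using osc[OF h _ y] pY[OF y] Y(1) by auto
    qed (rule eps)
    then show ?thesis by (simp add: A_def)
  qed
  \<comment> \<open>The first difference of f along \<open>g\<close> hardly varies along the orbit
    of the powers of \<open>g\<close>, so n times its value at \<open>x\<close> is nearly the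
    telescoping sum f(g^-n x) - f(x). That sum is of size \<epsilon>, as g^n lies in
    \<open>V\<close>; division by n gains the factor w = 1/n.\<close>
  have bg: "\<bar>f (inv g \<otimes> x) - f x\<bar> \<le> w * (2 * A * \<epsilon> / \<kappa>)" if g: "Gen g w" and x: "x \<in> carrier L" for g w x
  proof -
    have gc: "g \<in> carrier L" "0 < w" using good_genD[OF G g] by auto
    obtain n :: nat where n: "1 \<le> n" "w = 1 / real n" "\<And>j. j \<le> n \<Longrightarrow> g [^] j \<in> V" using gen[OF g] by blast
    define a where "a = (\<lambda>y. \<psi> (inv g \<otimes> y) - \<psi> y)"
    have ac: "a \<in> Cc" unfolding a_def using gc by (intro Cc_diff Cc_ltrans pcc) auto
    have dg: "f (inv g \<otimes> x) - f x = conv a \<eta> x" if "x \<in> carrier L" for x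
      unfolding f_def a_def using conv_ltrans[OF pcc ec that gc(1)] conv_diff_left[OF _ pcc ec that, of "\<lambda>y. \<psi> (inv g \<otimes> y)"] Cc_ltrans[OF pcc, of "inv g"] gc
      by simp
    have aY: "y \<in> Y" if "y \<in> carrier L" "a y \<noteq> 0" for y
    proof -
      have "\<psi> (inv g \<otimes> y) \<noteq> 0 \<or> \<psi> y \<noteq> 0" using that by (auto simp: a_def)
      then show ?thesis
      proof
        assume "\<psi> (inv g \<otimes> y) \<noteq> 0"
        then have "inv g \<otimes> y \<in> Y0" using pY[of "inv g \<otimes> y"] gc that by simp
        then show ?thesis by (rule Y(2)[OF g that(1)])
      next
        assume "\<psi> y \<noteq> 0"
        then show ?thesis using pY[OF that(1)] Y(1) by auto
      qed
    qed
    have bd: "\<bar>conv a \<eta> (inv h \<otimes> x) - conv a \<eta> x\<bar> \<le> w / \<kappa> * \<epsilon> * I \<Theta>" if h: "h \<in> V" "h \<in> carrier L" for h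
    proof (rule conv_diff_bound[OF ac ec tc(2) h(2) x])
      fix y assume y: "y \<in> carrier L"
      have lip: "\<bar>a y\<bar> \<le> w / \<kappa>" unfolding a_def \<psi>_def by (rule psi_lip[OF G k(1) th th1 g y])
      have wk: "0 \<le> w / \<kappa>" using gc k by simp
      show "\<bar>a y\<bar> \<le> w / \<kappa> * \<Theta> y"
      proof (cases "a y = 0")
        case False
        then have "1 \<le> \<Theta> y" using aY[OF y] Th by auto
        then have "w / \<kappa> * 1 \<le> w / \<kappa> * \<Theta> y" using wk by (rule mult_left_mono)
        then show ?thesis using lip by simp
      qed (use mult_nonneg_nonneg[OF wk Thn[OF y]] in simp)
      fix z assume "a y \<noteq> 0" "z \<in> carrier L"
      then show "\<bar>\<eta> (inv y \<otimes> inv h \<otimes> y \<otimes> z) - \<eta> z\<bar> \<le> \<epsilon>" using osc[OF h _ y] aY[OF y] by auto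
    qed (rule eps)
    have gp: "g [^] (j::nat) \<in> carrier L" for j using gc by simp
    have gs: "inv (g [^] Suc j) = inv g \<otimes> inv (g [^] j)" for j :: nat
      using gc gp[of j] by (simp add: inv_mult_group)
    have tel: "(\<Sum>j<m. conv a \<eta> (inv (g [^] j) \<otimes> x)) = f (inv (g [^] m) \<otimes> x) - f x" for m :: nat
    proof (induction m)
      case (Suc m)
      have "conv a \<eta> (inv (g [^] m) \<otimes> x) = f (inv g \<otimes> (inv (g [^] m) \<otimes> x)) - f (inv (g [^] m) \<otimes> x)"
        using dg[of "inv (g [^] m) \<otimes> x"] gp[of m] x by simp
      also have "inv g \<otimes> (inv (g [^] m) \<otimes> x) = inv (g [^] Suc m) \<otimes> x"
        unfolding gs using gc gp[of m] x by (simp add: m_assoc)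
      finally show ?case using Suc by simp
    qed (use x in simp)
    have "real n * conv a \<eta> x = (\<Sum>j<n. conv a \<eta> x)" by simp
    also have "\<dots> = (\<Sum>j<n. conv a \<eta> (inv (g [^] j) \<otimes> x)) - (\<Sum>j<n. conv a \<eta> (inv (g [^] j) \<otimes> x) - conv a \<eta> x)"
      by (simp add: sum_subtractf)
    finally have "\<bar>real n * conv a \<eta> x\<bar> \<le> \<bar>f (inv (g [^] n) \<otimes> x) - f x\<bar> + \<bar>\<Sum>j<n. conv a \<eta> (inv (g [^] j) \<otimes> x) - conv a \<eta> x\<bar>"
      unfolding tel by linarith
    also have "\<dots> \<le> \<epsilon> * A + (\<Sum>j<n. w / \<kappa> * \<epsilon> * A)"
    proof (rule add_mono[OF bf[OF n(3)[OF order_refl] gp x]])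
      show "\<bar>\<Sum>j<n. conv a \<eta> (inv (g [^] j) \<otimes> x) - conv a \<eta> x\<bar> \<le> (\<Sum>j<n. w / \<kappa> * \<epsilon> * A)"
        using bd n(3) gp by (intro order_trans[OF sum_abs sum_mono]) (auto simp: A_def)
    qed
    also have "\<dots> = \<epsilon> * A + \<epsilon> * A / \<kappa>" using n by simp
    also have "\<dots> \<le> \<epsilon> * A / \<kappa> + \<epsilon> * A / \<kappa>"
    proof -
      have "\<epsilon> * A * \<kappa> \<le> \<epsilon> * A * 1" using A eps k by (intro mult_left_mono) auto
      then have "\<epsilon> * A \<le> \<epsilon> * A / \<kappa>" using k by (simp add: le_divide_eq)
      then show ?thesis by (rule add_right_mono)
    qed
    finally have "real n * \<bar>conv a \<eta> x\<bar> \<le> 2 * A * \<epsilon> / \<kappa>" by (simp add: abs_mult mult_ac)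
    then have "w * (real n * \<bar>conv a \<eta> x\<bar>) \<le> w * (2 * A * \<epsilon> / \<kappa>)" using gc(2) by (intro mult_left_mono) auto
    moreover have "w * (real n * \<bar>conv a \<eta> x\<bar>) = \<bar>conv a \<eta> x\<bar>" using n by simp
    ultimately show ?thesis using dg[OF x] by simp
  qed
  have bq: "\<bar>f (inv q \<otimes> x) - f x\<bar> \<le> r * (2 * A * \<epsilon> / \<kappa>)" if "ball Gen q r" "x \<in> carrier L" for q r x
    using that
  proof (induction arbitrary: x rule: ball.induct)
    case ball_one
    then show ?case by simp
  next
    case (ball_step g w q r)
    have c: "g \<in> carrier L" "q \<in> carrier L" using good_genD[OF G ball_step(1)] ball_props[OF ball_step(2) G] by auto
    have e: "inv (g \<otimes> q) \<otimes> x = inv q \<otimes> (inv g \<otimes> x)" using c ball_step(4) by (simp add: inv_mult_group m_assoc)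
    have 1: "\<bar>f (inv q \<otimes> (inv g \<otimes> x)) - f (inv g \<otimes> x)\<bar> \<le> r * (2 * A * \<epsilon> / \<kappa>)" using ball_step(3)[of "inv g \<otimes> x"] c ball_step(4) by simp
    have 2: "\<bar>f (inv g \<otimes> x) - f x\<bar> \<le> w * (2 * A * \<epsilon> / \<kappa>)" by (rule bg[OF ball_step(1,4)])
    show ?case unfolding e distrib_right using 1 2 by linarith
  qed
  have qc: "q \<in> carrier L" using ball_props[OF q(1) G] by auto
  have f1: "I (\<lambda>x. \<theta> x * \<theta> x) \<le> f \<one>"
  proof -
    have i1: "(\<lambda>y. \<psi> y * \<eta> (inv y \<otimes> \<one>)) \<in> Cc" by (rule conv_integrand[OF pcc ec]) simp
    have "\<theta> x * \<theta> x \<le> \<psi> x * \<eta> (inv x \<otimes> \<one>)" if "x \<in> carrier L" for x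
      using that psi_ge_theta[OF G k(1) th th1 that] CpD(2)[OF th that] by (simp add: \<eta>_def \<psi>_def mult_right_mono)
    then show ?thesis unfolding f_def conv_def
      by (intro I_mono i1 Cc_mult Cc_cont tc)
  qed
  have "\<bar>f (inv (inv q) \<otimes> \<one>) - f \<one>\<bar> \<le> r * (2 * A * \<epsilon> / \<kappa>)" by (rule bq[OF ball_inv[OF G q(1)]]) simp
  then have "f q \<noteq> 0" using qc q(2) f1 by (auto simp: A_def)
  then obtain y where y: "y \<in> carrier L" "\<psi> y * \<eta> (inv y \<otimes> q) \<noteq> 0"
    using conv_zero[OF pcc ec qc] by (auto simp: f_def)
  obtain q' r' where q': "ball Gen q' r'" "r' < \<kappa>" "\<theta> (inv q' \<otimes> y) \<noteq> 0"
    using psi_supp[OF G k(1) th th1 y(1)] y(2) by (auto simp: \<psi>_def)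
  have q'c: "q' \<in> carrier L" using ball_props[OF q'(1) G] by auto
  have "\<theta> (inv q \<otimes> y) \<noteq> 0" using y(2) qc y(1) by (auto simp: \<eta>_def inv_mult_group)
  moreover have "q = q' \<otimes> (inv q' \<otimes> y) \<otimes> inv (inv q \<otimes> y)"
  proof -
    have "q' \<otimes> (inv q' \<otimes> y) = y" using q'c y by (simp add: m_assoc[symmetric])
    moreover have "y \<otimes> inv (inv q \<otimes> y) = q" using qc y by (simp add: inv_mult_group m_assoc[symmetric])
    ultimately show ?thesis by simp
  qed
  ultimately show ?thesis using q' q'c qc y(1)
    by (intro exI[of _ q'] exI[of _ r'] exI[of _ "inv q' \<otimes> y"] exI[of _ "inv q \<otimes> y"]) auto
qed

section \<open>Limit groups of balls\<close>

context lcgrp begin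

text \<open>Limits of points in balls of radius o(\<rho>). Allowing every factor
  \<open>t > 0\<close>, however small, is what makes the set closed under products: t = t/2 +
  t/2.\<close>

definition Hlim :: "'i filter \<Rightarrow> ('i \<Rightarrow> 'a \<Rightarrow> real \<Rightarrow> bool) \<Rightarrow> ('i \<Rightarrow> real) \<Rightarrow> 'a set" where
  "Hlim F Gn \<rho> = {p \<in> carrier L. \<forall>t>0. \<forall>S. openin T S \<longrightarrow> p \<in> S \<longrightarrow>
     eventually (\<lambda>i. Bset (Gn i) (t * \<rho> i) \<inter> S \<noteq> {}) F}"

lemma Hlim_mono:
  assumes "eventually (\<lambda>i. \<rho> i \<le> \<rho>' i) F"
  shows "Hlim F Gn \<rho> \<subseteq> Hlim F Gn \<rho>'"
proof
  fix p assume p: "p \<in> Hlim F Gn \<rho>"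
  show "p \<in> Hlim F Gn \<rho>'"
    unfolding Hlim_def
  proof (intro CollectI conjI allI impI)
    show "p \<in> carrier L" using p by (simp add: Hlim_def)
    fix t :: real and S assume t: "0 < t" and S: "openin T S" "p \<in> S"
    have "eventually (\<lambda>i. Bset (Gn i) (t * \<rho> i) \<inter> S \<noteq> {}) F" using p t S by (simp add: Hlim_def)
    with assms show "eventually (\<lambda>i. Bset (Gn i) (t * \<rho>' i) \<inter> S \<noteq> {}) F"
    proof eventually_elim
      case (elim i)
      then have "t * \<rho> i \<le> t * \<rho>' i" using t by simp
      then show ?case using Bset_mono[of "t * \<rho> i" "t * \<rho>' i" "Gn i"] elim(2) by blast
    qed
  qed
qed

lemma Hlim_closure:
  assumes F: "F \<noteq> bot" and ev: "eventually (\<lambda>i. Bset (Gn i) (\<rho> i) \<subseteq> A) F"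
  shows "Hlim F Gn \<rho> \<subseteq> T closure_of A"
proof
  fix p assume p: "p \<in> Hlim F Gn \<rho>"
  have "\<exists>y. y \<in> A \<and> y \<in> S" if S: "p \<in> S" "openin T S" for S
  proof -
    have "eventually (\<lambda>i. Bset (Gn i) (1 * \<rho> i) \<inter> S \<noteq> {}) F"
      using p S zero_less_one unfolding Hlim_def by blast
    with ev have "eventually (\<lambda>i. A \<inter> S \<noteq> {}) F" by eventually_elim auto
    then have "A \<inter> S \<noteq> {}" using F by (simp add: eventually_const_iff)
    then show ?thesis by blast
  qed
  then show "p \<in> T closure_of A" using p by (simp add: in_closure_of Hlim_def)
qed

lemma closedin_Hlim: "closedin T (Hlim F Gn \<rho>)"
proof -
  have "T closure_of Hlim F Gn \<rho> \<subseteq> Hlim F Gn \<rho>"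
  proof
    fix p assume p: "p \<in> T closure_of Hlim F Gn \<rho>"
    have cl: "\<forall>S. p \<in> S \<and> openin T S \<longrightarrow> (\<exists>y. y \<in> Hlim F Gn \<rho> \<and> y \<in> S)" using p by (simp add: in_closure_of)
    show "p \<in> Hlim F Gn \<rho>"
      unfolding Hlim_def
    proof (intro CollectI conjI allI impI)
      show "p \<in> carrier L" using p by (simp add: in_closure_of)
      fix t :: real and S assume t: "0 < t" and S: "openin T S" "p \<in> S"
      then obtain y where "y \<in> Hlim F Gn \<rho>" "y \<in> S" using cl by meson
      then show "eventually (\<lambda>i. Bset (Gn i) (t * \<rho> i) \<inter> S \<noteq> {}) F" using t S by (simp add: Hlim_def)
    qed
  qed
  moreover have "Hlim F Gn \<rho> \<subseteq> topspace T" by (auto simp: Hlim_def)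
  ultimately show ?thesis using closure_of_subset_eq[of "Hlim F Gn \<rho>" T] by auto
qed

lemma subgroup_Hlim:
  assumes good: "eventually (\<lambda>i. good_gen (Gn i) \<and> 0 < \<rho> i) F"
  shows "subgroup (Hlim F Gn \<rho>) L"
proof (rule subgroupI)
  show "Hlim F Gn \<rho> \<subseteq> carrier L" by (auto simp: Hlim_def)
  have "\<one> \<in> Hlim F Gn \<rho>"
    unfolding Hlim_def
  proof (intro CollectI conjI allI impI)
    fix t :: real and S assume t: "0 < t" and S: "openin T S" "\<one> \<in> S"
    from good show "eventually (\<lambda>i. Bset (Gn i) (t * \<rho> i) \<inter> S \<noteq> {}) F"
    proof eventually_elim
      case (elim i)
      then have "\<one> \<in> Bset (Gn i) (t * \<rho> i)" using t by (intro Bset_one) simp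
      then show ?case using S by blast
    qed
  qed simp
  then show "Hlim F Gn \<rho> \<noteq> {}" by auto
  show "inv a \<in> Hlim F Gn \<rho>" if a: "a \<in> Hlim F Gn \<rho>" for a
    unfolding Hlim_def
  proof (intro CollectI conjI allI impI)
    have ac: "a \<in> carrier L" using a by (simp add: Hlim_def)
    then show "inv a \<in> carrier L" by simp
    fix t :: real and S assume t: "0 < t" and S: "openin T S" "inv a \<in> S"
    have "openin T {x \<in> carrier L. inv x \<in> S}" by (rule openin_preimage[OF cont_inv S(1)])
    then have "eventually (\<lambda>i. Bset (Gn i) (t * \<rho> i) \<inter> {x \<in> carrier L. inv x \<in> S} \<noteq> {}) F"
      using a ac t S by (simp add: Hlim_def)
    with good show "eventually (\<lambda>i. Bset (Gn i) (t * \<rho> i) \<inter> S \<noteq> {}) F"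
    proof eventually_elim
      case (elim i)
      then obtain x where "x \<in> Bset (Gn i) (t * \<rho> i)" "inv x \<in> S" by blast
      then show ?case using Bset_inv[of "Gn i" x] elim by blast
    qed
  qed
  show "a \<otimes> b \<in> Hlim F Gn \<rho>" if a: "a \<in> Hlim F Gn \<rho>" and b: "b \<in> Hlim F Gn \<rho>" for a b
    unfolding Hlim_def
  proof (intro CollectI conjI allI impI)
    have ac: "a \<in> carrier L" "b \<in> carrier L" using a b by (auto simp: Hlim_def)
    then show "a \<otimes> b \<in> carrier L" by simp
    fix t :: real and S assume t: "0 < t" and S: "openin T S" "a \<otimes> b \<in> S"
    have "openin (prod_topology T T) {p \<in> topspace (prod_topology T T). fst p \<otimes> snd p \<in> S}"
      using openin_continuous_map_preimage[OF cont_mult S(1)] .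
    moreover have "(a,b) \<in> {p \<in> topspace (prod_topology T T). fst p \<otimes> snd p \<in> S}" using S ac by simp
    ultimately obtain A B where AB: "openin T A" "openin T B" "a \<in> A" "b \<in> B"
      "A \<times> B \<subseteq> {p \<in> topspace (prod_topology T T). fst p \<otimes> snd p \<in> S}"
      by (smt (verit, best) openin_prod_topology_alt)
    have t2: "0 < t / 2" using t by simp
    have "eventually (\<lambda>i. Bset (Gn i) (t / 2 * \<rho> i) \<inter> A \<noteq> {}) F" using a t2 AB unfolding Hlim_def by blast
    moreover have "eventually (\<lambda>i. Bset (Gn i) (t / 2 * \<rho> i) \<inter> B \<noteq> {}) F" using b t2 AB unfolding Hlim_def by blast
    ultimately show "eventually (\<lambda>i. Bset (Gn i) (t * \<rho> i) \<inter> S \<noteq> {}) F" using good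
    proof eventually_elim
      case (elim i)
      then obtain x y where xy: "x \<in> Bset (Gn i) (t / 2 * \<rho> i)" "x \<in> A" "y \<in> Bset (Gn i) (t / 2 * \<rho> i)" "y \<in> B" by blast
      then have "x \<otimes> y \<in> Bset (Gn i) (t / 2 * \<rho> i + t / 2 * \<rho> i)" using elim by (intro Bset_mult) auto
      moreover have "x \<otimes> y \<in> S" using subsetD[OF AB(5), of "(x,y)"] xy by auto
      ultimately show ?case by auto
    qed
  qed
qed

text \<open>By the definition of the limit group, balls of some radius \<tau> \<rho> lie near it.
  \<open>gleason_trap\<close> with \<kappa> = \<tau> \<rho> extends this to radius 2 \<rho>, that
  is, beyond the radius \<rho> for which confinement to \<open>U\<close> was assumed. This gain is
  what a critical choice of \<rho> contradicts.\<close>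

lemma Bset_eventually_near_Hlim:
  assumes F: "ultrafilter F" and U: "compactin T U" and V: "\<And>W. nbh W \<Longrightarrow> eventually (\<lambda>i. Vf i \<subseteq> W) F"
    and good: "eventually (\<lambda>i. good_gen (Gn i) \<and> 0 < \<rho> i \<and> \<rho> i \<le> 1 \<and> Bset (Gn i) (\<rho> i) \<subseteq> U) F"
    and gen: "eventually (\<lambda>i. \<forall>g w. Gn i g w \<longrightarrow> (\<exists>n::nat. 1 \<le> n \<and> w = 1 / real n \<and> (\<forall>j\<le>n. g [^] j \<in> Vf i))) F"
    and W: "nbh W"
  shows "eventually (\<lambda>i. Bset (Gn i) (2 * \<rho> i) \<subseteq> Hlim F Gn \<rho> <#> W) F"
proof -
  define H where "H = Hlim F Gn \<rho>"
  have Hc: "H \<subseteq> carrier L" by (auto simp: H_def Hlim_def)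
  have Uc: "U \<subseteq> carrier L" using compactin_subset_topspace[OF U] by simp
  obtain W2 where W2: "nbh W2" "symm W2" "W2 \<subseteq> W" "\<And>x y. x \<in> W2 \<Longrightarrow> y \<in> W2 \<Longrightarrow> x \<otimes> y \<in> W" using nbh_mult[OF W] by blast
  obtain W1 where W1: "nbh W1" "symm W1" "W1 \<subseteq> W2" "\<And>x y. x \<in> W1 \<Longrightarrow> y \<in> W1 \<Longrightarrow> x \<otimes> y \<in> W2" using nbh_mult[OF W2(1)] by blast
  have W1c: "W1 \<subseteq> carrier L" using nbh_carrier[OF W1(1)] .
  have op: "openin T (H <#> W1)" using W1(1) Hc by (intro openin_set_mult_right) (auto simp: nbh_def)
  let ?D = "U - (H <#> W1)"
  have D: "compactin T ?D" using closed_compactin[OF U, of ?D] closedin_diff[OF compactin_closed[OF U] op] by auto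
  have HD: "p \<notin> H" if "p \<in> ?D" for p
  proof
    assume "p \<in> H"
    then have "p \<otimes> \<one> \<in> H <#> W1" using W1(1) unfolding set_mult_def nbh_def by blast
    then show False using that Uc by auto
  qed
  have "\<forall>p\<in>?D. \<exists>t S. 0 < t \<and> openin T S \<and> p \<in> S \<and> eventually (\<lambda>i. Bset (Gn i) (t * \<rho> i) \<inter> S = {}) F"
  proof
    fix p assume p: "p \<in> ?D"
    then have "p \<notin> Hlim F Gn \<rho>" "p \<in> carrier L" using HD Uc by (auto simp: H_def)
    then obtain t S where tS: "0 < t" "openin T S" "p \<in> S" "\<not> eventually (\<lambda>i. Bset (Gn i) (t * \<rho> i) \<inter> S \<noteq> {}) F"
      unfolding Hlim_def by blast
    then show "\<exists>t S. 0 < t \<and> openin T S \<and> p \<in> S \<and> eventually (\<lambda>i. Bset (Gn i) (t * \<rho> i) \<inter> S = {}) F"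
      using ultrafilter_not_eventually[OF F] by auto
  qed
  then obtain t S where tS: "\<And>p. p \<in> ?D \<Longrightarrow> 0 < t p \<and> openin T (S p) \<and> p \<in> S p \<and> eventually (\<lambda>i. Bset (Gn i) (t p * \<rho> i) \<inter> S p = {}) F"
    by metis
  have "\<exists>\<F>. finite \<F> \<and> \<F> \<subseteq> S ` ?D \<and> ?D \<subseteq> \<Union>\<F>"
    using compactinD[OF D, of "S ` ?D"] tS by blast
  then obtain \<F> where FF: "finite \<F>" "\<F> \<subseteq> S ` ?D" "?D \<subseteq> \<Union>\<F>" by auto
  from finite_subset_image[OF FF(1,2)] obtain P where P: "finite P" "P \<subseteq> ?D" "?D \<subseteq> \<Union>(S ` P)" using FF(3) by auto
  \<comment> \<open>Each point of the compact rest of \<open>U\<close> has a neighbourhood that some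
    ball avoids, and finitely many suffice; \<open>\<tau>\<close> is the least of their factors. The
    bound by 1 keeps the ball of radius \<tau> \<rho> inside \<open>U\<close>.\<close>
  define \<tau> where "\<tau> = Min (insert 1 (t ` P))"
  have tau: "0 < \<tau>" "\<tau> \<le> 1" "\<And>p. p \<in> P \<Longrightarrow> \<tau> \<le> t p"
    unfolding \<tau>_def using P tS by (auto simp: Min_gr_iff)
  have "eventually (\<lambda>i. \<forall>p\<in>P. Bset (Gn i) (t p * \<rho> i) \<inter> S p = {}) F"
    using P tS by (intro eventually_ball_finite) auto
  with good have near: "eventually (\<lambda>i. Bset (Gn i) (\<tau> * \<rho> i) \<subseteq> H <#> W1) F"
  proof eventually_elim
    case (elim i)
    show ?case
    proof
      fix q assume q: "q \<in> Bset (Gn i) (\<tau> * \<rho> i)"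
      have "\<tau> * \<rho> i \<le> 1 * \<rho> i" using tau elim by (intro mult_right_mono) auto
      then have "q \<in> U" using q elim Bset_mono[of "\<tau> * \<rho> i" "\<rho> i" "Gn i"] by auto
      moreover have "q \<notin> S p" if p: "p \<in> P" for p
      proof -
        have "\<tau> * \<rho> i \<le> t p * \<rho> i" using tau(3)[OF p] elim by (intro mult_right_mono) auto
        then have "q \<in> Bset (Gn i) (t p * \<rho> i)" using q Bset_mono by blast
        then show ?thesis using elim p by blast
      qed
      ultimately show "q \<in> H <#> W1" using P(3) by blast
    qed
  qed
  obtain I where "haar L T I" by (rule haar_ex)
  then interpret haar L T I .
  obtain \<theta> Ct where th: "continuous_map T euclideanreal \<theta>" "compactin T Ct" "Ct \<subseteq> W1"
    "\<And>x. x \<in> carrier L \<Longrightarrow> 0 \<le> \<theta> x" "\<And>x. x \<in> carrier L \<Longrightarrow> \<theta> x \<le> 1" "\<theta> \<one> = 1"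
    "\<And>x. x \<in> carrier L \<Longrightarrow> x \<notin> Ct \<Longrightarrow> \<theta> x = 0"
    using bump_function[OF W1(1)] by blast
  have thp: "\<theta> \<in> Cp" using th by (intro CpI CcI[OF th(1,2)]) auto
  have c: "0 < I (\<lambda>x. \<theta> x * \<theta> x)"
    by (rule I_pos[of _ \<one>]) (use th in \<open>auto intro!: CpI Cc_mult CpD(1)[OF thp]\<close>)
  define Y0 where "Y0 = U <#> Ct"
  have Y0: "compactin T Y0" unfolding Y0_def by (rule compactin_mult[OF U th(2)])
  obtain W0 C0 where C0: "nbh W0" "compactin T C0" "W0 \<subseteq> C0" "C0 \<subseteq> carrier L" using nbh_compact[OF nbh_univ] .
  define Y where "Y = Y0 \<union> (C0 <#> Y0)"
  have Y: "compactin T Y" unfolding Y_def by (intro compactin_Un compactin_mult Y0 C0)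
  have Yc: "Y \<subseteq> carrier L" using compactin_subset_topspace[OF Y] by simp
  obtain \<Theta> where Th: "\<Theta> \<in> Cp" "\<And>y. y \<in> Y \<Longrightarrow> 1 \<le> \<Theta> y" using Cp_ge_one_on_compact[OF Y] by blast
  have IT: "0 \<le> I \<Theta>" by (rule I_nonneg[OF Th(1)])
  \<comment> \<open>A word of weight 2 \<rho> changes the convolution by at most 4 I(\<Theta>)
    \<epsilon> / \<tau>, which this choice makes smaller than the integral of the square of
    \<open>\<theta>\<close>. As \<rho> cancels, one \<open>\<epsilon>\<close>, and so one
    neighbourhood, serves all indices \<open>i\<close>.\<close>
  define \<epsilon> where "\<epsilon> = I (\<lambda>x. \<theta> x * \<theta> x) * \<tau> / (4 * (I \<Theta> + 1))"
  have eps: "0 < \<epsilon>" unfolding \<epsilon>_def using c tau IT by simp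
  obtain V1 where V1: "nbh V1" "\<And>x z. x \<in> carrier L \<Longrightarrow> z \<in> V1 \<Longrightarrow> \<bar>\<theta> (inv (z \<otimes> x)) - \<theta> (inv x)\<bar> < \<epsilon>"
    using Cc_uniform_left[OF Cc_inv[OF CpD(1)[OF thp]] eps] by blast
  obtain V2 where V2: "nbh V2" "\<And>y h. y \<in> Y \<Longrightarrow> h \<in> V2 \<Longrightarrow> inv y \<otimes> h \<otimes> y \<in> V1"
    using nbh_conj[OF Y V1(1)] by blast
  let ?V3 = "W0 \<inter> {x \<in> carrier L. inv x \<in> V2}"
  have V3: "nbh ?V3" using C0(1) nbh_inv[OF V2(1)] nbh_Int by blast
  from near good gen V[OF V3] show ?thesis
  proof eventually_elim
    case (elim i)
    have G: "good_gen (Gn i)" and r: "0 < \<rho> i" "\<rho> i \<le> 1" and BU: "Bset (Gn i) (\<rho> i) \<subseteq> U" using elim by auto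
    have k: "0 < \<tau> * \<rho> i" "\<tau> * \<rho> i \<le> 1" "\<tau> * \<rho> i \<le> \<rho> i" using r tau by (auto simp: mult_le_one mult_left_le_one_le)
    show ?case
    proof
      fix q assume "q \<in> Bset (Gn i) (2 * \<rho> i)"
      then obtain s where s: "ball (Gn i) q s" "s \<le> 2 * \<rho> i" by (auto simp: Bset_def)
      have "\<exists>q' r' a b. ball (Gn i) q' r' \<and> r' < \<tau> * \<rho> i \<and> a \<in> carrier L \<and> b \<in> carrier L \<and> \<theta> a \<noteq> 0 \<and> \<theta> b \<noteq> 0 \<and> q = q' \<otimes> a \<otimes> inv b"
      proof (rule gleason_trap[where V = "Vf i" and \<epsilon> = \<epsilon> and \<Theta> = \<Theta> and Y = Y and ?Y0.0 = Y0 and r = s])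
        show "x \<in> Y0" if b: "ball (Gn i) q r" "r < \<tau> * \<rho> i" "x \<in> carrier L" "\<theta> (inv q \<otimes> x) \<noteq> 0" for q r x
        proof -
          have qc: "q \<in> carrier L" using ball_props[OF b(1) G] by auto
          have "q \<in> Bset (Gn i) (\<rho> i)" using b k by (auto simp: Bset_def intro!: exI[of _ r])
          then have "q \<in> U" using BU by auto
          moreover have "inv q \<otimes> x \<in> Ct" using th(7)[of "inv q \<otimes> x"] b qc by auto
          moreover have "x = q \<otimes> (inv q \<otimes> x)" using qc b by (simp add: m_assoc[symmetric])
          ultimately show ?thesis unfolding Y0_def set_mult_def by blast
        qed
        show "x \<in> Y" if g: "Gn i g w" "x \<in> carrier L" "inv g \<otimes> x \<in> Y0" for g w x
        proof -
          have gc: "g \<in> carrier L" using good_genD[OF G g(1)] by auto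
          obtain n :: nat where "1 \<le> n" "\<forall>j\<le>n. g [^] j \<in> Vf i" using elim g(1) by blast
          then have "g [^] (1::nat) \<in> Vf i" by blast
          then have "g \<in> C0" using elim gc C0 by auto
          moreover have "x = g \<otimes> (inv g \<otimes> x)" using gc g by (simp add: m_assoc[symmetric])
          ultimately show ?thesis using g(3) unfolding Y_def set_mult_def by blast
        qed
        show "\<bar>\<theta> (inv (inv y \<otimes> inv h \<otimes> y \<otimes> z)) - \<theta> (inv z)\<bar> \<le> \<epsilon>" if "h \<in> Vf i" "h \<in> carrier L" "y \<in> Y" "y \<in> carrier L" "z \<in> carrier L" for h y z
        proof -
          have "inv h \<in> V2" using that elim by auto
          then have "inv y \<otimes> inv h \<otimes> y \<in> V1" using V2(2) that by auto
          then show ?thesis using V1(2)[OF that(5)] by (simp add: less_imp_le)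
        qed
        have "s * (2 * I \<Theta> * \<epsilon> / (\<tau> * \<rho> i)) \<le> (2 * \<rho> i) * (2 * I \<Theta> * \<epsilon> / (\<tau> * \<rho> i))"
          using s(2) IT eps k by (intro mult_right_mono) auto
        also have "\<dots> = 4 * I \<Theta> * \<epsilon> / \<tau>" using r tau by (simp add: field_simps)
        also have "\<dots> = I (\<lambda>x. \<theta> x * \<theta> x) * (I \<Theta> / (I \<Theta> + 1))"
        proof -
          have gen0: "4 * a * (c * t / (4 * b)) / t = c * (a / b)" if "t \<noteq> 0" "b \<noteq> 0" for a b c t :: real
            using that by (simp add: field_simps)
          have "\<tau> \<noteq> 0" "I \<Theta> + 1 \<noteq> 0" using tau(1) IT by auto
          then show ?thesis unfolding \<epsilon>_def by (rule gen0)
        qed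
        also have "\<dots> < I (\<lambda>x. \<theta> x * \<theta> x) * 1" using c IT by (intro mult_strict_left_mono) auto
        finally show "s * (2 * I \<Theta> * \<epsilon> / (\<tau> * \<rho> i)) < I (\<lambda>x. \<theta> x * \<theta> x)" by simp
        show "\<exists>n::nat. 1 \<le> n \<and> w = 1 / real n \<and> (\<forall>j\<le>n. g [^] j \<in> Vf i)" if "Gn i g w" for g w
          using elim that by blast
      qed (use G k thp th Y0 Th eps s in \<open>auto simp: Y_def\<close>)
      then obtain q' r' a b where q: "ball (Gn i) q' r'" "r' < \<tau> * \<rho> i" "a \<in> carrier L" "b \<in> carrier L" "\<theta> a \<noteq> 0" "\<theta> b \<noteq> 0" "q = q' \<otimes> a \<otimes> inv b"
        by blast
      have "q' \<in> Bset (Gn i) (\<tau> * \<rho> i)" using q by (auto simp: Bset_def intro!: exI[of _ r'])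
      then obtain h w where hw: "h \<in> H" "w \<in> W1" "q' = h \<otimes> w" using elim by (auto simp: set_mult_def)
      have ab: "a \<in> W1" "inv b \<in> W1" using q th(3,7) W1(2) by (auto simp: symm_def)
      have "w \<otimes> a \<otimes> inv b \<in> W" using W1 W2 hw ab by blast
      moreover have "q = h \<otimes> (w \<otimes> a \<otimes> inv b)" using q hw Hc W1c by (simp add: m_assoc subset_iff)
      ultimately show "q \<in> Hlim F Gn \<rho> <#> W" using hw unfolding H_def set_mult_def by blast
    qed
  qed
qed

end

text \<open>The first success of \<open>P\<close> along a, a/2, a/4, ...; it is not at
  \<open>a\<close>, so doubling fails.\<close>

lemma halving_scale:
  fixes a b :: real
  assumes "\<not> P a" "0 < a" "0 < b" "\<And>r. 0 < r \<Longrightarrow> r \<le> b \<Longrightarrow> P r"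
  obtains R where "0 < R" "R \<le> a" "P R" "\<not> P (2 * R)"
proof -
  obtain n where n: "a / b < 2 ^ n" using real_arch_pow[of 2 "a / b"] by auto
  have "a / 2 ^ n \<le> b" using n assms(3) by (simp add: field_simps)
  then have ex: "\<exists>k. P (a / 2 ^ k)" using assms by (intro exI[of _ n]) auto
  define k where "k = (LEAST k. P (a / 2 ^ k))"
  have Pk: "P (a / 2 ^ k)" unfolding k_def by (rule LeastI_ex[OF ex])
  have k0: "k \<noteq> 0" using Pk assms(1) by (cases k) auto
  then obtain m where m: "k = Suc m" by (cases k) auto
  have "\<not> P (a / 2 ^ m)" using not_less_Least[of m "\<lambda>k. P (a / 2 ^ k)"] m by (simp add: k_def)
  then have "\<not> P (2 * (a / 2 ^ k))" by (simp add: m)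
  moreover have "a / 2 ^ k \<le> a" using assms(2) by (simp add: divide_le_eq)
  ultimately show ?thesis using that[of "a / 2 ^ k"] Pk assms(2) by simp
qed

section \<open>The trapping theorem\<close>

context lcgrp begin

definition qset :: "'a set \<Rightarrow> nat \<Rightarrow> 'a set" where
  "qset V n = {x \<in> carrier L. \<forall>j\<le>n. x [^] (j::nat) \<in> V}"

text \<open>The longer the powers of \<open>g\<close> stay in \<open>V\<close>, the smaller the
  weight. The cap \<open>\<nu>\<close> bounds weights from below, so that sufficiently small balls
  are trivial and a scale of first escape exists; the trapping bound is uniform in
  \<open>\<nu>\<close>.\<close>

definition pgen :: "'a set \<Rightarrow> nat \<Rightarrow> 'a \<Rightarrow> real \<Rightarrow> bool" where
  "pgen V \<nu> g w \<longleftrightarrow> (\<exists>n::nat. 1 \<le> n \<and> n \<le> \<nu> \<and> w = 1 / real n \<and> g \<in> qset V n)"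

lemma qset_inv: "symm V \<Longrightarrow> x \<in> qset V n \<Longrightarrow> inv x \<in> qset V n"
  by (auto simp: qset_def symm_def nat_pow_inv)

lemma good_pgen: "symm V \<Longrightarrow> good_gen (pgen V \<nu>)"
  unfolding good_gen_def pgen_def using qset_inv by (fastforce simp: qset_def)

lemma Bset_pgen_small:
  assumes "symm V" "r < 1 / (real \<nu> + 1)" "q \<in> Bset (pgen V \<nu>) r"
  shows "q = \<one>"
proof -
  have key: "q = \<one> \<or> 1 / (real \<nu> + 1) \<le> s" if "ball (pgen V \<nu>) q s" for q s
    using that
  proof (induction rule: ball.induct)
    case (ball_step g w q r)
    then obtain n :: nat where n: "1 \<le> n" "n \<le> \<nu>" "w = 1 / real n" by (auto simp: pgen_def)
    have "1 / (real \<nu> + 1) \<le> w" unfolding n(3) using n by (intro divide_left_mono) auto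
    moreover have "0 \<le> r" using ball_props[OF ball_step(2) good_pgen[OF assms(1)]] by auto
    ultimately show ?case by simp
  qed simp
  then show ?thesis using assms unfolding Bset_def by fastforce
qed

text \<open>If balls escape from \<open>U\<close> for arbitrarily small \<open>V\<close>, the limit
  group \<open>H\<close> at the scale \<open>R\<close> of escape is a compact subgroup that leaves
  \<open>U0\<close>. With \<open>K \<subseteq> U0\<close> from the gap in \<open>H\<close>, the
  balls also escape from \<open>S <#> K\<close>, at some scale \<rho> \<le> R. The limit group at
  that smaller scale is caught by the gap in \<open>K\<close>, and then balls of radius 2 \<rho> are
  still inside \<open>S <#> K\<close>.\<close>

theorem trapping:
  assumes U: "compactin T U" "nbh U0" "U0 \<subseteq> U"
  obtains V and C :: nat where "nbh V" "symm V" "1 \<le> C" "\<And>\<nu>. Bset (pgen V \<nu>) (1 / real C) \<subseteq> U"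
proof -
  have "\<exists>V C::nat. nbh V \<and> symm V \<and> 1 \<le> C \<and> (\<forall>\<nu>. Bset (pgen V \<nu>) (1 / real C) \<subseteq> U)"
  proof (rule ccontr)
  assume neg0: "\<not> ?thesis"
  have neg: "\<exists>\<nu>. \<not> Bset (pgen V \<nu>) (1 / real C) \<subseteq> U" if "nbh V" "symm V" "1 \<le> C" for V and C :: nat
    using neg0 that by blast
  define J where "J = {(V, C::nat). nbh V \<and> symm V \<and> 1 \<le> C}"
  have "\<forall>i\<in>J. \<exists>\<nu>. \<not> Bset (pgen (fst i) \<nu>) (1 / real (snd i)) \<subseteq> U" using neg by (auto simp: J_def)
  then obtain \<nu> where nu: "\<And>i. i \<in> J \<Longrightarrow> \<not> Bset (pgen (fst i) (\<nu> i)) (1 / real (snd i)) \<subseteq> U" by metis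
  define Gn where "Gn = (\<lambda>i. pgen (fst i) (\<nu> i))"
  have small: "Bset (Gn i) r \<subseteq> Xs" if "i \<in> J" "\<one> \<in> Xs" "r \<le> 1 / (real (\<nu> i) + 2)" for i r Xs
  proof -
    have "r < 1 / (real (\<nu> i) + 1)" using that(3) by (rule order_le_less_trans) (simp add: field_simps)
    then show ?thesis using Bset_pgen_small[of "fst i" r "\<nu> i"] that by (auto simp: Gn_def J_def)
  qed
  have "\<forall>i\<in>J. \<exists>R. 0 < R \<and> R \<le> 1 / real (snd i) \<and> Bset (Gn i) R \<subseteq> U \<and> \<not> Bset (Gn i) (2 * R) \<subseteq> U"
  proof
    fix i assume i: "i \<in> J"
    show "\<exists>R. 0 < R \<and> R \<le> 1 / real (snd i) \<and> Bset (Gn i) R \<subseteq> U \<and> \<not> Bset (Gn i) (2 * R) \<subseteq> U"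
    proof (rule halving_scale[of "\<lambda>R. Bset (Gn i) R \<subseteq> U" "1 / real (snd i)" "1 / (real (\<nu> i) + 2)"])
      show "\<not> Bset (Gn i) (1 / real (snd i)) \<subseteq> U" using nu[OF i] by (simp add: Gn_def)
      show "Bset (Gn i) r \<subseteq> U" if "0 < r" "r \<le> 1 / (real (\<nu> i) + 2)" for r
        using small[OF i _ that(2)] U by (auto simp: nbh_def)
    qed (use i in \<open>auto simp: J_def\<close>)
  qed
  then obtain R where R: "\<And>i. i \<in> J \<Longrightarrow> 0 < R i \<and> R i \<le> 1 / real (snd i) \<and> Bset (Gn i) (R i) \<subseteq> U \<and> \<not> Bset (Gn i) (2 * R i) \<subseteq> U"
    by metis
  define A where "A V = {i \<in> J. fst i \<subseteq> V}" for V
  obtain F where F: "ultrafilter F" and FA: "\<And>V. nbh V \<Longrightarrow> eventually (\<lambda>i. i \<in> A V) F"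
  proof (rule ultrafilter_base[of "A ` {V. nbh V}"])
    show "A ` {V. nbh V} \<noteq> {}" using nbh_univ by auto
    show "B \<noteq> {}" if B: "B \<in> A ` {V. nbh V}" for B
    proof -
      obtain V where V: "nbh V" "B = A V" using B by auto
      obtain W where "nbh W" "symm W" "W \<subseteq> V" using nbh_sym[OF V(1)] .
      then have "(W, 1) \<in> A V" by (auto simp: A_def J_def)
      then show ?thesis using V by auto
    qed
    show "\<exists>D\<in>A ` {V. nbh V}. D \<subseteq> B \<inter> C" if BC: "B \<in> A ` {V. nbh V}" "C \<in> A ` {V. nbh V}" for B C
    proof -
      obtain V W where "nbh V" "B = A V" "nbh W" "C = A W" using BC by auto
      moreover have "A (V \<inter> W) \<subseteq> A V \<inter> A W" by (auto simp: A_def)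
      ultimately show ?thesis using nbh_Int by blast
    qed
  qed auto
  have Fb: "F \<noteq> bot" using F by (simp add: ultrafilter_def)
  have evJ: "eventually (\<lambda>i. i \<in> J) F" using FA[OF nbh_univ] by eventually_elim (auto simp: A_def)
  have V: "eventually (\<lambda>i. fst i \<subseteq> W) F" if "nbh W" for W using FA[OF that] by eventually_elim (auto simp: A_def)
  have good: "good_gen (Gn i)" if "i \<in> J" for i using that good_pgen by (auto simp: Gn_def J_def)
  have gen: "eventually (\<lambda>i. \<forall>g w. Gn i g w \<longrightarrow> (\<exists>n::nat. 1 \<le> n \<and> w = 1 / real n \<and> (\<forall>j\<le>n. g [^] j \<in> fst i))) F"
    by (rule always_eventually) (auto simp: Gn_def pgen_def qset_def)
  have R1: "R i \<le> 1" if "i \<in> J" for i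
  proof -
    have "1 / real (snd i) \<le> 1" using that by (auto simp: J_def)
    then show ?thesis using R[OF that] by linarith
  qed
  have near: "eventually (\<lambda>i. Bset (Gn i) (2 * \<rho> i) \<subseteq> Hlim F Gn \<rho> <#> W) F"
    if "eventually (\<lambda>i. 0 < \<rho> i \<and> \<rho> i \<le> R i) F" "nbh W" for \<rho> W
  proof (rule Bset_eventually_near_Hlim[OF F U(1) V _ gen that(2)])
    from evJ that(1) show "eventually (\<lambda>i. good_gen (Gn i) \<and> 0 < \<rho> i \<and> \<rho> i \<le> 1 \<and> Bset (Gn i) (\<rho> i) \<subseteq> U) F"
    proof eventually_elim
      case (elim i)
      then show ?case using good[of i] R1[of i] R[of i] Bset_mono[of "\<rho> i" "R i" "Gn i"] by auto
    qed
  qed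
  have evR: "eventually (\<lambda>i. 0 < R i \<and> R i \<le> R i) F" using evJ by eventually_elim (use R in auto)
  define H where "H = Hlim F Gn R"
  have H: "subgroup H L" unfolding H_def
    by (rule subgroup_Hlim) (use evJ in \<open>eventually_elim, use good R in auto\<close>)
  have "eventually (\<lambda>i. Bset (Gn i) (R i) \<subseteq> U) F" using evJ by eventually_elim (use R in auto)
  then have "H \<subseteq> T closure_of U" unfolding H_def by (rule Hlim_closure[OF Fb])
  then have HU: "H \<subseteq> U" using closure_of_closedin[OF compactin_closed[OF U(1)]] by simp
  have Hcl: "closedin T H" unfolding H_def by (rule closedin_Hlim)
  have Hcomp: "compactin T H" by (rule closed_compactin[OF U(1) HU Hcl])
  have Hc: "H \<subseteq> carrier L" using subgroup.subset[OF H] .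
  \<comment> \<open>Otherwise the balls of radius 2 R, being close to \<open>H\<close>, would lie in
    \<open>U0 \<subseteq> U\<close>, against the choice of \<open>R\<close>.\<close>
  have HU0: "\<not> H \<subseteq> U0"
  proof
    assume "H \<subseteq> U0"
    then obtain W where W: "nbh W" "H <#> W \<subseteq> U0" using nbh_compact_mult[OF Hcomp, of U0] U(2) by (auto simp: nbh_def)
    have "eventually (\<lambda>i. False) F" using near[OF evR W(1)] evJ
    proof eventually_elim
      case (elim i)
      then show ?case using W U R[of i] unfolding H_def by blast
    qed
    then show False using Fb by (simp add: eventually_False)
  qed
  obtain K W where K: "subgroup K L" "compactin T K" "K \<subseteq> U0" "K \<subseteq> H" "nbh W"
    and gap: "\<And>P. subgroup P L \<Longrightarrow> P \<subseteq> H \<Longrightarrow> P \<subseteq> W <#> K \<Longrightarrow> P \<subseteq> K"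
    using compact_subgroup_gap[OF H Hcomp U(2)] by blast
  have Kc: "K \<subseteq> carrier L" using subgroup.subset[OF K(1)] .
  obtain S where S: "nbh S" "symm S" "S \<subseteq> W" "\<And>x y. x \<in> S \<Longrightarrow> y \<in> S \<Longrightarrow> x \<otimes> y \<in> W" using nbh_mult[OF K(5)] by blast
  have Sc: "S \<subseteq> carrier L" using nbh_carrier[OF S(1)] .
  have opSK: "openin T (S <#> K)" using S(1) Kc by (intro openin_set_mult_left) (auto simp: nbh_def)
  have KSK: "K \<subseteq> S <#> K"
  proof
    fix k assume k: "k \<in> K"
    then have "\<one> \<otimes> k \<in> S <#> K" using S(1) unfolding set_mult_def nbh_def by blast
    then show "k \<in> S <#> K" using k Kc by auto
  qed
  obtain W' where W': "nbh W'" "K <#> W' \<subseteq> S <#> K" using nbh_compact_mult[OF K(2) opSK KSK] .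
  \<comment> \<open>Limit groups are only known to lie in closures, and the gap speaks about
    \<open>W <#> K\<close>; the room between \<open>S\<close> and \<open>W\<close> absorbs the
    closure.\<close>
  have cl: "T closure_of (S <#> K) \<subseteq> W <#> K"
  proof
    fix x assume "x \<in> T closure_of (S <#> K)"
    then have "x \<in> (S <#> K) <#> W'" using closure_of_subset_set_mult[OF _ W'(1), of "S <#> K"] openin_subset[OF opSK] by auto
    then obtain s k w where skw: "s \<in> S" "k \<in> K" "w \<in> W'" "x = s \<otimes> k \<otimes> w" by (auto simp: set_mult_def)
    have "k \<otimes> w \<in> K <#> W'" using skw unfolding set_mult_def by blast
    then have "k \<otimes> w \<in> S <#> K" using W'(2) by blast
    then obtain s' k' where sk': "s' \<in> S" "k' \<in> K" "k \<otimes> w = s' \<otimes> k'" by (auto simp: set_mult_def)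
    have c: "s \<in> carrier L" "k \<in> carrier L" "w \<in> carrier L" "s' \<in> carrier L" "k' \<in> carrier L"
      using skw sk' Sc Kc nbh_carrier[OF W'(1)] by auto
    have "x = s \<otimes> s' \<otimes> k'" using skw(4) sk'(3) c by (simp add: m_assoc)
    moreover have "s \<otimes> s' \<in> W" using S(4) skw sk' by blast
    ultimately show "x \<in> W <#> K" using sk' unfolding set_mult_def by blast
  qed
  \<comment> \<open>Otherwise \<open>H\<close> would lie in \<open>W <#> K\<close>, hence in
    \<open>K\<close> by the gap, hence in \<open>U0\<close>.\<close>
  have "\<not> eventually (\<lambda>i. Bset (Gn i) (R i) \<subseteq> S <#> K) F"
  proof
    assume "eventually (\<lambda>i. Bset (Gn i) (R i) \<subseteq> S <#> K) F"
    then have "H \<subseteq> W <#> K" using Hlim_closure[OF Fb] cl unfolding H_def by blast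
    then have "H \<subseteq> K" using gap[OF H order_refl] by blast
    then show False using HU0 K(3) by auto
  qed
  then have nR: "eventually (\<lambda>i. \<not> Bset (Gn i) (R i) \<subseteq> S <#> K) F" using ultrafilter_not_eventually[OF F] by simp
  have one: "\<one> \<in> S <#> K" using KSK subgroup.one_closed[OF K(1)] by auto
  have "\<forall>i. \<exists>\<rho>. i \<in> J \<longrightarrow> \<not> Bset (Gn i) (R i) \<subseteq> S <#> K \<longrightarrow> 0 < \<rho> \<and> \<rho> \<le> R i \<and> Bset (Gn i) \<rho> \<subseteq> S <#> K \<and> \<not> Bset (Gn i) (2 * \<rho>) \<subseteq> S <#> K"
  proof (intro allI)
    fix i
    show "\<exists>\<rho>. i \<in> J \<longrightarrow> \<not> Bset (Gn i) (R i) \<subseteq> S <#> K \<longrightarrow> 0 < \<rho> \<and> \<rho> \<le> R i \<and> Bset (Gn i) \<rho> \<subseteq> S <#> K \<and> \<not> Bset (Gn i) (2 * \<rho>) \<subseteq> S <#> K"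
    proof (cases "i \<in> J \<and> \<not> Bset (Gn i) (R i) \<subseteq> S <#> K")
      case True
      show ?thesis
      proof (rule halving_scale[of "\<lambda>R. Bset (Gn i) R \<subseteq> S <#> K" "R i" "1 / (real (\<nu> i) + 2)"])
        show "Bset (Gn i) r \<subseteq> S <#> K" if "0 < r" "r \<le> 1 / (real (\<nu> i) + 2)" for r
          using small[OF _ one that(2)] True by auto
      qed (use True R[of i] in auto)
    qed auto
  qed
  then obtain \<rho> where rho: "\<And>i. i \<in> J \<Longrightarrow> \<not> Bset (Gn i) (R i) \<subseteq> S <#> K \<Longrightarrow> 0 < \<rho> i \<and> \<rho> i \<le> R i \<and> Bset (Gn i) (\<rho> i) \<subseteq> S <#> K \<and> \<not> Bset (Gn i) (2 * \<rho> i) \<subseteq> S <#> K"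
    by metis
  have er: "eventually (\<lambda>i. 0 < \<rho> i \<and> \<rho> i \<le> R i) F" using nR evJ by eventually_elim (use rho in auto)
  have er2: "eventually (\<lambda>i. Bset (Gn i) (\<rho> i) \<subseteq> S <#> K) F" using nR evJ by eventually_elim (use rho in auto)
  have er3: "eventually (\<lambda>i. \<not> Bset (Gn i) (2 * \<rho> i) \<subseteq> S <#> K) F" using nR evJ by eventually_elim (use rho in auto)
  define H' where "H' = Hlim F Gn \<rho>"
  have H': "subgroup H' L" unfolding H'_def
    by (rule subgroup_Hlim) (use evJ er in \<open>eventually_elim, use good in auto\<close>)
  have "eventually (\<lambda>i. \<rho> i \<le> R i) F" using er by eventually_elim auto
  then have "H' \<subseteq> H" unfolding H'_def H_def by (rule Hlim_mono)
  moreover have "H' \<subseteq> W <#> K" using Hlim_closure[OF Fb er2] cl unfolding H'_def by blast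
  ultimately have H'K: "H' \<subseteq> K" using gap[OF H'] by blast
  have "eventually (\<lambda>i. False) F" using near[OF er W'(1)] er3
  proof eventually_elim
    case (elim i)
    have "H' <#> W' \<subseteq> K <#> W'" using H'K unfolding set_mult_def by blast
    then show ?case using elim W'(2) unfolding H'_def by blast
  qed
  then show False using Fb by (simp add: eventually_False)
  qed
  then show ?thesis using that by blast
qed

end

section \<open>One-parameter subgroups\<close>

text \<open>The function \<open>f\<close> turns left translation into a length \<open>p\<close> for which the group is nearly
  commutative near the identity.\<close>

locale gleason = lcgrp +
  fixes f :: "'a \<Rightarrow> real" and U :: "'a set" and c :: real and M :: real
  assumes f: "f \<in> Cc" and U: "compactin T U" and c: "0 < c" and M: "0 < M"
    and f1: "c \<le> f \<one>" and f_out: "\<And>x. x \<in> carrier L \<Longrightarrow> x \<notin> U \<Longrightarrow> f x = 0"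
    and second: "\<And>x y z b b'. x \<in> U \<Longrightarrow> y \<in> U \<Longrightarrow> z \<in> carrier L \<Longrightarrow>
        (\<And>z. z \<in> carrier L \<Longrightarrow> \<bar>f (inv x \<otimes> z) - f z\<bar> \<le> b) \<Longrightarrow> (\<And>z. z \<in> carrier L \<Longrightarrow> \<bar>f (inv y \<otimes> z) - f z\<bar> \<le> b') \<Longrightarrow>
        \<bar>f (inv y \<otimes> (inv x \<otimes> z)) - f (inv x \<otimes> z) - (f (inv y \<otimes> z) - f z)\<bar> \<le> M * b * b'"
    and separate: "\<And>x. x \<in> U \<Longrightarrow> (\<And>z. z \<in> carrier L \<Longrightarrow> f (inv x \<otimes> z) = f z) \<Longrightarrow> x = \<one>"
begin

lemma Uc: "U \<subseteq> carrier L" using compactin_subset_topspace[OF U] by simp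

text \<open>The supremum distance between \<open>f\<close> and its left translate by
  \<open>x\<close>, so that \<open>p (inv y \<otimes> x)\<close> is the distance between the
  translates by \<open>x\<close> and by \<open>y\<close>. The locale hypothesis
  \<open>second\<close> is phrased with arbitrary bounds \<open>b\<close> and \<open>b'\<close>, for
  which \<open>p x\<close> and \<open>p y\<close> are now the best choice.\<close>

definition p :: "'a \<Rightarrow> real" where
  "p x = (SUP z\<in>carrier L. \<bar>f (inv x \<otimes> z) - f z\<bar>)"

lemma p_ge:
  assumes "x \<in> carrier L" "z \<in> carrier L"
  shows "\<bar>f (inv x \<otimes> z) - f z\<bar> \<le> p x"
proof -
  obtain B where B: "\<And>x. x \<in> carrier L \<Longrightarrow> \<bar>f x\<bar> \<le> B" using Cc_bounded[OF f] by blast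
  have "\<bar>f (inv x \<otimes> z) - f z\<bar> \<le> B + B" if "z \<in> carrier L" for z
    using B[of "inv x \<otimes> z"] B[OF that] assms that by (auto simp: abs_le_iff)
  then show ?thesis unfolding p_def using assms by (intro cSUP_upper bdd_aboveI2[of _ _ "B + B"]) auto
qed

lemma p_le: "(\<And>z. z \<in> carrier L \<Longrightarrow> \<bar>f (inv x \<otimes> z) - f z\<bar> \<le> b) \<Longrightarrow> p x \<le> b"
  unfolding p_def by (rule cSUP_least) auto

lemma p_nonneg: "x \<in> carrier L \<Longrightarrow> 0 \<le> p x"
  using p_ge[of x \<one>] by (auto intro: order_trans[OF abs_ge_zero])

lemma p_mult:
  assumes "x \<in> carrier L" "y \<in> carrier L"
  shows "p (x \<otimes> y) \<le> p x + p y"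
proof (rule p_le)
  fix z assume z: "z \<in> carrier L"
  have e: "inv (x \<otimes> y) \<otimes> z = inv y \<otimes> (inv x \<otimes> z)" using assms z by (simp add: inv_mult_group m_assoc)
  show "\<bar>f (inv (x \<otimes> y) \<otimes> z) - f z\<bar> \<le> p x + p y"
    unfolding e using p_ge[OF assms(1) z] p_ge[OF assms(2), of "inv x \<otimes> z"] assms z by fastforce
qed

lemma dist_ge:
  assumes "x \<in> carrier L" "y \<in> carrier L" "z \<in> carrier L"
  shows "\<bar>f (inv x \<otimes> z) - f (inv y \<otimes> z)\<bar> \<le> p (inv y \<otimes> x)"
proof -
  have "inv (inv y \<otimes> x) \<otimes> (inv y \<otimes> z) = inv x \<otimes> z"
  proof -
    have "y \<otimes> (inv y \<otimes> z) = z" using assms by (simp add: m_assoc[symmetric])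
    then show ?thesis using assms by (simp add: inv_mult_group m_assoc)
  qed
  then show ?thesis using p_ge[of "inv y \<otimes> x" "inv y \<otimes> z"] assms by simp
qed

lemma dist_le:
  assumes "x \<in> carrier L" "y \<in> carrier L" "\<And>z. z \<in> carrier L \<Longrightarrow> \<bar>f (inv x \<otimes> z) - f (inv y \<otimes> z)\<bar> \<le> b"
  shows "p (inv y \<otimes> x) \<le> b"
proof (rule p_le)
  fix z assume z: "z \<in> carrier L"
  have 1: "inv (inv y \<otimes> x) \<otimes> z = inv x \<otimes> (y \<otimes> z)" using assms z by (simp add: inv_mult_group m_assoc)
  have 2: "z = inv y \<otimes> (y \<otimes> z)" using assms z by (simp add: m_assoc[symmetric])
  show "\<bar>f (inv (inv y \<otimes> x) \<otimes> z) - f z\<bar> \<le> b"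
    unfolding 1 using assms(3)[of "y \<otimes> z"] assms z 2 by simp
qed

lemma p_one: "p \<one> = 0"
  using p_le[of \<one> 0] p_nonneg[of \<one>] by force

lemma p_inv:
  assumes "x \<in> carrier L" shows "p (inv x) = p x"
proof -
  have le: "p (inv y) \<le> p y" if y: "y \<in> carrier L" for y
  proof (rule p_le)
    fix z assume z: "z \<in> carrier L"
    have "inv y \<otimes> (y \<otimes> z) = z" using y z by (simp add: m_assoc[symmetric])
    then show "\<bar>f (inv (inv y) \<otimes> z) - f z\<bar> \<le> p y" using p_ge[OF y, of "y \<otimes> z"] y z by (simp add: abs_minus_commute)
  qed
  show ?thesis using le[OF assms] le[of "inv x"] assms by simp
qed

text \<open>At z = x the difference is f(1) - f(x), which is f(1) \<ge> c when \<open>x\<close> is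
  outside \<open>U\<close>.\<close>

lemma p_out: "x \<in> carrier L \<Longrightarrow> p x < c \<Longrightarrow> x \<in> U"
proof (rule ccontr)
  assume x: "x \<in> carrier L" "p x < c" "x \<notin> U"
  have "\<bar>f (inv x \<otimes> x) - f x\<bar> \<le> p x" by (rule p_ge[OF x(1) x(1)])
  then show False using x f1 f_out[OF x(1,3)] by simp
qed

lemma p_zero: "x \<in> carrier L \<Longrightarrow> p x = 0 \<Longrightarrow> x = \<one>"
proof (rule separate)
  assume x: "x \<in> carrier L" "p x = 0"
  show "x \<in> U" using p_out[OF x(1)] x(2) c by simp
  show "f (inv x \<otimes> z) = f z" if "z \<in> carrier L" for z using p_ge[OF x(1) that] x(2) by simp
qed

lemma p_near: "e > 0 \<Longrightarrow> \<exists>V. nbh V \<and> (\<forall>z\<in>V. p z < e)"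
proof -
  assume e: "e > 0"
  obtain V0 where V0: "nbh V0" "\<And>x z. x \<in> carrier L \<Longrightarrow> z \<in> V0 \<Longrightarrow> \<bar>f (z \<otimes> x) - f x\<bar> < e / 2"
    using Cc_uniform_left[OF f, of "e/2"] e by auto
  obtain V where V: "nbh V" "symm V" "V \<subseteq> V0" using nbh_sym[OF V0(1)] .
  have "p z < e" if z: "z \<in> V" for z
  proof -
    have "inv z \<in> V0" using z V by (auto simp: symm_def)
    then have "p z \<le> e / 2" using V0(2) by (intro p_le) (simp add: less_imp_le)
    then show ?thesis using e by simp
  qed
  then show ?thesis using V(1) by blast
qed

lemma p_cont: "continuous_map T euclideanreal p"
proof (rule continuous_map_right_uniform)
  fix e :: real assume "e > 0"
  then obtain V where V: "nbh V" "\<And>z. z \<in> V \<Longrightarrow> p z < e" using p_near by blast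
  show "\<exists>V. nbh V \<and> (\<forall>x\<in>carrier L. \<forall>z\<in>V. \<bar>p (x \<otimes> z) - p x\<bar> < e)"
  proof (intro exI conjI ballI, rule V(1))
    fix x z assume x: "x \<in> carrier L" and z: "z \<in> V"
    have zc: "z \<in> carrier L" using z nbh_carrier[OF V(1)] by auto
    have "p (x \<otimes> z) \<le> p x + p z" by (rule p_mult[OF x zc])
    moreover have "p x \<le> p (x \<otimes> z) + p z"
      using p_mult[of "x \<otimes> z" "inv z"] x zc by (simp add: m_assoc p_inv)
    ultimately show "\<bar>p (x \<otimes> z) - p x\<bar> < e" using V(2)[OF z] by linarith
  qed
qed

text \<open>On the compact set \<open>U - V\<close> the length \<open>p\<close> has a positive
  minimum, and off \<open>U\<close> it is at least \<open>c\<close>. With \<open>p_near\<close> this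
  says that \<open>p\<close> describes the topology at \<open>\<one>\<close>.\<close>

lemma p_small:
  assumes V: "nbh V"
  obtains d where "d > 0" "\<And>x. x \<in> carrier L \<Longrightarrow> p x < d \<Longrightarrow> x \<in> V"
proof (cases "U - V = {}")
  case True
  then show ?thesis using p_out c by (intro that[of c]) auto
next
  case False
  have D: "compactin T (U - V)" using closed_compactin[OF U, of "U - V"] closedin_diff[OF compactin_closed[OF U]] V by (auto simp: nbh_def)
  have cp: "compact (p ` (U - V))" using image_compactin[OF D p_cont] by simp
  have ne: "p ` (U - V) \<noteq> {}" using False by blast
  obtain m where m: "m \<in> p ` (U - V)" "\<And>y. y \<in> p ` (U - V) \<Longrightarrow> m \<le> y" using compact_attains_inf[OF cp ne] by blast
  then obtain x where x: "x \<in> U - V" "m = p x" by blast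
  have "x \<noteq> \<one>" using x V by (auto simp: nbh_def)
  then have mp: "m > 0" using x p_zero[of x] p_nonneg[of x] Uc by fastforce
  show ?thesis
  proof (rule that[of "min m c"])
    show "min m c > 0" using mp c by simp
    fix y assume y: "y \<in> carrier L" "p y < min m c"
    then have "y \<in> U" using p_out by simp
    then show "y \<in> V" using m(2)[of "p y"] y by fastforce
  qed
qed

lemma p_pow: "x \<in> carrier L \<Longrightarrow> p (x [^] (n::nat)) \<le> real n * p x"
proof (induction n)
  case (Suc n)
  have "p (x [^] Suc n) \<le> p (x [^] n) + p x" using p_mult[of "x [^] n" x] Suc by simp
  then show ?case using Suc by (simp add: algebra_simps)
qed (simp add: p_one)

lemma p_int_pow: "x \<in> carrier L \<Longrightarrow> p (x [^] (k::int)) \<le> \<bar>real_of_int k\<bar> * p x"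
proof -
  assume x: "x \<in> carrier L"
  show ?thesis
  proof (cases "k \<ge> 0")
    case True
    then have "x [^] k = x [^] nat k" using pow_nat[where i=k and x=x and G=L] by simp
    then show ?thesis using p_pow[OF x, of "nat k"] True by simp
  next
    case False
    then have e: "x [^] k = inv (x [^] nat (-k))" using int_pow_neg[OF x, of "-k"] pow_nat[where i="-k" and x=x and G=L] by simp
    have "p (x [^] k) = p (x [^] nat (-k))" unfolding e by (rule p_inv) (rule nat_pow_closed[OF x])
    also have "\<dots> \<le> real (nat (-k)) * p x" by (rule p_pow[OF x])
    finally show ?thesis using False by simp
  qed
qed

lemma second_p:
  assumes "x \<in> U" "y \<in> U" "z \<in> carrier L"
  shows "\<bar>f (inv y \<otimes> (inv x \<otimes> z)) - f (inv x \<otimes> z) - (f (inv y \<otimes> z) - f z)\<bar> \<le> M * p x * p y"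
  using assms Uc by (intro second p_ge) auto

text \<open>The second differences along x, y and along y, x compare the translates by x y and by y
  x with one and the same sum of first differences.\<close>

lemma p_commutator:
  assumes "x \<in> U" "y \<in> U"
  shows "p (inv (y \<otimes> x) \<otimes> (x \<otimes> y)) \<le> 2 * M * p x * p y"
proof (rule dist_le)
  have xc: "x \<in> carrier L" "y \<in> carrier L" using assms Uc by auto
  then show "x \<otimes> y \<in> carrier L" "y \<otimes> x \<in> carrier L" by auto
  fix z assume z: "z \<in> carrier L"
  have e: "inv (x \<otimes> y) \<otimes> z = inv y \<otimes> (inv x \<otimes> z)" "inv (y \<otimes> x) \<otimes> z = inv x \<otimes> (inv y \<otimes> z)"
    using xc z by (auto simp: inv_mult_group m_assoc)
  have m: "M * p y * p x = M * p x * p y" by simp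
  have gen: "\<bar>a - b\<bar> \<le> 2 * K" if "\<bar>a - u - (v - w)\<bar> \<le> K" "\<bar>b - v - (u - w)\<bar> \<le> K" for a b u v w K :: real
    using that by linarith
  have "\<bar>f (inv y \<otimes> (inv x \<otimes> z)) - f (inv x \<otimes> (inv y \<otimes> z))\<bar> \<le> 2 * (M * p x * p y)"
    by (rule gen[OF second_p[OF assms z] second_p[OF assms(2,1) z, unfolded m]])
  then show "\<bar>f (inv (x \<otimes> y) \<otimes> z) - f (inv (y \<otimes> x) \<otimes> z)\<bar> \<le> 2 * M * p x * p y"
    unfolding e by simp
qed

text \<open>Each further factor \<open>x\<close> adds the first difference up to M p(x^n) p(x) \<le>
  M n p(x)^2, and these errors sum to at most M (n p(x))^2. The condition n p(x) < c keeps the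
  powers in \<open>U\<close>, where \<open>second\<close> applies.\<close>

lemma p_power_linear:
  assumes x: "x \<in> carrier L" and n: "real n * p x < c" and z: "z \<in> carrier L"
  shows "\<bar>f (inv (x [^] n) \<otimes> z) - f z - real n * (f (inv x \<otimes> z) - f z)\<bar> \<le> M * (real n * p x)\<^sup>2"
  using n
proof (induction n)
  case 0
  then show ?case using z by simp
next
  case (Suc n)
  have px: "0 \<le> p x" using p_nonneg[OF x] .
  have le: "real n * p x \<le> real (Suc n) * p x" using px by (simp add: mult_right_mono)
  have xn: "x [^] n \<in> carrier L" using x by simp
  have xnU: "x [^] n \<in> U" using p_out[OF xn] p_pow[OF x, of n] le Suc.prems by linarith
  have xU: "x \<in> U"
  proof -
    have "1 * p x \<le> real (Suc n) * p x" using px by (intro mult_right_mono) auto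
    then show ?thesis using p_out[OF x] Suc.prems by linarith
  qed
  have IH: "\<bar>f (inv (x [^] n) \<otimes> z) - f z - real n * (f (inv x \<otimes> z) - f z)\<bar> \<le> M * (real n * p x)\<^sup>2"
    using Suc.IH le Suc.prems by linarith
  have e: "inv (x [^] Suc n) \<otimes> z = inv x \<otimes> (inv (x [^] n) \<otimes> z)"
    using x xn z by (simp add: inv_mult_group m_assoc)
  have s: "\<bar>f (inv x \<otimes> (inv (x [^] n) \<otimes> z)) - f (inv (x [^] n) \<otimes> z) - (f (inv x \<otimes> z) - f z)\<bar> \<le> M * p (x [^] n) * p x"
    by (rule second_p[OF xnU xU z])
  have "M * p (x [^] n) * p x \<le> M * (real n * p x) * p x"
    using p_pow[OF x, of n] M px by (intro mult_right_mono mult_left_mono) auto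
  then have s': "\<bar>f (inv x \<otimes> (inv (x [^] n) \<otimes> z)) - f (inv (x [^] n) \<otimes> z) - (f (inv x \<otimes> z) - f z)\<bar> \<le> M * (real n * p x) * p x"
    using s by linarith
  have gen: "\<bar>A - F - (real n + 1) * D\<bar> \<le> k1 + k2" if "\<bar>B - F - real n * D\<bar> \<le> k1" "\<bar>A - B - D\<bar> \<le> k2" for A B D F k1 k2 :: real
    using that by (simp add: algebra_simps)
  have "\<bar>f (inv (x [^] Suc n) \<otimes> z) - f z - (real n + 1) * (f (inv x \<otimes> z) - f z)\<bar> \<le> M * (real n * p x)\<^sup>2 + M * (real n * p x) * p x"
    unfolding e by (rule gen[OF IH s'])
  also have "\<dots> \<le> M * (real (Suc n) * p x)\<^sup>2"
  proof -
    have "M * (real (Suc n) * p x)\<^sup>2 - (M * (real n * p x)\<^sup>2 + M * (real n * p x) * p x) = M * ((real n + 1) * (p x)\<^sup>2)"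
      by (simp add: power2_eq_square algebra_simps)
    moreover have "0 \<le> M * ((real n + 1) * (p x)\<^sup>2)" using M by (intro mult_nonneg_nonneg) auto
    ultimately show ?thesis by linarith
  qed
  finally show ?case by (simp add: add.commute)
qed

section \<open>Limits of rescaled powers\<close>

definition ops :: "(real \<Rightarrow> 'a) set" where
  "ops = {\<xi>. (\<forall>t. \<xi> t \<in> carrier L \<and> p (\<xi> t) \<le> \<bar>t\<bar>) \<and> (\<forall>s t. \<xi> (s + t) = \<xi> s \<otimes> \<xi> t)}"

lemma opsD:
  assumes "\<xi> \<in> ops"
  shows "\<xi> t \<in> carrier L" "p (\<xi> t) \<le> \<bar>t\<bar>" "\<xi> (s + t) = \<xi> s \<otimes> \<xi> t" "\<xi> 0 = \<one>"
proof -
  show 1: "\<xi> t \<in> carrier L" "p (\<xi> t) \<le> \<bar>t\<bar>" "\<xi> (s + t) = \<xi> s \<otimes> \<xi> t" using assms by (auto simp: ops_def)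
  have "\<xi> 0 \<in> carrier L" "p (\<xi> 0) \<le> 0" using assms unfolding ops_def by (auto dest: spec[of _ 0])
  then show "\<xi> 0 = \<one>" using p_zero[of "\<xi> 0"] p_nonneg[of "\<xi> 0"] by simp
qed

lemma ops_pow: "\<xi> \<in> ops \<Longrightarrow> \<xi> (real n * t) = \<xi> t [^] (n::nat)"
proof (induction n)
  case (Suc n)
  have "real (Suc n) * t = real n * t + t" by (simp add: algebra_simps)
  then show ?case using Suc opsD(3)[OF Suc.prems, of "real n * t" t] by simp
qed (simp add: opsD(4))

lemma ops_cont:
  assumes \<xi>: "\<xi> \<in> ops" shows "continuous_map euclideanreal T \<xi>"
proof -
  have "open {t. \<xi> t \<in> W}" if W: "openin T W" for W
  proof (subst open_dist, intro ballI)
    fix t assume "t \<in> {t. \<xi> t \<in> W}"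
    then have t: "\<xi> t \<in> W" by simp
    let ?V = "{z \<in> carrier L. \<xi> t \<otimes> z \<in> W}"
    have "nbh ?V" using openin_preimage[OF continuous_map_ltrans[OF opsD(1)[OF \<xi>, of t]] W] t opsD(1)[OF \<xi>] by (simp add: nbh_def)
    then obtain d where d: "d > 0" "\<And>x. x \<in> carrier L \<Longrightarrow> p x < d \<Longrightarrow> x \<in> ?V" using p_small by blast
    have "s \<in> {t. \<xi> t \<in> W}" if "dist s t < d" for s
    proof -
      have "p (\<xi> (s - t)) < d" using opsD(2)[OF \<xi>, of "s - t"] that by (simp add: dist_real_def)
      then have "\<xi> t \<otimes> \<xi> (s - t) \<in> W" using d(2)[OF opsD(1)[OF \<xi>]] by auto
      then show ?thesis using opsD(3)[OF \<xi>, of t "s - t"] by simp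
    qed
    then show "\<exists>e>0. \<forall>s. dist s t < e \<longrightarrow> s \<in> {t. \<xi> t \<in> W}" using d(1) by blast
  qed
  then show ?thesis using opsD(1)[OF \<xi>] by (auto simp: continuous_map_def)
qed

text \<open>A power of length k p(x) \<le> K c/2 is cut into \<open>K\<close> pieces of length below
  \<open>c\<close>, each in \<open>U\<close>, so it lies in a \<open>K\<close>-fold product of
  \<open>U\<close>. Requiring p(x) < c/2 allows for rounding the cutting points to integers.\<close>

lemma power_in_compact:
  "\<exists>D. compactin T D \<and> (\<forall>x\<in>carrier L. \<forall>k::nat. 0 < p x \<longrightarrow> p x < c / 2 \<longrightarrow> real k * p x \<le> real K * (c / 2) \<longrightarrow> x [^] k \<in> D)"
proof (induction K)
  case 0
  have "x [^] k \<in> {\<one>}" if "x \<in> carrier L" "0 < p x" "real k * p x \<le> real 0 * (c / 2)" for x and k :: nat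
  proof -
    have "k = 0" using that by (simp add: mult_le_0_iff)
    then show ?thesis by simp
  qed
  then show ?case by (intro exI[of _ "{\<one>}"]) (auto simp: compactin_sing)
next
  case (Suc K)
  then obtain D where D: "compactin T D" "\<And>x k::nat. x \<in> carrier L \<Longrightarrow> 0 < p x \<Longrightarrow> p x < c / 2 \<Longrightarrow> real k * p x \<le> real K * (c / 2) \<Longrightarrow> x [^] k \<in> D"
    by blast
  show ?case
  proof (intro exI[of _ "D <#> U"] conjI ballI allI impI compactin_mult D U)
    fix x and k :: nat assume x: "x \<in> carrier L" and px: "0 < p x" "p x < c / 2" and k: "real k * p x \<le> real (Suc K) * (c / 2)"
    define b where "b = nat \<lfloor>real K * (c / 2) / p x\<rfloor>"
    have q0: "0 \<le> real K * (c / 2) / p x" using c px by simp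
    have b1: "real b \<le> real K * (c / 2) / p x" unfolding b_def using q0 by (simp add: of_nat_floor)
    have b2: "real K * (c / 2) / p x < real b + 1" unfolding b_def using q0 by linarith
    define k1 where "k1 = min k b"
    have "real k1 \<le> real K * (c / 2) / p x" using b1 by (simp add: k1_def)
    then have "real k1 * p x \<le> real K * (c / 2)" using px by (simp add: field_simps)
    then have in1: "x [^] k1 \<in> D" using D(2)[OF x px] by blast
    have "real (k - k1) * p x < c"
    proof (cases "k \<le> b")
      case True
      then show ?thesis using c by (simp add: k1_def)
    next
      case False
      then have "real (k - k1) * p x = real k * p x - real b * p x" by (simp add: k1_def left_diff_distrib of_nat_diff)
      moreover have "real K * (c / 2) < (real b + 1) * p x" using b2 px by (simp add: field_simps)
      moreover have "real (Suc K) * (c / 2) = real K * (c / 2) + c / 2" by (simp add: algebra_simps)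
      moreover have "(real b + 1) * p x = real b * p x + p x" by (simp add: algebra_simps)
      ultimately show ?thesis using k px by linarith
    qed
    then have "p (x [^] (k - k1)) < c" using p_pow[OF x, of "k - k1"] by linarith
    then have in2: "x [^] (k - k1) \<in> U" using p_out x by simp
    have "x [^] k = x [^] k1 \<otimes> x [^] (k - k1)" using x by (simp add: nat_pow_mult k1_def)
    then show "x [^] k \<in> D <#> U" using in1 in2 unfolding set_mult_def by blast
  qed
qed

text \<open>Powers with exponents proportional to 1 / p(x) stay in compact sets and so converge
  along the ultrafilter. The limit is additive because the floors of s / p(x) and t / p(x) add up to
  that of (s + t) / p(x) with an error of 0 or 1, and \<open>x\<close> tends to
  \<open>\<one>\<close>.\<close>

lemma ops_limit:
  assumes F: "ultrafilter F" and ev: "\<And>d. d > 0 \<Longrightarrow> eventually (\<lambda>x. x \<in> carrier L \<and> 0 < p x \<and> p x < d) F"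
  obtains \<xi> where "\<xi> \<in> ops" "\<And>t. limitin T (\<lambda>x. x [^] \<lfloor>t / p x\<rfloor>) (\<xi> t) F"
proof -
  have Fb: "F \<noteq> bot" using F by (simp add: ultrafilter_def)
  have fl: "\<bar>real_of_int \<lfloor>t / q\<rfloor>\<bar> * q \<le> \<bar>t\<bar> + q" if "q > 0" for t q :: real
  proof -
    have "\<bar>real_of_int \<lfloor>t / q\<rfloor>\<bar> \<le> \<bar>t / q\<bar> + 1" by linarith
    then have "\<bar>real_of_int \<lfloor>t / q\<rfloor>\<bar> * q \<le> (\<bar>t / q\<bar> + 1) * q" using that by (intro mult_right_mono) auto
    then show ?thesis using that by (simp add: distrib_right abs_divide)
  qed
  have "\<exists>l. limitin T (\<lambda>x. x [^] \<lfloor>t / p x\<rfloor>) l F" for t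
  proof -
    obtain K :: nat where K: "(\<bar>t\<bar> + c / 2) / (c / 2) \<le> real K" using real_arch_simple by blast
    have K': "\<bar>t\<bar> + c / 2 \<le> real K * (c / 2)" using K c by (simp add: field_simps)
    obtain D where D: "compactin T D" "\<And>x k::nat. x \<in> carrier L \<Longrightarrow> 0 < p x \<Longrightarrow> p x < c / 2 \<Longrightarrow> real k * p x \<le> real K * (c / 2) \<Longrightarrow> x [^] k \<in> D"
      using power_in_compact[of K] by blast
    have D': "compactin T (D \<union> (\<lambda>x. inv x) ` D)" using D(1) by (intro compactin_Un compactin_inv)
    have "eventually (\<lambda>x. x [^] \<lfloor>t / p x\<rfloor> \<in> D \<union> (\<lambda>x. inv x) ` D) F"
      using ev[OF half_gt_zero[OF c]]
    proof eventually_elim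
      case (elim x)
      let ?k = "\<lfloor>t / p x\<rfloor>"
      have b: "\<bar>real_of_int ?k\<bar> * p x \<le> real K * (c / 2)" using fl[of "p x" t] K' elim by linarith
      show ?case
      proof (cases "?k \<ge> 0")
        case True
        then have "real (nat ?k) * p x \<le> real K * (c / 2)" using b by simp
        then have "x [^] nat ?k \<in> D" using D(2) elim by blast
        then show ?thesis using pow_nat[where i="?k" and x=x and G=L] True by simp
      next
        case False
        then have "real (nat (- ?k)) * p x \<le> real K * (c / 2)" using b by simp
        then have "x [^] nat (- ?k) \<in> D" using D(2) elim by blast
        moreover have "x [^] ?k = inv (x [^] nat (- ?k))"
        proof -
          have "0 \<le> - ?k" using False by linarith
          then show ?thesis using int_pow_neg[of x "- ?k"] pow_nat[where i="- ?k" and x=x and G=L] elim by simp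
        qed
        ultimately show ?thesis by simp
      qed
    qed
    then show ?thesis using ultrafilter_compactin_limit[OF F D'] by metis
  qed
  then obtain \<xi> where xi: "\<And>t. limitin T (\<lambda>x. x [^] \<lfloor>t / p x\<rfloor>) (\<xi> t) F" by metis
  have xc: "\<xi> t \<in> carrier L" for t using limitin_topspace[OF xi[of t]] by simp
  have hom: "\<xi> (s + t) = \<xi> s \<otimes> \<xi> t" for s t
  proof -
    define e where "e x = \<lfloor>(s + t) / p x\<rfloor> - \<lfloor>s / p x\<rfloor> - \<lfloor>t / p x\<rfloor>" for x
    have e01: "e x = 0 \<or> e x = 1" for x
      unfolding e_def add_divide_distrib by linarith
    have "limitin T (\<lambda>x. x [^] e x) \<one> F"
      unfolding limitin_def
    proof (intro conjI allI impI)
      fix V assume "openin T V \<and> \<one> \<in> V"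
      then have V: "nbh V" by (simp add: nbh_def)
      obtain d where d: "d > 0" "\<And>x. x \<in> carrier L \<Longrightarrow> p x < d \<Longrightarrow> x \<in> V" using p_small[OF V] by blast
      from ev[OF d(1)] show "eventually (\<lambda>x. x [^] e x \<in> V) F"
      proof eventually_elim
        case (elim x)
        have "x [^] (0::int) \<in> V" "x [^] (1::int) \<in> V" using d(2) elim V by (auto simp: nbh_def)
        then show ?case using e01[of x] by auto
      qed
    qed simp
    then have lim: "limitin T (\<lambda>x. x [^] \<lfloor>s / p x\<rfloor> \<otimes> x [^] \<lfloor>t / p x\<rfloor> \<otimes> x [^] e x) (\<xi> s \<otimes> \<xi> t \<otimes> \<one>) F"
      by (intro limitin_mult xi)
    have "eventually (\<lambda>x. x [^] \<lfloor>s / p x\<rfloor> \<otimes> x [^] \<lfloor>t / p x\<rfloor> \<otimes> x [^] e x = x [^] \<lfloor>(s + t) / p x\<rfloor>) F"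
      using ev[OF zero_less_one]
    proof eventually_elim
      case (elim x)
      have "x [^] \<lfloor>s / p x\<rfloor> \<otimes> x [^] \<lfloor>t / p x\<rfloor> \<otimes> x [^] e x = x [^] (\<lfloor>s / p x\<rfloor> + \<lfloor>t / p x\<rfloor> + e x)"
        using elim by (simp add: int_pow_mult)
      then show ?case by (simp add: e_def)
    qed
    from limitin_transform_eventually[OF this lim] have "limitin T (\<lambda>x. x [^] \<lfloor>(s + t) / p x\<rfloor>) (\<xi> s \<otimes> \<xi> t) F"
      using xc by simp
    then show ?thesis using limitin_Hausdorff_unique[OF xi _ _ Hausdorff_T] Fb by (simp add: trivial_limit_def)
  qed
  have "p (\<xi> t) \<le> \<bar>t\<bar>" for t
  proof (rule field_le_epsilon)
    fix d :: real assume d: "d > 0"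
    have "((\<lambda>x. p (x [^] \<lfloor>t / p x\<rfloor>)) \<longlongrightarrow> p (\<xi> t)) F"
      using continuous_map_limit[OF p_cont xi[of t]] by (simp add: o_def)
    moreover have "eventually (\<lambda>x. p (x [^] \<lfloor>t / p x\<rfloor>) \<le> \<bar>t\<bar> + d) F"
      using ev[OF d]
    proof eventually_elim
      case (elim x)
      show ?case using p_int_pow[of x "\<lfloor>t / p x\<rfloor>"] fl[of "p x" t] elim by linarith
    qed
    ultimately show "p (\<xi> t) \<le> \<bar>t\<bar> + d" using tendsto_upperbound Fb by blast
  qed
  then have "\<xi> \<in> ops" using hom xc by (simp add: ops_def)
  then show ?thesis using that xi by blast
qed

text \<open>Finitely many directions approximate every small element up to a quarter of its length;
  this plays the part of a finite-dimensional Lie algebra. If no finite set sufficed, the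
  counterexamples would have a limit \<open>\<xi>\<close> along an ultrafilter, and a finite set
  that contains \<open>\<xi>\<close> would serve them.\<close>

lemma ops_net:
  obtains Xs d where "finite Xs" "Xs \<subseteq> ops" "d > 0"
    "\<And>x. x \<in> carrier L \<Longrightarrow> p x < d \<Longrightarrow> \<exists>\<xi>\<in>Xs. \<exists>a. \<bar>a\<bar> \<le> 2 * p x \<and> p (inv (\<xi> a) \<otimes> x) \<le> p x / 4"
proof -
  define bad where "bad Xs d = {x \<in> carrier L. p x < d \<and> (\<forall>\<xi>\<in>Xs. \<forall>a. \<bar>a\<bar> \<le> 2 * p x \<longrightarrow> \<not> p (inv (\<xi> a) \<otimes> x) \<le> p x / 4)}" for Xs d
  \<comment> \<open>The constant subgroup, tried with a = 0, excludes p x = 0 among the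
    counterexamples, so that rescaling by 1 / p x makes sense.\<close>
  define triv :: "real \<Rightarrow> 'a" where "triv = (\<lambda>t. \<one>)"
  have tr: "triv \<in> ops" by (simp add: ops_def triv_def p_one)
  define J where "J = {(Xs, d). finite Xs \<and> Xs \<subseteq> ops \<and> triv \<in> Xs \<and> 0 < (d::real)}"
  have "\<exists>Xs d. (Xs, d) \<in> J \<and> bad Xs d = {}"
  proof (rule ccontr)
    assume neg: "\<not> ?thesis"
    obtain F where F: "ultrafilter F" and FB: "\<And>Xs d. (Xs, d) \<in> J \<Longrightarrow> eventually (\<lambda>x. x \<in> bad Xs d) F"
    proof (rule ultrafilter_base[of "(\<lambda>(Xs, d). bad Xs d) ` J"])
      have "({triv}, 1) \<in> J" using tr by (simp add: J_def)
      then show "(\<lambda>(Xs, d). bad Xs d) ` J \<noteq> {}" by blast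
      show "A \<noteq> {}" if "A \<in> (\<lambda>(Xs, d). bad Xs d) ` J" for A using that neg by auto
      show "\<exists>D\<in>(\<lambda>(Xs, d). bad Xs d) ` J. D \<subseteq> A \<inter> B" if AB: "A \<in> (\<lambda>(Xs, d). bad Xs d) ` J" "B \<in> (\<lambda>(Xs, d). bad Xs d) ` J" for A B
      proof -
        obtain Xs d Ys e where 1: "(Xs, d) \<in> J" "A = bad Xs d" "(Ys, e) \<in> J" "B = bad Ys e" using AB by auto
        have "(Xs \<union> Ys, min d e) \<in> J" using 1 by (auto simp: J_def)
        moreover have "bad (Xs \<union> Ys) (min d e) \<subseteq> A \<inter> B" using 1 by (auto simp: bad_def)
        ultimately show ?thesis by (intro bexI[of _ "bad (Xs \<union> Ys) (min d e)"]) (auto intro!: image_eqI[of _ _ "(Xs \<union> Ys, min d e)"])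
      qed
    qed force
    have Fb: "F \<noteq> bot" using F by (simp add: ultrafilter_def)
    have ev: "eventually (\<lambda>x. x \<in> carrier L \<and> 0 < p x \<and> p x < d) F" if d: "d > 0" for d
    proof -
      have "({triv}, d) \<in> J" using tr d by (simp add: J_def)
      from FB[OF this] show ?thesis
      proof eventually_elim
        case (elim x)
        then have x: "x \<in> carrier L" "p x < d" and b: "\<And>a. \<bar>a\<bar> \<le> 2 * p x \<Longrightarrow> \<not> p (inv (triv a) \<otimes> x) \<le> p x / 4" by (auto simp: bad_def)
        have "\<not> p x \<le> p x / 4" using b[of 0] x p_nonneg[OF x(1)] by (simp add: triv_def)
        then show ?case using x by simp
      qed
    qed
    obtain \<xi> where xi: "\<xi> \<in> ops" "\<And>t. limitin T (\<lambda>x. x [^] \<lfloor>t / p x\<rfloor>) (\<xi> t) F" using ops_limit[OF F ev] by blast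
    \<comment> \<open>The linear approximation is used up to length \<open>\<tau>\<close>: the
      quadratic errors of x^k and y^k give 2 M \<tau>^2 \<le> \<tau>/16, the limit contributes
      another \<tau>/16, and the total \<tau>/8 becomes at most p(x)/4 after division by k \<ge>
      \<tau> / (2 p(x)).\<close>
    define \<tau> where "\<tau> = min (c / 2) (1 / (32 * M))"
    have tau: "0 < \<tau>" "\<tau> < c" "4 * M * \<tau> \<le> 1 / 8"
    proof -
      show "0 < \<tau>" "\<tau> < c" unfolding \<tau>_def using c M by auto
      have "4 * M * \<tau> \<le> 4 * M * (1 / (32 * M))" unfolding \<tau>_def using M by (intro mult_left_mono) auto
      then show "4 * M * \<tau> \<le> 1 / 8" using M by simp
    qed
    have "limitin T (\<lambda>x. inv (\<xi> \<tau>) \<otimes> x [^] \<lfloor>\<tau> / p x\<rfloor>) (inv (\<xi> \<tau>) \<otimes> \<xi> \<tau>) F"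
      using xi(2)[of \<tau>] opsD(1)[OF xi(1)] by (intro limitin_mult) (auto simp: limitin_const_iff)
    then have "((\<lambda>x. p (inv (\<xi> \<tau>) \<otimes> x [^] \<lfloor>\<tau> / p x\<rfloor>)) \<longlongrightarrow> 0) F"
      using continuous_map_limit[OF p_cont, of _ "inv (\<xi> \<tau>) \<otimes> \<xi> \<tau>" F] opsD(1)[OF xi(1)] by (simp add: o_def p_one)
    then have ev1: "eventually (\<lambda>x. p (inv (\<xi> \<tau>) \<otimes> x [^] \<lfloor>\<tau> / p x\<rfloor>) < \<tau> / 16) F"
      using order_tendstoD(2)[of _ 0 F "\<tau> / 16"] tau by simp
    have t2: "0 < \<tau> / 2" using tau by simp
    have "({triv, \<xi>}, 1) \<in> J" using tr xi by (simp add: J_def)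
    from FB[OF this] ev1 ev[OF t2] have "eventually (\<lambda>x. False) F"
    proof eventually_elim
      case (elim x)
      have x: "x \<in> carrier L" "0 < p x" "p x < \<tau> / 2" using elim by auto
      define k where "k = nat \<lfloor>\<tau> / p x\<rfloor>"
      have q: "2 < \<tau> / p x" using x by (simp add: field_simps)
      have k1: "real k \<le> \<tau> / p x" unfolding k_def using q by (simp add: of_nat_floor)
      have "real k = real_of_int \<lfloor>\<tau> / p x\<rfloor>" unfolding k_def using q by simp
      moreover have "u / 2 \<le> real_of_int \<lfloor>u\<rfloor>" if "2 < u" for u :: real using that by linarith
      ultimately have k2: "\<tau> / p x / 2 \<le> real k" using q by metis
      have kpos: "0 < real k" by (rule less_le_trans[OF _ k2]) (use tau x in simp)
      have kp: "real k * p x \<le> \<tau>" using k1 x by (simp add: field_simps)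
      \<comment> \<open>The time step for which the k-th power of \<open>\<xi> a\<close> is exactly
        \<open>\<xi> \<tau>\<close>.\<close>
      define a where "a = \<tau> / real k"
      have a: "0 < a" "a \<le> 2 * p x" "real k * a = \<tau>"
      proof -
        show "0 < a" "real k * a = \<tau>" using kpos tau by (auto simp: a_def)
        have "\<tau> \<le> 2 * p x * real k" using k2 x by (simp add: field_simps)
        then show "a \<le> 2 * p x" using kpos by (simp add: a_def field_simps)
      qed
      define y where "y = \<xi> a"
      have y: "y \<in> carrier L" "p y \<le> a" using opsD(1,2)[OF xi(1), of a] a by (auto simp: y_def)
      have yk: "y [^] k = \<xi> \<tau>" using ops_pow[OF xi(1), of k a] a by (simp add: y_def)
      have kpy: "real k * p y \<le> \<tau>" using mult_left_mono[OF y(2), of "real k"] a by simp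
      have xk: "x [^] k = x [^] \<lfloor>\<tau> / p x\<rfloor>" unfolding k_def using pow_nat[where i="\<lfloor>\<tau> / p x\<rfloor>" and x=x and G=L] q by simp
      have near: "p (inv (\<xi> \<tau>) \<otimes> x [^] k) \<le> \<tau> / 16" unfolding xk using elim by simp
      have "p (inv y \<otimes> x) \<le> p x / 4"
      proof (rule dist_le[OF x(1) y(1)])
        fix z assume z: "z \<in> carrier L"
        have sq: "M * (real k * w)\<^sup>2 \<le> M * \<tau>\<^sup>2" if "0 \<le> w" "real k * w \<le> \<tau>" for w
          using that M by (intro mult_left_mono power_mono) auto
        have A: "\<bar>f (inv (x [^] k) \<otimes> z) - f z - real k * (f (inv x \<otimes> z) - f z)\<bar> \<le> M * \<tau>\<^sup>2"
          using p_power_linear[OF x(1) _ z, of k] kp tau sq[of "p x"] x by linarith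
        have B: "\<bar>f (inv (y [^] k) \<otimes> z) - f z - real k * (f (inv y \<otimes> z) - f z)\<bar> \<le> M * \<tau>\<^sup>2"
          using p_power_linear[OF y(1) _ z, of k] kpy tau sq[of "p y"] p_nonneg[OF y(1)] by linarith
        have C: "\<bar>f (inv (x [^] k) \<otimes> z) - f (inv (y [^] k) \<otimes> z)\<bar> \<le> \<tau> / 16"
          using order_trans[OF dist_ge[OF nat_pow_closed[OF x(1)] opsD(1)[OF xi(1)] z] near] by (simp only: yk)
        have gen: "\<bar>u - v\<bar> \<le> 2 * e1 + e2" if "\<bar>P - F - u\<bar> \<le> e1" "\<bar>Q - F - v\<bar> \<le> e1" "\<bar>P - Q\<bar> \<le> e2" for P Q F u v e1 e2 :: real
          using that by linarith
        have "\<bar>real k * (f (inv x \<otimes> z) - f z) - real k * (f (inv y \<otimes> z) - f z)\<bar> \<le> 2 * (M * \<tau>\<^sup>2) + \<tau> / 16"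
          by (rule gen[OF A B C])
        also have "real k * (f (inv x \<otimes> z) - f z) - real k * (f (inv y \<otimes> z) - f z) = real k * (f (inv x \<otimes> z) - f (inv y \<otimes> z))"
          by (simp add: algebra_simps)
        finally have D: "real k * \<bar>f (inv x \<otimes> z) - f (inv y \<otimes> z)\<bar> \<le> \<tau> * (2 * M * \<tau> + 1 / 16)"
        proof -
          assume "\<bar>real k * (f (inv x \<otimes> z) - f (inv y \<otimes> z))\<bar> \<le> 2 * (M * \<tau>\<^sup>2) + \<tau> / 16"
          moreover have "\<bar>real k * (f (inv x \<otimes> z) - f (inv y \<otimes> z))\<bar> = real k * \<bar>f (inv x \<otimes> z) - f (inv y \<otimes> z)\<bar>"
            by (simp add: abs_mult)
          moreover have "2 * (M * \<tau>\<^sup>2) + \<tau> / 16 = \<tau> * (2 * M * \<tau> + 1 / 16)" by (simp add: power2_eq_square algebra_simps)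
          ultimately show ?thesis by simp
        qed
        have "\<tau> * (2 * M * \<tau> + 1 / 16) \<le> \<tau> * (1 / 8)" using tau by (intro mult_left_mono) auto
        also have "\<dots> = (\<tau> / p x / 2) * (p x / 4)" using x by simp
        also have "\<dots> \<le> real k * (p x / 4)" using k2 x by (intro mult_right_mono) auto
        finally have "real k * \<bar>f (inv x \<otimes> z) - f (inv y \<otimes> z)\<bar> \<le> real k * (p x / 4)" using D by linarith
        then show "\<bar>f (inv x \<otimes> z) - f (inv y \<otimes> z)\<bar> \<le> p x / 4" using kpos by simp
      qed
      moreover have "\<bar>a\<bar> \<le> 2 * p x" using a by simp
      ultimately show False using elim(1) unfolding bad_def y_def by blast
    qed
    then show False using Fb by (simp add: eventually_False)
  qed
  then obtain Xs d where "(Xs, d) \<in> J" "bad Xs d = {}" by blast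
  then show ?thesis by (intro that[of Xs d]) (auto simp: J_def bad_def)
qed

section \<open>Products of one-parameter subgroups\<close>

primrec sp :: "(nat \<Rightarrow> real \<Rightarrow> 'a) \<Rightarrow> nat \<Rightarrow> (nat \<Rightarrow> real) \<Rightarrow> 'a" where
  "sp \<zeta> 0 t = \<one>"
| "sp \<zeta> (Suc j) t = sp \<zeta> j t \<otimes> \<zeta> j (t j)"

lemma sp_closed: "(\<And>j. j < m \<Longrightarrow> \<zeta> j \<in> ops) \<Longrightarrow> sp \<zeta> m t \<in> carrier L"
  by (induction m) (auto intro: opsD(1))

lemma sp_cong: "(\<And>j. j < m \<Longrightarrow> t j = t' j) \<Longrightarrow> sp \<zeta> m t = sp \<zeta> m t'"
  by (induction m) auto

text \<open>Isolates the factor that is going to be changed. The bound on \<open>B\<close>, the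
  product of the factors to its right, controls the commutator by which a new factor moves past
  them.\<close>

lemma sp_split:
  assumes "\<And>j. j < m \<Longrightarrow> \<zeta> j \<in> ops" "j < m"
  shows "\<exists>A B. A \<in> carrier L \<and> B \<in> carrier L \<and> p B \<le> (\<Sum>i<m. \<bar>t i\<bar>) \<and> (\<forall>a. sp \<zeta> m (t(j := a)) = A \<otimes> \<zeta> j a \<otimes> B)"
  using assms
proof (induction m)
  case (Suc m)
  show ?case
  proof (cases "j = m")
    case True
    have "sp \<zeta> (Suc m) (t(j := a)) = sp \<zeta> m t \<otimes> \<zeta> j a \<otimes> \<one>" for a
      using sp_cong[of m "t(j := a)" t \<zeta>] sp_closed[of m \<zeta> t] opsD(1)[of "\<zeta> j" a] Suc.prems True by simp
    moreover have "p \<one> \<le> (\<Sum>i<Suc m. \<bar>t i\<bar>)" by (simp only: p_one) (rule sum_nonneg, simp)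
    moreover have "sp \<zeta> m t \<in> carrier L" using sp_closed[of m \<zeta> t] Suc.prems by simp
    ultimately show ?thesis using one_closed by blast
  next
    case False
    then obtain A B where AB: "A \<in> carrier L" "B \<in> carrier L" "p B \<le> (\<Sum>i<m. \<bar>t i\<bar>)" "\<And>a. sp \<zeta> m (t(j := a)) = A \<otimes> \<zeta> j a \<otimes> B"
      using Suc.IH Suc.prems by (metis less_Suc_eq)
    have c: "\<zeta> m (t m) \<in> carrier L" "p (\<zeta> m (t m)) \<le> \<bar>t m\<bar>" using opsD(1,2)[of "\<zeta> m" "t m"] Suc.prems by auto
    have "p (B \<otimes> \<zeta> m (t m)) \<le> (\<Sum>i<Suc m. \<bar>t i\<bar>)" using p_mult[OF AB(2) c(1)] AB(3) c(2) by simp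
    moreover have "sp \<zeta> (Suc m) (t(j := a)) = A \<otimes> \<zeta> j a \<otimes> (B \<otimes> \<zeta> m (t m))" for a
      using AB c False opsD(1)[of "\<zeta> j" a] Suc.prems by (simp add: m_assoc)
    ultimately show ?thesis using AB(1) m_closed[OF AB(2) c(1)] by blast
  qed
qed simp

lemma sp_cont:
  assumes "\<And>j. j < m \<Longrightarrow> \<zeta> j \<in> ops" "m \<le> m'"
  shows "continuous_map (product_topology (\<lambda>_. euclideanreal) {..<m'}) T (sp \<zeta> m)"
  using assms
proof (induction m)
  case 0
  then show ?case by simp
next
  case (Suc m)
  have pr: "continuous_map (product_topology (\<lambda>_. euclideanreal) {..<m'}) euclideanreal (\<lambda>t. t m)"
    using Suc.prems by (intro continuous_map_product_projection) auto
  have "continuous_map (product_topology (\<lambda>_. euclideanreal) {..<m'}) T (\<lambda>t. \<zeta> m (t m))"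
    using continuous_map_compose[OF pr ops_cont[of "\<zeta> m"]] Suc.prems by (simp add: o_def)
  moreover have "continuous_map (product_topology (\<lambda>_. euclideanreal) {..<m'}) T (\<lambda>t. sp \<zeta> m t)" using Suc by auto
  ultimately have "continuous_map (product_topology (\<lambda>_. euclideanreal) {..<m'}) T (\<lambda>t. sp \<zeta> m t \<otimes> \<zeta> m (t m))"
    by (intro continuous_map_mult)
  moreover have "sp \<zeta> (Suc m) = (\<lambda>t. sp \<zeta> m t \<otimes> \<zeta> m (t m))" by (rule ext) simp
  ultimately show ?case by simp
qed

text \<open>For a small \<open>x\<close>, a product of one-parameter elements that is closest to
  \<open>x\<close> in a penalised sense equals \<open>x\<close>, since otherwise
  \<open>ops_net\<close> supplies a factor that improves it. Minimising over a compact box takes the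
  place of an infinite iteration.\<close>

theorem ops_generate_nbh:
  assumes N: "subgroup N L" and opN: "\<And>\<xi> t. \<xi> \<in> ops \<Longrightarrow> \<xi> t \<in> N"
  obtains V where "nbh V" "V \<subseteq> N"
proof -
  obtain Xs d where Xs: "finite Xs" "Xs \<subseteq> ops" "d > 0"
    and net: "\<And>x. x \<in> carrier L \<Longrightarrow> p x < d \<Longrightarrow> \<exists>\<xi>\<in>Xs. \<exists>a. \<bar>a\<bar> \<le> 2 * p x \<and> p (inv (\<xi> a) \<otimes> x) \<le> p x / 4"
    using ops_net by blast
  obtain xs where xs: "set xs = Xs" using finite_list[OF Xs(1)] by blast
  define m where "m = length xs"
  define \<zeta> where "\<zeta> = (\<lambda>j. xs ! j)"
  have chi: "\<zeta> j \<in> ops" if "j < m" for j using that xs Xs(2) by (auto simp: \<zeta>_def m_def)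
  have chiX: "\<exists>j<m. \<xi> = \<zeta> j" if "\<xi> \<in> Xs" for \<xi> using that xs by (auto simp: \<zeta>_def m_def in_set_conv_nth)
  have spN: "sp \<zeta> k t \<in> N" if "k \<le> m" for k t
    using that
  proof (induction k)
    case (Suc k)
    then show ?case using subgroup.m_closed[OF N] opN[OF chi[of k]] by simp
  qed (simp add: subgroup.one_closed[OF N])
  \<comment> \<open>\<open>r \<le> d\<close> makes \<open>ops_net\<close> applicable,
    \<open>8 * r \<le> c\<close> keeps the elements involved in \<open>U\<close>, and
    \<open>16 * M * r \<le> 1 / 8\<close> bounds the commutator cost 2 M (4 r) (2 p y) by
    p(y)/8.\<close>
  define r where "r = min d (min (c / 8) (1 / (128 * M)))"
  have r: "r > 0" "r \<le> d" "8 * r \<le> c" "16 * M * r \<le> 1 / 8"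
  proof -
    show "r > 0" "r \<le> d" "8 * r \<le> c" unfolding r_def using Xs c M by auto
    have "16 * M * r \<le> 16 * M * (1 / (128 * M))" unfolding r_def using M by (intro mult_left_mono) auto
    then show "16 * M * r \<le> 1 / 8" using M by simp
  qed
  have "x \<in> N" if x: "x \<in> carrier L" "p x < r" for x
  proof -
    let ?P = "product_topology (\<lambda>_. euclideanreal) {..<m}"
    let ?B = "PiE {..<m} (\<lambda>_. {- (8 * r)..8 * r})"
    \<comment> \<open>The penalty forces the sum \<open>S\<close> of parameters below 4 r at the
      minimum, so that a changed parameter stays in the box and commutators are cheap. Its weight is
      small enough: a new factor \<open>\<xi> a\<close> raises it by at most \<bar>a\<bar>/4 \<le>
      p(y)/2, while the distance drops from p(y) to at most p(y)/4 + p(y)/8; the sum 7/8 p(y) is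
      still an improvement.\<close>
    define \<Phi> where "\<Phi> t = p (inv (sp \<zeta> m t) \<otimes> x) + (\<Sum>j<m. \<bar>t j\<bar>) / 4" for t
    have "continuous_map ?P euclideanreal (\<lambda>t. p (inv (sp \<zeta> m t) \<otimes> x))"
      using sp_cont[of m \<zeta> m] chi x
      by (intro continuous_map_compose_grp[OF p_cont] continuous_map_mult continuous_map_inverse) auto
    moreover have "continuous_map ?P euclideanreal (\<lambda>t. (\<Sum>j<m. \<bar>t j\<bar>))"
      by (intro continuous_map_sum continuous_map_real_abs continuous_map_product_projection) auto
    ultimately have cont: "continuous_map ?P euclideanreal \<Phi>"
      unfolding \<Phi>_def by (intro continuous_map_add continuous_map_real_divide) auto
    have "compactin ?P ?B" by (simp add: compactin_PiE)
    then have comp: "compact (\<Phi> ` ?B)" using image_compactin[OF _ cont] by simp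
    define t0 :: "nat \<Rightarrow> real" where "t0 = (\<lambda>j\<in>{..<m}. 0)"
    have t0: "t0 \<in> ?B" using r by (auto simp: t0_def)
    obtain v where v: "v \<in> \<Phi> ` ?B" "\<And>y. y \<in> \<Phi> ` ?B \<Longrightarrow> v \<le> y" using compact_attains_inf[OF comp] t0 by blast
    then obtain t where t: "t \<in> ?B" "\<And>t'. t' \<in> ?B \<Longrightarrow> \<Phi> t \<le> \<Phi> t'" by blast
    have s0: "sp \<zeta> m t0 = \<one>"
    proof -
      have "sp \<zeta> k t0 = \<one>" if "k \<le> m" for k
        using that by (induction k) (auto simp: t0_def opsD(4)[OF chi])
      then show ?thesis by simp
    qed
    have P0: "\<Phi> t0 = p x" using x by (simp add: \<Phi>_def s0) (simp add: t0_def)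
    define s where "s = sp \<zeta> m t"
    have sc: "s \<in> carrier L" unfolding s_def by (rule sp_closed[OF chi])
    define y where "y = inv s \<otimes> x"
    have yc: "y \<in> carrier L" using sc x by (simp add: y_def)
    define S where "S = (\<Sum>j<m. \<bar>t j\<bar>)"
    have S0: "0 \<le> S" unfolding S_def by (rule sum_nonneg) simp
    have Pt: "\<Phi> t = p y + S / 4" by (simp add: \<Phi>_def y_def s_def S_def)
    have le: "p y + S / 4 \<le> p x" using t(2)[OF t0] P0 Pt by simp
    have py: "0 \<le> p y" by (rule p_nonneg[OF yc])
    have b: "p y < r" "S < 4 * r" using le S0 py x by linarith+
    have "p y = 0"
    proof (rule ccontr)
      assume "p y \<noteq> 0"
      then have ppos: "0 < p y" using py by simp
      obtain \<xi> a where xi: "\<xi> \<in> Xs" "\<bar>a\<bar> \<le> 2 * p y" "p (inv (\<xi> a) \<otimes> y) \<le> p y / 4"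
        using net[OF yc] b r by fastforce
      obtain j where j: "j < m" "\<xi> = \<zeta> j" using chiX[OF xi(1)] by blast
      have xo: "\<xi> \<in> ops" using chi j by simp
      obtain A B where AB: "A \<in> carrier L" "B \<in> carrier L" "p B \<le> S" "\<And>a. sp \<zeta> m (t(j := a)) = A \<otimes> \<xi> a \<otimes> B"
        using sp_split[of m \<zeta> j t] chi j unfolding S_def by blast
      define t' where "t' = t(j := t j + a)"
      have tj: "\<bar>t j\<bar> \<le> S" unfolding S_def using j by (intro member_le_sum) auto
      have "t' \<in> ?B"
      proof -
        have "\<bar>t j + a\<bar> \<le> 8 * r" using tj b xi(2) by linarith
        then show ?thesis using t(1) j by (auto simp: t'_def PiE_iff extensional_def abs_le_iff)
      qed
      then have min: "\<Phi> t \<le> \<Phi> t'" by (rule t(2))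
      have S': "(\<Sum>i<m. \<bar>t' i\<bar>) \<le> S + \<bar>a\<bar>"
      proof -
        have "(\<Sum>i<m. \<bar>t' i\<bar>) \<le> (\<Sum>i<m. \<bar>t i\<bar> + (if i = j then \<bar>a\<bar> else 0))"
          by (intro sum_mono) (auto simp: t'_def)
        also have "\<dots> = S + \<bar>a\<bar>" using j by (simp add: sum.distrib S_def)
        finally show ?thesis .
      qed
      have xa: "\<xi> a \<in> carrier L" "\<xi> (t j) \<in> carrier L" "p (\<xi> a) \<le> \<bar>a\<bar>" using opsD(1,2)[OF xo] by auto
      have s: "s = A \<otimes> \<xi> (t j) \<otimes> B" unfolding s_def using AB(4)[of "t j"] by simp
      define E where "E = A \<otimes> \<xi> (t j)"
      have Ec: "E \<in> carrier L" using AB xa by (simp add: E_def)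
      have s': "sp \<zeta> m t' = E \<otimes> (\<xi> a \<otimes> B)"
        unfolding t'_def AB(4) opsD(3)[OF xo] E_def using AB xa by (simp add: m_assoc)
      have sE: "s = E \<otimes> B" using s by (simp add: E_def)
      \<comment> \<open>The new factor enters to the left of \<open>B\<close>, although the
        approximation of \<open>y\<close> would want it at the right end; the discrepancy is a
        commutator of \<open>\<xi> a\<close> with \<open>B\<close>.\<close>
      have "inv (sp \<zeta> m t') \<otimes> x = (inv (\<xi> a \<otimes> B) \<otimes> (B \<otimes> \<xi> a)) \<otimes> (inv (\<xi> a) \<otimes> y)"
      proof -
        have "B \<otimes> \<xi> a \<otimes> (inv (\<xi> a) \<otimes> y) = B \<otimes> y" using AB xa yc inv_solve_left' by (simp add: m_assoc) (metis inv_closed l_one m_assoc r_inv)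
        also have "\<dots> = inv E \<otimes> x"
          unfolding y_def sE using AB Ec x by (simp add: inv_mult_group m_assoc) (metis inv_closed l_one m_assoc m_closed r_inv)
        finally have 1: "B \<otimes> \<xi> a \<otimes> (inv (\<xi> a) \<otimes> y) = inv E \<otimes> x" .
        have "(inv (\<xi> a \<otimes> B) \<otimes> (B \<otimes> \<xi> a)) \<otimes> (inv (\<xi> a) \<otimes> y) = inv (\<xi> a \<otimes> B) \<otimes> (B \<otimes> \<xi> a \<otimes> (inv (\<xi> a) \<otimes> y))"
          using AB xa yc by (simp add: m_assoc)
        also have "\<dots> = inv (\<xi> a \<otimes> B) \<otimes> (inv E \<otimes> x)" by (simp only: 1)
        also have "\<dots> = inv (E \<otimes> (\<xi> a \<otimes> B)) \<otimes> x" using AB xa Ec x by (simp add: inv_mult_group m_assoc)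
        finally show ?thesis by (simp add: s')
      qed
      then have "p (inv (sp \<zeta> m t') \<otimes> x) \<le> p (inv (\<xi> a \<otimes> B) \<otimes> (B \<otimes> \<xi> a)) + p (inv (\<xi> a) \<otimes> y)"
        using p_mult[of "inv (\<xi> a \<otimes> B) \<otimes> (B \<otimes> \<xi> a)" "inv (\<xi> a) \<otimes> y"] AB xa yc by simp
      also have "p (inv (\<xi> a \<otimes> B) \<otimes> (B \<otimes> \<xi> a)) \<le> 2 * M * p B * p (\<xi> a)"
      proof (rule p_commutator)
        show "B \<in> U" using AB b r by (intro p_out) auto
        show "\<xi> a \<in> U" using xa xi(2) b r by (intro p_out) linarith+
      qed
      also have "2 * M * p B * p (\<xi> a) \<le> 2 * M * (4 * r) * (2 * p y)"
        using M AB(2,3) b xa xi(2) p_nonneg[OF AB(2)] p_nonneg[OF xa(1)] by (intro mult_mono) auto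
      also have "2 * M * (4 * r) * (2 * p y) = (16 * M * r) * p y" by simp
      also have "\<dots> \<le> (1 / 8) * p y" using r(4) py by (rule mult_right_mono)
      finally have "p (inv (sp \<zeta> m t') \<otimes> x) \<le> (1 / 8) * p y + p (inv (\<xi> a) \<otimes> y)" by simp
      then have "\<Phi> t' \<le> (1 / 8) * p y + p y / 4 + (S + \<bar>a\<bar>) / 4"
      proof -
        have gen: "P + Q / 4 \<le> (1 / 8) * w + w / 4 + (S + b) / 4" if "P \<le> (1 / 8) * w + v" "v \<le> w / 4" "Q \<le> S + b" for P Q w v b :: real
          using that by (simp add: field_simps)
        assume "p (inv (sp \<zeta> m t') \<otimes> x) \<le> (1 / 8) * p y + p (inv (\<xi> a) \<otimes> y)"
        from gen[OF this xi(3) S'] show ?thesis unfolding \<Phi>_def .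
      qed
      then have "\<Phi> t' \<le> (1 / 8) * p y + p y / 4 + S / 4 + \<bar>a\<bar> / 4" by (simp only: add_divide_distrib add.assoc)
      then show False using min Pt xi(2) ppos by linarith
    qed
    then have "y = \<one>" by (rule p_zero[OF yc])
    then have "x = s" using sc x unfolding y_def by (metis inv_closed inv_inv inv_equality r_one inv_solve_left l_one)
    then show ?thesis using spN[of m t] by (simp add: s_def)
  qed
  moreover obtain V where "nbh V" "\<And>z. z \<in> V \<Longrightarrow> p z < r" using p_near[OF r(1)] by blast
  ultimately show ?thesis using that[of V] nbh_carrier[of V] by blast
qed

end

section \<open>Groups without small subgroups\<close>

context lcgrp begin

lemma powers_in_imp_one:
  assumes U: "symm U" and nss: "\<And>P. subgroup P L \<Longrightarrow> P \<subseteq> U \<Longrightarrow> P \<subseteq> {\<one>}"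
    and x: "x \<in> carrier L" "\<And>j::nat. x [^] j \<in> U"
  shows "x = \<one>"
proof -
  have "generate L {x} \<subseteq> U"
  proof
    fix y assume "y \<in> generate L {x}"
    then obtain k :: int where k: "y = x [^] k" using generate_pow[OF x(1)] by auto
    show "y \<in> U"
    proof (cases "k \<ge> 0")
      case True
      then show ?thesis using pow_nat[where i=k and x=x and G=L] x(2)[of "nat k"] k by simp
    next
      case False
      then have "0 \<le> - k" by simp
      then have "y = inv (x [^] nat (- k))" using int_pow_neg[OF x(1), of "-k"] pow_nat[where i="-k" and x=x and G=L] k by simp
      then show ?thesis using x(2)[of "nat (- k)"] U by (auto simp: symm_def)
    qed
  qed
  moreover have "subgroup (generate L {x}) L" using x(1) by (intro generate_is_subgroup) auto
  ultimately have "generate L {x} \<subseteq> {\<one>}" using nss by blast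
  then show ?thesis using generate.incl[of x "{x}" L] by auto
qed

text \<open>Otherwise, for every \<open>C\<close>, some y = x^j lies outside \<open>V\<close>
  although its powers up to y^C stay in \<open>U\<close>. A limit of such y has all its powers in
  \<open>U\<close>, so it is \<open>\<one>\<close>, and then the y would enter
  \<open>V\<close>.\<close>

lemma nss_power_control:
  assumes U: "compactin T U" "symm U" and nss: "\<And>P. subgroup P L \<Longrightarrow> P \<subseteq> U \<Longrightarrow> P \<subseteq> {\<one>}" and V: "nbh V"
  obtains C :: nat where "1 \<le> C" "\<And>n x j. x \<in> qset U n \<Longrightarrow> C * j \<le> n \<Longrightarrow> x [^] j \<in> V"
proof -
  have "\<exists>C\<ge>1. \<forall>n x j. x \<in> qset U n \<longrightarrow> C * j \<le> n \<longrightarrow> x [^] j \<in> V"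
  proof (rule ccontr)
    assume neg: "\<not> ?thesis"
    have "\<forall>C. \<exists>n x j. C \<ge> 1 \<longrightarrow> x \<in> qset U n \<and> C * j \<le> n \<and> x [^] j \<notin> V" using neg by blast
    then obtain n x j where nxj: "\<And>C. C \<ge> (1::nat) \<Longrightarrow> x C \<in> qset U (n C) \<and> C * j C \<le> n C \<and> x C [^] (j C) \<notin> V" by metis
    obtain F where F: "ultrafilter F" "F \<le> sequentially" using ultrafilter_exists[OF sequentially_bot] .
    have Fb: "F \<noteq> bot" using F by (simp add: ultrafilter_def)
    have ge: "eventually (\<lambda>C. C \<ge> m) F" for m using F(2) eventually_ge_at_top[of m] filter_leD by blast
    have pw: "eventually (\<lambda>C. (x C [^] j C) [^] s \<in> U \<and> x C \<in> carrier L) F" for s :: nat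
      using ge[of "max 1 s"]
    proof eventually_elim
      case (elim C)
      have C: "x C \<in> qset U (n C)" "C * j C \<le> n C" using nxj[of C] elim by auto
      have xc: "x C \<in> carrier L" using C by (simp add: qset_def)
      have "j C * s \<le> C * j C" using elim by (simp add: mult.commute)
      then have "j C * s \<le> n C" using C by linarith
      then have "x C [^] (j C * s) \<in> U" using C by (simp add: qset_def)
      then show ?case using xc by (simp add: nat_pow_pow)
    qed
    have "eventually (\<lambda>C. x C [^] j C \<in> U) F" using pw[of 1]
    proof eventually_elim
      case (elim C)
      then show ?case by (metis nat_pow_closed nat_pow_eone)
    qed
    from ultrafilter_compactin_limit[OF F(1) U(1) this]
    obtain l where l: "l \<in> U" "limitin T (\<lambda>C. x C [^] j C) l F" .
    have lc: "l \<in> carrier L" using limitin_topspace[OF l(2)] by simp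
    have "l [^] s \<in> U" for s :: nat
    proof (rule limitin_closedin[OF limitin_pow[OF l(2), of s] compactin_closed[OF U(1)]])
      show "eventually (\<lambda>C. (x C [^] j C) [^] s \<in> U) F" using pw[of s] by eventually_elim simp
    qed (use Fb in \<open>simp add: trivial_limit_def\<close>)
    then have "l = \<one>" using powers_in_imp_one[OF U(2) nss lc] by blast
    then have "eventually (\<lambda>C. x C [^] j C \<in> V) F" using l(2) V unfolding limitin_def nbh_def by blast
    with ge[of 1] have "eventually (\<lambda>C. False) F"
      by eventually_elim (use nxj in auto)
    then show False using Fb by (simp add: eventually_False)
  qed
  then show ?thesis using that by blast
qed

lemma ball_weaken:
  assumes "ball Gn q r" "\<And>g w. Gn g w \<Longrightarrow> Gn' g w" shows "ball Gn' q r"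
  using assms(1) by (induction rule: ball.induct) (auto intro: ball.intros assms(2))

text \<open>The hypotheses of \<open>gleason\<close> are verified for the convolution of
  \<open>\<psi>\<close> with itself, with weights 1/n as the common currency: second differences are
  bounded by products of weights, and \<open>escape\<close> bounds the weight of \<open>x\<close> by
  its displacement of the function. The condition on \<open>N\<close> concerns arbitrary
  homomorphisms from the reals, since it will be checked by algebra alone.\<close>

theorem nss_contains_nbh:
  assumes N0: "nbh N0" "\<And>P. subgroup P L \<Longrightarrow> P \<subseteq> N0 \<Longrightarrow> P \<subseteq> {\<one>}"
    and N: "subgroup N L" "\<And>\<xi> t. (\<And>t. \<xi> t \<in> carrier L) \<Longrightarrow> (\<And>s t :: real. \<xi> (s + t) = \<xi> s \<otimes> \<xi> t) \<Longrightarrow> \<xi> t \<in> N"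
  obtains V where "nbh V" "V \<subseteq> N"
proof -
  obtain N1 where N1: "nbh N1" "symm N1" "N1 \<subseteq> N0" using nbh_sym[OF N0(1)] .
  obtain Ui C0 where C0: "nbh Ui" "compactin T C0" "Ui \<subseteq> C0" "C0 \<subseteq> N1" using nbh_compact[OF N1(1)] .
  have C0c: "C0 \<subseteq> carrier L" using compactin_subset_topspace[OF C0(2)] by simp
  define U where "U = C0 \<union> (\<lambda>x. inv x) ` C0"
  have U: "compactin T U" unfolding U_def by (intro compactin_Un compactin_inv C0)
  have Us: "symm U" using C0c by (auto simp: U_def symm_def)
  have UN: "U \<subseteq> N0" using C0(4) N1(2,3) by (auto simp: U_def symm_def)
  have UiU: "Ui \<subseteq> U" using C0(3) by (auto simp: U_def)
  have Uc: "U \<subseteq> carrier L" using compactin_subset_topspace[OF U] by simp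
  have nss: "P \<subseteq> {\<one>}" if "subgroup P L" "P \<subseteq> U" for P using N0(2) that UN by blast
  obtain W2 where W2: "nbh W2" "symm W2" "W2 \<subseteq> Ui" "\<And>x y. x \<in> W2 \<Longrightarrow> y \<in> W2 \<Longrightarrow> x \<otimes> y \<in> Ui" using nbh_mult[OF C0(1)] by blast
  obtain W1 where W1: "nbh W1" "symm W1" "W1 \<subseteq> W2" "\<And>x y. x \<in> W1 \<Longrightarrow> y \<in> W1 \<Longrightarrow> x \<otimes> y \<in> W2" using nbh_mult[OF W2(1)] by blast
  have W1c: "W1 \<subseteq> carrier L" using nbh_carrier[OF W1(1)] .
  obtain Uj U1 where U1: "nbh Uj" "compactin T U1" "Uj \<subseteq> U1" "U1 \<subseteq> W1" using nbh_compact[OF W1(1)] .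
  obtain V and C :: nat where V: "nbh V" "symm V" "1 \<le> C" "\<And>\<nu>. Bset (pgen V \<nu>) (1 / real C) \<subseteq> U1" using trapping[OF U1(2,1,3)] by blast
  obtain C1 :: nat where C1: "1 \<le> C1" "\<And>n x j. x \<in> qset U n \<Longrightarrow> C1 * j \<le> n \<Longrightarrow> x [^] j \<in> V" using nss_power_control[OF U Us nss V(1)] by blast
  \<comment> \<open>The generators now refer to \<open>U\<close> itself and \<open>n\<close> has no
    cap; \<open>transfer\<close> relates them to \<open>pgen V\<close>, to which trapping
    applies.\<close>
  define Gn where "Gn g w \<longleftrightarrow> (\<exists>n::nat. 1 \<le> n \<and> w = 1 / real n \<and> g \<in> qset U n)" for g w
  have G: "good_gen Gn" unfolding good_gen_def Gn_def using qset_inv[OF Us] by (fastforce simp: qset_def)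
  \<comment> \<open>The factor 2 pays for rounding n / D down.\<close>
  have divb: "1 / real (n div D) \<le> 2 * real D * (1 / real n) \<and> 1 \<le> n div D" if "1 \<le> D" "D \<le> n" for n D :: nat
  proof -
    have q: "1 \<le> n div D" using that by (simp add: div_greater_zero_iff Suc_le_eq)
    have "n < D * (n div D + 1)" using that dividend_less_times_div[of D n] by (simp add: mult.commute)
    also have "\<dots> \<le> D * (n div D + n div D)" using q by (intro mult_le_mono) auto
    also have "\<dots> = 2 * D * (n div D)" by (simp only: add_mult_distrib2 mult_2 add_mult_distrib)
    finally have "n \<le> 2 * D * (n div D)" by (rule less_imp_le)
    then have "real n \<le> 2 * real D * real (n div D)" by (metis of_nat_le_iff of_nat_mult of_nat_numeral)
    then show ?thesis using q that by (auto simp: field_simps)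
  qed
  \<comment> \<open>By \<open>C1\<close> a generator of weight 1/n keeps its first n div C1 powers
    in \<open>V\<close>. Total weight below 1/C1 guarantees n \<ge> C1, so the quotient is not 0,
    and a finite word has a common cap \<open>\<nu>\<close>.\<close>
  have transfer: "\<exists>\<nu> r'. r' \<le> 2 * real C1 * r \<and> ball (pgen V \<nu>) q r'" if "ball Gn q r" "r < 1 / real C1" for q r
    using that
  proof (induction rule: ball.induct)
    case ball_one
    show ?case by (rule exI, rule exI[of _ 0]) (auto intro: ball.ball_one)
  next
    case (ball_step g w q r)
    have w: "0 < w" "0 \<le> r" using good_genD[OF G ball_step(1)] ball_props[OF ball_step(2) G] by auto
    obtain \<nu> r' where nu: "r' \<le> 2 * real C1 * r" "ball (pgen V \<nu>) q r'" using ball_step w by auto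
    obtain n :: nat where n: "1 \<le> n" "w = 1 / real n" "g \<in> qset U n" using ball_step(1) by (auto simp: Gn_def)
    have "1 / real n < 1 / real C1" using ball_step(4) w n(2) by linarith
    then have "C1 \<le> n" using n C1(1) by (simp add: field_simps)
    note d = divb[OF C1(1) this]
    have "g \<in> qset V (n div C1)"
      unfolding qset_def
    proof (intro CollectI conjI allI impI)
      show "g \<in> carrier L" using n(3) by (simp add: qset_def)
      fix j assume "j \<le> n div C1"
      then have "C1 * j \<le> n" using le_trans[OF mult_le_mono2 times_div_less_eq_dividend] by blast
      then show "g [^] j \<in> V" using C1(2)[OF n(3)] by blast
    qed
    then have pg: "pgen V (max \<nu> n) g (1 / real (n div C1))" using d
      unfolding pgen_def by (intro exI[of _ "n div C1"]) (auto simp: max_def intro: le_trans[OF div_le_dividend])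
    have "ball (pgen V (max \<nu> n)) q r'"
      by (rule ball_weaken[OF nu(2)]) (auto simp: pgen_def)
    then have "ball (pgen V (max \<nu> n)) (g \<otimes> q) (r' + 1 / real (n div C1))" by (intro ball.ball_step pg)
    moreover have "r' + 1 / real (n div C1) \<le> 2 * real C1 * (r + w)" using nu(1) d n(2) by (simp add: distrib_left)
    ultimately show ?case by blast
  qed
  \<comment> \<open>Words of weight below \<open>\<kappa>\<close> transfer to words of weight at
    most 1 / C, which trapping holds in \<open>U1\<close>.\<close>
  define \<kappa> where "\<kappa> = 1 / (2 * real C1 * real C)"
  have k: "0 < \<kappa>" "\<kappa> \<le> 1" "\<kappa> \<le> 1 / real C1"
  proof -
    have "1 \<le> real C1" "1 \<le> real C" using C1 V by auto
    then have "1 \<le> real C1 * real C" using mult_mono[of 1 "real C1" 1 "real C"] by simp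
    moreover have "real C1 \<le> real C1 * real C" using \<open>1 \<le> real C1\<close> \<open>1 \<le> real C\<close> by simp
    ultimately have h: "1 \<le> 2 * real C1 * real C" "real C1 \<le> 2 * real C1 * real C" by (simp_all add: mult.assoc)
    have d: "1 / x \<le> 1 / y" if "0 < y" "y \<le> x" for x y :: real using that by (simp add: frac_le)
    show "0 < \<kappa>" unfolding \<kappa>_def using h by simp
    show "\<kappa> \<le> 1" unfolding \<kappa>_def using d[OF _ h(1)] by simp
    show "\<kappa> \<le> 1 / real C1" unfolding \<kappa>_def using d[OF _ h(2)] \<open>1 \<le> real C1\<close> by linarith
  qed
  have ballU1: "q \<in> U1" if bq: "ball Gn q r" "r < \<kappa>" for q r
  proof -
    obtain \<nu> r' where nu: "r' \<le> 2 * real C1 * r" "ball (pgen V \<nu>) q r'" using transfer[OF bq(1)] bq(2) k by auto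
    have "2 * real C1 * r \<le> 2 * real C1 * \<kappa>" using bq(2) by (intro mult_left_mono) auto
    also have "\<dots> = 1 / real C" using C1 by (simp add: \<kappa>_def)
    finally have "r' \<le> 1 / real C" using nu by linarith
    then have "q \<in> Bset (pgen V \<nu>) (1 / real C)" using nu by (auto simp: Bset_def)
    then show ?thesis using V(4) by blast
  qed
  obtain I where "haar L T I" by (rule haar_ex)
  then interpret haar L T I .
  obtain \<theta> Ct where th: "continuous_map T euclideanreal \<theta>" "compactin T Ct" "Ct \<subseteq> W1"
    "\<And>x. x \<in> carrier L \<Longrightarrow> 0 \<le> \<theta> x" "\<And>x. x \<in> carrier L \<Longrightarrow> \<theta> x \<le> 1" "\<theta> \<one> = 1"
    "\<And>x. x \<in> carrier L \<Longrightarrow> x \<notin> Ct \<Longrightarrow> \<theta> x = 0"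
    using bump_function[OF W1(1)] by blast
  have thp: "\<theta> \<in> Cp" using th by (intro CpI CcI[OF th(1,2)]) auto
  define \<psi> where "\<psi> = psi Gn \<kappa> \<theta>"
  define Y0 where "Y0 = U1 <#> Ct"
  have Y0: "compactin T Y0" unfolding Y0_def by (rule compactin_mult[OF U1(2) th(2)])
  have inY0: "x \<in> Y0" if b: "ball Gn q r" "r < \<kappa>" "x \<in> carrier L" "\<theta> (inv q \<otimes> x) \<noteq> 0" for q r x
  proof -
    have qc: "q \<in> carrier L" using ball_props[OF b(1) G] by auto
    have "inv q \<otimes> x \<in> Ct" using th(7)[of "inv q \<otimes> x"] b qc by auto
    moreover have "x = q \<otimes> (inv q \<otimes> x)" using qc b by (simp add: m_assoc[symmetric])
    ultimately show ?thesis using ballU1[OF b(1,2)] unfolding Y0_def set_mult_def by blast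
  qed
  have pc: "\<psi> \<in> Cp" unfolding \<psi>_def by (rule psi_Cp[OF G k(1) thp th(5) Y0 inY0])
  have pcc: "\<psi> \<in> Cc" using pc by (rule CpD)
  have pY: "y \<in> Y0" if "y \<in> carrier L" "\<psi> y \<noteq> 0" for y
    using psi_supp[OF G k(1) thp th(5), of y] that inY0 unfolding \<psi>_def by metis
  have Y0W: "Y0 \<subseteq> W2" using U1(4) th(3) W1(4) unfolding Y0_def set_mult_def by blast
  have p01: "0 \<le> \<psi> y" "\<psi> y \<le> 1" if "y \<in> carrier L" for y
    unfolding \<psi>_def using psi_nonneg[OF G k(1) thp th(5)] psi_le_one[OF G k(1) thp th(5)] that by auto
  have plip: "\<bar>\<psi> (inv g \<otimes> x) - \<psi> x\<bar> \<le> w / \<kappa>" if "Gn g w" "x \<in> carrier L" for g w x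
    unfolding \<psi>_def by (rule psi_lip[OF G k(1) thp th(5) that])
  define Y where "Y = Y0 \<union> (U <#> Y0)"
  have Y: "compactin T Y" unfolding Y_def by (intro compactin_Un compactin_mult Y0 U)
  have Yc: "Y \<subseteq> carrier L" using compactin_subset_topspace[OF Y] by simp
  obtain \<Theta> where Th: "\<Theta> \<in> Cp" "\<And>y. y \<in> Y \<Longrightarrow> 1 \<le> \<Theta> y" using Cp_ge_one_on_compact[OF Y] by blast
  have Tc: "\<Theta> \<in> Cc" using Th(1) by (rule CpD)
  have IT: "0 \<le> I \<Theta>" by (rule I_nonneg[OF Th(1)])
  obtain V2 where V2: "nbh V2" "\<And>y h. y \<in> Y \<Longrightarrow> h \<in> V2 \<Longrightarrow> inv y \<otimes> h \<otimes> y \<in> Ui" using nbh_conj[OF Y C0(1)] by blast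
  obtain C2 :: nat where C2: "1 \<le> C2" "\<And>n x j. x \<in> qset U n \<Longrightarrow> C2 * j \<le> n \<Longrightarrow> x [^] j \<in> V2" using nss_power_control[OF U Us nss V2(1)] by blast
  define f where "f = conv \<psi> \<psi>"
  have fc: "f \<in> Cc" unfolding f_def by (rule conv_Cc[OF pcc pcc])
  have qU: "g \<in> U" if "g \<in> qset U n" "1 \<le> n" for g n
  proof -
    have "g [^] (1::nat) \<in> U" "g \<in> carrier L" using that by (auto simp: qset_def)
    then show ?thesis by simp
  qed
  define a where "a g = (\<lambda>y. \<psi> (inv g \<otimes> y) - \<psi> y)" for g
  have ac: "a g \<in> Cc" if "g \<in> carrier L" for g unfolding a_def using that by (intro Cc_diff Cc_ltrans pcc) auto
  have dg: "f (inv g \<otimes> x) - f x = conv (a g) \<psi> x" if "g \<in> carrier L" "x \<in> carrier L" for g x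
    unfolding f_def a_def using conv_ltrans[OF pcc pcc that(2,1)] conv_diff_left[OF _ pcc pcc that(2), of "\<lambda>y. \<psi> (inv g \<otimes> y)"] Cc_ltrans[OF pcc, of "inv g"] that
    by simp
  have aY: "y \<in> Y" if "g \<in> U" "y \<in> carrier L" "a g y \<noteq> 0" for g y
  proof -
    have gc: "g \<in> carrier L" using that Uc by auto
    have "\<psi> (inv g \<otimes> y) \<noteq> 0 \<or> \<psi> y \<noteq> 0" using that by (auto simp: a_def)
    then show ?thesis
    proof
      assume "\<psi> (inv g \<otimes> y) \<noteq> 0"
      then have "inv g \<otimes> y \<in> Y0" using pY[of "inv g \<otimes> y"] gc that by simp
      moreover have "y = g \<otimes> (inv g \<otimes> y)" using gc that by (simp add: m_assoc[symmetric])
      ultimately show ?thesis using that(1) unfolding Y_def set_mult_def by blast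
    next
      assume "\<psi> y \<noteq> 0"
      then show ?thesis using pY[OF that(2)] by (auto simp: Y_def)
    qed
  qed
  have abd: "\<bar>a g y\<bar> \<le> (1 / real n) / \<kappa> * \<Theta> y" if g: "g \<in> qset U n" "1 \<le> n" and y: "y \<in> carrier L" for g n y
  proof -
    have "Gn g (1 / real n)" using g by (auto simp: Gn_def)
    then have l: "\<bar>a g y\<bar> \<le> (1 / real n) / \<kappa>" using plip y unfolding a_def by blast
    have wk: "0 \<le> (1 / real n) / \<kappa>" using k by simp
    show ?thesis
    proof (cases "a g y = 0")
      case True
      then show ?thesis using mult_nonneg_nonneg[OF wk CpD(2)[OF Th(1) y]] by simp
    next
      case False
      then have "1 \<le> \<Theta> y" using aY[OF qU[OF g] y] Th by auto
      then have "(1 / real n) / \<kappa> * 1 \<le> (1 / real n) / \<kappa> * \<Theta> y" using wk by (rule mult_left_mono)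
      then show ?thesis using l by simp
    qed
  qed
  define D where "D = I \<Theta> / \<kappa> * (2 * real C2 / \<kappa>) + I \<Theta> / \<kappa> + 1"
  have D0: "0 < D" unfolding D_def using IT k by (intro add_nonneg_pos add_nonneg_nonneg mult_nonneg_nonneg) auto
  \<comment> \<open>The difference along \<open>g\<close> is charged to the first factor of the
    convolution, by the Lipschitz bound 1/(n \<kappa>); the one along \<open>h\<close> to the
    second, where \<open>h\<close> appears conjugated by a \<open>y\<close> in the compact
    \<open>Y\<close>. By the choice of \<open>V2\<close> and \<open>C2\<close> the first m div C2
    powers of that conjugate are in \<open>U\<close>.\<close>
  have D2: "\<bar>f (inv g \<otimes> (inv h \<otimes> x)) - f (inv h \<otimes> x) - (f (inv g \<otimes> x) - f x)\<bar> \<le> D * (1 / real m) * (1 / real n)"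
    if g: "g \<in> qset U n" "1 \<le> n" and h: "h \<in> qset U m" "1 \<le> m" and x: "x \<in> carrier L" for g n h m x
  proof -
    have gc: "g \<in> carrier L" and hc: "h \<in> carrier L" using g h by (auto simp: qset_def)
    let ?b = "(2 * real C2 / \<kappa>) * (1 / real m)"
    have b0: "0 \<le> ?b" using k by simp
    have "\<bar>conv (a g) \<psi> (inv h \<otimes> x) - conv (a g) \<psi> x\<bar> \<le> (1 / real n) / \<kappa> * ?b * I \<Theta>"
    proof (rule conv_diff_bound[OF ac[OF gc] pcc Tc hc x abd[OF g] _ b0])
      fix y z assume y: "y \<in> carrier L" "a g y \<noteq> 0" and z: "z \<in> carrier L"
      have yY: "y \<in> Y" using aY[OF qU[OF g] y] .
      define kk where "kk = inv y \<otimes> h \<otimes> y"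
      have kc: "kk \<in> carrier L" using y hc by (simp add: kk_def)
      have kj: "kk [^] (j::nat) = inv y \<otimes> (h [^] j) \<otimes> y" for j
      proof (induction j)
        case 0
        then show ?case using y by (simp add: l_inv)
      next
        case (Suc j)
        have hj: "h [^] j \<in> carrier L" using hc by simp
        have e1: "y \<otimes> (inv y \<otimes> (h \<otimes> y)) = h \<otimes> y" using hc y by (simp add: m_assoc[symmetric])
        have "kk [^] Suc j = (inv y \<otimes> h [^] j \<otimes> y) \<otimes> (inv y \<otimes> h \<otimes> y)" using Suc by (simp add: kk_def)
        also have "\<dots> = inv y \<otimes> (h [^] j \<otimes> (y \<otimes> (inv y \<otimes> (h \<otimes> y))))" using hj hc y by (simp add: m_assoc)
        also have "\<dots> = inv y \<otimes> (h [^] Suc j) \<otimes> y" unfolding e1 using hj hc y by (simp add: m_assoc)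
        finally show ?case .
      qed
      have ik: "inv kk = inv y \<otimes> inv h \<otimes> y" using y hc by (simp add: kk_def inv_mult_group m_assoc)
      have "\<bar>\<psi> (inv kk \<otimes> z) - \<psi> z\<bar> \<le> ?b"
      proof (cases "C2 \<le> m")
        case True
        note d = divb[OF C2(1) True]
        have "kk \<in> qset U (m div C2)"
          unfolding qset_def
        proof (intro CollectI conjI allI impI kc)
          fix j assume "j \<le> m div C2"
      then have "C2 * j \<le> m" using le_trans[OF mult_le_mono2 times_div_less_eq_dividend] by blast
          then have "h [^] j \<in> V2" using C2(2)[OF h(1)] by blast
          then show "kk [^] j \<in> U" using V2(2)[OF yY] UiU unfolding kj by blast
        qed
        then have "Gn kk (1 / real (m div C2))" using d by (auto simp: Gn_def)
        then have "\<bar>\<psi> (inv kk \<otimes> z) - \<psi> z\<bar> \<le> (1 / real (m div C2)) / \<kappa>" using plip z by blast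
        also have "\<dots> \<le> (2 * real C2 * (1 / real m)) / \<kappa>" using d k by (intro divide_right_mono) auto
        finally show ?thesis by (simp add: mult.commute)
      next
        \<comment> \<open>For m < C2 the conjugate is not controlled, but then the claimed bound is
          at least 1 and \<open>\<psi>\<close> takes values between 0 and 1.\<close>
        case False
        have "\<bar>\<psi> (inv kk \<otimes> z) - \<psi> z\<bar> \<le> 1" using p01[of "inv kk \<otimes> z"] p01[OF z] kc z by (auto simp: abs_le_iff)
        also have "1 \<le> ?b"
        proof -
          have "\<kappa> * real m \<le> 1 * real m" using k by (intro mult_right_mono) auto
          also have "\<dots> \<le> 2 * real C2" using False by simp
          finally show ?thesis using k h by (simp add: field_simps)
        qed
        finally show ?thesis .
      qed
      then show "\<bar>\<psi> (inv y \<otimes> inv h \<otimes> y \<otimes> z) - \<psi> z\<bar> \<le> ?b" by (simp add: ik)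
    qed
    also have "\<dots> = (I \<Theta> / \<kappa> * (2 * real C2 / \<kappa>)) * ((1 / real m) * (1 / real n))" by (simp add: mult_ac)
    also have "\<dots> \<le> D * ((1 / real m) * (1 / real n))" unfolding D_def using IT k by (intro mult_right_mono) auto
    finally show ?thesis using dg[OF gc x] dg[OF gc, of "inv h \<otimes> x"] hc x by (simp add: mult.assoc)
  qed
  define c where "c = f \<one>"
  have c: "0 < c"
  proof -
    have tt: "(\<lambda>y. \<theta> y * \<theta> (inv y)) \<in> Cc" by (intro Cc_mult CpD(1)[OF thp] Cc_cont[OF Cc_inv[OF CpD(1)[OF thp]]])
    have "0 < I (\<lambda>y. \<theta> y * \<theta> (inv y))" by (rule I_pos[OF CpI[OF tt], of \<one>]) (use th in auto)
    also have "\<dots> \<le> I (\<lambda>y. \<psi> y * \<psi> (inv y \<otimes> \<one>))"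
    proof (rule I_mono[OF tt conv_integrand[OF pcc pcc one_closed]])
      fix y assume y: "y \<in> carrier L"
      have "\<theta> y \<le> \<psi> y" "\<theta> (inv y) \<le> \<psi> (inv y)" unfolding \<psi>_def using psi_ge_theta[OF G k(1) thp th(5)] y by auto
      then have "\<theta> y * \<theta> (inv y) \<le> \<psi> y * \<psi> (inv y)" using th(4) y p01[OF y] by (intro mult_mono) auto
      then show "\<theta> y * \<theta> (inv y) \<le> \<psi> y * \<psi> (inv y \<otimes> \<one>)" using y by simp
    qed
    finally show ?thesis by (simp add: c_def f_def conv_def)
  qed
  have f0: "f x = 0" if x: "x \<in> carrier L" "x \<notin> U" for x
    unfolding f_def
  proof (rule conv_zero[OF pcc pcc x(1)])
    fix y assume y: "y \<in> carrier L"
    show "\<psi> y * \<psi> (inv y \<otimes> x) = 0"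
    proof (rule ccontr)
      assume "\<psi> y * \<psi> (inv y \<otimes> x) \<noteq> 0"
      then have "y \<in> Y0" "inv y \<otimes> x \<in> Y0" using pY[OF y] pY[of "inv y \<otimes> x"] x y by auto
      then have "y \<otimes> (inv y \<otimes> x) \<in> Ui" using W2(4) Y0W by blast
      moreover have "y \<otimes> (inv y \<otimes> x) = x" using x y by (simp add: m_assoc[symmetric])
      ultimately show False using UiU x by auto
    qed
  qed
  \<comment> \<open>At the first exponent \<open>j\<close> with x^j outside \<open>U\<close>, the
    function drops from f(1) = c to f(x^j) = 0 in \<open>j\<close> steps of size at most
    \<open>b\<close>, so c \<le> j b. Since j \<ge> 2, passing to the last exponent j - 1 inside
    \<open>U\<close> costs a factor 2.\<close>
  have escape: "\<exists>n. 1 \<le> n \<and> x \<in> qset U n \<and> 1 / real n \<le> 2 * b / c"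
    if x: "x \<in> U" "x \<noteq> \<one>" and b: "\<And>z. z \<in> carrier L \<Longrightarrow> \<bar>f (inv x \<otimes> z) - f z\<bar> \<le> b" for x b
  proof -
    have xc: "x \<in> carrier L" using x Uc by auto
    have "\<exists>j::nat. x [^] j \<notin> U" using powers_in_imp_one[OF Us nss xc] x(2) by blast
    define j where "j = (LEAST j::nat. x [^] j \<notin> U)"
    have j1: "x [^] j \<notin> U" unfolding j_def by (rule LeastI_ex) fact
    have j2: "x [^] i \<in> U" if "i < j" for i using not_less_Least[of i] that unfolding j_def by blast
    have "j \<noteq> 0"
    proof
      assume "j = 0"
      then have "\<one> \<notin> U" using j1 by simp
      then show False using UiU C0(1) by (auto simp: nbh_def)
    qed
    moreover have "j \<noteq> 1" using j1 x(1) xc by auto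
    ultimately have j: "2 \<le> j" by simp
    have tel: "\<bar>f (inv (x [^] i) \<otimes> z) - f z\<bar> \<le> real i * b" if z: "z \<in> carrier L" for i :: nat and z
      using z
    proof (induction i arbitrary: z)
      case (Suc i)
      have xi: "x [^] i \<in> carrier L" using xc by simp
      have e: "inv (x [^] Suc i) \<otimes> z = inv x \<otimes> (inv (x [^] i) \<otimes> z)" using xc xi Suc.prems by (simp add: inv_mult_group m_assoc)
      have "\<bar>f (inv x \<otimes> (inv (x [^] i) \<otimes> z)) - f (inv (x [^] i) \<otimes> z)\<bar> \<le> b" using b xi Suc.prems by simp
      moreover have "\<bar>f (inv (x [^] i) \<otimes> z) - f z\<bar> \<le> real i * b" using Suc by blast
      ultimately show ?case unfolding e by (simp add: distrib_right)
    qed simp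
    have xj: "x [^] j \<in> carrier L" using xc by simp
    have "c \<le> real j * b"
      using tel[OF xj, of j] f0[OF xj j1] xj c by (simp add: l_inv c_def)
    have b0: "0 \<le> b" using b[of \<one>] by (auto intro: order_trans[OF abs_ge_zero])
    have "real j \<le> 2 * real (j - 1)" using j by (simp add: of_nat_diff)
    then have "real j * b \<le> 2 * real (j - 1) * b" using b0 by (rule mult_right_mono)
    then have "c \<le> 2 * real (j - 1) * b" using \<open>c \<le> real j * b\<close> by linarith
    then have "1 / real (j - 1) \<le> 2 * b / c" using c j by (simp add: field_simps)
    moreover have "x \<in> qset U (j - 1)" using j2 xc j by (auto simp: qset_def)
    ultimately show ?thesis using j by (intro exI[of _ "j - 1"]) auto
  qed
  \<comment> \<open>Two applications of \<open>escape\<close> turn the weights in \<open>D2\<close>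
    into 2 b / c and 2 b' / c.\<close>
  define M where "M = D * (2 / c) * (2 / c)"
  have M0: "0 < M" unfolding M_def using D0 c by simp
  interpret gl: gleason L T f U c M
  proof unfold_locales
    show "f \<in> Cc" "compactin T U" "0 < c" "0 < M" by (fact fc U c M0)+
    show "c \<le> f \<one>" by (simp add: c_def)
    show "f x = 0" if "x \<in> carrier L" "x \<notin> U" for x using f0 that .
    fix x y z b b'
    assume xy: "x \<in> U" "y \<in> U" and z: "z \<in> carrier L"
      and b: "\<And>z. z \<in> carrier L \<Longrightarrow> \<bar>f (inv x \<otimes> z) - f z\<bar> \<le> b" and b': "\<And>z. z \<in> carrier L \<Longrightarrow> \<bar>f (inv y \<otimes> z) - f z\<bar> \<le> b'"
    have bb: "0 \<le> b" "0 \<le> b'" using b[of \<one>] b'[of \<one>] by (auto intro: order_trans[OF abs_ge_zero])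
    have xc: "x \<in> carrier L" "y \<in> carrier L" using xy Uc by auto
    have nn: "0 \<le> M * b * b'" using M0 bb by simp
    show "\<bar>f (inv y \<otimes> (inv x \<otimes> z)) - f (inv x \<otimes> z) - (f (inv y \<otimes> z) - f z)\<bar> \<le> M * b * b'"
    proof (cases "x = \<one> \<or> y = \<one>")
      case True
      then show ?thesis using xc z nn by auto
    next
      case False
      obtain m where m: "1 \<le> m" "x \<in> qset U m" "1 / real m \<le> 2 * b / c" using escape[OF xy(1) _ b] False by blast
      obtain n where n: "1 \<le> n" "y \<in> qset U n" "1 / real n \<le> 2 * b' / c" using escape[OF xy(2) _ b'] False by blast
      have "\<bar>f (inv y \<otimes> (inv x \<otimes> z)) - f (inv x \<otimes> z) - (f (inv y \<otimes> z) - f z)\<bar> \<le> D * (1 / real m) * (1 / real n)"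
        by (rule D2[OF n(2,1) m(2,1) z])
      also have "\<dots> \<le> D * (2 * b / c) * (2 * b' / c)"
        using m n D0 bb c by (intro mult_mono) auto
      also have "\<dots> = M * b * b'" by (simp add: M_def)
      finally show ?thesis .
    qed
  next
    fix x assume x: "x \<in> U" and e: "\<And>z. z \<in> carrier L \<Longrightarrow> f (inv x \<otimes> z) = f z"
    show "x = \<one>"
    proof (rule ccontr)
      assume "x \<noteq> \<one>"
      then obtain n where "1 \<le> n" "1 / real n \<le> 2 * 0 / c" using escape[OF x, of 0] e by auto
      then show False by simp
    qed
  qed
  obtain W where "nbh W" "W \<subseteq> N"
  proof (rule gl.ops_generate_nbh[OF N(1)])
    show "\<xi> t \<in> N" if "\<xi> \<in> gl.ops" for \<xi> t using N(2)[of \<xi> t] gl.opsD(1,3)[OF that] by blast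
  qed
  then show ?thesis by (rule that)
qed

end

section \<open>Groups in the class G\<close>

text \<open>Only finitely many coordinates of an element are nontrivial, so if all had finite order,
  the element would too. Thus \<open>x\<close> has a coordinate of infinite order; the cyclic
  summand there is infinite, and the exponent with respect to a generator is the required
  map.\<close>

lemma direct_sum_of_cyclic_int_hom:
  fixes G :: "('c, 'd) monoid_scheme"
  assumes "group G" and A: "subgroup A G" "direct_sum_of_cyclic G A" and x: "x \<in> A" "group.ord G x = 0"
  obtains \<psi> :: "'c \<Rightarrow> int" where "\<And>a b. a \<in> A \<Longrightarrow> b \<in> A \<Longrightarrow> \<psi> (a \<otimes>\<^bsub>G\<^esub> b) = \<psi> a + \<psi> b" "\<psi> x \<noteq> 0"
proof -
  interpret group G by fact
  interpret A: subgroup A G by (rule A(1))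
  have xc: "x \<in> carrier G" using x by simp
  obtain I :: "'c set" and C :: "'c \<Rightarrow> 'c monoid" where
    C: "\<And>i. i \<in> I \<Longrightarrow> group (C i)" "\<And>i. i \<in> I \<Longrightarrow> cyclic_group (C i)"
    and "subgroup_generated G A \<cong> sum_group I C"
    using A(2) unfolding direct_sum_of_cyclic_def by blast
  then obtain h where "h \<in> iso (subgroup_generated G A) (sum_group I C)" by (auto simp: is_iso_def)
  then have hh: "h \<in> hom (subgroup_generated G A) (sum_group I C)" and inj: "inj_on h A"
    using A.carrier_subgroup_generated_subgroup by (auto simp: iso_def bij_betw_def)
  have hc: "h a \<in> carrier (sum_group I C)" if "a \<in> A" for a
    using hh that A.carrier_subgroup_generated_subgroup by (auto simp: hom_def)
  have hci: "h a i \<in> carrier (C i)" if "a \<in> A" "i \<in> I" for a i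
    using hc[OF that(1)] that(2) C(1) by (auto simp: carrier_sum_group PiE_iff)
  have hm: "h (a \<otimes>\<^bsub>G\<^esub> b) = (\<lambda>i\<in>I. h a i \<otimes>\<^bsub>C i\<^esub> h b i)" if "a \<in> A" "b \<in> A" for a b
    using hom_mult[OF hh, of a b] that A.carrier_subgroup_generated_subgroup by simp
  have hmi: "h (a \<otimes>\<^bsub>G\<^esub> b) i = h a i \<otimes>\<^bsub>C i\<^esub> h b i" if "a \<in> A" "b \<in> A" "i \<in> I" for a b i
    using hm[OF that(1,2)] that(3) by simp
  have h1i: "h \<one>\<^bsub>G\<^esub> i = \<one>\<^bsub>C i\<^esub>" if "i \<in> I" for i
  proof -
    interpret Ci: group "C i" by (rule C(1)[OF that])
    show ?thesis using hmi[OF A.one_closed A.one_closed that] hci[OF A.one_closed that] by simp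
  qed
  have pw: "a [^]\<^bsub>G\<^esub> n \<in> A \<and> h (a [^]\<^bsub>G\<^esub> n) i = h a i [^]\<^bsub>C i\<^esub> n" if "a \<in> A" "i \<in> I" for a i and n :: nat
  proof (induction n)
    case 0
    then show ?case using h1i that by simp
  next
    case (Suc n)
    interpret Ci: group "C i" by (rule C(1)[OF that(2)])
    show ?case using Suc hmi that by simp
  qed
  have "\<exists>i\<in>I. group.ord (C i) (h x i) = 0"
  proof (rule ccontr)
    assume "\<not> ?thesis"
    then have fo: "group.ord (C i) (h x i) > 0" if "i \<in> I" for i using that by auto
    define J where "J = {i \<in> I. h x i \<noteq> \<one>\<^bsub>C i\<^esub>}"
    have J: "finite J" using hc[OF x(1)] C(1) by (simp add: carrier_sum_group J_def)
    define n where "n = (\<Prod>i\<in>J. group.ord (C i) (h x i))"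
    have n: "n > 0" unfolding n_def using fo by (intro prod_pos) (auto simp: J_def)
    have xn: "x [^]\<^bsub>G\<^esub> n \<in> A" for n :: nat by (induction n) (use x(1) in auto)
    have "h (x [^]\<^bsub>G\<^esub> n) i = h \<one>\<^bsub>G\<^esub> i" if i: "i \<in> I" for i
    proof -
      interpret Ci: group "C i" by (rule C(1)[OF i])
      have "h x i [^]\<^bsub>C i\<^esub> n = \<one>\<^bsub>C i\<^esub>"
      proof (cases "i \<in> J")
        case True
        then have "Ci.ord (h x i) dvd n" unfolding n_def using J by (intro dvd_prodI) auto
        then show ?thesis using Ci.pow_eq_id hci[OF x(1) i] by blast
      next
        case False
        then show ?thesis using i by (simp add: J_def)
      qed
      then show ?thesis using pw[OF x(1) i] h1i[OF i] by simp
    qed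
    then have "h (x [^]\<^bsub>G\<^esub> n) = h \<one>\<^bsub>G\<^esub>"
      using hc[OF xn] hc[OF A.one_closed] C(1) by (intro extensionalityI[of _ I]) (auto simp: carrier_sum_group PiE_iff)
    then have "x [^]\<^bsub>G\<^esub> n = \<one>\<^bsub>G\<^esub>" using inj xn A.one_closed by (auto dest: inj_onD)
    then show False using x(2) n ord_eq_0[OF xc] by auto
  qed
  then obtain i where i: "i \<in> I" "group.ord (C i) (h x i) = 0" by blast
  interpret Ci: group "C i" by (rule C(1)[OF i(1)])
  obtain g where g: "g \<in> carrier (C i)" "carrier (C i) = range (\<lambda>n::int. g [^]\<^bsub>C i\<^esub> n)"
    using C(2)[OF i(1)] Ci.cyclic_group by blast
  have ex: "\<exists>k::int. h a i = g [^]\<^bsub>C i\<^esub> k" if "a \<in> A" for a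
    using hci[OF that i(1)] g(2) by auto
  define \<psi> where "\<psi> = (\<lambda>a. SOME k::int. h a i = g [^]\<^bsub>C i\<^esub> k)"
  have \<psi>: "h a i = g [^]\<^bsub>C i\<^esub> \<psi> a" if "a \<in> A" for a
    unfolding \<psi>_def using someI_ex[OF ex[OF that]] .
  have "Ci.ord g = 0"
  proof (rule ccontr)
    assume o: "Ci.ord g \<noteq> 0"
    have "h x i [^]\<^bsub>C i\<^esub> Ci.ord g = g [^]\<^bsub>C i\<^esub> (\<psi> x * int (Ci.ord g))"
      using \<psi>[OF x(1)] g(1) by (simp add: Ci.int_pow_pow flip: int_pow_int)
    also have "\<dots> = \<one>\<^bsub>C i\<^esub>" using g(1) by (simp add: Ci.int_pow_eq_id)
    finally show False using i(2) o Ci.ord_eq_0[OF hci[OF x(1) i(1)]] by auto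
  qed
  then have uq: "k = l" if "g [^]\<^bsub>C i\<^esub> (k::int) = g [^]\<^bsub>C i\<^esub> (l::int)" for k l
    using Ci.int_pow_eq[OF g(1)] that by auto
  show ?thesis
  proof (rule that[of \<psi>])
    show "\<psi> (a \<otimes>\<^bsub>G\<^esub> b) = \<psi> a + \<psi> b" if "a \<in> A" "b \<in> A" for a b
      using \<psi>[OF that(1)] \<psi>[OF that(2)] \<psi>[of "a \<otimes>\<^bsub>G\<^esub> b"] hmi[OF that i(1)] that g(1)
      by (intro uq) (simp add: Ci.int_pow_mult)
    show "\<psi> x \<noteq> 0"
    proof
      assume "\<psi> x = 0"
      then have "h x i = \<one>\<^bsub>C i\<^esub>" using \<psi>[OF x(1)] by simp
      then show False using i(2) by simp
    qed
  qed
qed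

lemma class_G_int_hom:
  fixes G :: "('c, 'd) monoid_scheme"
  assumes G: "class_G G" and A: "subgroup A G" "\<And>a b. a \<in> A \<Longrightarrow> b \<in> A \<Longrightarrow> a \<otimes>\<^bsub>G\<^esub> b = b \<otimes>\<^bsub>G\<^esub> a"
    and x: "x \<in> A" "group.ord G x = 0"
  obtains \<psi> :: "'c \<Rightarrow> int" where "\<And>a b. a \<in> A \<Longrightarrow> b \<in> A \<Longrightarrow> \<psi> (a \<otimes>\<^bsub>G\<^esub> b) = \<psi> a + \<psi> b" "\<psi> x \<noteq> 0"
proof -
  have "group G" "direct_sum_of_cyclic G A"
    using G A by (auto simp: class_G_def abelian_subgroup_def)
  from direct_sum_of_cyclic_int_hom[OF this(1) A(1) this(2) x] show ?thesis using that by blast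
qed

text \<open>Divisibility of the image leaves no nonzero homomorphism to the integers, so the image
  is a torsion group, hence finite; and a finite divisible group is killed by the product of its
  orders, hence trivial.\<close>

lemma class_G_real_hom_trivial:
  fixes G :: "('c, 'd) monoid_scheme" and \<xi> :: "real \<Rightarrow> 'c"
  assumes G: "class_G G" and \<xi>: "\<And>t. \<xi> t \<in> carrier G" "\<And>s t. \<xi> (s + t) = \<xi> s \<otimes>\<^bsub>G\<^esub> \<xi> t"
  shows "\<xi> t = \<one>\<^bsub>G\<^esub>"
proof -
  interpret group G using G by (simp add: class_G_def)
  have \<xi>0: "\<xi> 0 = \<one>\<^bsub>G\<^esub>" using \<xi>(2)[of 0 0] \<xi>(1)[of 0] by simp
  have mul: "\<xi> (real n * t) = \<xi> t [^]\<^bsub>G\<^esub> n" for n t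
  proof (induction n)
    case (Suc n)
    then show ?case using \<xi>(2)[of "real n * t" t] by (simp add: algebra_simps)
  qed (simp add: \<xi>0)
  have sub: "subgroup (range \<xi>) G"
  proof (rule subgroupI)
    fix a assume "a \<in> range \<xi>"
    then obtain t where t: "a = \<xi> t" by blast
    have "\<xi> (- t) \<otimes>\<^bsub>G\<^esub> \<xi> t = \<one>\<^bsub>G\<^esub>" using \<xi>(2)[of "-t" t] \<xi>0 by simp
    then have "inv\<^bsub>G\<^esub> a = \<xi> (- t)" using t \<xi>(1) by (metis inv_equality)
    then show "inv\<^bsub>G\<^esub> a \<in> range \<xi>" by simp
  qed (use \<xi>(1) in \<open>auto simp flip: \<xi>(2)\<close>)
  have comm: "a \<otimes>\<^bsub>G\<^esub> b = b \<otimes>\<^bsub>G\<^esub> a" if "a \<in> range \<xi>" "b \<in> range \<xi>" for a b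
    using that by (auto simp: add.commute simp flip: \<xi>(2))
  have tors: "ord (\<xi> t) \<noteq> 0" for t
  proof
    assume "ord (\<xi> t) = 0"
    then obtain \<psi> :: "'c \<Rightarrow> int" where \<psi>: "\<And>a b. a \<in> range \<xi> \<Longrightarrow> b \<in> range \<xi> \<Longrightarrow> \<psi> (a \<otimes>\<^bsub>G\<^esub> b) = \<psi> a + \<psi> b" "\<psi> (\<xi> t) \<noteq> 0"
      using class_G_int_hom[OF G sub comm, of "\<xi> t"] by blast
    have z: "\<psi> (\<xi> 0) = 0" using \<psi>(1)[of "\<xi> 0" "\<xi> 0"] rangeI[of \<xi> 0] \<xi>0 by simp
    have m: "\<psi> (\<xi> (real n * s)) = int n * \<psi> (\<xi> s)" for n s
    proof (induction n)
      case (Suc n)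
      have "\<xi> (real (Suc n) * s) = \<xi> (real n * s) \<otimes>\<^bsub>G\<^esub> \<xi> s" using \<xi>(2)[of "real n * s" s] by (simp add: algebra_simps)
      then show ?case using \<psi>(1)[of "\<xi> (real n * s)" "\<xi> s"] Suc by (simp add: algebra_simps)
    qed (simp add: z)
    define n where "n = nat \<bar>\<psi> (\<xi> t)\<bar> + 1"
    have "\<psi> (\<xi> t) = int n * \<psi> (\<xi> (t / real n))" using m[of n "t / real n"] by (simp add: n_def)
    then have "int n dvd \<psi> (\<xi> t)" by simp
    then have "int n \<le> \<bar>\<psi> (\<xi> t)\<bar>" using dvd_imp_le_int[OF \<psi>(2), of "int n"] by simp
    then show False by (simp add: n_def)
  qed
  have fin: "finite (range \<xi>)"
    using G sub tors unfolding class_G_def torsion_subgroup_def by blast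
  define n where "n = (\<Prod>a\<in>range \<xi>. ord a)"
  have n: "n > 0" unfolding n_def using tors by (intro prod_pos) auto
  have "ord (\<xi> (t / real n)) dvd n" unfolding n_def using fin by (intro dvd_prodI) auto
  then have "\<xi> (t / real n) [^]\<^bsub>G\<^esub> n = \<one>\<^bsub>G\<^esub>" using pow_eq_id \<xi>(1) by blast
  then show ?thesis using mul[of n "t / real n"] n by simp
qed

section \<open>Homomorphic images of compact subgroups\<close>

context lcgrp
begin

lemma compact_image_finite:
  fixes G :: "('c, 'd) monoid_scheme"
  assumes K: "subgroup K L" "compactin T K" and \<phi>: "\<phi> \<in> hom L G" and G: "class_G G"
  shows "finite (\<phi> ` K)"
proof -
  interpret G: group G using G by (simp add: class_G_def)
  interpret K: subgroup K L by (rule K(1))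
  interpret \<phi>: group_hom L G \<phi> using \<phi> by unfold_locales
  have lim_uniq: "a = b" if "limitin T f a U" "limitin T f b U" "ultrafilter U" for f a b and U :: "nat filter"
    using limitin_Hausdorff_unique[OF that(1,2) _ Hausdorff_T] that(3) by (auto simp: ultrafilter_def)
  have "G.ord (\<phi> x) \<noteq> 0" if x: "x \<in> K" for x
  proof
    assume o: "G.ord (\<phi> x) = 0"
    \<comment> \<open>The double centraliser of \<open>x\<close> in \<open>K\<close>. It is abelian,
      contains \<open>x\<close>, and is closed under limits in \<open>K\<close> because commuting
      with a fixed element is a closed condition; so it contains the \<open>y n\<close>
      below.\<close>
    define A where "A = {a \<in> K. \<forall>b\<in>K. b \<otimes> x = x \<otimes> b \<longrightarrow> a \<otimes> b = b \<otimes> a}"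
    have AK: "A \<subseteq> K" by (auto simp: A_def)
    have Ac: "a \<in> carrier L" if "a \<in> A" for a using that AK by auto
    have xA: "x \<in> A" using x by (auto simp: A_def)
    have A: "subgroup A L"
    proof (rule subgroupI)
      fix a assume a: "a \<in> A"
      show "inv a \<in> A" unfolding A_def
      proof (intro CollectI conjI ballI impI)
        fix b assume b: "b \<in> K" "b \<otimes> x = x \<otimes> b"
        then have "a \<otimes> b = b \<otimes> a" using a by (auto simp: A_def)
        moreover have "inv a \<otimes> b = inv a \<otimes> (b \<otimes> a) \<otimes> inv a" using Ac[OF a] b by (simp add: m_assoc)
        moreover have "inv a \<otimes> (a \<otimes> b) \<otimes> inv a = b \<otimes> inv a" using Ac[OF a] b by (simp flip: m_assoc)
        ultimately show "inv a \<otimes> b = b \<otimes> inv a" by simp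
      qed (use a AK in auto)
    next
      fix a c assume a: "a \<in> A" "c \<in> A"
      show "a \<otimes> c \<in> A" unfolding A_def
      proof (intro CollectI conjI ballI impI)
        fix b assume b: "b \<in> K" "b \<otimes> x = x \<otimes> b"
        then have e: "a \<otimes> b = b \<otimes> a" "c \<otimes> b = b \<otimes> c" using a by (auto simp: A_def)
        have "a \<otimes> c \<otimes> b = a \<otimes> b \<otimes> c" using e(2) Ac a b by (simp add: m_assoc)
        also have "\<dots> = b \<otimes> a \<otimes> c" using e by simp
        also have "\<dots> = b \<otimes> (a \<otimes> c)" using Ac a b by (simp add: m_assoc)
        finally show "a \<otimes> c \<otimes> b = b \<otimes> (a \<otimes> c)" .
      qed (use a AK in auto)
    qed (use AK xA in auto)
    have comm: "a \<otimes> b = b \<otimes> a" if "a \<in> A" "b \<in> A" for a b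
    proof -
      have "b \<otimes> x = x \<otimes> b" using that(2) x by (auto simp: A_def)
      then show ?thesis using that AK by (auto simp: A_def)
    qed
    have pwA: "a [^] (n::nat) \<in> A" if "a \<in> A" for a n
      by (induction n) (use that A in \<open>auto intro: subgroup.m_closed subgroup.one_closed\<close>)
    have Alim: "l \<in> A" if "ultrafilter U" "l \<in> K" "limitin T f l U" "\<And>n. f n \<in> A" for f l and U :: "nat filter"
      unfolding A_def
    proof (intro CollectI conjI ballI impI)
      fix b assume b: "b \<in> K" "b \<otimes> x = x \<otimes> b"
      have "limitin T (\<lambda>n. b) b U" using b by (simp add: limitin_const_iff)
      then have "limitin T (\<lambda>n. f n \<otimes> b) (l \<otimes> b) U" "limitin T (\<lambda>n. b \<otimes> f n) (b \<otimes> l) U"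
        using that(3) limitin_mult by blast+
      moreover have "(\<lambda>n. f n \<otimes> b) = (\<lambda>n. b \<otimes> f n)" using that(4) b by (auto simp: A_def)
      ultimately show "l \<otimes> b = b \<otimes> l" using lim_uniq that(1) by metis
    qed (rule that(2))
    have \<phi>m: "\<phi> (a \<otimes> b) = \<phi> a \<otimes>\<^bsub>G\<^esub> \<phi> b" if "a \<in> A" "b \<in> A" for a b
      using Ac that by simp
    obtain \<psi>' :: "'c \<Rightarrow> int" where \<psi>': "\<And>a b. a \<in> \<phi> ` A \<Longrightarrow> b \<in> \<phi> ` A \<Longrightarrow> \<psi>' (a \<otimes>\<^bsub>G\<^esub> b) = \<psi>' a + \<psi>' b" "\<psi>' (\<phi> x) \<noteq> 0"
    proof (rule class_G_int_hom[OF G _ _ _ o])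
      show "subgroup (\<phi> ` A) G" by (rule \<phi>.subgroup_img_is_subgroup[OF A])
      show "a \<otimes>\<^bsub>G\<^esub> b = b \<otimes>\<^bsub>G\<^esub> a" if "a \<in> \<phi> ` A" "b \<in> \<phi> ` A" for a b
        using that comm by (auto simp flip: \<phi>m)
    qed (use xA in auto)
    define \<psi> where "\<psi> a = \<psi>' (\<phi> a)" for a
    have \<psi>: "\<psi> (a \<otimes> b) = \<psi> a + \<psi> b" if "a \<in> A" "b \<in> A" for a b
      using \<psi>'(1)[of "\<phi> a" "\<phi> b"] that by (simp add: \<psi>_def \<phi>m)
    have \<psi>1: "\<psi> \<one> = 0" using \<psi>[OF subgroup.one_closed[OF A] subgroup.one_closed[OF A]] by simp
    have \<psi>p: "\<psi> (a [^] n) = int n * \<psi> a" if "a \<in> A" for a and n :: nat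
      by (induction n) (simp_all add: \<psi>1 \<psi> that pwA algebra_simps)
    define m where "m = \<psi> x"
    have m0: "m \<noteq> 0" using \<psi>'(2) by (simp add: m_def \<psi>_def)
    \<comment> \<open>Then k - 1 = \<bar>m\<bar> + 1 cannot divide m \<noteq> 0.\<close>
    define k where "k = nat \<bar>m\<bar> + 2"
    \<comment> \<open>The exponents 1 + k + ... + k^(j-1), for which e(j+1) = 1 + k e(j). As N
      grows, x to the power e(N - n) then turns this recursion into y n = x (y (n+1))^k; the
      subtraction is a genuine one as soon as n < N.\<close>
    define e where "e j = (\<Sum>i<j. k ^ i)" for j :: nat
    have eS: "e (Suc j) = 1 + k * e j" for j
      unfolding e_def by (subst sum.lessThan_Suc_shift) (simp add: sum_distrib_left)
    obtain U :: "nat filter" where U: "ultrafilter U" "U \<le> sequentially"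
      using ultrafilter_exists[of sequentially] by auto
    have "\<exists>y\<in>K. limitin T (\<lambda>N. x [^] e (N - n)) y U" for n
      using ultrafilter_compactin_limit[OF U(1) K(2), of "\<lambda>N. x [^] e (N - n)"] pwA[OF xA] AK
      by (metis (no_types, lifting) always_eventually subsetD)
    then obtain y where y: "\<And>n. y n \<in> K" "\<And>n. limitin T (\<lambda>N. x [^] e (N - n)) (y n) U" by metis
    have yA: "y n \<in> A" for n using Alim[OF U(1) y(1) y(2)] pwA[OF xA] by blast
    have rec: "y n = x \<otimes> y (Suc n) [^] k" for n
    proof (rule lim_uniq[OF y(2) _ U(1)])
      have l: "limitin T (\<lambda>N. x \<otimes> (x [^] e (N - Suc n)) [^] k) (x \<otimes> y (Suc n) [^] k) U"
        using Ac[OF xA] by (intro limitin_mult limitin_pow y(2)) (simp add: limitin_const_iff)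
      show "limitin T (\<lambda>N. x [^] e (N - n)) (x \<otimes> y (Suc n) [^] k) U"
      proof (rule limitin_transform_eventually[OF _ l])
        have "eventually (\<lambda>N. n < N) U" using U(2) eventually_gt_at_top filter_leD by blast
        then show "eventually (\<lambda>N. x \<otimes> (x [^] e (N - Suc n)) [^] k = x [^] e (N - n)) U"
        proof eventually_elim
          case (elim N)
          then have "N - n = Suc (N - Suc n)" by simp
          then have "e (N - n) = Suc (e (N - Suc n) * k)" using eS[of "N - Suc n"] by (simp add: mult.commute)
          moreover have "x \<otimes> (x [^] e (N - Suc n)) [^] k = x [^] Suc (e (N - Suc n) * k)"
            using Ac[OF xA] by (simp only: nat_pow_pow nat_pow_Suc2)
          ultimately show ?case by simp
        qed
      qed
    qed
    define z where "z n = \<psi> (y n)" for n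
    have zr: "z n = m + int k * z (Suc n)" for n
      using rec[of n] \<psi>[OF xA pwA[OF yA]] \<psi>p[OF yA] by (simp add: z_def m_def)
    \<comment> \<open>The shift by m makes the recursion for \<open>z\<close> purely multiplicative,
      so the value at 0 is divisible by every power of \<open>k\<close> and must vanish.\<close>
    have it: "(int k - 1) * z 0 + m = int k ^ n * ((int k - 1) * z n + m)" for n
    proof (induction n)
      case (Suc n)
      have "(int k - 1) * z n + m = int k * ((int k - 1) * z (Suc n) + m)"
        by (subst zr) (simp add: algebra_simps)
      from Suc this show ?case by (simp only: power_Suc mult.assoc mult.left_commute[of "int k"])
    qed simp
    define w where "w = (int k - 1) * z 0 + m"
    have "w = 0"
    proof (rule ccontr)
      assume w: "w \<noteq> 0"
      have "int k ^ nat \<bar>w\<bar> dvd w" using it[of "nat \<bar>w\<bar>"] unfolding w_def[symmetric] by (metis dvd_triv_left)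
      then have "int k ^ nat \<bar>w\<bar> \<le> \<bar>w\<bar>" using dvd_imp_le_int[OF w, of "int k ^ nat \<bar>w\<bar>"] by simp
      moreover have "int 2 ^ nat \<bar>w\<bar> \<le> int k ^ nat \<bar>w\<bar>" by (intro power_mono) (simp_all add: k_def)
      moreover have "\<bar>w\<bar> < int 2 ^ nat \<bar>w\<bar>"
      proof -
        have "int (nat \<bar>w\<bar>) < int (2 ^ nat \<bar>w\<bar>)" using less_exp of_nat_less_iff by blast
        then show ?thesis by simp
      qed
      ultimately show False by linarith
    qed
    then have "(int k - 1) dvd m" unfolding w_def by (metis add.commute add_eq_0_iff dvd_minus_iff dvd_triv_left)
    then have "\<bar>int k - 1\<bar> \<le> \<bar>m\<bar>" using dvd_imp_le_int[OF m0] by blast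
    then show False by (simp add: k_def)
  qed
  then have "torsion_subgroup G (\<phi> ` K)"
    unfolding torsion_subgroup_def using \<phi>.subgroup_img_is_subgroup[OF K(1)] by blast
  then show ?thesis using G by (simp add: class_G_def)
qed

end

section \<open>Quotients by compact normal subgroups\<close>

context lcgrp
begin

text \<open>The saturation of an open \<open>U\<close> is \<open>K <#> U\<close>, hence open, so the
  projection is open. This transports neighbourhoods of products and local compactness to the
  quotient topology; the Hausdorff property comes from \<open>K\<close> being closed.\<close>

lemma lcgrp_quotient:
  assumes K: "K \<lhd> L" "closedin T K"
  obtains Q where "lcgrp (L Mod K) Q" "continuous_map T Q (\<lambda>x. K #> x)" "open_map T Q (\<lambda>x. K #> x)"
proof -
  interpret K: normal K L by (rule K(1))
  have sK: "subgroup K L" by (rule K.subgroup_axioms)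
  interpret Q: group "L Mod K" by (rule K.factorgroup_is_group)
  define opn where "opn = (\<lambda>S. S \<subseteq> carrier (L Mod K) \<and> openin T {x \<in> carrier L. K #> x \<in> S})"
  have ist: "istopology opn"
    unfolding istopology_def
  proof (intro conjI allI impI)
    fix A B assume "opn A" "opn B"
    moreover have "{x \<in> carrier L. K #> x \<in> A \<inter> B} = {x \<in> carrier L. K #> x \<in> A} \<inter> {x \<in> carrier L. K #> x \<in> B}" by auto
    ultimately show "opn (A \<inter> B)" by (auto simp: opn_def)
  next
    fix \<K> assume "\<forall>A\<in>\<K>. opn A"
    moreover have "{x \<in> carrier L. K #> x \<in> \<Union>\<K>} = (\<Union>A\<in>\<K>. {x \<in> carrier L. K #> x \<in> A})" by auto
    ultimately show "opn (\<Union>\<K>)" by (auto simp: opn_def intro!: openin_Union)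
  qed
  define Q where "Q = topology opn"
  have op: "openin Q S \<longleftrightarrow> S \<subseteq> carrier (L Mod K) \<and> openin T {x \<in> carrier L. K #> x \<in> S}" for S
    using topology_inverse'[OF ist] by (simp add: Q_def opn_def)
  have \<pi>c: "K #> x \<in> carrier (L Mod K)" if "x \<in> carrier L" for x
    using that by (simp add: carrier_FactGroup)
  have eq: "K #> x = K #> y \<longleftrightarrow> x \<otimes> inv y \<in> K" if "x \<in> carrier L" "y \<in> carrier L" for x y
  proof
    assume "K #> x = K #> y"
    then have "x \<in> K #> y" using rcos_self[OF that(1) sK] by simp
    then obtain k where "k \<in> K" "x = k \<otimes> y" by (auto simp: r_coset_def)
    then show "x \<otimes> inv y \<in> K" using that by (simp add: m_assoc)
  next
    assume "x \<otimes> inv y \<in> K"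
    moreover have "x = (x \<otimes> inv y) \<otimes> y" using that by (simp add: m_assoc)
    ultimately have "x \<in> K #> y" unfolding r_coset_def by blast
    then show "K #> x = K #> y" using repr_independence[OF _ that(2) sK] by simp
  qed
  have tsQ: "topspace Q = carrier (L Mod K)"
  proof -
    have "openin Q (carrier (L Mod K))"
      using \<pi>c openin_topspace[of T] by (simp add: op cong: conj_cong)
    then show ?thesis using openin_subset[of Q] op openin_topspace[of Q] by blast
  qed
  have cont: "continuous_map T Q (\<lambda>x. K #> x)"
    unfolding continuous_map_def using \<pi>c op tsQ by (auto simp: Pi_iff)
  have om: "open_map T Q (\<lambda>x. K #> x)"
    unfolding open_map_def
  proof (intro allI impI)
    fix U assume U: "openin T U"
    have Uc: "U \<subseteq> carrier L" using openin_subset[OF U] by simp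
    have "{x \<in> carrier L. K #> x \<in> (\<lambda>x. K #> x) ` U} = K <#> U"
    proof (intro equalityI subsetI)
      fix x assume "x \<in> {x \<in> carrier L. K #> x \<in> (\<lambda>x. K #> x) ` U}"
      then obtain u where u: "x \<in> carrier L" "u \<in> U" "K #> x = K #> u" by auto
      then have "x \<in> K #> u" using rcos_self[OF u(1) sK] by simp
      then show "x \<in> K <#> U" using u(2) by (auto simp: r_coset_def set_mult_def)
    next
      fix x assume "x \<in> K <#> U"
      then obtain k u where u: "k \<in> K" "u \<in> U" "x = k \<otimes> u" by (auto simp: set_mult_def)
      then have "x \<in> K #> u" by (auto simp: r_coset_def)
      then have "K #> x = K #> u" using repr_independence[OF _ _ sK, of x u] u Uc by auto
      then show "x \<in> {x \<in> carrier L. K #> x \<in> (\<lambda>x. K #> x) ` U}" using u Uc by auto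
    qed
    then show "openin Q ((\<lambda>x. K #> x) ` U)"
      using openin_set_mult_right[OF K.subset U] Uc \<pi>c by (auto simp: op)
  qed
  have nb: "\<exists>A B. openin T A \<and> openin T B \<and> a \<in> A \<and> b \<in> B \<and> (\<forall>x\<in>A. \<forall>y\<in>B. f x y \<in> W)"
    if f: "continuous_map (prod_topology T T) T (\<lambda>p. f (fst p) (snd p))" "openin T W"
      and ab: "a \<in> carrier L" "b \<in> carrier L" "f a b \<in> W" for f W a b
  proof -
    have "openin (prod_topology T T) {p \<in> topspace (prod_topology T T). f (fst p) (snd p) \<in> W}"
      by (rule openin_continuous_map_preimage[OF f])
    moreover have "(a, b) \<in> {p \<in> topspace (prod_topology T T). f (fst p) (snd p) \<in> W}" using ab by simp
    ultimately obtain A B where "openin T A" "openin T B" "a \<in> A" "b \<in> B"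
      and AB: "A \<times> B \<subseteq> {p \<in> topspace (prod_topology T T). f (fst p) (snd p) \<in> W}"
      unfolding openin_prod_topology_alt by meson
    moreover have "f x y \<in> W" if "x \<in> A" "y \<in> B" for x y using subsetD[OF AB, of "(x, y)"] that by simp
    ultimately show ?thesis by blast
  qed
  have "lcgrp (L Mod K) Q"
  proof (unfold_locales)
    show "topspace Q = carrier (L Mod K)" by (rule tsQ)
    show "continuous_map (prod_topology Q Q) Q (\<lambda>p. fst p \<otimes>\<^bsub>L Mod K\<^esub> snd p)"
      unfolding continuous_map_def
    proof (intro conjI allI impI)
      show "(\<lambda>p. fst p \<otimes>\<^bsub>L Mod K\<^esub> snd p) \<in> topspace (prod_topology Q Q) \<rightarrow> topspace Q"
        using Q.m_closed by (auto simp: tsQ)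
      fix S assume S: "openin Q S"
      show "openin (prod_topology Q Q) {p \<in> topspace (prod_topology Q Q). fst p \<otimes>\<^bsub>L Mod K\<^esub> snd p \<in> S}"
        unfolding openin_prod_topology_alt
      proof (intro allI impI)
        fix u v assume "(u, v) \<in> {p \<in> topspace (prod_topology Q Q). fst p \<otimes>\<^bsub>L Mod K\<^esub> snd p \<in> S}"
        then have "u \<in> carrier (L Mod K)" "v \<in> carrier (L Mod K)" and uvS: "u <#> v \<in> S" by (auto simp: tsQ)
        then obtain a b where ab: "a \<in> carrier L" "b \<in> carrier L" "u = K #> a" "v = K #> b"
          unfolding carrier_FactGroup by blast
        have oS: "openin T {x \<in> carrier L. K #> x \<in> S}" using S by (simp add: op)
        have abS: "a \<otimes> b \<in> {x \<in> carrier L. K #> x \<in> S}" using uvS ab K.rcos_sum by simp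
        obtain A B where AB: "openin T A" "openin T B" "a \<in> A" "b \<in> B"
          "\<forall>x\<in>A. \<forall>y\<in>B. x \<otimes> y \<in> {x \<in> carrier L. K #> x \<in> S}"
          using nb[of "\<lambda>x y. x \<otimes> y", OF cont_mult oS ab(1,2) abS] by (elim exE conjE) (rule that)
        have AL: "A \<subseteq> carrier L" "B \<subseteq> carrier L" using AB(1,2) openin_subset by fastforce+
        show "\<exists>U V. openin Q U \<and> openin Q V \<and> u \<in> U \<and> v \<in> V \<and>
            U \<times> V \<subseteq> {p \<in> topspace (prod_topology Q Q). fst p \<otimes>\<^bsub>L Mod K\<^esub> snd p \<in> S}"
        proof (intro exI conjI)
          show "openin Q ((\<lambda>x. K #> x) ` A)" "openin Q ((\<lambda>x. K #> x) ` B)" using om AB by (auto simp: open_map_def)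
          show "u \<in> (\<lambda>x. K #> x) ` A" "v \<in> (\<lambda>x. K #> x) ` B" using AB ab by auto
          show "(\<lambda>x. K #> x) ` A \<times> (\<lambda>x. K #> x) ` B \<subseteq> {p \<in> topspace (prod_topology Q Q). fst p \<otimes>\<^bsub>L Mod K\<^esub> snd p \<in> S}"
          proof clarsimp
            fix x y assume xy: "x \<in> A" "y \<in> B"
            then have "(K #> x) <#> (K #> y) = K #> (x \<otimes> y)" using AL by (intro K.rcos_sum) auto
            then show "K #> x \<in> topspace Q \<and> K #> y \<in> topspace Q \<and> (K #> x) <#> (K #> y) \<in> S"
              using xy AB(5) AL \<pi>c by (auto simp: tsQ)
          qed
        qed
      qed
    qed
    show "continuous_map Q Q (\<lambda>x. inv\<^bsub>L Mod K\<^esub> x)"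
    proof (rule continuous_compose_quotient_map)
      show "quotient_map T Q (\<lambda>x. K #> x)"
        using cont om by (rule continuous_open_imp_quotient_map) (simp add: tsQ carrier_FactGroup)
      have "continuous_map T Q (\<lambda>x. K #> inv x)"
        using continuous_map_compose[OF cont_inv cont] by (simp add: o_def)
      then show "continuous_map T Q ((\<lambda>x. inv\<^bsub>L Mod K\<^esub> x) \<circ> (\<lambda>x. K #> x))"
        by (rule continuous_map_eq) (simp add: K.inv_FactGroup \<pi>c K.rcos_inv)
    qed
    show "Hausdorff_space Q"
      unfolding Hausdorff_space_def
    proof (intro allI impI)
      fix u v assume uv: "u \<in> topspace Q \<and> v \<in> topspace Q \<and> u \<noteq> v"
      then obtain a b where ab: "a \<in> carrier L" "b \<in> carrier L" "u = K #> a" "v = K #> b"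
        unfolding tsQ carrier_FactGroup by blast
      have nK: "a \<otimes> inv b \<in> carrier L - K" using eq[OF ab(1,2)] uv ab by auto
      have c: "continuous_map (prod_topology T T) T (\<lambda>p. fst p \<otimes> inv (snd p))"
        by (intro continuous_intros continuous_map_fst continuous_map_snd)
      have oK: "openin T (carrier L - K)" using openin_diff[OF openin_topspace K(2)] by simp
      obtain A B where AB: "openin T A" "openin T B" "a \<in> A" "b \<in> B"
        "\<forall>x\<in>A. \<forall>y\<in>B. x \<otimes> inv y \<in> carrier L - K"
        using nb[of "\<lambda>x y. x \<otimes> inv y", OF c oK ab(1,2) nK] by (elim exE conjE) (rule that)
      have AL: "A \<subseteq> carrier L" "B \<subseteq> carrier L" using AB(1,2) openin_subset by fastforce+
      show "\<exists>U V. openin Q U \<and> openin Q V \<and> u \<in> U \<and> v \<in> V \<and> disjnt U V"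
      proof (intro exI conjI)
        show "openin Q ((\<lambda>x. K #> x) ` A)" "openin Q ((\<lambda>x. K #> x) ` B)" using om AB by (auto simp: open_map_def)
        show "u \<in> (\<lambda>x. K #> x) ` A" "v \<in> (\<lambda>x. K #> x) ` B" using AB ab by auto
        have "K #> x \<noteq> K #> y" if "x \<in> A" "y \<in> B" for x y
          using eq[of x y] AB(5) AL that by blast
        then show "disjnt ((\<lambda>x. K #> x) ` A) ((\<lambda>x. K #> x) ` B)" by (auto simp: disjnt_def)
      qed
    qed
    show "locally_compact_space Q"
      by (rule locally_compact_space_continuous_open_map_image[OF cont om _ lc_T]) (simp add: tsQ carrier_FactGroup)
  qed
  then show ?thesis using that cont om by blast
qed

text \<open>The hypothesis on \<open>\<Omega>\<close> says that \<open>L Mod K\<close> has no small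
  subgroups. Homomorphisms from the reals into \<open>L Mod K\<close> take values in the image of
  the kernel, since \<open>G\<close> admits only the trivial one; so that image contains a
  neighbourhood, and it pulls back to the kernel because \<open>\<phi>\<close> kills
  \<open>K\<close>.\<close>

lemma nss_modulo_kernel_contains_nbh:
  fixes G :: "('c, 'd) monoid_scheme"
  assumes K: "K \<lhd> L" "compactin T K" and \<Omega>: "openin T \<Omega>" "K \<subseteq> \<Omega>" "\<And>P. subgroup P L \<Longrightarrow> P \<subseteq> \<Omega> \<Longrightarrow> P \<subseteq> K"
    and G: "class_G G" and \<phi>: "\<phi> \<in> hom L G" "\<And>x. x \<in> K \<Longrightarrow> \<phi> x = \<one>\<^bsub>G\<^esub>"
  obtains V where "nbh V" "\<And>x. x \<in> V \<Longrightarrow> \<phi> x = \<one>\<^bsub>G\<^esub>"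
proof -
  interpret G: group G using G by (simp add: class_G_def)
  interpret K: normal K L by (rule K(1))
  interpret \<phi>: group_hom L G \<phi> using \<phi>(1) by unfold_locales
  have sK: "subgroup K L" by (rule K.subgroup_axioms)
  obtain Q where Q: "lcgrp (L Mod K) Q" "continuous_map T Q (\<lambda>x. K #> x)" "open_map T Q (\<lambda>x. K #> x)"
    using lcgrp_quotient[OF K(1) compactin_closed[OF K(2)]] .
  interpret Q: lcgrp "L Mod K" Q by (rule Q(1))
  interpret \<pi>: group_hom L "L Mod K" "\<lambda>x. K #> x"
    using K.r_coset_hom_Mod by unfold_locales
  have repr: "\<exists>k\<in>K. x = k \<otimes> y" if "x \<in> carrier L" "K #> x = K #> y" for x y
    using rcos_self[OF that(1) sK] that(2) by (auto simp: r_coset_def)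
  have \<phi>eq: "\<phi> x = \<phi> y" if "x \<in> carrier L" "y \<in> carrier L" "K #> x = K #> y" for x y
    using repr[OF that(1,3)] that(2) \<phi>(2) by auto
  have K1: "K #> \<one> = K" using coset_mult_one[OF K.subset] .
  obtain V1 where V1: "nbh V1" "K <#> V1 \<subseteq> \<Omega>" using nbh_compact_mult[OF K(2) \<Omega>(1,2)] .
  have V1c: "V1 \<subseteq> carrier L" using nbh_carrier[OF V1(1)] .
  obtain W where W: "Q.nbh W" "W \<subseteq> (\<lambda>x. K #> x) ` kernel L G \<phi>"
  proof (rule Q.nss_contains_nbh)
    show "Q.nbh ((\<lambda>x. K #> x) ` V1)"
      unfolding Q.nbh_def using V1(1) Q(3) K1 by (auto simp: nbh_def open_map_def image_iff intro!: bexI[of _ \<one>])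
    show "P \<subseteq> {\<one>\<^bsub>L Mod K\<^esub>}" if P: "subgroup P (L Mod K)" "P \<subseteq> (\<lambda>x. K #> x) ` V1" for P
    proof -
      define P' where "P' = {x \<in> carrier L. K #> x \<in> P}"
      have "subgroup P' L"
      proof (rule subgroupI)
        show "P' \<noteq> {}" using subgroup.one_closed[OF P(1)] K1 by (auto simp: P'_def intro!: exI[of _ \<one>])
        show "inv a \<in> P'" if "a \<in> P'" for a
          using subgroup.m_inv_closed[OF P(1), of "K #> a"] that \<pi>.hom_inv[of a] by (simp add: P'_def)
        show "a \<otimes> b \<in> P'" if "a \<in> P'" "b \<in> P'" for a b
          using subgroup.m_closed[OF P(1), of "K #> a" "K #> b"] that \<pi>.hom_mult[of a b] by (simp add: P'_def)
      qed (auto simp: P'_def)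
      moreover have "P' \<subseteq> \<Omega>"
      proof
        fix x assume "x \<in> P'"
        then obtain v where v: "x \<in> carrier L" "v \<in> V1" "K #> x = K #> v" using P(2) by (auto simp: P'_def)
        then have "x \<in> K <#> V1" using repr[of x v] by (auto simp: set_mult_def)
        then show "x \<in> \<Omega>" using V1(2) by blast
      qed
      ultimately have P'K: "P' \<subseteq> K" by (rule \<Omega>(3))
      show ?thesis
      proof
        fix u assume u: "u \<in> P"
        then obtain v where v: "v \<in> V1" "u = K #> v" using P(2) by blast
        then have "v \<in> P'" using u V1c by (auto simp: P'_def)
        then have "v \<in> K" using P'K by blast
        then show "u \<in> {\<one>\<^bsub>L Mod K\<^esub>}" using v(2) K.rcos_const[OF is_group] by simp
      qed
    qed
    show "subgroup ((\<lambda>x. K #> x) ` kernel L G \<phi>) (L Mod K)"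
      by (rule \<pi>.subgroup_img_is_subgroup[OF \<phi>.subgroup_kernel])
    fix \<xi> :: "real \<Rightarrow> 'a set" and t
    assume \<xi>: "\<And>t. \<xi> t \<in> carrier (L Mod K)" "\<And>s t. \<xi> (s + t) = \<xi> s \<otimes>\<^bsub>L Mod K\<^esub> \<xi> t"
    have "\<exists>x. x \<in> carrier L \<and> \<xi> t = K #> x" for t using \<xi>(1)[of t] by (auto simp: carrier_FactGroup)
    \<comment> \<open>The representatives are arbitrary and \<open>r\<close> need not be a
      homomorphism, but its composite with \<open>\<phi>\<close> is one, as \<open>\<phi>\<close> is
      constant on the cosets of \<open>K\<close>.\<close>
    then obtain r where r: "\<And>t. r t \<in> carrier L" "\<And>t. \<xi> t = K #> r t" by metis
    have "\<phi> (r (s + t)) = \<phi> (r s) \<otimes>\<^bsub>G\<^esub> \<phi> (r t)" for s t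
    proof -
      have "K #> r (s + t) = K #> (r s \<otimes> r t)"
        using \<xi>(2)[of s t] r \<pi>.hom_mult[of "r s" "r t"] by simp
      then show ?thesis using \<phi>eq[of "r (s + t)" "r s \<otimes> r t"] r(1) by simp
    qed
    then have "\<phi> (r t) = \<one>\<^bsub>G\<^esub>"
      using class_G_real_hom_trivial[OF G, of "\<lambda>t. \<phi> (r t)" t] r(1) by simp
    then show "\<xi> t \<in> (\<lambda>x. K #> x) ` kernel L G \<phi>" using r by (auto simp: kernel_def)
  qed
  show ?thesis
  proof (rule that[of "{x \<in> carrier L. K #> x \<in> W}"])
    show "nbh {x \<in> carrier L. K #> x \<in> W}"
      using openin_continuous_map_preimage[OF Q(2), of W] W(1) K1 by (auto simp: nbh_def Q.nbh_def)
    fix x assume "x \<in> {x \<in> carrier L. K #> x \<in> W}"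
    then obtain y where "x \<in> carrier L" "y \<in> kernel L G \<phi>" "K #> x = K #> y" using W(2) by auto
    then show "\<phi> x = \<one>\<^bsub>G\<^esub>" using \<phi>eq[of x y] by (auto simp: kernel_def)
  qed
qed

definition qinf :: "'a set \<Rightarrow> 'a set" where
  "qinf V = {x \<in> carrier L. \<forall>j::nat. x [^] j \<in> V}"

text \<open>A member of \<open>qinf V\<close> is a generator of weight 1/n for every n. A word of
  length k thus has weight k/n for every n, which is eventually below 1/C.\<close>

lemma generate_qinf_subset:
  assumes V: "symm V" and C: "1 \<le> C" and U: "\<And>\<nu>. Bset (pgen V \<nu>) (1 / real C) \<subseteq> U"
  shows "generate L (qinf V) \<subseteq> U"
proof
  fix g assume "g \<in> generate L (qinf V)"
  then have "\<exists>k::nat. \<forall>n\<ge>1. ball (pgen V n) g (real k / real n)"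
  proof (induction rule: generate.induct)
    case one
    show ?case by (rule exI[of _ 0]) (auto intro: ball.ball_one)
  next
    case (incl h)
    have "ball (pgen V n) (h \<otimes> \<one>) (0 + 1 / real n)" if "n \<ge> 1" for n
      using incl that by (intro ball.ball_step ball.ball_one) (auto simp: pgen_def qset_def qinf_def)
    then show ?case using incl by (intro exI[of _ 1]) (auto simp: qinf_def)
  next
    case (inv h)
    have "ball (pgen V n) (inv h \<otimes> \<one>) (0 + 1 / real n)" if n: "n \<ge> 1" for n
    proof -
      have "pgen V n h (1 / real n)" using inv n by (auto simp: pgen_def qset_def qinf_def)
      then show ?thesis using good_genD[OF good_pgen[OF V]] by (intro ball.ball_step ball.ball_one) auto
    qed
    then show ?case using inv by (intro exI[of _ 1]) (auto simp: qinf_def)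
  next
    case (eng h1 h2)
    then obtain k l where "\<forall>n\<ge>1. ball (pgen V n) h1 (real k / real n)" "\<forall>n\<ge>1. ball (pgen V n) h2 (real l / real n)" by blast
    then have "ball (pgen V n) (h1 \<otimes> h2) (real k / real n + real l / real n)" if "n \<ge> 1" for n
      using that ball_mult[OF good_pgen[OF V]] by blast
    then show ?case by (intro exI[of _ "k + l"]) (auto simp: add_divide_distrib)
  qed
  then obtain k :: nat where k: "\<And>n. n \<ge> 1 \<Longrightarrow> ball (pgen V n) g (real k / real n)" by blast
  define n where "n = k * C + 1"
  have "real k / real n \<le> 1 / real C" using C by (simp add: n_def field_simps flip: of_nat_mult of_nat_add)
  then have "g \<in> Bset (pgen V n) (1 / real C)" using k[of n] by (auto simp: Bset_def n_def)
  then show "g \<in> U" using U by blast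
qed

end

section \<open>The kernel of a homomorphism into a group of class G\<close>

lemma (in group) inv_mult_cancel: "x \<in> carrier G \<Longrightarrow> y \<in> carrier G \<Longrightarrow> inv x \<otimes> (x \<otimes> y) = y"
  by (simp flip: m_assoc)

lemma (in group) mult_inv_cancel: "x \<in> carrier G \<Longrightarrow> y \<in> carrier G \<Longrightarrow> x \<otimes> (inv x \<otimes> y) = y"
  by (simp flip: m_assoc)

context lcgrp
begin

lemma openin_subgroup_contains_nbh:
  assumes H: "subgroup H L" "nbh V" "V \<subseteq> H"
  shows "openin T H"
proof -
  have Hc: "H \<subseteq> carrier L" using H(1) by (rule subgroup.subset)
  have "H <#> V = H"
  proof (intro equalityI subsetI)
    fix x assume "x \<in> H <#> V"
    then show "x \<in> H" using H(1,3) by (auto simp: set_mult_def intro: subgroup.m_closed)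
  next
    fix x assume x: "x \<in> H"
    then have "x = x \<otimes> \<one>" using Hc by auto
    then show "x \<in> H <#> V" using x H(2) unfolding set_mult_def nbh_def by blast
  qed
  then show ?thesis using openin_set_mult_right[OF Hc, of V] H(2) by (simp add: nbh_def)
qed

text \<open>A subgroup inside \<open>V0\<close> consists of elements all of whose powers stay in
  \<open>V0\<close>, so it lies in \<open>H\<close>, where the gap applies; hence subgroups inside
  \<open>\<Omega>\<close> lie in \<open>K\<close>. This also covers the conjugates of
  \<open>K\<close> by elements near \<open>\<one>\<close>, which is why the normaliser
  \<open>L'\<close> is open.\<close>

lemma kernel_contains_nbh:
  fixes G :: "('c, 'd) monoid_scheme"
  assumes V0: "nbh V0" and H: "subgroup H L" "compactin T H" "qinf V0 \<subseteq> H"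
    and G: "class_G G" and \<phi>: "\<phi> \<in> hom L G" "\<And>x. x \<in> H \<Longrightarrow> \<phi> x = \<one>\<^bsub>G\<^esub>"
  obtains V where "nbh V" "\<And>x. x \<in> V \<Longrightarrow> \<phi> x = \<one>\<^bsub>G\<^esub>"
proof -
  obtain K W where K: "subgroup K L" "compactin T K" "K \<subseteq> V0" "K \<subseteq> H" and W: "nbh W"
    "\<And>P. subgroup P L \<Longrightarrow> P \<subseteq> H \<Longrightarrow> P \<subseteq> W <#> K \<Longrightarrow> P \<subseteq> K"
    using compact_subgroup_gap[OF H(1,2) V0] by blast
  interpret K: subgroup K L by (rule K(1))
  define \<Omega> where "\<Omega> = V0 \<inter> (W <#> K)"
  have \<Omega>o: "openin T \<Omega>"
    unfolding \<Omega>_def using V0 W(1) openin_set_mult_left[OF K.subset, of W] by (auto simp: nbh_def)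
  have K\<Omega>: "K \<subseteq> \<Omega>"
  proof
    fix x assume x: "x \<in> K"
    then have "x = \<one> \<otimes> x" by simp
    then have "x \<in> W <#> K" using x W(1) unfolding set_mult_def nbh_def by blast
    then show "x \<in> \<Omega>" using x K(3) by (auto simp: \<Omega>_def)
  qed
  have \<Omega>: "P \<subseteq> K" if P: "subgroup P L" "P \<subseteq> \<Omega>" for P
  proof (rule W(2)[OF P(1)])
    show "P \<subseteq> W <#> K" using P(2) by (auto simp: \<Omega>_def)
    have "x [^] (j::nat) \<in> P" if "x \<in> P" for x j
      by (induction j) (use that P(1) in \<open>auto intro: subgroup.m_closed subgroup.one_closed\<close>)
    then have "P \<subseteq> qinf V0" using P(2) subgroup.subset[OF P(1)] by (auto simp: qinf_def \<Omega>_def)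
    then show "P \<subseteq> H" using H(3) by blast
  qed
  have conj_sub: "(\<lambda>k. x \<otimes> k \<otimes> inv x) ` K \<subseteq> K" if x: "x \<in> carrier L" "\<And>k. k \<in> K \<Longrightarrow> x \<otimes> k \<otimes> inv x \<in> \<Omega>" for x
  proof (rule \<Omega>)
    show "subgroup ((\<lambda>k. x \<otimes> k \<otimes> inv x) ` K) L"
    proof (rule subgroupI)
      fix a assume "a \<in> (\<lambda>k. x \<otimes> k \<otimes> inv x) ` K"
      then obtain k where k: "k \<in> K" "a = x \<otimes> k \<otimes> inv x" by blast
      then have "inv a = x \<otimes> inv k \<otimes> inv x" using x(1) by (simp add: inv_mult_group m_assoc)
      then show "inv a \<in> (\<lambda>k. x \<otimes> k \<otimes> inv x) ` K" using k by auto
    next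
      fix a b assume "a \<in> (\<lambda>k. x \<otimes> k \<otimes> inv x) ` K" "b \<in> (\<lambda>k. x \<otimes> k \<otimes> inv x) ` K"
      then obtain k l where k: "k \<in> K" "a = x \<otimes> k \<otimes> inv x" "l \<in> K" "b = x \<otimes> l \<otimes> inv x" by blast
      have "a \<otimes> b = x \<otimes> (k \<otimes> l) \<otimes> inv x" unfolding k(2,4) using x(1) k(1,3) by (simp add: m_assoc inv_mult_cancel)
      then show "a \<otimes> b \<in> (\<lambda>k. x \<otimes> k \<otimes> inv x) ` K" using k by auto
    next
      show "(\<lambda>k. x \<otimes> k \<otimes> inv x) ` K \<noteq> {}" using K.one_closed by blast
    qed (use x(1) in auto)
  qed (use x(2) in auto)
  \<comment> \<open>Both directions of conjugation are demanded, so that closure under inverses is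
    immediate.\<close>
  define L' where "L' = {x \<in> carrier L. \<forall>k\<in>K. x \<otimes> k \<otimes> inv x \<in> K \<and> inv x \<otimes> k \<otimes> x \<in> K}"
  have L': "subgroup L' L"
  proof (rule subgroupI)
    show "L' \<noteq> {}" by (auto simp: L'_def intro!: exI[of _ \<one>])
    show "inv a \<in> L'" if "a \<in> L'" for a using that by (auto simp: L'_def)
    show "a \<otimes> b \<in> L'" if ab: "a \<in> L'" "b \<in> L'" for a b
      unfolding L'_def
    proof (intro CollectI conjI ballI)
      fix k assume k: "k \<in> K"
      have "a \<otimes> b \<otimes> k \<otimes> inv (a \<otimes> b) = a \<otimes> (b \<otimes> k \<otimes> inv b) \<otimes> inv a"
        "inv (a \<otimes> b) \<otimes> k \<otimes> (a \<otimes> b) = inv b \<otimes> (inv a \<otimes> k \<otimes> a) \<otimes> b"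
        using ab k by (auto simp: L'_def inv_mult_group m_assoc)
      then show "a \<otimes> b \<otimes> k \<otimes> inv (a \<otimes> b) \<in> K" "inv (a \<otimes> b) \<otimes> k \<otimes> (a \<otimes> b) \<in> K"
        using ab k by (auto simp: L'_def)
    qed (use ab in \<open>auto simp: L'_def\<close>)
  qed (auto simp: L'_def)
  have "continuous_map (prod_topology T T) T (\<lambda>p. snd p \<otimes> fst p \<otimes> inv (snd p))"
    by (intro continuous_intros continuous_map_fst continuous_map_snd)
  then obtain V2 where V2: "nbh V2" "\<And>y h. y \<in> K \<Longrightarrow> h \<in> V2 \<Longrightarrow> h \<otimes> y \<otimes> inv h \<in> \<Omega>"
    using nbh_tube[of "\<lambda>y h. h \<otimes> y \<otimes> inv h" K \<Omega>] K(2) \<Omega>o K\<Omega> by (auto simp: subset_iff)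
  obtain V3 where V3: "nbh V3" "symm V3" "V3 \<subseteq> V2" using nbh_sym[OF V2(1)] .
  have V3c: "V3 \<subseteq> carrier L" by (rule nbh_carrier[OF V3(1)])
  have "V3 \<subseteq> L'"
  proof
    fix h assume h: "h \<in> V3"
    have hi: "inv h \<in> V3" "h \<in> carrier L" using h V3 V3c by (auto simp: symm_def)
    have a: "g \<otimes> k \<otimes> inv g \<in> K" if "g \<in> V3" "k \<in> K" for g k
    proof -
      have "(\<lambda>k. g \<otimes> k \<otimes> inv g) ` K \<subseteq> K" using conj_sub[of g] V2(2) V3(3) V3c that(1) by blast
      then show ?thesis using that(2) by blast
    qed
    show "h \<in> L'" unfolding L'_def using a[OF h] a[OF hi(1)] hi(2) by simp
  qed
  then have L'o: "openin T L'" using openin_subgroup_contains_nbh[OF L' V3(1)] by blast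
  define L1 where "L1 = L\<lparr>carrier := L'\<rparr>"
  define T1 where "T1 = subtopology T L'"
  have KL': "K \<subseteq> L'" by (auto simp: L'_def)
  have L'c: "L' \<subseteq> carrier L" by (auto simp: L'_def)
  interpret L1: lcgrp L1 T1 unfolding L1_def T1_def by (rule lcgrp_open_subgroup[OF L' L'o])
  have sub1: "subgroup K L1" unfolding L1_def by (rule subgroup_incl[OF K(1) L' KL'])
  obtain V where V: "L1.nbh V" "\<And>x. x \<in> V \<Longrightarrow> \<phi> x = \<one>\<^bsub>G\<^esub>"
  proof (rule L1.nss_modulo_kernel_contains_nbh[of K "\<Omega> \<inter> L'" G \<phi>])
    show "K \<lhd> L1"
    proof (rule L1.normal_invI[OF sub1])
      fix x h assume x: "x \<in> carrier L1" "h \<in> K"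
      then have "inv\<^bsub>L1\<^esub> x = inv x" unfolding L1_def using m_inv_consistent[OF L'] by simp
      then show "x \<otimes>\<^bsub>L1\<^esub> h \<otimes>\<^bsub>L1\<^esub> inv\<^bsub>L1\<^esub> x \<in> K" using x by (simp add: L1_def L'_def)
    qed
    show "compactin T1 K" unfolding T1_def using K(2) KL' by (simp add: compactin_subtopology)
    show "openin T1 (\<Omega> \<inter> L')" unfolding T1_def using \<Omega>o by (auto simp: openin_subtopology)
    show "P \<subseteq> K" if "subgroup P L1" "P \<subseteq> \<Omega> \<inter> L'" for P
      using \<Omega>[of P] incl_subgroup[OF L'] that by (auto simp: L1_def)
    show "\<phi> \<in> hom L1 G" using \<phi>(1) L'c by (auto simp: hom_def L1_def)
    show "\<phi> x = \<one>\<^bsub>G\<^esub>" if "x \<in> K" for x using \<phi>(2) K(4) that by blast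
  qed (use K\<Omega> KL' G in auto)
  have "openin T1 V" "\<one>\<^bsub>L1\<^esub> \<in> V" using V(1) by (auto simp: L1.nbh_def)
  then have "nbh V" using openin_trans_full[OF _ L'o, of V] by (auto simp: nbh_def T1_def L1_def)
  then show ?thesis using V(2) that by blast
qed

text \<open>The finite images of \<open>hg V'\<close> shrink with \<open>V'\<close>, so one of least
  cardinality coincides with all smaller ones; this is \<open>F\<close>. Conjugation by an element
  of \<open>L\<close> is continuous, so it carries some \<open>hg V'\<close>, which still has image
  \<open>F\<close>, into \<open>hg V0\<close>.\<close>

theorem continuous_or_normalizes_finite:
  fixes G :: "('c, 'd) monoid_scheme"
  assumes G: "class_G G" and \<phi>: "\<phi> \<in> hom L G"
  shows "continuous_map T (discrete_topology (carrier G)) \<phi> \<or>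
         (\<exists>F. subgroup F G \<and> finite F \<and> F \<noteq> {\<one>\<^bsub>G\<^esub>} \<and> \<phi> ` carrier L \<subseteq> normalizer G F)"
proof -
  interpret G: group G using G by (simp add: class_G_def)
  interpret \<phi>: group_hom L G \<phi> using \<phi> by unfold_locales
  obtain U0 U where U: "nbh U0" "compactin T U" "U0 \<subseteq> U" "U \<subseteq> carrier L" using nbh_compact[OF nbh_univ] .
  obtain V and C :: nat where V: "nbh V" "symm V" "1 \<le> C" "\<And>\<nu>. Bset (pgen V \<nu>) (1 / real C) \<subseteq> U"
    using trapping[OF U(2,1,3)] by blast
  define hg where "hg V' = T closure_of generate L (qinf V')" for V'
  have genU: "generate L (qinf V) \<subseteq> U" by (rule generate_qinf_subset[OF V(2,3,4)])
  have qc: "qinf V' \<subseteq> carrier L" for V' by (auto simp: qinf_def)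
  have gs: "subgroup (generate L (qinf V')) L" for V' by (rule generate_is_subgroup[OF qc])
  have hs: "subgroup (hg V') L" for V' unfolding hg_def by (rule subgroup_closure[OF gs])
  have qm: "qinf A \<subseteq> qinf B" if "A \<subseteq> B" for A B using that by (auto simp: qinf_def)
  have hm: "hg A \<subseteq> hg B" if "A \<subseteq> B" for A B
    unfolding hg_def by (intro closure_of_mono mono_generate qm that)
  have qh: "qinf A \<subseteq> hg A" for A
    unfolding hg_def using closure_of_subset[of "generate L (qinf A)" T] subgroup.subset[OF gs[of A]] generate.incl[of _ "qinf A" L] by auto
  have hU: "hg V \<subseteq> U" unfolding hg_def by (rule closure_of_minimal[OF genU compactin_closed[OF U(2)]])
  have hc: "compactin T (hg V')" if "V' \<subseteq> V" for V'
  proof (rule closed_compactin[OF U(2)])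
    show "hg V' \<subseteq> U" using hm[OF that] hU by blast
    show "closedin T (hg V')" by (simp add: hg_def)
  qed
  have fin: "finite (\<phi> ` hg V')" if "V' \<subseteq> V" for V'
    by (rule compact_image_finite[OF hs hc[OF that] \<phi> G])
  obtain V0 where V0: "nbh V0" "V0 \<subseteq> V"
    and min: "\<And>V'. nbh V' \<Longrightarrow> V' \<subseteq> V \<Longrightarrow> card (\<phi> ` hg V0) \<le> card (\<phi> ` hg V')"
    using ex_has_least_nat[of "\<lambda>V'. nbh V' \<and> V' \<subseteq> V" V "\<lambda>V'. card (\<phi> ` hg V')"] V(1) by blast
  define F where "F = \<phi> ` hg V0"
  have Feq: "\<phi> ` hg V' = F" if "nbh V'" "V' \<subseteq> V0" for V'
    unfolding F_def
  proof (rule card_seteq)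
    show "finite (\<phi> ` hg V0)" by (rule fin[OF V0(2)])
    show "\<phi> ` hg V' \<subseteq> \<phi> ` hg V0" using hm[OF that(2)] by blast
    show "card (\<phi> ` hg V0) \<le> card (\<phi> ` hg V')" using min that V0(2) by blast
  qed
  have sF: "subgroup F G" unfolding F_def by (rule \<phi>.subgroup_img_is_subgroup[OF hs])
  have conjF: "inv\<^bsub>G\<^esub> \<phi> g \<otimes>\<^bsub>G\<^esub> f \<otimes>\<^bsub>G\<^esub> \<phi> g \<in> F" if g: "g \<in> carrier L" and f: "f \<in> F" for g f
  proof -
    define c where "c = (\<lambda>x. inv g \<otimes> x \<otimes> g)"
    have ccont: "continuous_map T T c" unfolding c_def using g by (intro continuous_intros) auto
    have cc: "c x \<in> carrier L" if "x \<in> carrier L" for x using that g by (simp add: c_def)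
    have cm: "c (x \<otimes> y) = c x \<otimes> c y" if "x \<in> carrier L" "y \<in> carrier L" for x y
      unfolding c_def using g that by (simp add: m_assoc mult_inv_cancel)
    interpret c: group_hom L L c using cc cm by unfold_locales (auto simp: hom_def)
    \<comment> \<open>Containment in \<open>V0\<close> keeps the image equal to \<open>F\<close>;
      containment of the conjugate in \<open>V0\<close> sends \<open>qinf V'\<close> into
      \<open>qinf V0\<close>.\<close>
    define V' where "V' = V0 \<inter> {x \<in> carrier L. c x \<in> V0}"
    have V': "nbh V'" "V' \<subseteq> V0"
      using V0(1) openin_preimage[OF ccont, of V0] g by (auto simp: V'_def nbh_def c_def)
    have "c x \<in> qinf V0" if "x \<in> qinf V'" for x
      using that cc by (auto simp: qinf_def V'_def simp flip: c.hom_nat_pow)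
    then have "c ` qinf V' \<subseteq> qinf V0" by blast
    then have "generate L (c ` qinf V') \<subseteq> generate L (qinf V0)" by (rule mono_generate)
    then have "c ` generate L (qinf V') \<subseteq> generate L (qinf V0)" using c.generate_img[OF qc] by simp
    then have "T closure_of (c ` generate L (qinf V')) \<subseteq> hg V0" unfolding hg_def by (rule closure_of_mono)
    then have ch: "c ` hg V' \<subseteq> hg V0"
      using continuous_map_image_closure_subset[OF ccont, of "generate L (qinf V')"] unfolding hg_def by blast
    obtain x where x: "x \<in> hg V'" "f = \<phi> x" using f Feq[OF V'] by blast
    have xc: "x \<in> carrier L" using subgroup.subset[OF hs] x(1) by blast
    have "\<phi> (c x) \<in> F" using ch x(1) by (auto simp: F_def)
    then show ?thesis using x(2) xc g by (simp add: c_def)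
  qed
  have conjF': "\<phi> g \<otimes>\<^bsub>G\<^esub> f \<otimes>\<^bsub>G\<^esub> inv\<^bsub>G\<^esub> \<phi> g \<in> F" if g: "g \<in> carrier L" and f: "f \<in> F" for g f
    using conjF[of "inv g" f] that by simp
  have Fc: "F \<subseteq> carrier G" by (rule subgroup.subset[OF sF])
  have "\<phi> ` carrier L \<subseteq> normalizer G F"
  proof clarify
    fix g assume g: "g \<in> carrier L"
    have "\<phi> g <#\<^bsub>G\<^esub> F #>\<^bsub>G\<^esub> inv\<^bsub>G\<^esub> \<phi> g = F"
    proof (intro equalityI subsetI)
      fix y assume "y \<in> \<phi> g <#\<^bsub>G\<^esub> F #>\<^bsub>G\<^esub> inv\<^bsub>G\<^esub> \<phi> g"
      then show "y \<in> F" using conjF'[OF g] by (auto simp: l_coset_def r_coset_def)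
    next
      fix y assume y: "y \<in> F"
      have "y = \<phi> g \<otimes>\<^bsub>G\<^esub> (inv\<^bsub>G\<^esub> \<phi> g \<otimes>\<^bsub>G\<^esub> y \<otimes>\<^bsub>G\<^esub> \<phi> g) \<otimes>\<^bsub>G\<^esub> inv\<^bsub>G\<^esub> \<phi> g"
        using y Fc \<phi>.hom_closed[OF g] by (simp add: G.m_assoc G.mult_inv_cancel subset_iff)
      then show "y \<in> \<phi> g <#\<^bsub>G\<^esub> F #>\<^bsub>G\<^esub> inv\<^bsub>G\<^esub> \<phi> g"
        using conjF[OF g y] unfolding l_coset_def r_coset_def by blast
    qed
    then show "\<phi> g \<in> normalizer G F" using Fc g \<phi>.hom_closed[OF g] by (simp add: normalizer_def stabilizer_def)
  qed
  moreover have "finite F" unfolding F_def by (rule fin[OF V0(2)])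
  moreover have "continuous_map T (discrete_topology (carrier G)) \<phi>" if F1: "F = {\<one>\<^bsub>G\<^esub>}"
  proof -
    obtain O1 where O1: "nbh O1" "\<And>x. x \<in> O1 \<Longrightarrow> \<phi> x = \<one>\<^bsub>G\<^esub>"
      using kernel_contains_nbh[OF V0(1) hs hc[OF V0(2)] qh G \<phi>] F1 unfolding F_def by blast
    have O1c: "O1 \<subseteq> carrier L" by (rule nbh_carrier[OF O1(1)])
    show ?thesis
      unfolding continuous_map_def
    proof (intro conjI allI impI)
      fix S
      let ?P = "{x \<in> carrier L. \<phi> x \<in> S}"
      have "?P = ?P <#> O1"
      proof (intro equalityI subsetI)
        fix x assume x: "x \<in> ?P"
        then have "x = x \<otimes> \<one>" by auto
        then show "x \<in> ?P <#> O1" using x O1(1) unfolding set_mult_def nbh_def by blast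
      next
        fix x assume "x \<in> ?P <#> O1"
        then show "x \<in> ?P" using O1(2) O1c by (auto simp: set_mult_def subset_iff)
      qed
      moreover have "openin T (?P <#> O1)" using O1(1) by (intro openin_set_mult_right) (auto simp: nbh_def)
      ultimately show "openin T {x \<in> topspace T. \<phi> x \<in> S}" by simp
    qed auto
  qed
  ultimately show ?thesis using sF by blast
qed

end

theorem theoremD:
  fixes L :: "('a, 'b) monoid_scheme" and T :: "'a topology"
    and G :: "('c, 'd) monoid_scheme" and \<phi> :: "'a \<Rightarrow> 'c"
  assumes "locally_compact_group L T"
    and "class_G G"
    and "\<phi> \<in> hom L G"
  shows "continuous_map T (discrete_topology (carrier G)) \<phi> \<or>
         (\<exists>F. subgroup F G \<and> finite F \<and> F \<noteq> {\<one>\<^bsub>G\<^esub>} \<and>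
              \<phi> ` carrier L \<subseteq> normalizer G F)"
proof -
  interpret lcgrp L T
    using assms(1) unfolding locally_compact_group_def topological_group_def
      lcgrp_def lcgrp_axioms_def topgrp_def topgrp_axioms_def by blast
  show ?thesis by (rule continuous_or_normalizes_finite[OF assms(2,3)])
qed

end
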